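(* Let $k$ be a field of characteristic $0$, let $d\ge 1$, and let $G=([n],E)$ be a graph. If $\hat L_G^{k}(d)$ is radical (resp. is a complete intersection, resp. is prime), then $\operatorname{Pf}^{k}_{2d+2}(X_G^{\mathrm{skew}})$ is radical (resp. has maximal height, resp. is prime).
   Context: Graphs are finite simple graphs; $[n]=\{1,\dots,n\}$. For $G=([n],E)$, a field $k$ and $d\ge 1$, consider the polynomial ring $k[y_{i,\ell} : i\in[n],\ \ell\in[2d]]$ and, for each edge $e=\{i,j\}\in E$ with $i<j$, put $$\hat f_e^{(d)}=\sum_{k'=1}^d\big(y_{i,2k'-1}\,y_{j,2k'}-y_{i,2k'}\,y_{j,2k'-1}\big).$$ The twisted Lovász–Saks–Schrijver ideal is $\hat L_G^{k}(d)=(\hat f_e^{(d)} : e\in E)$. An ideal is a complete intersection if it is generated by a regular sequence (the zero ideal counts); here this is equivalent to the $\hat f_e^{(d)}$, $e\in E$, forming a regular sequence. Let $S^{\mathrm{skew}}=k[x_{ij} : 1\le i<j\le n]$ and let $X_n^{\mathrm{skew}}$ be the generic skew-symmetric $n\times n$ matrix, with $(i,j)$ entry $x_{ij}$ if $i<j$, $-x_{ji}$ if $i>j$, and $0$ if $i=j$. $X_G^{\mathrm{skew}}$ is obtained from $X_n^{\mathrm{skew}}$ by replacing the entries in positions $(i,j)$ and $(j,i)$ with $0$ for all $\{i,j\}\in E$. For a skew-symmetric matrix $X$, $\operatorname{Pf}^{k}_{2t}(X)\subseteq S^{\mathrm{skew}}$ is the ideal generated by the Pfaffians of size $2t$, i.e.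 the Pfaffians of the $2t\times 2t$ submatrices with the same row and column indices. "$\operatorname{Pf}^k_{2t}(X_G^{\mathrm{skew}})$ has maximal height" means that its height equals that of $\operatorname{Pf}^k_{2t}(X_n^{\mathrm{skew}})$, which is $\binom{n-2t+2}{2}$ for $2t\le n$ (and both ideals are zero for $2t>n$). *)

theory Defs
  imports
    "HOL-Algebra.QuotRing"
    "HOL-Combinatorics.Permutations"
    "HOL-Library.Poly_Mapping"
    "HOL-Library.Extended_Nat"
begin

section \<open>Polynomial rings\<close>

text \<open>
  All polynomials live in the type of finitely supported functions from monomials to
  coefficients, with variables named by pairs of natural numbers.  The type provides infinitely
  many variables; the polynomial ring in a given set of variables is a carrier inside it.
\<close>

type_synonym 'k mpoly = "(nat \<times> nat \<Rightarrow>\<^sub>0 nat) \<Rightarrow>\<^sub>0 'k"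

definition mvar :: "nat \<times> nat \<Rightarrow> 'k::field mpoly" where
  "mvar v = Poly_Mapping.single (Poly_Mapping.single v 1) 1"

definition mvars :: "'k::field mpoly \<Rightarrow> (nat \<times> nat) set" where
  "mvars p = (\<Union>m \<in> Poly_Mapping.keys p. Poly_Mapping.keys m)"

definition mpoly_ring :: "'k::field itself \<Rightarrow> (nat \<times> nat) set \<Rightarrow> 'k mpoly ring" where
  "mpoly_ring _ V =
    \<lparr>carrier = {p. mvars p \<subseteq> V}, monoid.mult = (*), one = 1, zero = 0, add = (+)\<rparr>"

section \<open>Properties of ideals\<close>

definition radical_ideal :: "'a set \<Rightarrow> ('a, 'b) ring_scheme \<Rightarrow> bool" where
  "radical_ideal I R \<longleftrightarrow>
    ideal I R \<and> (\<forall>a \<in> carrier R. \<forall>m::nat. a [^]\<^bsub>R\<^esub> m \<in> I \<longrightarrow> a \<in> I)"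

definition regular_sequence :: "('a, 'b) ring_scheme \<Rightarrow> 'a list \<Rightarrow> bool" where
  "regular_sequence R fs \<longleftrightarrow>
    set fs \<subseteq> carrier R \<and>
    (\<forall>i < length fs. \<forall>a \<in> carrier R.
        fs ! i \<otimes>\<^bsub>R\<^esub> a \<in> Idl\<^bsub>R\<^esub> (set (take i fs)) \<longrightarrow> a \<in> Idl\<^bsub>R\<^esub> (set (take i fs))) \<and>
    Idl\<^bsub>R\<^esub> (set fs) \<noteq> carrier R"

text \<open>The empty sequence is regular, so the zero ideal is a complete intersection.\<close>

definition complete_intersection :: "'a set \<Rightarrow> ('a, 'b) ring_scheme \<Rightarrow> bool" where
  "complete_intersection I R \<longleftrightarrow> (\<exists>fs. regular_sequence R fs \<and> I = Idl\<^bsub>R\<^esub> (set fs))"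

text \<open>
  Height of a prime: supremum of the lengths of the strict chains of primes ending in it.
  Height of an ideal: infimum of the heights of the primes containing it
  (so the unit ideal has height \<open>\<infinity>\<close>).
\<close>

definition prime_height :: "('a, 'b) ring_scheme \<Rightarrow> 'a set \<Rightarrow> enat" where
  "prime_height R P =
    Sup {enat m | m. \<exists>C :: nat \<Rightarrow> 'a set.
           (\<forall>i \<le> m. primeideal (C i) R) \<and> (\<forall>i < m. C i \<subset> C (Suc i)) \<and> C m = P}"

definition ideal_height :: "('a, 'b) ring_scheme \<Rightarrow> 'a set \<Rightarrow> enat" where
  "ideal_height R I = Inf {prime_height R P | P. primeideal P R \<and> I \<subseteq> P}"

section \<open>Twisted Lovasz-Saks-Schrijver ideals\<close>

text \<open>The variable \<open>y\<^sub>i\<^sub>,\<^sub>l\<close> is \<open>mvar (i, l)\<close>.\<close>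

definition lss_ring :: "'k::field itself \<Rightarrow> nat \<Rightarrow> nat \<Rightarrow> 'k mpoly ring" where
  "lss_ring K n d = mpoly_ring K ({1..n} \<times> {1..2 * d})"

definition twisted_lss_poly :: "nat \<Rightarrow> nat \<Rightarrow> nat \<Rightarrow> 'k::field mpoly" where
  "twisted_lss_poly d i j =
    (\<Sum>k = 1..d. mvar (i, 2 * k - 1) * mvar (j, 2 * k) - mvar (i, 2 * k) * mvar (j, 2 * k - 1))"

definition twisted_lss_ideal ::
    "'k::field itself \<Rightarrow> nat \<Rightarrow> nat \<Rightarrow> nat set set \<Rightarrow> 'k mpoly set" where
  "twisted_lss_ideal K n d E =
    Idl\<^bsub>lss_ring K n d\<^esub> {twisted_lss_poly d i j | i j. i < j \<and> {i, j} \<in> E}"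

section \<open>Pfaffian ideals\<close>

text \<open>
  The Pfaffian of a skew-symmetric matrix of size \<open>2t\<close> with rows and columns \<open>0, \<dots>, 2t - 1\<close>.
  Each perfect matching of the index set is represented by the unique permutation \<open>p\<close> that
  lists its edges \<open>p (2a) < p (2a + 1)\<close> in increasing order of their smaller endpoints.
\<close>

definition pfaffian :: "nat \<Rightarrow> (nat \<Rightarrow> nat \<Rightarrow> 'a::comm_ring_1) \<Rightarrow> 'a" where
  "pfaffian t A =
    (\<Sum>p | p permutes {..<2 * t} \<and>
            (\<forall>a < t. p (2 * a) < p (2 * a + 1)) \<and>
            (\<forall>a b. a < b \<and> b < t \<longrightarrow> p (2 * a) < p (2 * b)).
       of_int (sign p) * (\<Prod>a < t. A (p (2 * a)) (p (2 * a + 1))))"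

text \<open>The variable \<open>x\<^sub>i\<^sub>j\<close> with \<open>i < j\<close> is \<open>mvar (i, j)\<close>.  Matrices have indices \<open>1, \<dots>, n\<close>.\<close>

definition skew_ring :: "'k::field itself \<Rightarrow> nat \<Rightarrow> 'k mpoly ring" where
  "skew_ring K n = mpoly_ring K {(i, j). 1 \<le> i \<and> i < j \<and> j \<le> n}"

definition generic_skew_matrix :: "nat \<Rightarrow> nat \<Rightarrow> 'k::field mpoly" where
  "generic_skew_matrix i j =
    (if i < j then mvar (i, j) else if j < i then - mvar (j, i) else 0)"

definition graph_skew_matrix :: "nat set set \<Rightarrow> nat \<Rightarrow> nat \<Rightarrow> 'k::field mpoly" where
  "graph_skew_matrix E i j = (if {i, j} \<in> E then 0 else generic_skew_matrix i j)"

text \<open>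
  The ideal generated by the Pfaffians of size \<open>2t\<close> of an \<open>n \<times> n\<close> matrix.  The submatrix
  with row and column set \<open>I\<close> is reindexed through the increasing enumeration of \<open>I\<close>.
\<close>

definition pfaffian_ideal ::
    "'k::field itself \<Rightarrow> nat \<Rightarrow> nat \<Rightarrow> (nat \<Rightarrow> nat \<Rightarrow> 'k mpoly) \<Rightarrow> 'k mpoly set" where
  "pfaffian_ideal K n t A =
    Idl\<^bsub>skew_ring K n\<^esub>
      {pfaffian t (\<lambda>a b. A (sorted_list_of_set I ! a) (sorted_list_of_set I ! b)) | I.
         I \<subseteq> {1..n} \<and> card I = 2 * t}"

section \<open>Well-formedness\<close>

lemma mpoly_ring_cring: "cring (mpoly_ring K V)"
proof -
  have sums: "mvars (p + q) \<subseteq> V" if "mvars p \<subseteq> V" "mvars q \<subseteq> V" for p q :: "'a mpoly"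
    using that Poly_Mapping.keys_add[of p q] unfolding mvars_def by blast
  have prods: "mvars (p * q) \<subseteq> V" if "mvars p \<subseteq> V" "mvars q \<subseteq> V" for p q :: "'a mpoly"
  proof
    fix v assume "v \<in> mvars (p * q)"
    then obtain m where m: "m \<in> Poly_Mapping.keys (p * q)" "v \<in> Poly_Mapping.keys m"
      unfolding mvars_def by blast
    then obtain a b where ab: "m = a + b" "a \<in> Poly_Mapping.keys p" "b \<in> Poly_Mapping.keys q"
      using keys_mult[of p q] by blast
    then have "v \<in> Poly_Mapping.keys a \<union> Poly_Mapping.keys b"
      using m(2) Poly_Mapping.keys_add[of a b] by blast
    then show "v \<in> V" using ab that unfolding mvars_def by blast
  qed
  have negs: "mvars (- p) = mvars p" for p :: "'a mpoly"
    unfolding mvars_def by (simp add: keys.rep_eq)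
  show ?thesis
  proof (rule cringI)
    show "abelian_group (mpoly_ring K V)"
    proof (rule abelian_groupI)
      fix p assume "p \<in> carrier (mpoly_ring K V)"
      then show "\<exists>q \<in> carrier (mpoly_ring K V). q \<oplus>\<^bsub>mpoly_ring K V\<^esub> p = \<zero>\<^bsub>mpoly_ring K V\<^esub>"
        by (intro bexI[of _ "- p"]) (auto simp: mpoly_ring_def negs)
    qed (auto simp: mpoly_ring_def sums add.assoc add.commute, auto simp: mvars_def)
    show "comm_monoid (mpoly_ring K V)"
      by (rule comm_monoidI) (auto simp: mpoly_ring_def prods mult.assoc mult.commute, auto simp: mvars_def)
  qed (auto simp: mpoly_ring_def algebra_simps)
qed

end

(* Sending x_ij to f_ij = sum_k (y_{i,2k-1} y_{j,2k} - y_{i,2k} y_{j,2k-1}) defines a homomorphism phi from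
   the skew ring to the ring of the y's. Its kernel is the generic Pfaffian ideal P: matrices of rank at
   most 2d have vanishing Pfaffians, and modulo P every monomial reduces to monomials without d + 1 nested
   edges, whose images are linearly independent. Characteristic 0 enters through the apolar form: the image of phi
   is stable under contraction with the f_ij, so the orthogonal projection onto it is a substitute for the
   Reynolds operator of the symplectic group. It shows that the contraction of L along phi is P + (x_e : e in E),
   which is the Pfaffian ideal of X_G once the variables x_e are set to zero. Hence the ring of X_G modulo
   its Pfaffians embeds into the quotient by L, and primality and radicality descend.

   Heights are computed through maximal sets of independent variables. Setting |E| variables to zero drops
   the dimension by at most |E|. For the converse, let V be independent modulo the Pfaffians of X_G and
   suppose that the variables V and x_e (e in E) satisfy a relation F modulo P. Evaluating F under phi gives
   a relation between the f_e; they minimally generate a complete intersection, so quasi-regularity puts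
   the coefficients of its lowest form in the f_e into L, and these coefficients then vanish. *)

theory Submission
  imports Defs Complex_Main "HOL-Library.Product_Lexorder" "HOL-Library.FuncSet"
begin


section \<open>Arithmetic, gradings and substitutions inside one ambient polynomial ring\<close>

section \<open>Polynomials as linear combinations of monomials\<close>

text \<open>But every image \<open>phi d (xmon m)\<close> has rational coefficients; on rational
  polynomials the form is positive definite, Gram-Schmidt stays rational, and the basis so obtained
  also serves the span over the whole field. One weight, \<open>box_wt\<close>, drives both halves
  of the kernel computation. Among all matchings of 2t points the nested one is the unique lightest,
  so rewriting by Pfaffians raises the weight; and a nest-free m is the heaviest among the monomials
  whose image contains the exponent \<open>layer_exp m\<close>, which makes the images triangular.
  The hypothesis on L provides some regular sequence, neither made of the f_e nor homogeneous.
  Quasi-regularity therefore has to be carried from one generating set to another, which rests on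
  the f_e being linearly independent quadrics. All rings are carriers inside one polynomial ring in
  infinitely many variables; first index 0 is free for auxiliary variables.\<close>

type_synonym mexp = "nat \<times> nat \<Rightarrow>\<^sub>0 nat"

abbreviation lookup :: "('a \<Rightarrow>\<^sub>0 'b::zero) \<Rightarrow> 'a \<Rightarrow> 'b" where "lookup \<equiv> Poly_Mapping.lookup"
abbreviation keys :: "('a \<Rightarrow>\<^sub>0 'b::zero) \<Rightarrow> 'a set" where "keys \<equiv> Poly_Mapping.keys"

definition cst :: "'k::field \<Rightarrow> 'k mpoly" where "cst c = Poly_Mapping.single 0 c"
definition xmon :: "mexp \<Rightarrow> 'k::field mpoly" where "xmon m = Poly_Mapping.single m 1"

lemma cst_0 [simp]: "cst 0 = 0" by (simp add: cst_def)
lemma cst_1 [simp]: "cst 1 = 1" by (simp add: cst_def)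
lemma cst_add: "cst (a + b) = cst a + cst b" by (simp add: cst_def single_add)
lemma cst_diff: "cst (a - b) = cst a - cst b" by (simp add: cst_def single_diff)
lemma cst_uminus: "cst (- a) = - cst a" by (simp add: cst_def single_uminus)
lemma cst_mult: "cst (a * b) = cst a * cst b" by (simp add: cst_def mult_single)
lemma cst_eq_0_iff [simp]: "cst c = 0 \<longleftrightarrow> c = 0"
  by (metis cst_def lookup_single_eq lookup_zero single_zero)
lemma cst_prod: "cst (prod f A) = (\<Prod>a\<in>A. cst (f a))"
  by (induction A rule: infinite_finite_induct) (auto simp: cst_mult)
lemma cst_sum: "cst (sum f A) = (\<Sum>a\<in>A. cst (f a))"
  by (induction A rule: infinite_finite_induct) (auto simp: cst_add)

lemma xmon_0 [simp]: "xmon 0 = 1" by (simp add: xmon_def)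
lemma xmon_add: "xmon (m + n) = xmon m * xmon n" by (simp add: xmon_def mult_single)
lemma lookup_xmon: "lookup (xmon m) n = (if m = n then 1 else 0)"
  by (simp add: xmon_def lookup_single when_def)
lemma lookup_cst: "lookup (cst c) n = (if n = 0 then c else 0)"
  by (simp add: cst_def lookup_single when_def)
lemma keys_xmon [simp]: "keys (xmon m) = {m}" by (simp add: xmon_def)
lemma xmon_nz [simp]: "xmon m \<noteq> 0"
  by (metis keys_xmon insert_not_empty keys_zero)
lemma mvar_xmon: "mvar v = xmon (Poly_Mapping.single v 1)"
  by (simp add: mvar_def xmon_def)

lemma lookup_cst_mult: "lookup (cst c * p) m = c * lookup p m"
proof (cases "c = 0")
  case False
  have "cst c * p = Poly_Mapping.map ((*) c) p" by (simp add: cst_def mult_map_scale_conv_mult)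
  then show ?thesis by (simp add: Poly_Mapping.map.rep_eq when_def)
qed simp

lemma mpoly_sum_monomials: "p = (\<Sum>m\<in>keys p. cst (lookup p m) * xmon m)"
proof (rule poly_mapping_eqI)
  fix n
  have "lookup (\<Sum>m\<in>keys p. cst (lookup p m) * xmon m) n
      = (\<Sum>m\<in>keys p. if m = n then lookup p m else 0)"
    unfolding lookup_sum by (intro sum.cong refl) (auto simp: lookup_cst_mult lookup_xmon)
  also have "\<dots> = lookup p n" by (simp add: sum.delta' in_keys_iff)
  finally show "lookup p n = lookup (\<Sum>m\<in>keys p. cst (lookup p m) * xmon m) n" by simp
qed

lemma mpoly_induct [case_names monomial add]:
  assumes "\<And>m c. P (cst c * xmon m)" "\<And>p q. P p \<Longrightarrow> P q \<Longrightarrow> P (p + q)"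
  shows "P p"
proof -
  have "P (\<Sum>m\<in>A. cst (f m) * xmon m)" if "finite A" for A and f :: "mexp \<Rightarrow> 'a"
    using that
  proof (induction A rule: finite_induct)
    case empty
    show ?case using assms(1)[of 0] by simp
  qed (auto intro: assms)
  from this[OF finite_keys] show ?thesis by (subst mpoly_sum_monomials) 
qed

subsection \<open>Linear maps\<close>

definition lin :: "('k::field mpoly \<Rightarrow> 'k mpoly) \<Rightarrow> bool" where
  "lin f \<longleftrightarrow> (\<forall>p q. f (p + q) = f p + f q) \<and> (\<forall>c p. f (cst c * p) = cst c * f p)"

lemma lin_add: "lin f \<Longrightarrow> f (p + q) = f p + f q" by (simp add: lin_def)
lemma lin_scale: "lin f \<Longrightarrow> f (cst c * p) = cst c * f p" by (simp add: lin_def)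
lemma lin_0: "lin f \<Longrightarrow> f 0 = 0" using lin_scale[of f 0 0] by simp
lemma lin_uminus: "lin f \<Longrightarrow> f (- p) = - f p" using lin_scale[of f "-1" p] by (simp add: cst_uminus)
lemma lin_diff: "lin f \<Longrightarrow> f (p - q) = f p - f q"
  using lin_add[of f p "- q"] by (simp add: lin_uminus)
lemma lin_sum: "lin f \<Longrightarrow> f (sum g A) = (\<Sum>a\<in>A. f (g a))"
  by (induction A rule: infinite_finite_induct) (auto simp: lin_add lin_0)

lemma lin_id: "lin (\<lambda>p. p)" by (simp add: lin_def)
lemma lin_comp: "lin f \<Longrightarrow> lin g \<Longrightarrow> lin (\<lambda>p. f (g p))" by (simp add: lin_def)
lemma lin_mult_left: "lin f \<Longrightarrow> lin (\<lambda>p. q * f p)"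
  by (simp add: lin_def algebra_simps)
lemma lin_plus: "lin f \<Longrightarrow> lin g \<Longrightarrow> lin (\<lambda>p. f p + g p)" by (simp add: lin_def algebra_simps)
lemma lin_minus: "lin f \<Longrightarrow> lin g \<Longrightarrow> lin (\<lambda>p. f p - g p)" by (simp add: lin_def algebra_simps)
lemma lin_setsum: "(\<And>a. a \<in> A \<Longrightarrow> lin (f a)) \<Longrightarrow> lin (\<lambda>p. \<Sum>a\<in>A. f a p)"
  by (induction A rule: infinite_finite_induct) (auto simp: lin_def algebra_simps)

lemma lin_eqI:
  assumes "lin f" "lin g" "\<And>m. m \<in> keys p \<Longrightarrow> f (xmon m) = g (xmon m)"
  shows "f p = g p"
proof -
  have "f (\<Sum>m\<in>keys p. cst (lookup p m) * xmon m) = g (\<Sum>m\<in>keys p. cst (lookup p m) * xmon m)"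
    using assms by (simp add: lin_sum lin_scale)
  then show ?thesis using mpoly_sum_monomials[of p] by simp
qed

definition linext :: "(mexp \<Rightarrow> 'k::field mpoly) \<Rightarrow> 'k mpoly \<Rightarrow> 'k mpoly" where
  "linext F p = (\<Sum>m\<in>keys p. cst (lookup p m) * F m)"

lemma linext_superset:
  "finite A \<Longrightarrow> keys p \<subseteq> A \<Longrightarrow> linext F p = (\<Sum>m\<in>A. cst (lookup p m) * F m)"
  unfolding linext_def by (rule sum.mono_neutral_left) (auto simp: in_keys_iff)

lemma lin_linext [simp]: "lin (linext F)"
  unfolding lin_def
proof (intro conjI allI)
  fix p q :: "'a mpoly"
  have "keys (p + q) \<subseteq> keys p \<union> keys q" by (rule Poly_Mapping.keys_add)
  then show "linext F (p + q) = linext F p + linext F q"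
    by (subst (1 2 3) linext_superset[of "keys p \<union> keys q"])
      (auto simp: lookup_add cst_add algebra_simps sum.distrib)
next
  fix c and p :: "'a mpoly"
  have "keys (cst c * p) \<subseteq> keys p" by (auto simp: in_keys_iff lookup_cst_mult)
  then show "linext F (cst c * p) = cst c * linext F p"
    by (subst (1 2) linext_superset[of "keys p"])
      (auto simp: lookup_cst_mult cst_mult sum_distrib_left mult.assoc)
qed

lemma linext_xmon [simp]: "linext F (xmon m) = F m"
  by (simp add: linext_def lookup_xmon)

section \<open>Polynomials in a given set of variables\<close>

definition polys :: "(nat \<times> nat) set \<Rightarrow> 'k::field mpoly set" where
  "polys V = {p. \<forall>m\<in>keys p. keys m \<subseteq> V}"

lemma polys_iff_mvars: "p \<in> polys V \<longleftrightarrow> mvars p \<subseteq> V"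
  by (auto simp: polys_def mvars_def)

lemma polysD: "p \<in> polys V \<Longrightarrow> m \<in> keys p \<Longrightarrow> keys m \<subseteq> V"
  by (simp add: polys_def)

lemma polys_UNIV [simp]: "p \<in> polys UNIV" by (simp add: polys_def)
lemma polys_mono: "V \<subseteq> W \<Longrightarrow> polys V \<subseteq> polys W" by (auto simp: polys_def)

lemma keys_add_mexp: "keys ((m::mexp) + n) = keys m \<union> keys n"
  by (auto simp: in_keys_iff lookup_add)

lemma polys_0 [simp]: "0 \<in> polys V" by (simp add: polys_def)
lemma polys_cst [simp]: "cst c \<in> polys V" by (auto simp: polys_def cst_def split: if_splits)
lemma polys_1 [simp]: "1 \<in> polys V" using polys_cst[of 1] by simp
lemma polys_xmon [simp]: "xmon m \<in> polys V \<longleftrightarrow> keys m \<subseteq> V" by (simp add: polys_def)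
lemma polys_mvar [simp]: "mvar v \<in> polys V \<longleftrightarrow> v \<in> V" by (simp add: mvar_xmon)
lemma polys_add: "p \<in> polys V \<Longrightarrow> q \<in> polys V \<Longrightarrow> p + q \<in> polys V"
  using Poly_Mapping.keys_add[of p q] by (auto simp: polys_def)
lemma polys_uminus: "p \<in> polys V \<Longrightarrow> - p \<in> polys V" by (simp add: polys_def in_keys_iff)
lemma polys_diff: "p \<in> polys V \<Longrightarrow> q \<in> polys V \<Longrightarrow> p - q \<in> polys V"
  using polys_add[of p V "- q"] polys_uminus by auto
lemma polys_mult: "p \<in> polys V \<Longrightarrow> q \<in> polys V \<Longrightarrow> p * q \<in> polys V"
  using keys_mult[of p q] by (force simp: polys_def keys_add_mexp)
lemma polys_power: "p \<in> polys V \<Longrightarrow> p ^ n \<in> polys V"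
  by (induction n) (auto intro: polys_mult)
lemma polys_sum: "(\<And>a. a \<in> A \<Longrightarrow> f a \<in> polys V) \<Longrightarrow> sum f A \<in> polys V"
  by (induction A rule: infinite_finite_induct) (auto intro: polys_add)
lemma polys_prod: "(\<And>a. a \<in> A \<Longrightarrow> f a \<in> polys V) \<Longrightarrow> prod f A \<in> polys V"
  by (induction A rule: infinite_finite_induct) (auto intro: polys_mult)

lemma polys_linext: "(\<And>m. m \<in> keys p \<Longrightarrow> F m \<in> polys V) \<Longrightarrow> linext F p \<in> polys V"
  unfolding linext_def by (intro polys_sum polys_mult) auto

lemma polys_empty: "p \<in> polys {} \<Longrightarrow> p = cst (lookup p 0)"
  by (rule poly_mapping_eqI) (auto simp: polys_def lookup_cst in_keys_iff)

section \<open>Substitution homomorphisms\<close>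

definition alghom :: "('k::field mpoly \<Rightarrow> 'k mpoly) \<Rightarrow> bool" where
  "alghom f \<longleftrightarrow> (\<forall>p q. f (p + q) = f p + f q) \<and> (\<forall>p q. f (p * q) = f p * f q) \<and> (\<forall>c. f (cst c) = cst c)"

lemma alghom_add: "alghom f \<Longrightarrow> f (p + q) = f p + f q" by (simp add: alghom_def)
lemma alghom_mult: "alghom f \<Longrightarrow> f (p * q) = f p * f q" by (simp add: alghom_def)
lemma alghom_cst: "alghom f \<Longrightarrow> f (cst c) = cst c" by (simp add: alghom_def)
lemma alghom_lin: "alghom f \<Longrightarrow> lin f" by (simp add: alghom_def lin_def)
lemma alghom_1: "alghom f \<Longrightarrow> f 1 = 1" using alghom_cst[of f 1] by simp
lemma alghom_power: "alghom f \<Longrightarrow> f (p ^ n) = f p ^ n"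
  by (induction n) (auto simp: alghom_1 alghom_mult)
lemma alghom_prod: "alghom f \<Longrightarrow> f (prod g A) = (\<Prod>a\<in>A. f (g a))"
  by (induction A rule: infinite_finite_induct) (auto simp: alghom_1 alghom_mult)
lemma alghom_id: "alghom (\<lambda>p. p)" by (simp add: alghom_def)
lemma alghom_comp: "alghom f \<Longrightarrow> alghom g \<Longrightarrow> alghom (\<lambda>p. f (g p))" by (simp add: alghom_def)

definition mprod :: "(nat \<times> nat \<Rightarrow> 'k::field mpoly) \<Rightarrow> mexp \<Rightarrow> 'k mpoly" where
  "mprod \<sigma> m = (\<Prod>v\<in>keys m. \<sigma> v ^ lookup m v)"

lemma mprod_superset:
  "finite A \<Longrightarrow> keys m \<subseteq> A \<Longrightarrow> mprod \<sigma> m = (\<Prod>v\<in>A. \<sigma> v ^ lookup m v)"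
  unfolding mprod_def by (rule prod.mono_neutral_left) (auto simp: in_keys_iff)

lemma mprod_add: "mprod \<sigma> (m + n) = mprod \<sigma> m * mprod \<sigma> n"
  by (subst (1 2 3) mprod_superset[of "keys m \<union> keys n"])
    (auto simp: keys_add_mexp lookup_add power_add prod.distrib)

lemma mprod_0 [simp]: "mprod \<sigma> 0 = 1" by (simp add: mprod_def)
lemma mprod_single [simp]: "mprod \<sigma> (Poly_Mapping.single v n) = \<sigma> v ^ n"
  by (cases "n = 0") (auto simp: mprod_def)

definition subst :: "(nat \<times> nat \<Rightarrow> 'k::field mpoly) \<Rightarrow> 'k mpoly \<Rightarrow> 'k mpoly" where
  "subst \<sigma> = linext (mprod \<sigma>)"

lemma subst_xmon: "subst \<sigma> (xmon m) = mprod \<sigma> m" by (simp add: subst_def)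
lemma subst_mvar [simp]: "subst \<sigma> (mvar v) = \<sigma> v" by (simp add: mvar_xmon subst_xmon)
lemma lin_subst: "lin (subst \<sigma>)" by (simp add: subst_def)

lemma alghom_subst [simp]: "alghom (subst \<sigma>)"
  unfolding alghom_def
proof (intro conjI allI)
  fix p q :: "'a mpoly"
  show "subst \<sigma> (p + q) = subst \<sigma> p + subst \<sigma> q" by (rule lin_add[OF lin_subst])
  show "subst \<sigma> (p * q) = subst \<sigma> p * subst \<sigma> q"
  proof (induction p rule: mpoly_induct)
    case (monomial m c)
    show ?case
    proof (induction q rule: mpoly_induct)
      case (monomial m' c')
      have "cst c * xmon m * (cst c' * xmon m') = cst (c * c') * xmon (m + m')"
        by (simp add: xmon_add cst_mult)
      then have "subst \<sigma> (cst c * xmon m * (cst c' * xmon m')) = cst (c * c') * mprod \<sigma> (m + m')"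
        by (simp only: lin_scale[OF lin_subst] subst_xmon)
      then show ?case by (simp add: lin_scale[OF lin_subst] subst_xmon mprod_add cst_mult)
    next
      case (add p q)
      then show ?case by (simp add: algebra_simps lin_add[OF lin_subst])
    qed
  next
    case (add p q)
    then show ?case by (simp add: algebra_simps lin_add[OF lin_subst])
  qed
next
  fix c show "subst \<sigma> (cst c) = cst c"
    using lin_scale[OF lin_subst, of \<sigma> c 1] subst_xmon[of \<sigma> 0] by simp
qed

lemmas subst_mult = alghom_mult[OF alghom_subst]
  and subst_cst [simp] = alghom_cst[OF alghom_subst]
  and subst_sum = lin_sum[OF lin_subst]
  and subst_prod = alghom_prod[OF alghom_subst]

lemma xmon_mprod: "(xmon m :: 'a::field mpoly) = mprod mvar m"
proof -
  have "(xmon (\<Sum>v\<in>A. Poly_Mapping.single v (lookup m v)) :: 'a mpoly) = (\<Prod>v\<in>A. mvar v ^ lookup m v)" if "finite A" for A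
    using that
  proof (induction A rule: finite_induct)
    case (insert v A)
    have "(xmon (Poly_Mapping.single v n) :: 'a mpoly) = mvar v ^ n" for n
    proof (induction n)
      case (Suc n)
      have "Poly_Mapping.single v (Suc n) = Poly_Mapping.single v 1 + Poly_Mapping.single v n"
        by (simp add: single_add[symmetric])
      then show ?case using Suc by (simp only: xmon_add mvar_xmon power_Suc)
    qed simp
    then show ?case using insert by (simp add: xmon_add)
  qed simp
  moreover have "m = (\<Sum>v\<in>keys m. Poly_Mapping.single v (lookup m v))"
    by (rule poly_mapping_eqI) (auto simp: lookup_sum lookup_single when_def sum.delta' in_keys_iff)
  ultimately show ?thesis unfolding mprod_def by (metis finite_keys)
qed

lemma alghom_xmon: "alghom f \<Longrightarrow> f (xmon m) = mprod (\<lambda>v. f (mvar v)) m"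
  by (simp add: xmon_mprod mprod_def alghom_prod alghom_power)

lemma alghom_eqI:
  assumes "alghom f" "alghom g" "p \<in> polys V" "\<And>v. v \<in> V \<Longrightarrow> f (mvar v) = g (mvar v)"
  shows "f p = g p"
proof (rule lin_eqI[of f g])
  fix m assume "m \<in> keys p"
  then have "f (mvar v) = g (mvar v)" if "v \<in> keys m" for v
    using assms(4)[of v] polysD[OF assms(3) \<open>m \<in> keys p\<close>] that by blast
  then show "f (xmon m) = g (xmon m)"
    by (simp add: alghom_xmon[OF assms(1)] alghom_xmon[OF assms(2)] mprod_def cong: prod.cong)
qed (auto intro: alghom_lin assms)

lemma subst_id: "p \<in> polys V \<Longrightarrow> (\<And>v. v \<in> V \<Longrightarrow> \<sigma> v = mvar v) \<Longrightarrow> subst \<sigma> p = p"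
  by (rule alghom_eqI[of "subst \<sigma>" "\<lambda>p. p"]) (auto intro: alghom_id)

lemma polys_subst:
  assumes "p \<in> polys V" "\<And>v. v \<in> V \<Longrightarrow> \<sigma> v \<in> polys W"
  shows "subst \<sigma> p \<in> polys W"
  unfolding subst_def
proof (rule polys_linext)
  fix m assume "m \<in> keys p"
  then have "keys m \<subseteq> V" using assms(1) by (simp add: polys_def)
  then show "mprod \<sigma> m \<in> polys W" unfolding mprod_def
    by (intro polys_prod polys_power assms) auto
qed

section \<open>Weight components\<close>

text \<open>Weights may vanish on some variables. The same function yields the total degree, the
  degree in a chosen set of variables, and the combinatorial weight \<open>box_wt\<close>.\<close>

definition wt :: "(nat \<times> nat \<Rightarrow> nat) \<Rightarrow> mexp \<Rightarrow> nat" where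
  "wt w m = (\<Sum>v\<in>keys m. w v * lookup m v)"

lemma wt_superset: "finite A \<Longrightarrow> keys m \<subseteq> A \<Longrightarrow> wt w m = (\<Sum>v\<in>A. w v * lookup m v)"
  unfolding wt_def by (rule sum.mono_neutral_left) (auto simp: in_keys_iff)

lemma wt_add: "wt w (m + n) = wt w m + wt w n"
  by (subst (1 2 3) wt_superset[of "keys m \<union> keys n"])
    (auto simp: keys_add_mexp lookup_add algebra_simps sum.distrib)
lemma wt_0 [simp]: "wt w 0 = 0" by (simp add: wt_def)
lemma wt_single [simp]: "wt w (Poly_Mapping.single v n) = w v * n"
  by (cases "n = 0") (auto simp: wt_def)
lemma wt_eq_0_iff: "wt w m = 0 \<longleftrightarrow> (\<forall>v\<in>keys m. w v = 0)"
  by (auto simp: wt_def in_keys_iff)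

definition hcomp :: "(nat \<times> nat \<Rightarrow> nat) \<Rightarrow> nat \<Rightarrow> 'k::field mpoly \<Rightarrow> 'k mpoly" where
  "hcomp w s = linext (\<lambda>m. if wt w m = s then xmon m else 0)"

definition homog :: "(nat \<times> nat \<Rightarrow> nat) \<Rightarrow> nat \<Rightarrow> 'k::field mpoly \<Rightarrow> bool" where
  "homog w s p \<longleftrightarrow> (\<forall>m\<in>keys p. wt w m = s)"

lemma lin_hcomp [simp]: "lin (hcomp w s)" by (simp add: hcomp_def)

lemma hcomp_xmon: "hcomp w s (xmon m) = (if wt w m = s then xmon m else 0)"
  by (simp add: hcomp_def)

lemma lookup_hcomp: "lookup (hcomp w s p) m = (if wt w m = s then lookup p m else 0)"
proof (induction p rule: mpoly_induct)
  case (monomial m c)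
  then show ?case by (auto simp: lin_scale hcomp_xmon lookup_cst_mult lookup_xmon)
qed (auto simp: lin_add lookup_add)

lemma homog_hcomp [simp]: "homog w s (hcomp w s p)"
  by (auto simp: homog_def in_keys_iff lookup_hcomp split: if_splits)

lemma hcomp_homog: "homog w s p \<Longrightarrow> hcomp w t p = (if s = t then p else 0)"
  by (rule poly_mapping_eqI) (auto simp: lookup_hcomp homog_def in_keys_iff)

lemma homog_iff_hcomp: "homog w s p \<longleftrightarrow> hcomp w s p = p"
  by (metis hcomp_homog homog_hcomp)

lemma homog_0 [simp]: "homog w s 0" by (simp add: homog_def)
lemma homog_add: "homog w s p \<Longrightarrow> homog w s q \<Longrightarrow> homog w s (p + q)"
  by (simp add: homog_iff_hcomp lin_add)
lemma homog_diff: "homog w s p \<Longrightarrow> homog w s q \<Longrightarrow> homog w s (p - q)"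
  by (simp add: homog_iff_hcomp lin_diff)
lemma homog_sum: "(\<And>a. a \<in> A \<Longrightarrow> homog w s (f a)) \<Longrightarrow> homog w s (sum f A)"
  by (induction A rule: infinite_finite_induct) (auto intro: homog_add)
lemma homog_mult: "homog w s p \<Longrightarrow> homog w t q \<Longrightarrow> homog w (s + t) (p * q)"
  using keys_mult[of p q] by (fastforce simp: homog_def wt_add)
lemma homog_cst [simp]: "homog w 0 (cst c)" by (auto simp: homog_def cst_def split: if_splits)
lemma homog_1 [simp]: "homog w 0 1" using homog_cst[of w 1] by simp
lemma homog_cst_mult: "homog w s p \<Longrightarrow> homog w s (cst c * p)"
  using homog_mult[of w 0 "cst c" s p] by simp
lemma homog_xmon: "homog w (wt w m) (xmon m)" by (simp add: homog_def)
lemma homog_mvar: "homog w (w v) (mvar v)" by (simp add: mvar_xmon homog_def)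
lemma homog_polys_0: "p \<in> polys V \<Longrightarrow> (\<And>v. v \<in> V \<Longrightarrow> w v = 0) \<Longrightarrow> homog w 0 p"
  by (auto simp: homog_def wt_eq_0_iff dest: polysD)

lemma hcomp_hcomp: "hcomp w s (hcomp w t p) = (if s = t then hcomp w t p else 0)"
  by (simp add: hcomp_homog[OF homog_hcomp])

lemma sum_hcomp:
  assumes "\<And>m. m \<in> keys p \<Longrightarrow> wt w m \<le> N"
  shows "p = (\<Sum>s\<le>N. hcomp w s p)"
  using assms by (intro poly_mapping_eqI) (auto simp: lookup_sum lookup_hcomp sum.delta' in_keys_iff)

lemma sum_hcomp_obtain: obtains N where "p = (\<Sum>s\<le>N. hcomp w s p)" "\<And>m. m \<in> keys p \<Longrightarrow> wt w m \<le> N"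
proof -
  have "wt w m \<le> Max (insert 0 (wt w ` keys p))" if "m \<in> keys p" for m using that by (intro Max_ge) auto
  then show ?thesis using that sum_hcomp by blast
qed

lemma hcomp_eq_0I: "(\<And>m. m \<in> keys p \<Longrightarrow> wt w m \<noteq> s) \<Longrightarrow> hcomp w s p = 0"
  by (rule poly_mapping_eqI) (auto simp: lookup_hcomp in_keys_iff)

lemma hcomp_mult_homog:
  assumes "homog w r q"
  shows "hcomp w s (q * p) = (if r \<le> s then q * hcomp w (s - r) p else 0)"
proof (induction p rule: mpoly_induct)
  case (monomial m c)
  have "homog w (r + wt w m) (q * (cst c * xmon m))"
    by (intro homog_mult assms homog_cst_mult homog_xmon)
  then show ?case
    by (auto simp: hcomp_homog lin_scale hcomp_xmon)
qed (auto simp: lin_add algebra_simps)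

lemma polys_hcomp: "p \<in> polys V \<Longrightarrow> hcomp w s p \<in> polys V"
  by (auto simp: polys_def in_keys_iff lookup_hcomp split: if_splits)


section \<open>The Pfaffian as an alternating sum over all permutations\<close>

section \<open>Pfaffians of matrices of low rank\<close>

definition canonical :: "nat \<Rightarrow> (nat \<Rightarrow> nat) set" where
  "canonical t = {p. p permutes {..<2 * t} \<and> (\<forall>a<t. p (2 * a) < p (2 * a + 1)) \<and>
     (\<forall>a b. a < b \<and> b < t \<longrightarrow> p (2 * a) < p (2 * b))}"

definition blocks :: "nat \<Rightarrow> (nat \<Rightarrow> nat) \<Rightarrow> nat set set" where
  "blocks t p = (\<lambda>a. {p (2 * a), p (2 * a + 1)}) ` {..<t}"

text \<open>The stabilizer of the standard matching {0,1}, {2,3}, ..., the hyperoctahedral group.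
  Only the fact that it is finite and nonempty enters, never its order.\<close>

definition block_perms :: "nat \<Rightarrow> (nat \<Rightarrow> nat) set" where
  "block_perms t = {h. h permutes {..<2 * t} \<and> blocks t h = blocks t id}"

text \<open>Defined for every permutation rather than only for the canonical listings, so that sums
  over the full symmetric group can be formed.\<close>

definition pterm :: "nat \<Rightarrow> (nat \<Rightarrow> nat \<Rightarrow> 'a::comm_ring_1) \<Rightarrow> (nat \<Rightarrow> nat) \<Rightarrow> 'a" where
  "pterm t A p = of_int (sign p) * (\<Prod>a<t. A (p (2 * a)) (p (2 * a + 1)))"

lemma pfaffian_pterm: "pfaffian t A = sum (pterm t A) (canonical t)"
  by (simp add: pfaffian_def canonical_def pterm_def)

lemma blocks_comp: "blocks t (p \<circ> h) = (`) p ` blocks t h"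
  by (auto simp: blocks_def image_image)

lemma nat_lt_2t_cases:
  fixes i :: nat assumes "i < 2 * t" obtains a where "a < t" "i = 2 * a" | a where "a < t" "i = 2 * a + 1"
proof (cases "even i")
  case True
  then show ?thesis using assms that(1)[of "i div 2"] by auto
next
  case False
  then show ?thesis using assms that(2)[of "i div 2"] by (auto elim: oddE)
qed

lemma transpose_blocks:
  fixes a b m :: nat
  defines "\<tau> \<equiv> transpose (2 * m) (2 * b) \<circ> transpose (2 * m + 1) (2 * b + 1)"
  shows "\<tau> (2 * a) = 2 * transpose m b a" "\<tau> (2 * a + 1) = 2 * transpose m b a + 1"
  unfolding \<tau>_def comp_apply
  by (cases "a = m"; cases "a = b"; simp add: transpose_def double_not_eq_Suc_double Suc_double_not_eq_double)+

lemma apply_transpose_blocks: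
  fixes p :: "nat \<Rightarrow> nat"
  shows "(p \<circ> (transpose (2 * a) (2 * b) \<circ> transpose (2 * a + 1) (2 * b + 1))) (2 * x)
    = (if x = a then p (2 * b) else if x = b then p (2 * a) else p (2 * x))"
proof -
  have "(p \<circ> (transpose (2 * a) (2 * b) \<circ> transpose (2 * a + 1) (2 * b + 1))) (2 * x) = p (2 * transpose a b x)"
    by (metis comp_apply transpose_blocks(1))
  then show ?thesis by (simp add: transpose_def)
qed

lemma pterm_transpose_block:
  assumes p: "p permutes {..<2 * t}" and A: "\<And>i j. A i j = - A j i" and m: "m < t"
  shows "pterm t A (p \<circ> transpose (2 * m) (2 * m + 1)) = pterm t A p"
proof -
  let ?\<tau> = "transpose (2 * m) (2 * m + 1)"
  have perm: "permutation p" "permutation ?\<tau>"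
    by (rule permutes_imp_permutation[OF _ p], simp, rule permutation_swap_id)
  have other: "?\<tau> (2 * a) = 2 * a" "?\<tau> (2 * a + 1) = 2 * a + 1" if "a \<noteq> m" for a
    using that unfolding transpose_def by presburger+
  have "(\<Prod>a<t. A ((p \<circ> ?\<tau>) (2 * a)) ((p \<circ> ?\<tau>) (2 * a + 1)))
      = A (p (2 * m + 1)) (p (2 * m)) * (\<Prod>a\<in>{..<t} - {m}. A (p (2 * a)) (p (2 * a + 1)))"
    using m by (subst prod.remove[of _ m]) (auto simp: other[simplified])
  also have "\<dots> = - (\<Prod>a<t. A (p (2 * a)) (p (2 * a + 1)))"
    using m A[of "p (2 * m + 1)" "p (2 * m)"] by (subst prod.remove[of "{..<t}" m]) auto
  finally show ?thesis
    unfolding pterm_def sign_compose[OF perm] by (simp add: sign_swap_id)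
qed

lemma pterm_swap_blocks:
  assumes p: "p permutes {..<2 * t}" and m: "m < t" "b < t" "m \<noteq> b"
  shows "pterm t A (p \<circ> (transpose (2 * m) (2 * b) \<circ> transpose (2 * m + 1) (2 * b + 1))) = pterm t A p"
proof -
  let ?\<tau> = "transpose (2 * m) (2 * b) \<circ> transpose (2 * m + 1) (2 * b + 1)"
  have perm: "permutation p" "permutation ?\<tau>" "permutation (transpose (2 * m) (2 * b))"
    "permutation (transpose (2 * m + 1) (2 * b + 1))"
    by (rule permutes_imp_permutation[OF _ p], simp) (intro permutation_swap_id permutation_compose)+
  note \<tau> = transpose_blocks[of m b]
  have "(\<Prod>a<t. A ((p \<circ> ?\<tau>) (2 * a)) ((p \<circ> ?\<tau>) (2 * a + 1)))
      = (\<Prod>a<t. A (p (2 * transpose m b a)) (p (2 * transpose m b a + 1)))"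
    using \<tau> by (simp only: comp_def)
  also have "\<dots> = (\<Prod>a<t. A (p (2 * a)) (p (2 * a + 1)))"
    by (rule prod.reindex_bij_betw[of "transpose m b" "{..<t}" "{..<t}" "\<lambda>a. A (p (2 * a)) (p (2 * a + 1))"])
      (rule permutes_imp_bij, rule permutes_swap_id, use m in auto)
  finally show ?thesis
    unfolding pterm_def sign_compose[OF perm(1,2)] sign_compose[OF perm(3,4)] using m by (simp add: sign_swap_id)
qed

lemma blocks_swap_blocks:
  assumes "m < t" "b < t"
  shows "blocks t (h \<circ> (transpose (2 * m) (2 * b) \<circ> transpose (2 * m + 1) (2 * b + 1))) = blocks t h"
proof -
  let ?\<tau> = "transpose (2 * m) (2 * b) \<circ> transpose (2 * m + 1) (2 * b + 1)"
  note \<tau> = transpose_blocks[of m b]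
  have "transpose m b ` {..<t} = {..<t}" by (rule permutes_image, rule permutes_swap_id) (use assms in auto)
  then have "blocks t h = (\<lambda>a. {h (2 * a), h (2 * a + 1)}) ` transpose m b ` {..<t}"
    by (simp add: blocks_def)
  then show ?thesis unfolding blocks_def image_image comp_apply using \<tau> by (simp only: comp_apply)
qed

lemma blocks_transpose_block:
  "blocks t (h \<circ> transpose (2 * m) (2 * m + 1)) = blocks t h"
proof -
  have "{(h \<circ> transpose (2 * m) (2 * m + 1)) (2 * a), (h \<circ> transpose (2 * m) (2 * m + 1)) (2 * a + 1)}
      = {h (2 * a), h (2 * a + 1)}" for a
    by (cases "a = m") (auto simp: transpose_def)
  then show ?thesis by (simp add: blocks_def)
qed

lemma permutes_swap_blocks:
  fixes m b t :: nat
  shows "m < t \<Longrightarrow> b < t \<Longrightarrow> h permutes {..<2 * t} \<Longrightarrow>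
    h \<circ> (transpose (2 * m) (2 * b) \<circ> transpose (2 * m + 1) (2 * b + 1)) permutes {..<2 * t}"
  by (intro permutes_compose permutes_swap_id) auto

lemma permutes_transpose_block:
  fixes m t :: nat
  shows "m < t \<Longrightarrow> h permutes {..<2 * t} \<Longrightarrow> h \<circ> transpose (2 * m) (2 * m + 1) permutes {..<2 * t}"
  by (intro permutes_compose permutes_swap_id) auto

text \<open>Reversing a block changes the sign and, by skew symmetry, one factor; exchanging two
  blocks is an even permutation and only reorders the factors. Such moves bring the blocks of
  \<open>h\<close> home one after another.\<close>

lemma pterm_block_perms:
  assumes p: "p permutes {..<2 * t}" and A: "\<And>i j. A i j = - A j i" and h: "h \<in> block_perms t"
  shows "pterm t A (p \<circ> h) = pterm t A p"
proof -
  have "pterm t A (p \<circ> h) = pterm t A p"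
    if "h permutes {..<2 * t}" "blocks t h = blocks t id" "\<forall>i<2 * m. h i = i" "m \<le> t" for m h
    using that
  \<comment> \<open>\<open>m\<close> counts the leading blocks that \<open>h\<close> already fixes
    pointwise; at \<open>m = t\<close> nothing is left to move.\<close>
  proof (induction "t - m" arbitrary: m h)
    case 0
    then have "h i = i" for i using permutes_not_in[of h "{..<2 * t}" i] by (cases "i < 2 * t") auto
    then have "h = id" by auto
    then show ?case by simp
  next
    case (Suc k)
    then have m: "m < t" by auto
    have "{2 * m, 2 * m + 1} \<in> blocks t h" unfolding Suc.prems(2) using m by (auto simp: blocks_def)
    then obtain b where b: "b < t" "{h (2 * b), h (2 * b + 1)} = {2 * m, 2 * m + 1}" by (auto simp: blocks_def)
    define \<tau> where "\<tau> = transpose (2 * m) (2 * b) \<circ> transpose (2 * m + 1) (2 * b + 1)"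
    define h1 where "h1 = h \<circ> \<tau>"
    have bm: "m \<le> b"
    proof (rule ccontr)
      assume "\<not> m \<le> b"
      then have "h (2 * b) = 2 * b" using Suc.prems(3) by auto
      then show False using b \<open>\<not> m \<le> b\<close> by (auto simp: doubleton_eq_iff)
    qed
    have \<tau>: "\<tau> (2 * m) = 2 * b" "\<tau> (2 * m + 1) = 2 * b + 1" "\<And>i. i < 2 * m \<Longrightarrow> \<tau> i = i"
      using bm unfolding \<tau>_def comp_apply transpose_def by presburger+
    have h1: "h1 permutes {..<2 * t}" "blocks t h1 = blocks t id"
      using permutes_swap_blocks[OF m b(1) Suc.prems(1)] blocks_swap_blocks[OF m b(1), of h] Suc.prems(2)
      unfolding h1_def \<tau>_def by simp_all
    have h1': "\<forall>i<2 * m. h1 i = i" "{h1 (2 * m), h1 (2 * m + 1)} = {2 * m, 2 * m + 1}"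
      using Suc.prems(3) b(2) \<tau> unfolding h1_def comp_apply by simp_all
    have ph: "p \<circ> h permutes {..<2 * t}" "p \<circ> h1 permutes {..<2 * t}"
      using permutes_compose[OF Suc.prems(1) p] permutes_compose[OF h1(1) p] by auto
    have e1: "pterm t A (p \<circ> h1) = pterm t A (p \<circ> h)"
    proof (cases "b = m")
      case True
      then show ?thesis by (simp add: h1_def \<tau>_def)
    next
      case False
      then show ?thesis
        using pterm_swap_blocks[OF ph(1) m b(1) not_sym[OF False]] unfolding h1_def \<tau>_def by (simp only: comp_assoc)
    qed
    define h2 where "h2 = (if h1 (2 * m) = 2 * m then h1 else h1 \<circ> transpose (2 * m) (2 * m + 1))"
    have h2: "h2 permutes {..<2 * t}" "blocks t h2 = blocks t id" "\<forall>i<2 * Suc m. h2 i = i"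
    proof -
      show "h2 permutes {..<2 * t}" "blocks t h2 = blocks t id"
        using h1 permutes_transpose_block[OF m h1(1)] blocks_transpose_block[of t h1 m] by (simp_all add: h2_def)
      have "h1 (2 * m) = 2 * m \<and> h1 (2 * m + 1) = 2 * m + 1 \<or> h1 (2 * m) = 2 * m + 1 \<and> h1 (2 * m + 1) = 2 * m"
        using h1'(2) unfolding doubleton_eq_iff by blast
      then have "h2 (2 * m) = 2 * m" "h2 (2 * m + 1) = 2 * m + 1" by (auto simp: h2_def)
      moreover have "h2 i = i" if "i < 2 * m" for i
        using h1'(1) that by (simp add: h2_def transpose_def)
      moreover have "i < 2 * m \<or> i = 2 * m \<or> i = 2 * m + 1" if "i < 2 * Suc m" for i using that by auto
      ultimately show "\<forall>i<2 * Suc m. h2 i = i" by blast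
    qed
    have e2: "pterm t A (p \<circ> h2) = pterm t A (p \<circ> h1)"
      using pterm_transpose_block[OF ph(2) A m] by (simp add: h2_def comp_assoc)
    have "pterm t A (p \<circ> h2) = pterm t A p"
      using Suc.hyps(1)[of "Suc m" h2] Suc.hyps(2) h2 m by auto
    then show ?case using e1 e2 by simp
  qed
  from this[of h 0] h show ?thesis by (simp add: block_perms_def)
qed

text \<open>A listing of the matching with least \<open>\<mu>\<close> is canonical: undoing a
  reversed block or a pair of blocks in the wrong order would lower \<open>\<mu>\<close>.\<close>

lemma canonical_exists:
  assumes "q permutes {..<2 * t}"
  shows "\<exists>p\<in>canonical t. blocks t p = blocks t q"
proof -
  define F where "F = {p. p permutes {..<2 * t} \<and> blocks t p = blocks t q}"
  \<comment> \<open>The factor \<open>t - a\<close> is positive and strictly decreasing in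
    \<open>a\<close>; positivity punishes a large first entry in a block, monotonicity punishes a
    large first entry in an early block.\<close>
  define \<mu> where "\<mu> p = (\<Sum>a<t. (t - a) * p (2 * a))" for p :: "nat \<Rightarrow> nat"
  have "q \<in> F" using assms by (simp add: F_def)
  then obtain p where p: "p \<in> F" "\<And>p'. p' \<in> F \<Longrightarrow> \<mu> p \<le> \<mu> p'"
    using ex_has_least_nat[of "\<lambda>p. p \<in> F" q \<mu>] by blast
  have pp: "p permutes {..<2 * t}" using p by (simp add: F_def)
  have inj: "p i = p j \<longleftrightarrow> i = j" for i j by (rule inj_eq[OF permutes_inj[OF pp]])
  have "p (2 * a) < p (2 * a + 1)" if a: "a < t" for a
  proof (rule ccontr)
    assume "\<not> ?thesis"
    moreover have "p (2 * a) \<noteq> p (2 * a + 1)" unfolding inj by simp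
    ultimately have lt: "p (2 * a + 1) < p (2 * a)" by simp
    let ?p = "p \<circ> transpose (2 * a) (2 * a + 1)"
    have "transpose (2 * a) (2 * a + 1) (2 * x) = 2 * x" if "x \<noteq> a" for x
      using that unfolding transpose_def by presburger
    then have "\<mu> ?p = (t - a) * p (2 * a + 1) + (\<Sum>x\<in>{..<t} - {a}. (t - x) * p (2 * x))"
      unfolding \<mu>_def using a by (subst sum.remove[of _ a]) auto
    also have "\<dots> < (t - a) * p (2 * a) + (\<Sum>x\<in>{..<t} - {a}. (t - x) * p (2 * x))"
      using lt a by simp
    also have "\<dots> = \<mu> p" unfolding \<mu>_def using a by (subst sum.remove[of "{..<t}" a]) auto
    finally have "\<mu> ?p < \<mu> p" .
    moreover have "?p \<in> F"
      using p(1) a permutes_transpose_block[of a t p] blocks_transpose_block[of t p a] by (simp add: F_def)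
    ultimately show False using p(2) by (meson leD)
  qed
  moreover have "p (2 * a) < p (2 * b)" if a: "a < b" "b < t" for a b
  proof (rule ccontr)
    assume "\<not> ?thesis"
    moreover have "p (2 * a) \<noteq> p (2 * b)" unfolding inj using a by simp
    ultimately have lt: "p (2 * b) < p (2 * a)" by simp
    let ?p = "p \<circ> (transpose (2 * a) (2 * b) \<circ> transpose (2 * a + 1) (2 * b + 1))"
    have ev: "?p (2 * x) = (if x = a then p (2 * b) else if x = b then p (2 * a) else p (2 * x))" for x
      by (rule apply_transpose_blocks)
    have split: "(\<Sum>x<t. f x) = f a + (f b + (\<Sum>x\<in>{..<t} - {a} - {b}. f x))" for f :: "nat \<Rightarrow> nat"
      using a by (subst sum.remove[of _ a], simp, simp, subst sum.remove[of _ b]) auto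
    have "\<mu> ?p = (t - a) * p (2 * b) + ((t - b) * p (2 * a) + (\<Sum>x\<in>{..<t} - {a} - {b}. (t - x) * p (2 * x)))"
      unfolding \<mu>_def ev split using a by simp
    moreover have "\<mu> p = (t - a) * p (2 * a) + ((t - b) * p (2 * b) + (\<Sum>x\<in>{..<t} - {a} - {b}. (t - x) * p (2 * x)))"
      unfolding \<mu>_def by (rule split)
    moreover have "(t - a) * p (2 * b) + (t - b) * p (2 * a) < (t - a) * p (2 * a) + (t - b) * p (2 * b)"
    proof -
      obtain u where u: "t - a = t - b + u" "u > 0" using a by (intro that[of "b - a"]) auto
      obtain v where "p (2 * a) = p (2 * b) + v" "v > 0" using lt by (intro that[of "p (2 * a) - p (2 * b)"]) auto
      then show ?thesis unfolding u(1) using u(2) by (simp add: algebra_simps)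
    qed
    ultimately have "\<mu> ?p < \<mu> p" by linarith
    moreover have "?p \<in> F"
      using p(1) a permutes_swap_blocks[of a t b p] blocks_swap_blocks[of a t b p] by (simp add: F_def)
    ultimately show False using p(2) by (meson leD)
  qed
  ultimately show ?thesis using pp p(1) by (intro bexI[of _ p]) (auto simp: canonical_def F_def)
qed

text \<open>The minima of the blocks, sorted, are the entries at even places; each odd place is then
  the partner of the entry before it.\<close>

lemma canonical_unique:
  assumes p: "p \<in> canonical t" and q: "q \<in> canonical t" and e: "blocks t p = blocks t q"
  shows "p = q"
proof -
  have mins: "Min ` blocks t r = (\<lambda>a. r (2 * a)) ` {..<t}" if "r \<in> canonical t" for r
  proof -
    have "Min {r (2 * a), r (2 * a + 1)} = r (2 * a)" if "a < t" for a
      using \<open>r \<in> _\<close> that by (auto simp: canonical_def min_def dest: spec[of _ a])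
    then show ?thesis by (auto simp: blocks_def image_image)
  qed
  have srt: "sorted_list_of_set ((\<lambda>a. r (2 * a)) ` {..<t}) = map (\<lambda>a. r (2 * a)) [0..<t]" if "r \<in> canonical t" for r
  proof -
    have "sorted_wrt (<) (map (\<lambda>a. r (2 * a)) [0..<t])"
      using that by (auto simp: sorted_wrt_iff_nth_less canonical_def)
    then show ?thesis
      by (intro strict_sorted_equal) (simp_all add: atLeast0LessThan)
  qed
  have "map (\<lambda>a. p (2 * a)) [0..<t] = map (\<lambda>a. q (2 * a)) [0..<t]"
    using srt[OF p] srt[OF q] mins[OF p] mins[OF q] e by metis
  then have ev: "p (2 * a) = q (2 * a)" if "a < t" for a using that by (auto simp: map_eq_conv)
  have od: "p (2 * a + 1) = q (2 * a + 1)" if a: "a < t" for a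
  proof -
    have "{p (2 * a), p (2 * a + 1)} \<in> blocks t q" using a e[symmetric] by (auto simp: blocks_def)
    then obtain b where b: "b < t" "{p (2 * a), p (2 * a + 1)} = {q (2 * b), q (2 * b + 1)}" by (auto simp: blocks_def)
    have "p (2 * a) < p (2 * a + 1)" "q (2 * b) < q (2 * b + 1)"
      using p q a b by (auto simp: canonical_def)
    then have eq: "p (2 * a) = q (2 * b)" "p (2 * a + 1) = q (2 * b + 1)" using b(2) by (auto simp: doubleton_eq_iff)
    then have "q (2 * a) = q (2 * b)" using ev[OF a] by simp
    then have "2 * a = 2 * b" using q permutes_inj[of q "{..<2 * t}"] injD[of q "2 * a" "2 * b"]
      by (simp add: canonical_def)
    then have "a = b" by simp
    then show ?thesis using eq by simp
  qed
  show ?thesis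
  proof
    fix i
    show "p i = q i"
    proof (cases "i < 2 * t")
      case True
      then show ?thesis using ev od by (cases rule: nat_lt_2t_cases) auto
    next
      case False
      then show ?thesis using p q permutes_not_in[of p "{..<2 * t}" i] permutes_not_in[of q "{..<2 * t}" i]
        by (simp add: canonical_def)
    qed
  qed
qed

text \<open>The canonical permutations represent the cosets of the stabilizer of the standard
  matching, and \<open>pterm\<close> is constant on each coset. This is the classical formula for
  \<open>2^t t!\<close> times the Pfaffian.\<close>

lemma sum_pterm_permutes:
  assumes A: "\<And>i j. A i j = - A j i"
  shows "(\<Sum>q | q permutes {..<2 * t}. pterm t A q) = of_nat (card (block_perms t)) * pfaffian t A"
proof -
  have perm: "p permutes {..<2 * t}" if "p \<in> canonical t" for p using that by (simp add: canonical_def)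
  have bij: "bij_betw (\<lambda>(p, h). p \<circ> h) (canonical t \<times> block_perms t) {q. q permutes {..<2 * t}}"
    unfolding bij_betw_def
  proof
    show "inj_on (\<lambda>(p, h). p \<circ> h) (canonical t \<times> block_perms t)"
    proof (rule inj_onI, clarify)
      fix p h p' h' assume *: "p \<in> canonical t" "h \<in> block_perms t" "p' \<in> canonical t" "h' \<in> block_perms t" "p \<circ> h = p' \<circ> h'"
      then have "blocks t (p \<circ> id) = blocks t (p' \<circ> id)"
        unfolding blocks_comp by (metis (mono_tags, lifting) block_perms_def blocks_comp mem_Collect_eq)
      then have "p = p'" using * canonical_unique by simp
      moreover from this have "h = h'" using *(5) permutes_inj[OF perm[OF *(1)]] by (simp add: fun.inj_map_strong inj_def fun_eq_iff)
      ultimately show "p = p' \<and> h = h'" by simp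
    qed
    show "(\<lambda>(p, h). p \<circ> h) ` (canonical t \<times> block_perms t) = {q. q permutes {..<2 * t}}"
    proof (intro subset_antisym subsetI)
      fix q assume "q \<in> {q. q permutes {..<2 * t}}"
      then have q: "q permutes {..<2 * t}" by simp
      obtain p where p: "p \<in> canonical t" "blocks t p = blocks t q" using canonical_exists[OF q] by blast
      let ?h = "inv_into UNIV p \<circ> q"
      have "blocks t ?h = (`) (inv_into UNIV p) ` blocks t (p \<circ> id)" unfolding blocks_comp[of t "inv_into UNIV p"] p(2)[symmetric] by simp
      also have "\<dots> = blocks t (inv_into UNIV p \<circ> (p \<circ> id))" by (rule blocks_comp[symmetric])
      also have "inv_into UNIV p \<circ> (p \<circ> id) = id" using permutes_inv_o(2)[OF perm[OF p(1)]] by simp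
      finally have "?h \<in> block_perms t"
        using permutes_compose[OF q permutes_inv[OF perm[OF p(1)]]] unfolding block_perms_def by blast
      moreover have "q = p \<circ> ?h" using permutes_inv_o(1)[OF perm[OF p(1)]] by (simp flip: comp_assoc)
      ultimately show "q \<in> (\<lambda>(p, h). p \<circ> h) ` (canonical t \<times> block_perms t)"
        using p(1) by (intro image_eqI[of _ _ "(p, ?h)"]) auto
    qed (auto simp: block_perms_def intro: permutes_compose perm)
  qed
  have "(\<Sum>q | q permutes {..<2 * t}. pterm t A q) = (\<Sum>x\<in>canonical t \<times> block_perms t. pterm t A (case x of (p, h) \<Rightarrow> p \<circ> h))"
    by (rule sum.reindex_bij_betw[OF bij, symmetric])
  also have "\<dots> = (\<Sum>p\<in>canonical t. \<Sum>h\<in>block_perms t. pterm t A (p \<circ> h))"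
    by (simp add: sum.cartesian_product split_def)
  also have "\<dots> = (\<Sum>p\<in>canonical t. \<Sum>h\<in>block_perms t. pterm t A p)"
  proof (intro sum.cong refl)
    fix p h assume ph: "p \<in> canonical t" "h \<in> block_perms t"
    show "pterm t A (p \<circ> h) = pterm t A p"
      by (rule pterm_block_perms[where A = A, OF perm[OF ph(1)] _ ph(2)]) (rule A)
  qed
  finally show ?thesis by (simp add: pfaffian_pterm sum_distrib_left)
qed

text \<open>Expanding all entries chooses, for every block, an index in \<open>K\<close> and one of
  its two products. With fewer indices than blocks two blocks share an index; exchanging the points
  that carry their \<open>a\<close>-factors preserves the product and flips the sign, so every
  choice contributes zero.\<close>

lemma sum_pterm_low_rank:
  fixes a b :: "nat \<Rightarrow> nat \<Rightarrow> 'a::{idom, ring_char_0}"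
  assumes "finite K" "card K < t" and A: "\<And>i j. A i j = (\<Sum>k\<in>K. a i k * b j k - b i k * a j k)"
  shows "(\<Sum>q | q permutes {..<2 * t}. pterm t A q) = 0"
proof -
  define f where "f = (\<lambda>(k, s::bool) i j. if s then - (b i k * a j k) else a i k * b j k)"
  define C where "C = K \<times> (UNIV :: bool set)"
  have finC: "finite C" using assms(1) by (simp add: C_def)
  have Af: "A i j = (\<Sum>c\<in>C. f c i j)" for i j
  proof -
    have "(\<Sum>c\<in>C. f c i j) = (\<Sum>k\<in>K. \<Sum>s\<in>UNIV. f (k, s) i j)"
      unfolding C_def sum.cartesian_product by (simp add: split_def)
    then show ?thesis unfolding A by (simp add: f_def UNIV_bool)
  qed
  define F where "F \<kappa> q = (\<Prod>x<t. f (\<kappa> x) (q (2 * x)) (q (2 * x + 1)))" for \<kappa> q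
  have "(\<Sum>q | q permutes {..<2 * t}. pterm t A q)
      = (\<Sum>q | q permutes {..<2 * t}. \<Sum>\<kappa>\<in>PiE {..<t} (\<lambda>_. C). of_int (sign q) * F \<kappa> q)"
    unfolding pterm_def Af F_def using finC
    by (intro sum.cong refl) (simp add: prod_sum_PiE sum_distrib_left)
  also have "\<dots> = (\<Sum>\<kappa>\<in>PiE {..<t} (\<lambda>_. C). \<Sum>q | q permutes {..<2 * t}. of_int (sign q) * F \<kappa> q)"
    by (rule sum.swap)
  also have "\<dots> = 0"
  proof (rule sum.neutral, rule ballI)
    fix \<kappa> assume k: "\<kappa> \<in> PiE {..<t} (\<lambda>_. C)"
    have "\<not> inj_on (fst \<circ> \<kappa>) {..<t}"
    proof
      assume "inj_on (fst \<circ> \<kappa>) {..<t}"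
      then have "card {..<t} \<le> card K"
      proof (rule card_inj_on_le)
        show "(fst \<circ> \<kappa>) ` {..<t} \<subseteq> K" using PiE_mem[OF k] by (auto simp: C_def mem_Times_iff)
      qed (rule assms(1))
      then show False using assms(2) by simp
    qed
    then obtain x y where xy: "x < t" "y < t" "x \<noteq> y" "fst (\<kappa> x) = fst (\<kappa> y)" by (auto simp: inj_on_def)
    \<comment> \<open>The offset inside block \<open>x\<close> of the point that carries the
      \<open>a\<close>-factor: the second point exactly if the negative product was chosen.\<close>
    define ox where "ox = (if snd (\<kappa> x) then 1 else 0 :: nat)"
    define oy where "oy = (if snd (\<kappa> y) then 1 else 0 :: nat)"
    define \<tau> where "\<tau> = transpose (2 * x + ox) (2 * y + oy)"
    have o: "ox < 2" "oy < 2" by (auto simp: ox_def oy_def)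
    have ne: "2 * x + ox \<noteq> 2 * y + oy" using xy(3) o by presburger
    have \<tau>p: "\<tau> permutes {..<2 * t}" unfolding \<tau>_def using xy o by (intro permutes_swap_id) auto
    have split: "(\<Prod>z<t. g z) = g x * g y * (\<Prod>z\<in>{..<t} - {x} - {y}. g z)" for g :: "nat \<Rightarrow> 'a"
      using xy by (subst prod.remove[of _ x], simp, simp, subst prod.remove[of _ y]) (auto simp: mult.assoc)
    have inv: "F \<kappa> (q \<circ> \<tau>) = F \<kappa> q" for q
    proof -
      have rest: "\<tau> (2 * z) = 2 * z" "\<tau> (2 * z + 1) = 2 * z + 1" if "z \<noteq> x" "z \<noteq> y" for z
      proof -
        have "2 * z \<noteq> 2 * x + ox" "2 * z \<noteq> 2 * y + oy" "2 * z + 1 \<noteq> 2 * x + ox" "2 * z + 1 \<noteq> 2 * y + oy"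
          using that o by presburger+
        then show "\<tau> (2 * z) = 2 * z" "\<tau> (2 * z + 1) = 2 * z + 1"
          by (simp_all only: \<tau>_def transpose_apply_other not_False_eq_True)
      qed
      obtain k s where kx: "\<kappa> x = (k, s)" by (cases "\<kappa> x")
      obtain r where ky: "\<kappa> y = (k, r)" using xy(4) kx by (cases "\<kappa> y") simp
      have xy2: "2 * x \<noteq> 2 * y" "Suc (2 * x) \<noteq> Suc (2 * y)" "2 * x \<noteq> Suc (2 * y)" "2 * y \<noteq> Suc (2 * x)"
        using xy(3) by presburger+
      have "f (\<kappa> x) ((q \<circ> \<tau>) (2 * x)) ((q \<circ> \<tau>) (2 * x + 1)) * f (\<kappa> y) ((q \<circ> \<tau>) (2 * y)) ((q \<circ> \<tau>) (2 * y + 1))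
          = f (\<kappa> x) (q (2 * x)) (q (2 * x + 1)) * f (\<kappa> y) (q (2 * y)) (q (2 * y + 1))"
        using xy2 not_sym[OF xy2(1)] not_sym[OF xy2(2)] not_sym[OF xy2(3)] not_sym[OF xy2(4)] unfolding \<tau>_def ox_def oy_def kx ky f_def
        by (cases s; cases r) (simp_all add: transpose_def)
      moreover have "(\<Prod>z\<in>{..<t} - {x} - {y}. f (\<kappa> z) ((q \<circ> \<tau>) (2 * z)) ((q \<circ> \<tau>) (2 * z + 1)))
          = (\<Prod>z\<in>{..<t} - {x} - {y}. f (\<kappa> z) (q (2 * z)) (q (2 * z + 1)))"
        using rest by (intro prod.cong refl) auto
      ultimately show ?thesis unfolding F_def split by simp
    qed
    let ?S = "\<Sum>q | q permutes {..<2 * t}. of_int (sign q) * F \<kappa> q"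
    have "?S = (\<Sum>q | q permutes {..<2 * t}. of_int (sign (q \<circ> \<tau>)) * F \<kappa> (q \<circ> \<tau>))"
      by (rule sum_permutations_compose_right[OF \<tau>p])
    also have "\<dots> = (\<Sum>q | q permutes {..<2 * t}. - (of_int (sign q) * F \<kappa> q))"
    proof (intro sum.cong refl)
      fix q assume "q \<in> {q. q permutes {..<2 * t}}"
      then have "permutation q" "permutation \<tau>"
        using \<tau>p by (auto intro: permutes_imp_permutation[of "{..<2 * t}"])
      then have "sign (q \<circ> \<tau>) = - sign q" using ne by (simp add: sign_compose \<tau>_def sign_swap_id)
      then show "of_int (sign (q \<circ> \<tau>)) * F \<kappa> (q \<circ> \<tau>) = - (of_int (sign q) * F \<kappa> q)" using inv by simp
    qed
    also have "\<dots> = - ?S" by (rule sum_negf)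
    \<comment> \<open>Passing from \<open>?S = - ?S\<close> to \<open>?S = 0\<close> divides by 2,
      hence the assumption on the characteristic.\<close>
    finally have "?S + ?S = 0" by simp
    then have "2 * ?S = 0" by (simp only: mult_2)
    then show "?S = 0" by simp
  qed
  finally show ?thesis .
qed

text \<open>The matrix is a sum of \<open>card K\<close> skew forms of rank at most 2, so its rank
  is below its size 2t. The sum over all permutations vanishes, and its multiplicity
  \<open>card (block_perms t)\<close> is a nonzero integer that cancels.\<close>

theorem pfaffian_low_rank:
  fixes a b :: "nat \<Rightarrow> nat \<Rightarrow> 'a::{idom, ring_char_0}"
  assumes "finite K" "card K < t" and A: "\<And>i j. A i j = (\<Sum>k\<in>K. a i k * b j k - b i k * a j k)"
  shows "pfaffian t A = 0"
proof -
  have "finite (block_perms t)"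
    by (rule finite_subset[OF _ finite_permutations[of "{..<2 * t}"]]) (auto simp: block_perms_def)
  moreover have "id \<in> block_perms t" by (auto simp: block_perms_def permutes_id)
  ultimately have card: "card (block_perms t) \<noteq> 0" by auto
  have skew: "A i j = - A j i" for i j
    unfolding A sum_negf[symmetric] by (intro sum.cong refl) (simp add: mult.commute)
  have "of_nat (card (block_perms t)) * pfaffian t A = 0"
    unfolding sum_pterm_permutes[of A t, OF skew, symmetric] by (rule sum_pterm_low_rank[OF assms])
  then show ?thesis using card by simp
qed


section \<open>Ideals of a subring as contractions from the ambient ring, and adjunction of
  variables\<close>

section \<open>Ideals and coefficients\<close>

text \<open>With the ring seen as a module over itself, \<open>gen.span B\<close> is the ideal
  generated by \<open>B\<close> in the polynomial ring in all variables; \<open>kv.span\<close>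
  below is the linear span over the field.\<close>

interpretation gen: module "(*) :: 'a::comm_ring_1 \<Rightarrow> 'a \<Rightarrow> 'a"
  by unfold_locales (simp_all add: distrib_left distrib_right mult.assoc)

interpretation kv: vector_space "\<lambda>(c::'k::field) (p::'k mpoly). cst c * p"
  by (rule vector_space.intro)
    (simp_all only: cst_1 cst_mult cst_add distrib_left distrib_right mult.assoc mult_1_left)

lemma hom_span:
  assumes "\<And>p q. f (p + q) = f p + f q" "\<And>p q. f (p * q) = f p * f q"
    and "\<And>b. b \<in> B \<Longrightarrow> f b \<in> gen.span C" and "p \<in> gen.span B"
  shows "(f :: 'a::comm_ring_1 \<Rightarrow> 'a) p \<in> gen.span C"
  using assms(4)
proof (induction rule: gen.span_induct_alt)
  case base
  have "f 0 + f 0 = f 0" using assms(1)[of 0 0] by simp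
  then show ?case by (simp add: gen.span_zero)
next
  case (step c b y)
  have "f (c * b + y) = f c * f b + f y" by (simp only: assms(1,2))
  then show ?case using step assms(3)[of b] by (simp add: gen.span_add gen.span_scale)
qed

lemma alghom_span:
  "alghom f \<Longrightarrow> (\<And>b. b \<in> B \<Longrightarrow> f b \<in> gen.span C) \<Longrightarrow> p \<in> gen.span B \<Longrightarrow> f p \<in> gen.span C"
  by (rule hom_span[of f B C p]) (simp_all add: alghom_add alghom_mult)

lemma span_image_finite:
  assumes E: "finite Es" and p: "p \<in> gen.span (f ` Es)"
  shows "\<exists>h. p = (\<Sum>e\<in>Es. h e * f e)"
  using p
proof (induction rule: gen.span_induct_alt)
  case base
  then show ?case by (intro exI[of _ "\<lambda>_. 0"]) simp
next
  case (step c b y)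
  then obtain e h where e: "e \<in> Es" "b = f e" and h: "y = (\<Sum>e\<in>Es. h e * f e)" by auto
  have "(\<Sum>x\<in>Es. (h(e := h e + c)) x * f x) = (\<Sum>x\<in>Es. h x * f x + (if x = e then c * f e else 0))"
    by (intro sum.cong refl) (auto simp: distrib_right)
  also have "\<dots> = y + c * f e" unfolding sum.distrib h using e(1) E by simp
  also have "\<dots> = c * b + y" unfolding e(2) by (rule add.commute)
  finally show ?case by (intro exI[of _ "h(e := h e + c)"]) (rule sym)
qed

text \<open>An ideal with homogeneous generators is graded: the component of a multiple of a
  generator is a component of the cofactor times that generator.\<close>

lemma span_homog_hcomp:
  assumes "\<And>b. b \<in> B \<Longrightarrow> \<exists>r. homog w r b" "p \<in> gen.span B"
  shows "hcomp w s p \<in> gen.span B"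
  using assms(2)
proof (induction rule: gen.span_induct_alt)
  case base
  then show ?case by (simp add: lin_0 gen.span_zero)
next
  case (step c b y)
  obtain r where r: "homog w r b" using assms(1) step by blast
  have "hcomp w s (c * b) \<in> gen.span B"
    using hcomp_mult_homog[OF r, of s c] step gen.span_zero[of B]
      gen.span_scale[OF gen.span_base[of b B], of "hcomp w (s - r) c"]
    by (simp add: mult.commute[of b])
  then show ?case using step by (simp add: lin_add gen.span_add)
qed

definition restr :: "(nat \<times> nat) set \<Rightarrow> mexp \<Rightarrow> mexp" where
  "restr W m = Poly_Mapping.mapp (\<lambda>v c. if v \<in> W then c else 0) m"

lemma lookup_restr: "lookup (restr W m) v = (if v \<in> W then lookup m v else 0)"
  by (simp add: restr_def lookup_mapp when_def in_keys_iff)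
lemma keys_restr [simp]: "keys (restr W m) = keys m \<inter> W"
  by (auto simp: in_keys_iff lookup_restr split: if_splits)
lemma restr_add: "restr W (m + n) = restr W m + restr W n"
  by (rule poly_mapping_eqI) (simp add: lookup_restr lookup_add)
lemma restr_id: "keys m \<subseteq> W \<Longrightarrow> restr W m = m"
  by (rule poly_mapping_eqI) (auto simp: lookup_restr in_keys_iff)
lemma restr_0: "keys m \<inter> W = {} \<Longrightarrow> restr W m = 0"
  by (rule poly_mapping_eqI) (auto simp: lookup_restr in_keys_iff)
lemma restr_split: "m = restr W m + restr (- W) m"
  by (rule poly_mapping_eqI) (simp add: lookup_restr lookup_add)

text \<open>\<open>cf W \<mu> p\<close> is the coefficient of \<open>\<mu>\<close> in \<open>p\<close> seen as a polynomial in the variables \<open>W\<close>.\<close>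

definition cf :: "(nat \<times> nat) set \<Rightarrow> mexp \<Rightarrow> 'k::field mpoly \<Rightarrow> 'k mpoly" where
  "cf W \<mu> = linext (\<lambda>m. if restr W m = \<mu> then xmon (restr (- W) m) else 0)"

lemma lin_cf [simp]: "lin (cf W \<mu>)" by (simp add: cf_def)
lemma cf_xmon: "cf W \<mu> (xmon m) = (if restr W m = \<mu> then xmon (restr (- W) m) else 0)"
  by (simp add: cf_def)

lemma polys_cf: "p \<in> polys V \<Longrightarrow> cf W \<mu> p \<in> polys (V - W)"
  unfolding cf_def by (rule polys_linext) (auto dest: polysD)

lemma polys_cf': "cf W \<mu> p \<in> polys (- W)"
  using polys_cf[of p UNIV W] by (simp add: Compl_eq_Diff_UNIV)

lemma cf_sum:
  assumes "finite A" "restr W ` keys p \<subseteq> A"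
  shows "p = (\<Sum>\<mu>\<in>A. xmon \<mu> * cf W \<mu> p)"
proof (rule lin_eqI[of "\<lambda>p. p" "\<lambda>p. \<Sum>\<mu>\<in>A. xmon \<mu> * cf W \<mu> p"])
  fix m assume "m \<in> keys p"
  then have "restr W m \<in> A" using assms by auto
  then have "(\<Sum>\<mu>\<in>A. xmon \<mu> * cf W \<mu> (xmon m)) = xmon (restr W m) * (xmon (restr (- W) m) :: 'a mpoly)"
    using assms(1) by (simp add: cf_xmon if_distrib cong: if_cong)
  also have "\<dots> = xmon m" by (simp flip: xmon_add restr_split)
  finally show "xmon m = (\<Sum>\<mu>\<in>A. xmon \<mu> * cf W \<mu> (xmon m :: 'a mpoly))" by (rule sym)
qed (rule lin_id, rule lin_setsum, rule lin_mult_left, rule lin_cf)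

lemma cf_eq_0: "\<mu> \<notin> restr W ` keys p \<Longrightarrow> cf W \<mu> p = 0"
  unfolding cf_def linext_def by (rule sum.neutral) auto

lemma lin_mult_arg: "lin f \<Longrightarrow> lin (\<lambda>q. f (q * p))"
  unfolding lin_def by (simp only: distrib_right mult.assoc) simp

lemma lin_mult_arg': "lin f \<Longrightarrow> lin (\<lambda>q. f (p * q))"
  unfolding lin_def by (simp only: distrib_left mult.left_commute[of p]) simp

lemma cf_mult_const:
  assumes "q \<in> polys (- W)"
  shows "cf W \<mu> (q * p) = q * cf W \<mu> p"
proof (rule lin_eqI[of "\<lambda>q. cf W \<mu> (q * p)" "\<lambda>q. q * cf W \<mu> p"])
  show "lin (\<lambda>q. cf W \<mu> (q * p))" by (rule lin_mult_arg, rule lin_cf)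
  fix m assume "m \<in> keys q"
  then have m: "keys m \<inter> W = {}" using polysD[OF assms] by blast
  then have m': "restr W m = 0" "restr (- W) m = m" by (auto intro: restr_0 restr_id)
  show "cf W \<mu> (xmon m * p) = xmon m * cf W \<mu> p"
  proof (rule lin_eqI[of "\<lambda>p. cf W \<mu> (xmon m * p)" "\<lambda>p. xmon m * cf W \<mu> p"])
    show "lin (\<lambda>p. cf W \<mu> (xmon m * p))" by (rule lin_mult_arg', rule lin_cf)
    fix n
    show "cf W \<mu> (xmon m * xmon n) = xmon m * cf W \<mu> (xmon n :: 'a mpoly)"
      using m' by (simp add: cf_xmon restr_add flip: xmon_add)
  qed (rule lin_mult_left, rule lin_cf)
next
  show "lin (\<lambda>q. q * cf W \<mu> p)" by (simp only: lin_def distrib_right mult.assoc) simp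
qed

lemma cf_const: "q \<in> polys (- W) \<Longrightarrow> cf W \<mu> q = (if \<mu> = 0 then q else 0)"
  using cf_mult_const[of q W \<mu> 1] cf_xmon[of W \<mu> 0] by (auto simp: restr_0)

lemma cf_xmon_mult:
  assumes "q \<in> polys (- W)" "keys \<nu> \<subseteq> W"
  shows "cf W \<mu> (xmon \<nu> * q) = (if \<mu> = \<nu> then q else 0)"
proof -
  have "restr (- W) \<nu> = 0" using assms(2) by (intro restr_0) auto
  then show ?thesis
    using cf_mult_const[OF assms(1), of \<mu> "xmon \<nu>"] assms(2)
    by (auto simp: cf_xmon restr_id mult.commute)
qed

lemma cf_mult:
  assumes "finite A" "restr W ` keys p \<subseteq> A" "finite B" "restr W ` keys q \<subseteq> B"
    and "\<And>\<mu>. \<mu> \<in> A \<union> B \<Longrightarrow> keys \<mu> \<subseteq> W"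
  shows "cf W \<rho> (p * q) = (\<Sum>\<mu>\<in>A. \<Sum>\<nu>\<in>B. if \<mu> + \<nu> = \<rho> then cf W \<mu> p * cf W \<nu> q else 0)"
proof -
  have "p * q = (\<Sum>\<mu>\<in>A. xmon \<mu> * cf W \<mu> p) * (\<Sum>\<nu>\<in>B. xmon \<nu> * cf W \<nu> q)"
    by (rule arg_cong2[where f = "(*)", OF cf_sum[OF assms(1,2)] cf_sum[OF assms(3,4)]])
  also have "\<dots> = (\<Sum>\<mu>\<in>A. \<Sum>\<nu>\<in>B. xmon (\<mu> + \<nu>) * (cf W \<mu> p * cf W \<nu> q))"
    unfolding sum_product xmon_add by (intro sum.cong refl) (simp only: mult_ac)
  also have "cf W \<rho> \<dots> = (\<Sum>\<mu>\<in>A. \<Sum>\<nu>\<in>B. if \<mu> + \<nu> = \<rho> then cf W \<mu> p * cf W \<nu> q else 0)"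
    unfolding lin_sum[OF lin_cf]
  proof (intro sum.cong refl, goal_cases)
    case (1 a b)
    have "cf W \<rho> (xmon (a + b) * (cf W a p * cf W b q)) = (if \<rho> = a + b then cf W a p * cf W b q else 0)"
      using 1 assms(5) by (intro cf_xmon_mult polys_mult polys_cf') (simp add: keys_add_mexp)
    then show ?case by (simp only: eq_commute)
  qed
  finally show ?thesis .
qed

lemma span_cf:
  assumes "B \<subseteq> polys (- W)" "p \<in> gen.span B"
  shows "cf W \<mu> p \<in> gen.span B"
  using assms(2)
proof (induction rule: gen.span_induct_alt)
  case base
  then show ?case by (simp add: lin_0 gen.span_zero)
next
  case (step c b y)
  have "cf W \<mu> (b * c) = b * cf W \<mu> c" by (rule cf_mult_const) (use step assms in blast)
  then show ?case using step
    by (simp add: lin_add mult.commute[of _ b] gen.span_add)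
       (metis gen.span_add gen.span_base gen.span_scale mult.commute)
qed

text \<open>The generators are constants with respect to \<open>W\<close>, so the ideal is extended
  from the polynomials free of \<open>W\<close> and membership is decided coefficient by
  coefficient.\<close>

lemma span_cf_iff:
  assumes "B \<subseteq> polys (- W)"
  shows "p \<in> gen.span B \<longleftrightarrow> (\<forall>\<mu>. cf W \<mu> p \<in> gen.span B)"
proof
  assume *: "\<forall>\<mu>. cf W \<mu> p \<in> gen.span B"
  have "(\<Sum>\<mu>\<in>restr W ` keys p. xmon \<mu> * cf W \<mu> p) \<in> gen.span B"
    using * by (intro gen.span_sum gen.span_scale) auto
  then show "p \<in> gen.span B" using cf_sum[of "restr W ` keys p" W p] by simp
qed (use span_cf[OF assms] in blast)

subsection \<open>Ideals of a polynomial ring in given variables\<close>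

text \<open>The variables in \<open>V\<close> survive and all others are set to zero: a retraction
  of the ambient ring onto \<open>polys V\<close>.\<close>

definition kill :: "(nat \<times> nat) set \<Rightarrow> 'k::field mpoly \<Rightarrow> 'k mpoly" where
  "kill V = subst (\<lambda>v. if v \<in> V then mvar v else 0)"

lemma alghom_kill [simp]: "alghom (kill V)" by (simp add: kill_def)
lemma kill_polys: "p \<in> polys W \<Longrightarrow> kill V p \<in> polys (V \<inter> W)"
  unfolding kill_def by (rule polys_subst[of _ W]) auto
lemma kill_polys': "kill V p \<in> polys V"
  using kill_polys[of p UNIV V] by simp
lemma kill_id: "p \<in> polys V \<Longrightarrow> kill V p = p"
  unfolding kill_def by (rule subst_id) auto

definition idealin :: "(nat \<times> nat) set \<Rightarrow> 'k::field mpoly set \<Rightarrow> bool" where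
  "idealin V I \<longleftrightarrow> I \<subseteq> polys V \<and> 0 \<in> I \<and> (\<forall>p\<in>I. \<forall>q\<in>I. p + q \<in> I) \<and> (\<forall>p\<in>I. \<forall>q\<in>polys V. q * p \<in> I)"

lemma idealin_span: "B \<subseteq> polys V \<Longrightarrow> idealin V (gen.span B \<inter> polys V)"
  unfolding idealin_def by (auto intro: gen.span_zero gen.span_add gen.span_scale polys_add polys_mult)

lemma idealin_uminus: "idealin V I \<Longrightarrow> p \<in> I \<Longrightarrow> - p \<in> I"
  unfolding idealin_def by (metis cst_1 cst_uminus mult_minus1 polys_cst)

lemma idealin_diff: "idealin V I \<Longrightarrow> p \<in> I \<Longrightarrow> q \<in> I \<Longrightarrow> p - q \<in> I"
  using idealin_uminus[of V I q] unfolding idealin_def by (metis add_uminus_conv_diff)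

lemma idealin_sum: "idealin V I \<Longrightarrow> (\<And>a. a \<in> A \<Longrightarrow> f a \<in> I) \<Longrightarrow> sum f A \<in> I"
  by (induction A rule: infinite_finite_induct) (auto simp: idealin_def)

text \<open>The retraction fixes the generators and moves their cofactors into
  \<open>polys V\<close>, where \<open>I\<close> absorbs them.\<close>

lemma span_Int_polys:
  assumes I: "idealin V I" and "B \<subseteq> I" "p \<in> gen.span B"
  shows "kill V p \<in> I"
  using assms(3)
proof (induction rule: gen.span_induct_alt)
  case base
  then show ?case using I by (simp add: idealin_def lin_0 alghom_lin)
next
  case (step c b y)
  then have b: "b \<in> I" "b \<in> polys V" using I assms(2) by (auto simp: idealin_def)
  have "kill V c \<in> polys V" by (rule kill_polys')
  then show ?case using I step b
    by (simp add: alghom_add alghom_mult kill_id idealin_def)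
qed

lemma span_idealin: "idealin V I \<Longrightarrow> p \<in> gen.span I \<Longrightarrow> p \<in> polys V \<Longrightarrow> p \<in> I"
  using span_Int_polys[of V I I p] kill_id[of p V] by simp

lemma carrier_mpoly_ring [simp]: "carrier (mpoly_ring K V) = polys V"
  by (auto simp: mpoly_ring_def polys_iff_mvars)

lemma ideal_mpoly_ring: "ideal I (mpoly_ring TYPE('k::field) V) \<longleftrightarrow> idealin V (I :: 'k mpoly set)"
proof
  assume "ideal I (mpoly_ring TYPE('k) V)"
  then interpret ideal I "mpoly_ring TYPE('k) V" .
  show "idealin V I"
    using a_subset additive_subgroup.zero_closed[OF additive_subgroup_axioms]
      additive_subgroup.a_closed[OF additive_subgroup_axioms] I_l_closed
    by (auto simp: idealin_def mpoly_ring_def polys_iff_mvars)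
next
  assume I: "idealin V I"
  have ring: "ring (mpoly_ring TYPE('k) V)" using mpoly_ring_cring by (rule cring.axioms(1))
  then interpret ring "mpoly_ring TYPE('k) V" .
  have sub: "subgroup I (add_monoid (mpoly_ring TYPE('k) V))"
  proof (rule group.subgroupI)
    show "group (add_monoid (mpoly_ring TYPE('k) V))" using a_group by simp
    show "I \<subseteq> carrier (add_monoid (mpoly_ring TYPE('k) V))" "I \<noteq> {}"
      using I by (auto simp: idealin_def)
    fix a assume a: "a \<in> I"
    then have "a \<in> polys V" using I by (auto simp: idealin_def)
    moreover have "\<ominus>\<^bsub>mpoly_ring TYPE('k) V\<^esub> a = - a"
    proof (rule minus_equality)
      show "- a \<oplus>\<^bsub>mpoly_ring TYPE('k) V\<^esub> a = \<zero>\<^bsub>mpoly_ring TYPE('k) V\<^esub>" by (simp add: mpoly_ring_def)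
    qed (use calculation in \<open>auto intro: polys_uminus\<close>)
    ultimately show "inv\<^bsub>add_monoid (mpoly_ring TYPE('k) V)\<^esub> a \<in> I"
      using idealin_uminus[OF I a] by (simp add: a_inv_def)
    fix b assume "b \<in> I"
    then show "a \<otimes>\<^bsub>add_monoid (mpoly_ring TYPE('k) V)\<^esub> b \<in> I"
      using I a by (auto simp: idealin_def mpoly_ring_def)
  qed
  show "ideal I (mpoly_ring TYPE('k) V)"
  proof (rule idealI[OF ring sub])
    fix a x assume "a \<in> I" "x \<in> carrier (mpoly_ring TYPE('k) V)"
    then have "x * a \<in> I" using I by (auto simp: idealin_def)
    then show "x \<otimes>\<^bsub>mpoly_ring TYPE('k) V\<^esub> a \<in> I" "a \<otimes>\<^bsub>mpoly_ring TYPE('k) V\<^esub> x \<in> I"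
      by (simp_all add: mpoly_ring_def mult.commute)
  qed
qed

text \<open>The bridge to the ideals of the carriers: extension to the ambient ring followed by
  contraction adds nothing, because cofactors can be retracted by \<open>kill V\<close>. From here
  on ideals are handled as ambient spans.\<close>

lemma Idl_mpoly_ring:
  assumes "B \<subseteq> polys V"
  shows "Idl\<^bsub>mpoly_ring TYPE('k::field) V\<^esub> (B :: 'k mpoly set) = gen.span B \<inter> polys V"
proof
  have "B \<subseteq> gen.span B \<inter> polys V" using assms by (auto intro: gen.span_base)
  then show "Idl\<^bsub>mpoly_ring TYPE('k) V\<^esub> B \<subseteq> gen.span B \<inter> polys V"
    unfolding genideal_def ideal_mpoly_ring using idealin_span[OF assms] by blast
  show "gen.span B \<inter> polys V \<subseteq> Idl\<^bsub>mpoly_ring TYPE('k) V\<^esub> B"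
  proof
    fix p assume p: "p \<in> gen.span B \<inter> polys V"
    have "p \<in> I" if "idealin V I" "B \<subseteq> I" for I
      using span_Int_polys[OF that, of p] p kill_id[of p V] by auto
    then show "p \<in> Idl\<^bsub>mpoly_ring TYPE('k) V\<^esub> B"
      unfolding genideal_def by (auto simp: ideal_mpoly_ring)
  qed
qed

definition prime_in :: "(nat \<times> nat) set \<Rightarrow> 'k::field mpoly set \<Rightarrow> bool" where
  "prime_in V I \<longleftrightarrow> idealin V I \<and> 1 \<notin> I \<and> (\<forall>p\<in>polys V. \<forall>q\<in>polys V. p * q \<in> I \<longrightarrow> p \<in> I \<or> q \<in> I)"

definition radical_in :: "(nat \<times> nat) set \<Rightarrow> 'k::field mpoly set \<Rightarrow> bool" where
  "radical_in V I \<longleftrightarrow> idealin V I \<and> (\<forall>p\<in>polys V. \<forall>m. p ^ m \<in> I \<longrightarrow> p \<in> I)"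

lemma idealin_eq_polys: "idealin V I \<Longrightarrow> I = polys V \<longleftrightarrow> 1 \<in> I"
  unfolding idealin_def by (metis mult.right_neutral polys_1 subsetI subset_antisym)

lemma prime_mpoly_ring: "primeideal I (mpoly_ring TYPE('k::field) V) \<longleftrightarrow> prime_in V (I :: 'k mpoly set)"
proof
  assume "primeideal I (mpoly_ring TYPE('k) V)"
  then interpret primeideal I "mpoly_ring TYPE('k) V" .
  have I: "idealin V I" using ideal_mpoly_ring ideal_axioms by blast
  then show "prime_in V I"
    using I_notcarr I_prime idealin_eq_polys[OF I] by (auto simp: prime_in_def mpoly_ring_def polys_iff_mvars)
next
  assume I: "prime_in V I"
  then have I': "idealin V I" by (simp add: prime_in_def)
  show "primeideal I (mpoly_ring TYPE('k) V)"
  proof (rule primeidealI)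
    show "ideal I (mpoly_ring TYPE('k) V)" using I' ideal_mpoly_ring by blast
    show "carrier (mpoly_ring TYPE('k) V) \<noteq> I"
      using I idealin_eq_polys[OF I'] by (auto simp: prime_in_def)
    fix a b assume "a \<in> carrier (mpoly_ring TYPE('k) V)" "b \<in> carrier (mpoly_ring TYPE('k) V)"
      "a \<otimes>\<^bsub>mpoly_ring TYPE('k) V\<^esub> b \<in> I"
    then show "a \<in> I \<or> b \<in> I" using I by (simp add: prime_in_def) (simp add: mpoly_ring_def)
  qed (rule mpoly_ring_cring)
qed

lemma nat_pow_mpoly_ring: "a [^]\<^bsub>mpoly_ring K V\<^esub> (m::nat) = a ^ m"
  unfolding nat_pow_def by (induction m) (auto simp: mpoly_ring_def)

lemma radical_mpoly_ring: "radical_ideal I (mpoly_ring TYPE('k::field) V) \<longleftrightarrow> radical_in V (I :: 'k mpoly set)"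
  by (simp add: radical_ideal_def radical_in_def ideal_mpoly_ring nat_pow_mpoly_ring)

text \<open>Primality and radicality survive the adjunction of variables: compare the coefficients at the
  largest monomials in the new variables that are not in the ideal.\<close>

lemma leading_coefficient_modulo:
  assumes I: "idealin V I" and "p \<notin> gen.span I"
  obtains p' \<mu> where "p - p' \<in> gen.span I" "keys \<mu> \<subseteq> - V" "cf (- V) \<mu> p' \<notin> I" "\<And>\<nu>. \<mu> < \<nu> \<Longrightarrow> cf (- V) \<nu> p' = 0"
proof -
  let ?A = "restr (- V) ` keys p"
  \<comment> \<open>The exponents whose coefficient is not in the ideal. Dropping all other terms of
    \<open>p\<close> changes it only modulo the ideal.\<close>
  define M where "M = {\<mu>\<in>?A. cf (- V) \<mu> p \<notin> gen.span I}"
  define p' where "p' = (\<Sum>\<mu>\<in>M. xmon \<mu> * cf (- V) \<mu> p)"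
  have IV: "I \<subseteq> polys (- (- V))" using I by (simp add: idealin_def)
  have fin: "finite M" "M \<subseteq> ?A" by (auto simp: M_def)
  have cf0: "cf (- V) \<mu> p = 0" if "\<mu> \<notin> ?A" for \<mu> using that by (rule cf_eq_0)
  have "M \<noteq> {}"
  proof
    assume "M = {}"
    then have "\<forall>\<mu>. cf (- V) \<mu> p \<in> gen.span I"
      using cf0 gen.span_zero[of I] unfolding M_def by fastforce
    then show False using span_cf_iff[OF IV] assms(2) by blast
  qed
  have "p = (\<Sum>\<mu>\<in>?A. xmon \<mu> * cf (- V) \<mu> p)" by (rule cf_sum) auto
  also have "\<dots> = p' + (\<Sum>\<mu>\<in>?A - M. xmon \<mu> * cf (- V) \<mu> p)"
    unfolding p'_def using fin by (simp add: sum.subset_diff[of M ?A] add.commute)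
  finally have "(\<Sum>\<mu>\<in>?A - M. xmon \<mu> * cf (- V) \<mu> p) + p' = p" by (simp only: add.commute)
  then have "p - p' = (\<Sum>\<mu>\<in>?A - M. xmon \<mu> * cf (- V) \<mu> p)" by (rule add_implies_diff[symmetric])
  also have "\<dots> \<in> gen.span I" by (intro gen.span_sum gen.span_scale) (auto simp: M_def)
  finally have 1: "p - p' \<in> gen.span I" .
  have 2: "cf (- V) \<mu> p' = (if \<mu> \<in> M then cf (- V) \<mu> p else 0)" for \<mu>
  proof -
    have "cf (- V) \<mu> p' = (\<Sum>\<nu>\<in>M. if \<mu> = \<nu> then cf (- V) \<nu> p else 0)"
      unfolding p'_def lin_sum[OF lin_cf] using fin
      by (intro sum.cong refl cf_xmon_mult polys_cf') auto
    then show ?thesis using fin by simp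
  qed
  have top: "Max M \<in> M" "\<And>\<nu>. Max M < \<nu> \<Longrightarrow> \<nu> \<notin> M" using fin(1) \<open>M \<noteq> {}\<close> Max_ge leD by auto
  show thesis
  proof (rule that[of p' "Max M"])
    show "keys (Max M) \<subseteq> - V" using top(1) fin by auto
    have "cf (- V) (Max M) p \<notin> gen.span I" using top(1) by (simp add: M_def)
    then show "cf (- V) (Max M) p' \<notin> I" using 2 top(1) by (metis gen.span_base)
  qed (use 1 2 top in auto)
qed

text \<open>The linear order on exponents (lexicographic, with variables ordered as pairs) is
  compatible with addition, so only the pair of the two leading exponents reaches their sum.\<close>

lemma leading_coefficient_mult:
  assumes "\<And>\<rho>. \<mu> < \<rho> \<Longrightarrow> cf W \<rho> p = 0" "\<And>\<rho>. \<nu> < \<rho> \<Longrightarrow> cf W \<rho> q = 0" "keys \<mu> \<subseteq> W" "keys \<nu> \<subseteq> W"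
  shows "cf W (\<mu> + \<nu>) (p * q) = cf W \<mu> p * cf W \<nu> q"
    and "\<And>\<rho>. \<mu> + \<nu> < \<rho> \<Longrightarrow> cf W \<rho> (p * q) = 0"
proof -
  let ?A = "insert \<mu> (restr W ` keys p)" and ?B = "insert \<nu> (restr W ` keys q)"
  have *: "cf W \<rho> (p * q) = (\<Sum>\<mu>\<in>?A. \<Sum>\<nu>\<in>?B. if \<mu> + \<nu> = \<rho> then cf W \<mu> p * cf W \<nu> q else 0)" for \<rho>
    using assms(3,4) by (intro cf_mult) auto
  show "cf W \<rho> (p * q) = 0" if "\<mu> + \<nu> < \<rho>" for \<rho>
    unfolding *
  proof (intro sum.neutral ballI, goal_cases)
    case (1 a b)
    have "\<mu> < a \<or> \<nu> < b" if "a + b = \<rho>"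
      using that \<open>\<mu> + \<nu> < \<rho>\<close> add_mono[of a \<mu> b \<nu>] by (auto simp: not_less[symmetric])
    then show ?case using assms by auto
  qed
  have "cf W (\<mu> + \<nu>) (p * q) = (\<Sum>a\<in>?A. \<Sum>b\<in>?B. if a = \<mu> \<and> b = \<nu> then cf W \<mu> p * cf W \<nu> q else 0)"
    unfolding *
  proof (intro sum.cong refl, goal_cases)
    case (1 a b)
    have "\<mu> < a \<or> \<nu> < b" if "a + b = \<mu> + \<nu>" "\<not> (a = \<mu> \<and> b = \<nu>)"
    proof (rule ccontr)
      assume "\<not> ?thesis"
      then have le: "a \<le> \<mu>" "b \<le> \<nu>" by auto
      show False
      proof (cases "a = \<mu>")
        case True
        then show False using that by simp
      next
        case False
        then have "a + b < \<mu> + \<nu>" using le by (intro add_less_le_mono) auto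
        then show False using that by simp
      qed
    qed
    then show ?case using assms by auto
  qed
  also have "\<dots> = (\<Sum>a\<in>?A. if a = \<mu> then cf W \<mu> p * cf W \<nu> q else 0)"
    by (intro sum.cong refl) auto
  also have "\<dots> = cf W \<mu> p * cf W \<nu> q" by simp
  finally show "cf W (\<mu> + \<nu>) (p * q) = cf W \<mu> p * cf W \<nu> q" .
qed

lemma prime_in_span:
  assumes I: "prime_in V I" and pq: "p * q \<in> gen.span I"
  shows "p \<in> gen.span I \<or> q \<in> gen.span I"
proof (rule ccontr)
  assume "\<not> ?thesis"
  then have "p \<notin> gen.span I" "q \<notin> gen.span I" by auto
  have I': "idealin V I" using I by (simp add: prime_in_def)
  obtain p' \<mu> where p': "p - p' \<in> gen.span I" "keys \<mu> \<subseteq> - V" "cf (- V) \<mu> p' \<notin> I"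
    "\<And>\<nu>. \<mu> < \<nu> \<Longrightarrow> cf (- V) \<nu> p' = 0"
    using leading_coefficient_modulo[OF I' \<open>p \<notin> _\<close>] by blast
  obtain q' \<nu> where q': "q - q' \<in> gen.span I" "keys \<nu> \<subseteq> - V" "cf (- V) \<nu> q' \<notin> I"
    "\<And>\<rho>. \<nu> < \<rho> \<Longrightarrow> cf (- V) \<rho> q' = 0"
    using leading_coefficient_modulo[OF I' \<open>q \<notin> _\<close>] by blast
  \<comment> \<open>Replacing the factors one at a time shows \<open>p' * q'\<close> congruent to
    \<open>p * q\<close>.\<close>
  have "p * q - (q * (p - p') + p' * (q - q')) \<in> gen.span I"
    by (rule gen.span_diff[OF pq gen.span_add[OF gen.span_scale[OF p'(1)] gen.span_scale[OF q'(1)]]])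
  moreover have "p * q - (q * (p - p') + p' * (q - q')) = p' * q'"
    by (simp only: right_diff_distrib) (simp only: mult.commute[of q] diff_add_eq_diff_diff_swap, simp)
  ultimately have "p' * q' \<in> gen.span I" by simp
  then have "cf (- V) (\<mu> + \<nu>) (p' * q') \<in> gen.span I"
    by (rule span_cf[rotated]) (use I' in \<open>auto simp: idealin_def\<close>)
  then have *: "cf (- V) \<mu> p' * cf (- V) \<nu> q' \<in> gen.span I"
    using leading_coefficient_mult(1)[OF p'(4) q'(4) p'(2) q'(2)] by simp
  have P: "cf (- V) \<mu> p' \<in> polys V" "cf (- V) \<nu> q' \<in> polys V"
    using polys_cf'[of "- V"] by auto
  then have "cf (- V) \<mu> p' * cf (- V) \<nu> q' \<in> I" using * by (intro span_idealin[OF I'] polys_mult)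
  then show False using I P p'(3) q'(3) by (auto simp: prime_in_def)
qed

lemma radical_in_span:
  assumes I: "radical_in V I" and pm: "p ^ m \<in> gen.span I"
  shows "p \<in> gen.span I"
proof (rule ccontr)
  assume "p \<notin> gen.span I"
  have I': "idealin V I" using I by (simp add: radical_in_def)
  obtain p' \<mu> where p': "p - p' \<in> gen.span I" "keys \<mu> \<subseteq> - V" "cf (- V) \<mu> p' \<notin> I"
    "\<And>\<nu>. \<mu> < \<nu> \<Longrightarrow> cf (- V) \<nu> p' = 0"
    using leading_coefficient_modulo[OF I' \<open>p \<notin> _\<close>] by blast
  have id: "a * x - b * y = a * (x - y) + y * (a - b)" for a b x y :: "'a mpoly"
    by (simp add: algebra_simps)
  have "p ^ k - p' ^ k \<in> gen.span I" for k
  proof (induction k)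
    case (Suc k)
    have "p ^ Suc k - p' ^ Suc k = p * (p ^ k - p' ^ k) + p' ^ k * (p - p')"
      using id by simp
    then show ?case using gen.span_add[OF gen.span_scale[OF Suc] gen.span_scale[OF p'(1)]] by simp
  qed (simp add: gen.span_zero)
  from gen.span_diff[OF pm this[of m]] have "p' ^ m \<in> gen.span I" by simp
  moreover have "\<exists>\<rho>. keys \<rho> \<subseteq> - V \<and> cf (- V) \<rho> (p' ^ k) = cf (- V) \<mu> p' ^ k \<and> (\<forall>\<nu>>\<rho>. cf (- V) \<nu> (p' ^ k) = 0)" for k
  proof (induction k)
    case 0
    show ?case by (intro exI[of _ 0]) (auto simp: cf_const)
  next
    case (Suc k)
    then obtain \<rho> where r: "keys \<rho> \<subseteq> - V" "cf (- V) \<rho> (p' ^ k) = cf (- V) \<mu> p' ^ k"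
      "\<And>\<nu>. \<rho> < \<nu> \<Longrightarrow> cf (- V) \<nu> (p' ^ k) = 0" by blast
    show ?case
      using leading_coefficient_mult[OF p'(4) r(3) p'(2) r(1)] r p'(2)
      by (intro exI[of _ "\<mu> + \<rho>"]) (auto simp: keys_add_mexp)
  qed
  ultimately have *: "cf (- V) \<mu> p' ^ m \<in> gen.span I"
    using span_cf[of I "- V" "p' ^ m"] I' by (metis idealin_def double_complement)
  have P: "cf (- V) \<mu> p' \<in> polys V" using polys_cf'[of "- V"] by auto
  then have "cf (- V) \<mu> p' ^ m \<in> I" using * by (intro span_idealin[OF I'] polys_power)
  then show False using I P p'(3) by (auto simp: radical_in_def)
qed

lemma one_notin_span: "idealin V I \<Longrightarrow> 1 \<notin> I \<Longrightarrow> 1 \<notin> gen.span I"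
  using span_idealin[of V I 1] by auto

lemma span_Int_mono: "B \<subseteq> polys V \<Longrightarrow> gen.span (gen.span B \<inter> polys V) = gen.span B"
  using gen.span_mono[of "gen.span B \<inter> polys V" "gen.span B"] gen.span_mono[of B "gen.span B \<inter> polys V"]
    gen.span_superset[of B] by (simp add: gen.span_span subset_antisym)

lemma prime_in_extend:
  assumes "B \<subseteq> polys V" "prime_in V (gen.span B \<inter> polys V)" "V \<subseteq> W"
  shows "prime_in W (gen.span B \<inter> polys W)"
proof -
  have W: "B \<subseteq> polys W" using assms(1) polys_mono[OF assms(3)] by blast
  have "1 \<notin> gen.span B"
    using one_notin_span[of V "gen.span B \<inter> polys V"] assms(2)
    unfolding prime_in_def span_Int_mono[OF assms(1)] by blast
  then show ?thesis
    using prime_in_span[OF assms(2)] idealin_span[OF W]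
    unfolding prime_in_def span_Int_mono[OF assms(1)] by blast
qed

lemma radical_in_extend:
  assumes "B \<subseteq> polys V" "radical_in V (gen.span B \<inter> polys V)" "V \<subseteq> W"
  shows "radical_in W (gen.span B \<inter> polys W)"
proof -
  have W: "B \<subseteq> polys W" using assms(1) polys_mono[OF assms(3)] by blast
  then show ?thesis
    using radical_in_span[OF assms(2)] idealin_span[OF W]
    unfolding radical_in_def span_Int_mono[OF assms(1)] by blast
qed


section \<open>The kernel of \<open>phi\<close>: straightening by Pfaffians and independence of
  nest-free monomials\<close>

section \<open>Monomials without long nestings\<close>

text \<open>A monomial is seen as a multiset of edges. Each edge is put into the layer given by the length
  of the longest chain of nested edges ending in it; a layer contains no two nested edges, hence it
  has, among all multisets with the same tails and heads, the largest number of edges in each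
  box \<open>{..x} \<times> {..y}\<close>.\<close>

lemma card_eq_sum_fibre:
  assumes "finite S"
  shows "card {s \<in> S. P s \<and> f s \<le> (x::nat)} = (\<Sum>v\<le>x. card {s \<in> S. P s \<and> f s = v})"
proof -
  have "{s \<in> S. P s \<and> f s \<le> x} = (\<Union>v\<le>x. {s \<in> S. P s \<and> f s = v})" by auto
  then show ?thesis using assms by (simp only:) (subst card_UN_disjoint, auto)
qed

text \<open>Without nested edges in a layer, either every edge with tail at most \<open>x\<close>
  has head at most \<open>y\<close>, or every edge with head at most \<open>y\<close> has tail at
  most \<open>x\<close>. The box count of \<open>S\<close> in the layer is thus one of its two
  marginal counts, and each of them bounds the count of any \<open>S'\<close> with the same
  marginals.\<close>

lemma dominance:
  fixes i j :: "'a \<Rightarrow> nat" and \<tau> h :: "'b \<Rightarrow> nat" and t :: "'a \<Rightarrow> nat" and k :: "'b \<Rightarrow> nat"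
  assumes fin: "finite S" "finite S'"
    and tails: "\<And>v c. card {s \<in> S'. k s = c \<and> \<tau> s = v} = card {s \<in> S. t s = c \<and> i s = v}"
    and heads: "\<And>v c. card {s \<in> S'. k s = c \<and> h s = v} = card {s \<in> S. t s = c \<and> j s = v}"
    and nest: "\<And>s r. s \<in> S \<Longrightarrow> r \<in> S \<Longrightarrow> t s = t r \<Longrightarrow> i s < i r \<Longrightarrow> j r < j s \<Longrightarrow> False"
  shows "card {s \<in> S'. \<tau> s \<le> x \<and> h s \<le> y} \<le> card {s \<in> S. i s \<le> x \<and> j s \<le> y}"
proof -
  define K where "K = t ` S \<union> k ` S'"
  have split: "card {s \<in> T. P s} = (\<Sum>c\<in>K. card {s \<in> T. f s = c \<and> P s})"
    if "finite T" "f ` T \<subseteq> K" for T :: "'c set" and P and f :: "'c \<Rightarrow> nat"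
  proof -
    have "{s \<in> T. P s} = (\<Union>c\<in>K. {s \<in> T. f s = c \<and> P s})" using that(2) by auto
    then show ?thesis using that(1) fin by (simp only:) (subst card_UN_disjoint, auto simp: K_def)
  qed
  have "card {s \<in> S'. k s = c \<and> \<tau> s \<le> x \<and> h s \<le> y} \<le> card {s \<in> S. t s = c \<and> i s \<le> x \<and> j s \<le> y}" for c
  proof -
    have R: "card {s \<in> S'. k s = c \<and> \<tau> s \<le> x} = card {s \<in> S. t s = c \<and> i s \<le> x}"
      using fin tails by (simp add: card_eq_sum_fibre)
    have C: "card {s \<in> S'. k s = c \<and> h s \<le> y} = card {s \<in> S. t s = c \<and> j s \<le> y}"
      using fin heads by (simp add: card_eq_sum_fibre)
    have le: "card {s \<in> S'. k s = c \<and> \<tau> s \<le> x \<and> h s \<le> y} \<le> card {s \<in> S'. k s = c \<and> \<tau> s \<le> x}"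
      "card {s \<in> S'. k s = c \<and> \<tau> s \<le> x \<and> h s \<le> y} \<le> card {s \<in> S'. k s = c \<and> h s \<le> y}"
      using fin(2) by (auto intro!: card_mono)
    have "{s \<in> S. t s = c \<and> i s \<le> x \<and> j s \<le> y} = {s \<in> S. t s = c \<and> i s \<le> x} \<or>
        {s \<in> S. t s = c \<and> i s \<le> x \<and> j s \<le> y} = {s \<in> S. t s = c \<and> j s \<le> y}"
    proof (rule ccontr)
      assume "\<not> ?thesis"
      then obtain s r where "s \<in> S" "t s = c" "i s \<le> x" "\<not> j s \<le> y" "r \<in> S" "t r = c" "j r \<le> y" "\<not> i r \<le> x"
        by blast
      then show False using nest[of s r] by auto
    qed
    then show ?thesis using le R C by auto
  qed
  then show ?thesis
    using split[of S' k "\<lambda>s. \<tau> s \<le> x \<and> h s \<le> y"] split[of S t "\<lambda>s. i s \<le> x \<and> j s \<le> y"] fin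
    by (auto simp: K_def intro!: sum_mono)
qed

text \<open>The product counts the corners (x, y) with coordinates up to \<open>n\<close> whose box
  contains (a, b). Summed over edges, this turns the weight into a total of box counts, which
  \<open>dominance\<close> controls.\<close>

lemma box_weight:
  fixes a b n :: nat
  assumes "a \<le> n" "b \<le> n"
  shows "(n + 1 - a) * (n + 1 - b) = (\<Sum>x\<le>n. \<Sum>y\<le>n. if a \<le> x \<and> b \<le> y then 1 else 0)"
proof -
  have *: "(\<Sum>x\<le>n. if c \<le> x then 1 else 0) = n + 1 - c" if "c \<le> n" for c :: nat
  proof -
    have "(\<Sum>x\<le>n. if c \<le> x then 1 else 0 :: nat) = card {x \<in> {..n}. c \<le> x}"
      by (simp add: sum.inter_filter[symmetric])
    also have "{x \<in> {..n}. c \<le> x} = {c..n}" by auto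
    finally show ?thesis by simp
  qed
  have "(\<Sum>x\<le>n. \<Sum>y\<le>n. if a \<le> x \<and> b \<le> y then 1 else 0 :: nat)
      = (\<Sum>x\<le>n. \<Sum>y\<le>n. (if a \<le> x then 1 else 0) * (if b \<le> y then 1 else 0))"
    by (intro sum.cong refl) auto
  also have "\<dots> = (n + 1 - a) * (n + 1 - b)"
    unfolding sum_product[symmetric] *[OF assms(1)] *[OF assms(2)] ..
  finally show ?thesis by simp
qed

lemma sum_box_weight:
  fixes f g :: "'a \<Rightarrow> nat"
  assumes "finite S" "\<And>s. s \<in> S \<Longrightarrow> f s \<le> n \<and> g s \<le> n"
  shows "(\<Sum>s\<in>S. (n + 1 - f s) * (n + 1 - g s)) = (\<Sum>x\<le>n. \<Sum>y\<le>n. card {s \<in> S. f s \<le> x \<and> g s \<le> y})"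
proof -
  have "(\<Sum>s\<in>S. (n + 1 - f s) * (n + 1 - g s))
      = (\<Sum>s\<in>S. \<Sum>x\<le>n. \<Sum>y\<le>n. if f s \<le> x \<and> g s \<le> y then 1 else 0)"
    using assms(2) by (intro sum.cong refl box_weight) auto
  also have "\<dots> = (\<Sum>x\<le>n. \<Sum>s\<in>S. \<Sum>y\<le>n. if f s \<le> x \<and> g s \<le> y then 1 else 0)" by (rule sum.swap)
  also have "\<dots> = (\<Sum>x\<le>n. \<Sum>y\<le>n. \<Sum>s\<in>S. if f s \<le> x \<and> g s \<le> y then 1 else 0)"
    by (intro sum.cong refl sum.swap)
  also have "\<dots> = (\<Sum>x\<le>n. \<Sum>y\<le>n. card {s \<in> S. f s \<le> x \<and> g s \<le> y})"
    using assms(1) by (intro sum.cong refl) (simp add: sum.inter_filter[symmetric])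
  finally show ?thesis .
qed

lemma card_level:
  fixes f :: "'a \<Rightarrow> nat"
  assumes "finite T"
  shows "card {s \<in> T. P s \<and> f s = x} = (if x = 0 then card {s \<in> T. P s \<and> f s \<le> x}
    else card {s \<in> T. P s \<and> f s \<le> x} - card {s \<in> T. P s \<and> f s \<le> x - 1})"
proof (cases "x = 0")
  case False
  have "{s \<in> T. P s \<and> f s = x} = {s \<in> T. P s \<and> f s \<le> x} - {s \<in> T. P s \<and> f s \<le> x - 1}"
    using False by auto
  moreover have "card ({s \<in> T. P s \<and> f s \<le> x} - {s \<in> T. P s \<and> f s \<le> x - 1})
      = card {s \<in> T. P s \<and> f s \<le> x} - card {s \<in> T. P s \<and> f s \<le> x - 1}"
    using assms by (intro card_Diff_subset) auto
  ultimately show ?thesis using False by presburger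
qed simp

text \<open>Inclusion-exclusion: differences of box counts, taken in one coordinate after the other,
  recover the multiplicity of a single edge.\<close>

lemma card_box_eq_imp_card_eq:
  fixes i j :: "'a \<Rightarrow> nat" and \<tau> h :: "'b \<Rightarrow> nat"
  assumes fin: "finite S" "finite S'"
    and eq: "\<And>x y. x \<le> n \<Longrightarrow> y \<le> n \<Longrightarrow> card {s \<in> S'. \<tau> s \<le> x \<and> h s \<le> y} = card {s \<in> S. i s \<le> x \<and> j s \<le> y}"
    and xy: "x \<le> n" "y \<le> n"
  shows "card {s \<in> S'. \<tau> s = x \<and> h s = y} = card {s \<in> S. i s = x \<and> j s = y}"
proof -
  have 1: "card {s \<in> S'. h s \<le> y \<and> \<tau> s = x} = card {s \<in> S. j s \<le> y \<and> i s = x}" if "y \<le> n" for y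
    unfolding card_level[OF fin(1)] card_level[OF fin(2)]
    using eq[OF xy(1) that] eq[OF le_trans[OF diff_le_self xy(1)] that, of 1]
    by (simp only: conj_commute)
  show ?thesis
    unfolding card_level[OF fin(1)] card_level[OF fin(2)]
    using 1[OF xy(2)] 1[OF le_trans[OF diff_le_self xy(2)], of 1]
    by (simp only: conj_commute)
qed

text \<open>Dominance bounds every box count of \<open>S'\<close> by that of \<open>S\<close>, while
  the weights bound the totals the other way. So all box counts agree, and with them the two
  multisets of edges.\<close>

lemma dominance_weight:
  fixes i j :: "'a \<Rightarrow> nat" and \<tau> h :: "'b \<Rightarrow> nat" and t :: "'a \<Rightarrow> nat" and k :: "'b \<Rightarrow> nat"
  assumes fin: "finite S" "finite S'"
    and tails: "\<And>v c. card {s \<in> S'. k s = c \<and> \<tau> s = v} = card {s \<in> S. t s = c \<and> i s = v}"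
    and heads: "\<And>v c. card {s \<in> S'. k s = c \<and> h s = v} = card {s \<in> S. t s = c \<and> j s = v}"
    and nest: "\<And>s r. s \<in> S \<Longrightarrow> r \<in> S \<Longrightarrow> t s = t r \<Longrightarrow> i s < i r \<Longrightarrow> j r < j s \<Longrightarrow> False"
    and le: "\<And>s. s \<in> S \<Longrightarrow> i s \<le> n \<and> j s \<le> n" "\<And>s. s \<in> S' \<Longrightarrow> \<tau> s \<le> n \<and> h s \<le> n"
    and ge: "(\<Sum>s\<in>S. (n + 1 - i s) * (n + 1 - j s)) \<le> (\<Sum>s\<in>S'. (n + 1 - \<tau> s) * (n + 1 - h s))"
  shows "card {s \<in> S'. \<tau> s = x \<and> h s = y} = card {s \<in> S. i s = x \<and> j s = y}"
proof -
  define N where "N x y = card {s \<in> S. i s \<le> x \<and> j s \<le> y}" for x y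
  define N' where "N' x y = card {s \<in> S'. \<tau> s \<le> x \<and> h s \<le> y}" for x y
  have N: "N' x y \<le> N x y" for x y
    unfolding N_def N'_def by (rule dominance[OF fin tails heads nest])
  have sums: "(\<Sum>z\<in>{..n} \<times> {..n}. N (fst z) (snd z)) \<le> (\<Sum>z\<in>{..n} \<times> {..n}. N' (fst z) (snd z))"
    using ge sum_box_weight[OF fin(1), of i n j] sum_box_weight[OF fin(2), of \<tau> n h] le
    by (simp add: sum.cartesian_product' N_def N'_def)
  have eq: "N' x y = N x y" if "x \<le> n" "y \<le> n" for x y
  proof (rule ccontr)
    assume "N' x y \<noteq> N x y"
    then have "N' x y < N x y" using N[of x y] by simp
    then have "(\<Sum>z\<in>{..n} \<times> {..n}. N' (fst z) (snd z)) < (\<Sum>z\<in>{..n} \<times> {..n}. N (fst z) (snd z))"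
      using that N by (intro sum_strict_mono_ex1) (auto intro!: bexI[of _ "(x, y)"])
    then show False using sums by simp
  qed
  show ?thesis
  proof (cases "x \<le> n \<and> y \<le> n")
    case True
    then show ?thesis
      using card_box_eq_imp_card_eq[OF fin, of n \<tau> h i j x y] eq unfolding N_def N'_def by blast
  next
    case False
    then have "{s \<in> S'. \<tau> s = x \<and> h s = y} = {}" "{s \<in> S. i s = x \<and> j s = y} = {}" using le by blast+
    then show ?thesis by (simp only: card.empty)
  qed
qed

definition nested :: "nat \<times> nat \<Rightarrow> nat \<times> nat \<Rightarrow> bool" where
  "nested e f \<longleftrightarrow> fst e < fst f \<and> snd f < snd e"

definition nest_chain :: "(nat \<times> nat) set \<Rightarrow> (nat \<times> nat) list \<Rightarrow> bool" where
  "nest_chain A c \<longleftrightarrow> sorted_wrt nested c \<and> set c \<subseteq> A"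

text \<open>Forbidding the exact length \<open>r\<close> also forbids longer chains, since an
  initial piece of a chain is a chain.\<close>

definition nest_free :: "nat \<Rightarrow> mexp \<Rightarrow> bool" where
  "nest_free r m \<longleftrightarrow> (\<forall>c. nest_chain (keys m) c \<longrightarrow> length c \<noteq> r)"

text \<open>Chains run from the outermost edge inwards and \<open>c\<close> leaves out
  \<open>e\<close> itself, so depths start at 0; layers are therefore numbered by the successor of
  the depth and run from 1 to \<open>d\<close> for nest-free exponents of order
  \<open>d + 1\<close>.\<close>

definition nest_depth :: "mexp \<Rightarrow> nat \<times> nat \<Rightarrow> nat" where
  "nest_depth m e = Max {length c |c. nest_chain (keys m) (c @ [e])}"

lemma nest_free_length: "nest_free r m \<Longrightarrow> nest_chain (keys m) c \<Longrightarrow> length c < r"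
proof (rule ccontr)
  assume *: "nest_free r m" "nest_chain (keys m) c" "\<not> length c < r"
  then have "nest_chain (keys m) (take r c)"
    by (auto simp: nest_chain_def intro: sorted_wrt_take dest: in_set_takeD)
  then show False using * by (auto simp: nest_free_def)
qed

lemma nest_depth:
  assumes m: "nest_free r m"
  shows "e \<in> keys m \<Longrightarrow> nest_depth m e < r - 1 + (if r = 0 then 1 else 0)"
    and "e \<in> keys m \<Longrightarrow> f \<in> keys m \<Longrightarrow> nested e f \<Longrightarrow> nest_depth m e < nest_depth m f"
proof -
  let ?L = "\<lambda>e. {length c |c. nest_chain (keys m) (c @ [e])}"
  have fin: "finite (?L e)" for e
    by (rule finite_subset[of _ "{..r}"]) (use nest_free_length[OF m] in fastforce)+
  have mem: "nest_depth m e \<in> ?L e" if "e \<in> keys m" for e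
  proof -
    have "nest_chain (keys m) ([] @ [e])" using that by (simp add: nest_chain_def)
    then have "?L e \<noteq> {}" by blast
    then show ?thesis unfolding nest_depth_def by (rule Max_in[OF fin])
  qed
  show "nest_depth m e < r - 1 + (if r = 0 then 1 else 0)" if "e \<in> keys m"
    using mem[OF that] nest_free_length[OF m] by fastforce
  show "nest_depth m e < nest_depth m f" if e: "e \<in> keys m" "f \<in> keys m" "nested e f"
  proof -
    obtain c where c: "nest_depth m e = length c" "nest_chain (keys m) (c @ [e])" using mem[OF e(1)] by auto
    have "nest_chain (keys m) ((c @ [e]) @ [f])"
      using c(2) e by (fastforce simp: nest_chain_def sorted_wrt_append nested_def)
    then have "length (c @ [e]) \<in> ?L f" by blast
    then have "length (c @ [e]) \<le> nest_depth m f" unfolding nest_depth_def by (rule Max_ge[OF fin])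
    then show ?thesis using c(1) by simp
  qed
qed

section \<open>Images of monomials without long nestings\<close>

definition skew_vars :: "nat \<Rightarrow> (nat \<times> nat) set" where
  "skew_vars n = {(i, j). 1 \<le> i \<and> i < j \<and> j \<le> n}"

definition lss_vars :: "nat \<Rightarrow> nat \<Rightarrow> (nat \<times> nat) set" where
  "lss_vars n d = {1..n} \<times> {1..2 * d}"

definition phi :: "nat \<Rightarrow> 'k::field mpoly \<Rightarrow> 'k mpoly" where
  "phi d = subst (\<lambda>v. twisted_lss_poly d (fst v) (snd v))"

text \<open>Lists the factors of a monomial with repetition, so that a product of sums can be
  expanded over choice functions and exponents become cardinalities.\<close>

lemma mexp_edges:
  obtains N and es :: "nat \<Rightarrow> nat \<times> nat" where "m = (\<Sum>s<N. Poly_Mapping.single (es s) 1)"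
    "\<And>s. s < N \<Longrightarrow> es s \<in> keys m" "\<And>e. lookup m e = card {s \<in> {..<N}. es s = e}"
proof -
  have "\<exists>(N::nat) es. m = (\<Sum>s<N. Poly_Mapping.single (es s) 1)"
  proof (induction "wt (\<lambda>_. 1) m" arbitrary: m)
    case 0
    then have "m = 0" by (metis keys_eq_empty wt_eq_0_iff all_not_in_conv zero_neq_one)
    then have "m = (\<Sum>s<0::nat. Poly_Mapping.single (undefined s) 1)" by simp
    then show ?case by blast
  next
    case (Suc k)
    then obtain e where e: "e \<in> keys m" by (metis wt_eq_0_iff Zero_not_Suc)
    define m' where "m' = m - Poly_Mapping.single e 1"
    have m: "m = m' + Poly_Mapping.single e 1"
      using e by (intro poly_mapping_eqI)
        (auto simp: m'_def lookup_add lookup_minus lookup_single when_def in_keys_iff)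
    then have "k = wt (\<lambda>_. 1) m'" using Suc.hyps(2) by (simp add: wt_add)
    then obtain N :: nat and es where "m' = (\<Sum>s<N. Poly_Mapping.single (es s) 1)" using Suc.hyps(1) by blast
    then have "m = (\<Sum>s<Suc N. Poly_Mapping.single ((es(N := e)) s) 1)" using m by simp
    then show ?case by blast
  qed
  then obtain N :: nat and es where m: "m = (\<Sum>s<N. Poly_Mapping.single (es s) 1)" by blast
  have l: "lookup m e = card {s \<in> {..<N}. es s = e}" for e
    unfolding m lookup_sum by (simp add: lookup_single when_def sum.inter_filter[symmetric])
  show thesis
  proof (rule that[OF m _ l])
    fix s assume "s < N"
    then have "card {r \<in> {..<N}. es r = es s} \<noteq> 0" by auto
    then show "es s \<in> keys m" by (simp add: in_keys_iff l)
  qed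
qed

lemma xmon_sum: "finite A \<Longrightarrow> xmon (\<Sum>a\<in>A. f a) = (\<Prod>a\<in>A. xmon (f a))"
  by (induction A rule: finite_induct) (simp_all add: xmon_add)

text \<open>The exponent of one of the \<open>2d\<close> monomials of f_ij: \<open>fst c\<close> is
  the pair of columns, and \<open>snd c\<close> marks the negative monomial, in which the ends of
  the edge exchange their columns.\<close>

definition layer_term :: "nat \<times> nat \<Rightarrow> nat \<times> bool \<Rightarrow> mexp" where
  "layer_term e c = (if snd c
     then Poly_Mapping.single (snd e, 2 * fst c - 1) 1 + Poly_Mapping.single (fst e, 2 * fst c) 1
     else Poly_Mapping.single (fst e, 2 * fst c - 1) 1 + Poly_Mapping.single (snd e, 2 * fst c) 1)"

lemma twisted_lss_poly_layers:
  "(twisted_lss_poly d i j :: 'k::field mpoly)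
    = (\<Sum>c\<in>{1..d} \<times> UNIV. cst (if snd c then - 1 else 1) * xmon (layer_term (i, j) c))"
proof -
  have "(\<Sum>c\<in>{1..d} \<times> UNIV. cst (if snd c then - 1 else 1) * xmon (layer_term (i, j) c))
      = (\<Sum>k\<in>{1..d}. \<Sum>b\<in>UNIV. cst (if b then - 1 else 1) * (xmon (layer_term (i, j) (k, b)) :: 'k mpoly))"
    unfolding sum.cartesian_product by (simp add: split_def)
  also have "\<dots> = twisted_lss_poly d i j"
    unfolding twisted_lss_poly_def
    by (intro sum.cong refl)
      (simp add: UNIV_bool layer_term_def xmon_add mvar_xmon cst_uminus mult.commute)
  finally show ?thesis by simp
qed

lemma phi_xmon_expand:
  fixes N :: nat
  assumes m: "m = (\<Sum>s<N. Poly_Mapping.single (es s) 1)"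
  shows "lookup (phi d (xmon m) :: 'k::field mpoly) \<mu>
    = (\<Sum>\<kappa> \<in> {\<kappa> \<in> PiE {..<N} (\<lambda>_. {1..d} \<times> UNIV). (\<Sum>s<N. layer_term (es s) (\<kappa> s)) = \<mu>}.
        \<Prod>s<N. if snd (\<kappa> s) then - 1 else 1)"
proof -
  let ?C = "{1..d} \<times> (UNIV :: bool set)"
  have "phi d (xmon m) = (\<Prod>s<N. phi d (xmon (Poly_Mapping.single (es s) 1)) :: 'k mpoly)"
    unfolding m by (simp add: xmon_sum phi_def subst_prod)
  also have "\<dots> = (\<Prod>s<N. \<Sum>c\<in>?C. cst (if snd c then - 1 else 1) * xmon (layer_term (es s) c))"
    unfolding mvar_xmon[symmetric] phi_def subst_mvar twisted_lss_poly_layers prod.collapse ..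
  also have "\<dots> = (\<Sum>\<kappa>\<in>PiE {..<N} (\<lambda>_. ?C). \<Prod>s<N. cst (if snd (\<kappa> s) then - 1 else 1) * xmon (layer_term (es s) (\<kappa> s)))"
    by (rule prod_sum_PiE) auto
  also have "\<dots> = (\<Sum>\<kappa>\<in>PiE {..<N} (\<lambda>_. ?C). cst (\<Prod>s<N. if snd (\<kappa> s) then - 1 else 1) * xmon (\<Sum>s<N. layer_term (es s) (\<kappa> s)))"
    by (intro sum.cong refl) (simp add: prod.distrib xmon_sum cst_prod)
  finally have "lookup (phi d (xmon m) :: 'k mpoly) \<mu> = (\<Sum>\<kappa>\<in>PiE {..<N} (\<lambda>_. ?C).
      if (\<Sum>s<N. layer_term (es s) (\<kappa> s)) = \<mu> then \<Prod>s<N. if snd (\<kappa> s) then - 1 else 1 else 0)"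
    by (simp only: lookup_sum lookup_cst_mult lookup_xmon if_distrib[of "\<lambda>x. _ * x"] mult_1_right mult_zero_right)
  also have "\<dots> = (\<Sum>\<kappa> \<in> {\<kappa> \<in> PiE {..<N} (\<lambda>_. ?C). (\<Sum>s<N. layer_term (es s) (\<kappa> s)) = \<mu>}.
        \<Prod>s<N. if snd (\<kappa> s) then - 1 else 1)"
    by (rule sum.inter_filter[symmetric]) (simp add: finite_PiE)
  finally show ?thesis .
qed

text \<open>Odd columns record the tails and even columns the heads of the edges in a layer, after
  the reversals prescribed by \<open>\<kappa>\<close>. Layers start at 1, so that
  \<open>2 * c - 1\<close> is a genuine odd column.\<close>

lemma lookup_layer_terms:
  fixes N :: nat
  assumes "\<And>s. s < N \<Longrightarrow> 1 \<le> fst (\<kappa> s)" "1 \<le> c"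
  shows "lookup (\<Sum>s<N. layer_term (es s) (\<kappa> s)) (v, 2 * c - 1)
      = card {s \<in> {..<N}. fst (\<kappa> s) = c \<and> (if snd (\<kappa> s) then snd (es s) else fst (es s)) = v}"
    and "lookup (\<Sum>s<N. layer_term (es s) (\<kappa> s)) (v, 2 * c)
      = card {s \<in> {..<N}. fst (\<kappa> s) = c \<and> (if snd (\<kappa> s) then fst (es s) else snd (es s)) = v}"
proof -
  have *: "lookup (layer_term (es s) (\<kappa> s)) (v, 2 * c - 1)
      = (if fst (\<kappa> s) = c \<and> (if snd (\<kappa> s) then snd (es s) else fst (es s)) = v then 1 else 0)"
    "lookup (layer_term (es s) (\<kappa> s)) (v, 2 * c)
      = (if fst (\<kappa> s) = c \<and> (if snd (\<kappa> s) then fst (es s) else snd (es s)) = v then 1 else 0)"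
    if "s < N" for s
  proof -
    have "2 * fst (\<kappa> s) - 1 = 2 * c - 1 \<longleftrightarrow> fst (\<kappa> s) = c" "2 * fst (\<kappa> s) = 2 * c \<longleftrightarrow> fst (\<kappa> s) = c"
      "2 * fst (\<kappa> s) - 1 \<noteq> 2 * c" "2 * fst (\<kappa> s) \<noteq> 2 * c - 1"
      using assms(1)[OF that] assms(2) by presburger+
    then show "lookup (layer_term (es s) (\<kappa> s)) (v, 2 * c - 1)
      = (if fst (\<kappa> s) = c \<and> (if snd (\<kappa> s) then snd (es s) else fst (es s)) = v then 1 else 0)"
      "lookup (layer_term (es s) (\<kappa> s)) (v, 2 * c)
      = (if fst (\<kappa> s) = c \<and> (if snd (\<kappa> s) then fst (es s) else snd (es s)) = v then 1 else 0)"
      unfolding layer_term_def by (cases "snd (\<kappa> s)"; simp add: lookup_add lookup_single when_def)+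
  qed
  show "lookup (\<Sum>s<N. layer_term (es s) (\<kappa> s)) (v, 2 * c - 1)
      = card {s \<in> {..<N}. fst (\<kappa> s) = c \<and> (if snd (\<kappa> s) then snd (es s) else fst (es s)) = v}"
    unfolding lookup_sum card_eq_sum
    by (subst sum.inter_filter, simp, intro sum.cong refl) (simp only: *(1) lessThan_iff)
  show "lookup (\<Sum>s<N. layer_term (es s) (\<kappa> s)) (v, 2 * c)
      = card {s \<in> {..<N}. fst (\<kappa> s) = c \<and> (if snd (\<kappa> s) then fst (es s) else snd (es s)) = v}"
    unfolding lookup_sum card_eq_sum
    by (subst sum.inter_filter, simp, intro sum.cong refl) (simp only: *(2) lessThan_iff)
qed

text \<open>The exponent of \<open>\<Prod> y\<^sub>i\<^sub>,\<^sub>2\<^sub>t\<^sub>-\<^sub>1 y\<^sub>j\<^sub>,\<^sub>2\<^sub>t\<close> over the edges \<open>i < j\<close> of \<open>m\<close>, where \<open>t\<close> is the layer of the edge.\<close>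

definition layer_exp :: "mexp \<Rightarrow> mexp" where
  "layer_exp m = (\<Sum>e\<in>keys m. \<Sum>_<lookup m e. layer_term e (Suc (nest_depth m e), False))"

lemma layer_exp_edges:
  assumes m: "m = (\<Sum>s<N. Poly_Mapping.single (es s) 1)" "\<And>s. s < N \<Longrightarrow> es s \<in> keys m"
    "\<And>e. lookup m e = card {s \<in> {..<N::nat}. es s = e}"
  shows "layer_exp m = (\<Sum>s<N. layer_term (es s) (Suc (nest_depth m (es s)), False))"
proof -
  have "(\<Sum>s<N. layer_term (es s) (Suc (nest_depth m (es s)), False))
      = (\<Sum>e\<in>keys m. \<Sum>s\<in>{s \<in> {..<N}. es s = e}. layer_term (es s) (Suc (nest_depth m (es s)), False))"
    using m(2) by (intro sum.group[symmetric]) auto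
  also have "\<dots> = (\<Sum>e\<in>keys m. \<Sum>s\<in>{s \<in> {..<N}. es s = e}. layer_term e (Suc (nest_depth m e), False))"
    by (intro sum.cong refl) auto
  also have "\<dots> = layer_exp m"
    unfolding layer_exp_def
  proof (rule sum.cong[OF refl])
    fix e
    have const: "(\<Sum>s\<in>A. x) = (\<Sum>_<card A. x)" if "finite A" for A :: "nat set" and x :: mexp
      using that by (induction A rule: finite_induct) (auto simp: add.commute)
    show "(\<Sum>s\<in>{s \<in> {..<N}. es s = e}. layer_term e (Suc (nest_depth m e), False))
      = (\<Sum>_<lookup m e. layer_term e (Suc (nest_depth m e), False))"
      unfolding m(3) by (rule const) simp
  qed
  finally show ?thesis by simp
qed

text \<open>The number of boxes that contain the edge. The formula is symmetric in the two ends, so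
  an edge reversed by a negative monomial keeps its weight.\<close>

definition box_wt :: "nat \<Rightarrow> nat \<times> nat \<Rightarrow> nat" where
  "box_wt n v = (n + 1 - fst v) * (n + 1 - snd v)"

lemma wt_edges:
  fixes N :: nat
  shows "wt w (\<Sum>s<N. Poly_Mapping.single (es s) 1) = (\<Sum>s<N. w (es s))"
  by (induction N) (simp_all add: wt_add)

text \<open>A choice \<open>\<kappa>\<close> that produces \<open>layer_exp m\<close> reorients the
  edges of \<open>m'\<close> into a multiset with the same tails and heads as \<open>m\<close> in
  every layer. Since \<open>m'\<close> is at least as heavy, \<open>dominance_weight\<close>
  identifies the two multisets; a reversed edge would have its tail above its head, unlike every
  edge of \<open>m\<close>.\<close>

lemma layer_exp_in_phi:
  assumes m: "keys m \<subseteq> skew_vars n" and m': "keys m' \<subseteq> skew_vars n" and free: "nest_free (d + 1) m"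
    and le: "wt (box_wt n) m \<le> wt (box_wt n) m'"
    and es': "m' = (\<Sum>s<N'. Poly_Mapping.single (es' s) 1)" "\<And>s. s < N' \<Longrightarrow> es' s \<in> keys m'"
    "\<And>e. lookup m' e = card {s \<in> {..<N'::nat}. es' s = e}"
    and Q: "\<kappa> \<in> PiE {..<N'} (\<lambda>_. {1..d} \<times> (UNIV :: bool set))" "(\<Sum>s<N'. layer_term (es' s) (\<kappa> s)) = layer_exp m"
  shows "m' = m \<and> (\<forall>s<N'. \<not> snd (\<kappa> s))"
proof -
  obtain N es where es: "m = (\<Sum>s<N. Poly_Mapping.single (es s) 1)" "\<And>s. s < N \<Longrightarrow> es s \<in> keys m"
    "\<And>e. lookup m e = card {s \<in> {..<N::nat}. es s = e}" by (rule mexp_edges[of m]) (rule that)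
  have edge: "fst (es s) < snd (es s)" "snd (es s) \<le> n" if "s < N" for s
    using es(2)[OF that] m by (auto simp: skew_vars_def)
  have edge': "fst (es' s) < snd (es' s)" "snd (es' s) \<le> n" if "s < N'" for s
    using es'(2)[OF that] m' by (auto simp: skew_vars_def)
    \<comment> \<open>\<open>\<tau>\<close>, \<open>h\<close> and \<open>k\<close> are the tail, the
      head and the layer of a factor of \<open>m'\<close> as chosen by \<open>\<kappa>\<close>;
      \<open>t\<close> is the layer of a factor of \<open>m\<close>.\<close>
    define \<tau> where "\<tau> s = (if snd (\<kappa> s) then snd (es' s) else fst (es' s))" for s
    define h where "h s = (if snd (\<kappa> s) then fst (es' s) else snd (es' s))" for s
    define k where "k s = fst (\<kappa> s)" for s
    define t where "t s = Suc (nest_depth m (es s))" for s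
    have \<kappa>: "\<kappa> s \<in> {1..d} \<times> UNIV" if "s < N'" for s using PiE_mem[OF Q(1), of s] that by simp
    have k1: "1 \<le> k s" if "s < N'" for s using \<kappa>[OF that] by (auto simp: k_def mem_Times_iff)
    have E: "(\<Sum>s<N'. layer_term (es' s) (\<kappa> s)) = (\<Sum>s<N. layer_term (es s) (t s, False))"
      using Q(2) layer_exp_edges[OF es] by (simp add: t_def)
    have tails: "card {s \<in> {..<N'}. k s = c \<and> \<tau> s = v} = card {s \<in> {..<N}. t s = c \<and> fst (es s) = v}" for v c
    proof (cases "c = 0")
      case True
      have "{s \<in> {..<N'}. k s = c \<and> \<tau> s = v} = {}" using k1 True by fastforce
      moreover have "{s \<in> {..<N}. t s = c \<and> fst (es s) = v} = {}" using True by (auto simp: t_def)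
      ultimately show ?thesis by (simp only:)
    next
      case False
      then show ?thesis
        using lookup_layer_terms(1)[of N' \<kappa> c es' v] lookup_layer_terms(1)[of N "\<lambda>s. (t s, False)" c es v] k1 E
        by (simp add: k_def \<tau>_def t_def)
    qed
    have heads: "card {s \<in> {..<N'}. k s = c \<and> h s = v} = card {s \<in> {..<N}. t s = c \<and> snd (es s) = v}" for v c
    proof (cases "c = 0")
      case True
      have "{s \<in> {..<N'}. k s = c \<and> h s = v} = {}" using k1 True by fastforce
      moreover have "{s \<in> {..<N}. t s = c \<and> snd (es s) = v} = {}" using True by (auto simp: t_def)
      ultimately show ?thesis by (simp only:)
    next
      case False
      then show ?thesis
        using lookup_layer_terms(2)[of N' \<kappa> c es' v] lookup_layer_terms(2)[of N "\<lambda>s. (t s, False)" c es v] k1 E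
        by (simp add: k_def h_def t_def)
    qed
    have nest: False if "s \<in> {..<N}" "r \<in> {..<N}" "t s = t r" "fst (es s) < fst (es r)" "snd (es r) < snd (es s)" for s r
      using nest_depth(2)[OF free es(2) es(2), of s r] that by (auto simp: t_def nested_def)
    have bw: "(n + 1 - \<tau> s) * (n + 1 - h s) = box_wt n (es' s)" for s by (simp add: \<tau>_def h_def box_wt_def)
    have ge: "(\<Sum>s<N. (n + 1 - fst (es s)) * (n + 1 - snd (es s))) \<le> (\<Sum>s<N'. (n + 1 - \<tau> s) * (n + 1 - h s))"
      using le unfolding es(1) es'(1) wt_edges bw box_wt_def[symmetric] .
    have le1: "fst (es s) \<le> n \<and> snd (es s) \<le> n" if "s \<in> {..<N}" for s using edge[of s] that by auto
    have le2: "\<tau> s \<le> n \<and> h s \<le> n" if "s \<in> {..<N'}" for s using edge'[of s] that by (auto simp: \<tau>_def h_def)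
    have card: "card {s \<in> {..<N'}. \<tau> s = x \<and> h s = y} = card {s \<in> {..<N}. fst (es s) = x \<and> snd (es s) = y}" for x y
      by (rule dominance_weight[where t = t and k = k and n = n]) (use tails heads nest le1 le2 ge in \<open>simp_all\<close>)
    have fwd: "\<not> snd (\<kappa> s)" if "s < N'" for s
    proof
      assume b: "snd (\<kappa> s)"
      have "s \<in> {r \<in> {..<N'}. \<tau> r = \<tau> s \<and> h r = h s}" using that by simp
      then have "card {r \<in> {..<N'}. \<tau> r = \<tau> s \<and> h r = h s} \<noteq> 0"
        by (subst card_0_eq) auto
      then obtain r where "r < N" "fst (es r) = \<tau> s" "snd (es r) = h s"
        unfolding card by (metis (mono_tags, lifting) Collect_empty_eq card.empty lessThan_iff)
      then show False using edge[of r] edge'[OF that] b by (simp add: \<tau>_def h_def)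
    qed
    have "lookup m' e = lookup m e" for e
    proof -
      have "{s \<in> {..<N'}. es' s = e} = {s \<in> {..<N'}. \<tau> s = fst e \<and> h s = snd e}"
        using fwd by (auto simp: \<tau>_def h_def prod_eq_iff)
      moreover have "{s \<in> {..<N}. es s = e} = {s \<in> {..<N}. fst (es s) = fst e \<and> snd (es s) = snd e}"
        by (auto simp: prod_eq_iff)
      ultimately show ?thesis unfolding es(3) es'(3) by (simp only: card)
    qed
    then show ?thesis using fwd by (auto intro: poly_mapping_eqI)
qed

text \<open>All contributing choices use positive monomials only, so nothing cancels: the
  coefficient is the number of such choices, nonzero in characteristic 0 as soon as there is
  one.\<close>

lemma lookup_phi_layer_exp:
  assumes m: "keys m \<subseteq> skew_vars n" and m': "keys m' \<subseteq> skew_vars n" and free: "nest_free (d + 1) m"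
    and le: "wt (box_wt n) m \<le> wt (box_wt n) m'"
  shows "lookup (phi d (xmon m') :: 'k::field_char_0 mpoly) (layer_exp m) \<noteq> 0 \<longleftrightarrow> m' = m"
proof -
  obtain N es where es: "m' = (\<Sum>s<N. Poly_Mapping.single (es s) 1)" "\<And>s. s < N \<Longrightarrow> es s \<in> keys m'"
    "\<And>e. lookup m' e = card {s \<in> {..<N::nat}. es s = e}" by (rule mexp_edges[of m']) (rule that)
  let ?C = "{1..d} \<times> (UNIV :: bool set)"
  define Q where "Q = {\<kappa> \<in> PiE {..<N} (\<lambda>_. ?C). (\<Sum>s<N. layer_term (es s) (\<kappa> s)) = layer_exp m}"
  have L: "lookup (phi d (xmon m') :: 'k mpoly) (layer_exp m) = (\<Sum>\<kappa>\<in>Q. \<Prod>s<N. if snd (\<kappa> s) then - 1 else 1)"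
    unfolding Q_def by (rule phi_xmon_expand[OF es(1)])
  have key: "m' = m \<and> (\<forall>s<N. \<not> snd (\<kappa> s))" if "\<kappa> \<in> Q" for \<kappa>
    by (rule layer_exp_in_phi[OF assms es]) (use that in \<open>auto simp: Q_def\<close>)
  have fin: "finite Q" unfolding Q_def by (rule finite_subset[of _ "PiE {..<N} (\<lambda>_. ?C)"]) (auto intro: finite_PiE)
  have "lookup (phi d (xmon m') :: 'k mpoly) (layer_exp m) = (\<Sum>\<kappa>\<in>Q. 1)"
    unfolding L using key by (intro sum.cong refl prod.neutral) auto
  then have c: "lookup (phi d (xmon m') :: 'k mpoly) (layer_exp m) = of_nat (card Q)" by simp
  have "Q \<noteq> {}" if "m' = m"
  proof -
    define \<kappa> where "\<kappa> = (\<lambda>s\<in>{..<N}. (Suc (nest_depth m (es s)), False))"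
    have "\<kappa> s \<in> ?C" if "s < N" for s
      using nest_depth(1)[OF free, of "es s"] es(2)[OF that] \<open>m' = m\<close> that by (auto simp: \<kappa>_def)
    then have "\<kappa> \<in> PiE {..<N} (\<lambda>_. ?C)" by (intro PiE_I) (auto simp: \<kappa>_def)
    moreover have "(\<Sum>s<N. layer_term (es s) (\<kappa> s)) = layer_exp m"
      using layer_exp_edges[OF es] \<open>m' = m\<close> by (simp add: \<kappa>_def)
    ultimately show ?thesis by (auto simp: Q_def)
  qed
  then show ?thesis using c key fin by (auto simp: card_eq_0_iff)
qed

text \<open>Triangularity: for a lightest monomial \<open>m\<close> of \<open>s\<close>, no other
  monomial of \<open>s\<close> contributes to the coefficient of \<open>layer_exp m\<close> in the
  image.\<close>

lemma phi_nest_free_independent: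
  assumes s: "s \<in> polys (skew_vars n)" and free: "\<And>m. m \<in> keys s \<Longrightarrow> nest_free (d + 1) m"
    and 0: "phi d (s :: 'k::field_char_0 mpoly) = 0"
  shows "s = 0"
proof (rule ccontr)
  assume "s \<noteq> 0"
  then obtain m0 where "m0 \<in> keys s" by (metis all_not_in_conv keys_eq_empty)
  then obtain m where m: "m \<in> keys s" "\<And>m'. m' \<in> keys s \<Longrightarrow> wt (box_wt n) m \<le> wt (box_wt n) m'"
    using ex_has_least_nat[of "\<lambda>m. m \<in> keys s" m0 "wt (box_wt n)"] by blast
  have V: "keys m' \<subseteq> skew_vars n" if "m' \<in> keys s" for m' using polysD[OF s that] .
  have "0 = phi d (\<Sum>m'\<in>keys s. cst (lookup s m') * xmon m')" using 0 mpoly_sum_monomials[of s] by simp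
  also have "\<dots> = (\<Sum>m'\<in>keys s. cst (lookup s m') * phi d (xmon m'))"
    by (simp add: phi_def subst_sum subst_mult)
  finally have "0 = lookup \<dots> (layer_exp m)" by simp
  also have "\<dots> = (\<Sum>m'\<in>keys s. lookup s m' * lookup (phi d (xmon m')) (layer_exp m))"
    by (simp add: lookup_sum lookup_cst_mult)
  also have "\<dots> = (\<Sum>m'\<in>keys s. if m' = m then lookup s m * lookup (phi d (xmon m)) (layer_exp m) else 0)"
    using lookup_phi_layer_exp[OF V[OF m(1)] V free[OF m(1)] m(2), where 'k = 'k] by (intro sum.cong refl) auto
  also have "\<dots> = lookup s m * lookup (phi d (xmon m)) (layer_exp m)" using m(1) by simp
  finally show False
    using lookup_phi_layer_exp[OF V[OF m(1)] V[OF m(1)] free[OF m(1)] order_refl, where 'k = 'k] m(1)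
    by (simp add: in_keys_iff)
qed


section \<open>The kernel is generated by Pfaffians\<close>

definition pf_gens :: "nat \<Rightarrow> nat \<Rightarrow> (nat \<Rightarrow> nat \<Rightarrow> 'k::field mpoly) \<Rightarrow> 'k mpoly set" where
  "pf_gens n t A = {pfaffian t (\<lambda>a b. A (sorted_list_of_set I ! a) (sorted_list_of_set I ! b)) | I.
     I \<subseteq> {1..n} \<and> card I = 2 * t}"

lemma cst_of_int: "cst (of_int z) = of_int z" by (simp add: cst_def)

lemma alghom_pfaffian:
  assumes "alghom f"
  shows "f (pfaffian t A) = pfaffian t (\<lambda>i j. f (A i j))"
proof -
  have "f (of_int z * p) = of_int z * f p" for z p
    using lin_scale[OF alghom_lin[OF assms], of "of_int z" p] by (simp add: cst_of_int)
  then show ?thesis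
    by (simp add: pfaffian_def lin_sum[OF alghom_lin[OF assms]] alghom_prod[OF assms])
qed

lemma phi_mvar [simp]: "phi d (mvar v) = twisted_lss_poly d (fst v) (snd v)" by (simp add: phi_def)
lemma alghom_phi [simp]: "alghom (phi d)" by (simp add: phi_def)

lemma phi_generic_skew_matrix:
  "phi d (generic_skew_matrix i j)
    = (\<Sum>k=1..d. mvar (i, 2 * k - 1) * mvar (j, 2 * k) - mvar (i, 2 * k) * mvar (j, 2 * k - 1))"
proof -
  consider "i < j" | "j < i" | "i = j" by linarith
  then show ?thesis
  proof cases
    case 2
    have "- (\<Sum>k=1..d. mvar (j, 2 * k - 1) * mvar (i, 2 * k) - mvar (j, 2 * k) * mvar (i, 2 * k - 1))
        = (\<Sum>k=1..d. mvar (i, 2 * k - 1) * mvar (j, 2 * k) - mvar (i, 2 * k) * mvar (j, 2 * k - 1) :: 'a mpoly)"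
      unfolding sum_negf[symmetric] by (intro sum.cong refl) (simp add: mult.commute)
    then show ?thesis using 2
      by (simp add: generic_skew_matrix_def lin_uminus[OF alghom_lin] twisted_lss_poly_def)
  qed (simp_all add: generic_skew_matrix_def twisted_lss_poly_def lin_0[OF alghom_lin] mult.commute)
qed

lemma phi_pf_gens:
  assumes "g \<in> pf_gens n (d + 1) (generic_skew_matrix :: nat \<Rightarrow> nat \<Rightarrow> 'k::field_char_0 mpoly)"
  shows "phi d g = 0"
proof -
  obtain I where g: "g = pfaffian (d + 1) (\<lambda>a b. generic_skew_matrix (sorted_list_of_set I ! a) (sorted_list_of_set I ! b))"
    using assms by (auto simp: pf_gens_def)
  show ?thesis
    unfolding g alghom_pfaffian[OF alghom_phi]
    by (rule pfaffian_low_rank[where K = "{1..d}"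
      and a = "\<lambda>i k. mvar (sorted_list_of_set I ! i, 2 * k - 1)" and b = "\<lambda>i k. mvar (sorted_list_of_set I ! i, 2 * k)"])
      (simp, simp, rule phi_generic_skew_matrix)
qed

text \<open>Counted from 0 the values cannot fall behind their arguments, and counted back from
  \<open>N - 1\<close> they cannot run ahead.\<close>

lemma strict_increasing_self_map:
  fixes s :: "nat \<Rightarrow> nat"
  assumes inc: "\<And>x y. x < y \<Longrightarrow> y < N \<Longrightarrow> s x < s y" and less: "\<And>x. x < N \<Longrightarrow> s x < N" and x: "x < N"
  shows "s x = x"
proof -
  have *: "s x + k \<le> s (x + k)" if "x + k < N" for x k
    using that
  proof (induction k)
    case (Suc k)
    then show ?case using inc[of "x + k" "x + Suc k"] by simp
  qed simp
  show ?thesis using *[of 0 x] *[of x "N - 1 - x"] less[of "N - 1"] x by simp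
qed

text \<open>The canonical listing of the totally nested matching that pairs \<open>a\<close> with
  \<open>2 * t - 1 - a\<close>.\<close>

definition nest_perm :: "nat \<Rightarrow> nat \<Rightarrow> nat" where
  "nest_perm t i = (if i < 2 * t then if even i then i div 2 else 2 * t - 1 - i div 2 else i)"

lemma nest_perm_apply: "a < t \<Longrightarrow> nest_perm t (2 * a) = a" "a < t \<Longrightarrow> nest_perm t (2 * a + 1) = 2 * t - 1 - a"
  by (auto simp: nest_perm_def)

lemma nest_perm_canonical: "nest_perm t \<in> canonical t"
proof -
  have "inj_on (nest_perm t) {..<2 * t}"
  proof (rule inj_onI)
    fix i j assume "i \<in> {..<2 * t}" "j \<in> {..<2 * t}" and e: "nest_perm t i = nest_perm t j"
    then have ij: "i < 2 * t" "j < 2 * t" by auto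
    show "i = j"
      by (rule nat_lt_2t_cases[OF ij(1)]; rule nat_lt_2t_cases[OF ij(2)])
        (use e nest_perm_apply in auto)
  qed
  moreover have "nest_perm t ` {..<2 * t} \<subseteq> {..<2 * t}" by (auto simp: nest_perm_def)
  ultimately have "bij_betw (nest_perm t) {..<2 * t} {..<2 * t}"
    by (simp add: bij_betw_def endo_inj_surj)
  then have "nest_perm t permutes {..<2 * t}" by (rule bij_imp_permutes) (auto simp: nest_perm_def)
  moreover have "nest_perm t (2 * a) < nest_perm t (2 * a + 1)" if "a < t" for a
    unfolding nest_perm_apply[OF that] using that by arith
  moreover have "nest_perm t (2 * a) < nest_perm t (2 * b)" if "a < b" "b < t" for a b
    using nest_perm_apply(1)[of a t] nest_perm_apply(1)[of b t] that by simp
  ultimately show ?thesis by (simp add: canonical_def)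
qed

text \<open>The first points of the blocks in order, followed by the second points in reverse order,
  increase strictly; an increasing self-map of 2t points is the identity.\<close>

lemma all_nested_eq_nest_perm:
  assumes p: "p \<in> canonical t" and nest: "\<And>a b. a < b \<Longrightarrow> b < t \<Longrightarrow> p (2 * b + 1) < p (2 * a + 1)"
  shows "p = nest_perm t"
proof -
  have pp: "p permutes {..<2 * t}" and p1: "\<And>a. a < t \<Longrightarrow> p (2 * a) < p (2 * a + 1)"
    and p2: "\<And>a b. a < b \<Longrightarrow> b < t \<Longrightarrow> p (2 * a) < p (2 * b)" using p by (auto simp: canonical_def)
  have lt: "p x < 2 * t" if "x < 2 * t" for x using permutes_in_image[OF pp, of x] that by simp
  define s where "s x = (if x < t then p (2 * x) else p (2 * (2 * t - 1 - x) + 1))" for x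
  have s: "s x = x" if "x < 2 * t" for x
  proof (rule strict_increasing_self_map[OF _ _ that])
    fix x assume "x < 2 * t"
    then show "s x < 2 * t" unfolding s_def by (auto intro!: lt)
  next
    fix x y assume xy: "x < y" "y < 2 * t"
    consider "y < t" | "t \<le> x" | "x < t" "t \<le> y" by linarith
    then show "s x < s y"
    proof cases
      case 1
      then show ?thesis using xy p2 by (simp add: s_def)
    next
      case 2
      then show ?thesis using xy nest[of "2 * t - 1 - y" "2 * t - 1 - x"] by (simp add: s_def)
    next
      case 3
      \<comment> \<open>A first point is compared with a second point through the inner one of the
        two blocks, where the comparison holds within a single block.\<close>
      define b where "b = max x (2 * t - 1 - y)"
      have b: "x \<le> b" "2 * t - 1 - y \<le> b" "b < t" using 3 xy by (auto simp: b_def)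
      have "p (2 * x) \<le> p (2 * b)" using p2[of x b] b by (cases "x = b") auto
      also have "\<dots> < p (2 * b + 1)" using p1 b by simp
      also have "\<dots> \<le> p (2 * (2 * t - 1 - y) + 1)"
        using nest[of "2 * t - 1 - y" b] b by (cases "2 * t - 1 - y = b") auto
      finally show ?thesis using 3 by (simp add: s_def)
    qed
  qed
  have "p i = nest_perm t i" for i
  proof (cases "i < 2 * t")
    case True
    then show ?thesis
    proof (cases rule: nat_lt_2t_cases)
      case (1 a)
      then show ?thesis using s[of a] nest_perm_apply(1)[of a t] by (simp add: s_def)
    next
      case (2 a)
      then have "2 * t - 1 - (2 * t - 1 - a) = a" "\<not> 2 * t - 1 - a < t" "2 * t - 1 - a < 2 * t" by auto
      then have "p (2 * a + 1) = 2 * t - 1 - a" using s[of "2 * t - 1 - a"] unfolding s_def by presburger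
      then show ?thesis using 2 nest_perm_apply(2)[of a t] by simp
    qed
  next
    case False
    then show ?thesis using permutes_not_in[OF pp, of i] by (simp add: nest_perm_def)
  qed
  then show ?thesis by auto
qed

definition match_wt :: "nat \<Rightarrow> (nat \<Rightarrow> nat) \<Rightarrow> (nat \<Rightarrow> nat) \<Rightarrow> nat" where
  "match_wt t u p = (\<Sum>a<t. u (p (2 * a)) * u (p (2 * a + 1)))"

text \<open>The ends of a block enter symmetrically, so the weight depends on the matching alone and
  survives a return to canonical form.\<close>

lemma match_wt_blocks:
  assumes "p permutes {..<2 * t}"
  shows "match_wt t u p = (\<Sum>B\<in>blocks t p. \<Prod>x\<in>B. u x)"
proof -
  have inj: "p i = p j \<longleftrightarrow> i = j" for i j by (rule inj_eq[OF permutes_inj[OF assms]])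
  have "inj_on (\<lambda>a. {p (2 * a), p (2 * a + 1)}) {..<t}"
    by (rule inj_onI) (auto simp: doubleton_eq_iff inj double_not_eq_Suc_double Suc_double_not_eq_double)
  then show ?thesis
    unfolding blocks_def match_wt_def by (subst sum.reindex) (auto simp: inj)
qed

text \<open>Uncrossing two edges decreases the weight, so the nesting is the only lightest matching.\<close>

lemma match_wt_improve:
  assumes p: "p \<in> canonical t" and ne: "p \<noteq> nest_perm t"
    and u: "\<And>x y. x < y \<Longrightarrow> y < 2 * t \<Longrightarrow> u y < u x"
  shows "\<exists>q\<in>canonical t. match_wt t u q < match_wt t u p"
proof -
  have pp: "p permutes {..<2 * t}" using p by (simp add: canonical_def)
  have inj: "p i = p j \<longleftrightarrow> i = j" for i j by (rule inj_eq[OF permutes_inj[OF pp]])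
  have lt: "p x < 2 * t" if "x < 2 * t" for x using permutes_in_image[OF pp, of x] that by simp
  obtain a b where ab: "a < b" "b < t" "\<not> p (2 * b + 1) < p (2 * a + 1)"
    using all_nested_eq_nest_perm[OF p] ne by blast
  moreover have "p (2 * b + 1) \<noteq> p (2 * a + 1)" unfolding inj using ab by simp
  ultimately have o: "p (2 * a + 1) < p (2 * b + 1)" by simp
  have e: "p (2 * a) < p (2 * b)" using p ab by (simp add: canonical_def)
  let ?\<tau> = "transpose (2 * a + 1) (2 * b + 1)"
  have perm: "p \<circ> ?\<tau> permutes {..<2 * t}" using ab by (intro permutes_compose permutes_swap_id pp) auto
  \<comment> \<open>Exchanging the second points can leave a block reversed, namely if the two edges
    were disjoint; the listing is therefore sorted again.\<close>
  obtain q where q: "q \<in> canonical t" "blocks t q = blocks t (p \<circ> ?\<tau>)" using canonical_exists[OF perm] by blast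
  have \<tau>e: "?\<tau> (2 * x) = 2 * x" for x
    by (rule transpose_apply_other) (simp_all add: double_not_eq_Suc_double)
  have \<tau>o: "?\<tau> (2 * x + 1) = (if x = a then 2 * b + 1 else if x = b then 2 * a + 1 else 2 * x + 1)" for x
    by (simp add: transpose_def)
  have split: "(\<Sum>x<t. f x) = f a + (f b + (\<Sum>x\<in>{..<t} - {a} - {b}. f x))" for f :: "nat \<Rightarrow> nat"
    using ab by (subst sum.remove[of _ a], simp, simp, subst sum.remove[of _ b]) auto
  have "match_wt t u (p \<circ> ?\<tau>) = u (p (2 * a)) * u (p (2 * b + 1)) + (u (p (2 * b)) * u (p (2 * a + 1))
      + (\<Sum>x\<in>{..<t} - {a} - {b}. u (p (2 * x)) * u (p (2 * x + 1))))"
    unfolding match_wt_def comp_apply \<tau>e \<tau>o split using ab by simp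
  moreover have "match_wt t u p = u (p (2 * a)) * u (p (2 * a + 1)) + (u (p (2 * b)) * u (p (2 * b + 1))
      + (\<Sum>x\<in>{..<t} - {a} - {b}. u (p (2 * x)) * u (p (2 * x + 1))))"
    unfolding match_wt_def by (rule split)
  moreover have "u (p (2 * a)) * u (p (2 * b + 1)) + u (p (2 * b)) * u (p (2 * a + 1))
      < u (p (2 * a)) * u (p (2 * a + 1)) + u (p (2 * b)) * u (p (2 * b + 1))"
  proof -
    have 1: "u (p (2 * b)) < u (p (2 * a))" using u[OF e lt] ab by simp
    have 2: "u (p (2 * b + 1)) < u (p (2 * a + 1))" using u[OF o lt] ab by simp
    \<comment> \<open>Rearrangement inequality: opposite pairing of the larger and smaller values
      saves exactly \<open>v * w\<close>.\<close>
    obtain v where v: "u (p (2 * a)) = u (p (2 * b)) + v" "v > 0" using 1 by (intro that[of "u (p (2 * a)) - u (p (2 * b))"]) auto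
    obtain w where w: "u (p (2 * a + 1)) = u (p (2 * b + 1)) + w" "w > 0" using 2 by (intro that[of "u (p (2 * a + 1)) - u (p (2 * b + 1))"]) auto
    show ?thesis unfolding v(1) w(1) using v(2) w(2) by (simp add: algebra_simps)
  qed
  ultimately have "match_wt t u (p \<circ> ?\<tau>) < match_wt t u p" by linarith
  moreover have "match_wt t u q = match_wt t u (p \<circ> ?\<tau>)"
    using q perm by (simp add: match_wt_blocks canonical_def)
  ultimately show ?thesis using q(1) by (intro bexI[of _ q]) (simp only:)
qed

lemma match_wt_nest_perm:
  assumes p: "p \<in> canonical t" "p \<noteq> nest_perm t"
    and u: "\<And>x y. x < y \<Longrightarrow> y < 2 * t \<Longrightarrow> u y < u x"
  shows "match_wt t u (nest_perm t) < match_wt t u p"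
proof -
  obtain q where q: "q \<in> canonical t" "\<And>p. p \<in> canonical t \<Longrightarrow> match_wt t u q \<le> match_wt t u p"
    using ex_has_least_nat[of "\<lambda>q. q \<in> canonical t" p "match_wt t u"] p(1) by blast
  have "q = nest_perm t"
  proof (rule ccontr)
    assume "q \<noteq> nest_perm t"
    from match_wt_improve[OF q(1) this, of u] u
    obtain r where "r \<in> canonical t" "match_wt t u r < match_wt t u q" by blast
    then show False using q(2)[of r] by simp
  qed
  moreover from match_wt_improve[OF p, of u] u
  obtain r where "r \<in> canonical t" "match_wt t u r < match_wt t u p" by blast
  ultimately show ?thesis using q(2)[of r] by simp
qed

lemma finite_canonical: "finite (canonical t)"
  by (rule finite_subset[OF _ finite_permutations[of "{..<2 * t}"]]) (auto simp: canonical_def)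

definition match_exp :: "nat list \<Rightarrow> nat \<Rightarrow> (nat \<Rightarrow> nat) \<Rightarrow> mexp" where
  "match_exp l t p = (\<Sum>a<t. Poly_Mapping.single (l ! p (2 * a), l ! p (2 * a + 1)) 1)"

lemma pfaffian_match_exp:
  assumes l: "sorted_wrt (<) l" "length l = 2 * t"
  shows "pfaffian t (\<lambda>a b. generic_skew_matrix (l ! a) (l ! b))
    = (\<Sum>p\<in>canonical t. cst (of_int (sign p)) * (xmon (match_exp l t p) :: 'k::field mpoly))"
  unfolding pfaffian_pterm
proof (intro sum.cong refl)
  fix p assume p: "p \<in> canonical t"
  have "l ! p (2 * a) < l ! p (2 * a + 1)" if "a < t" for a
  proof -
    have "p permutes {..<2 * t}" "p (2 * a) < p (2 * a + 1)" using p that by (simp_all add: canonical_def)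
    moreover from this(1) have "p (2 * a + 1) < 2 * t" using permutes_in_image[of p "{..<2 * t}" "2 * a + 1"] that by simp
    ultimately show ?thesis using sorted_wrt_nth_less[OF l(1)] l(2) by simp
  qed
  then have "(\<Prod>a<t. generic_skew_matrix (l ! p (2 * a)) (l ! p (2 * a + 1)) :: 'k mpoly)
      = (\<Prod>a<t. xmon (Poly_Mapping.single (l ! p (2 * a), l ! p (2 * a + 1)) 1))"
    by (intro prod.cong refl) (simp add: generic_skew_matrix_def mvar_xmon)
  then show "pterm t (\<lambda>a b. generic_skew_matrix (l ! a) (l ! b)) p = cst (of_int (sign p)) * (xmon (match_exp l t p) :: 'k mpoly)"
    by (simp add: pterm_def match_exp_def xmon_sum cst_of_int)
qed

lemma wt_match_exp: "wt w (match_exp l t p) = (\<Sum>a<t. w (l ! p (2 * a), l ! p (2 * a + 1)))"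
  unfolding match_exp_def by (rule wt_edges)

text \<open>A chain of \<open>t\<close> nested edges has 2t distinct endpoints, and its product is
  the nested term of the Pfaffian on them. Subtracting a multiple of this Pfaffian replaces the
  monomial by monomials of the same degree and strictly larger \<open>box_wt\<close>.\<close>

lemma reduce_monomial:
  assumes m: "keys m \<subseteq> skew_vars n"
  shows "\<exists>r\<in>polys (skew_vars n). (\<forall>m\<in>keys r. nest_free t m) \<and>
    xmon m - r \<in> gen.span (pf_gens n t (generic_skew_matrix :: nat \<Rightarrow> nat \<Rightarrow> 'k::field mpoly))"
  using m
\<comment> \<open>An edge weighs at most \<open>(n + 1) * (n + 1)\<close>, so the weight is bounded
  in terms of the degree, which rewriting preserves; the measure is the distance to that
  bound.\<close>
proof (induction "(n + 1) * (n + 1) * wt (\<lambda>_. 1) m - wt (box_wt n) m" arbitrary: m rule: less_induct)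
  case less
  let ?PF = "pf_gens n t (generic_skew_matrix :: nat \<Rightarrow> nat \<Rightarrow> 'k mpoly)"
  let ?R = "\<lambda>p. \<exists>r\<in>polys (skew_vars n). (\<forall>m\<in>keys r. nest_free t m) \<and> p - r \<in> gen.span ?PF"
  have R_add: "?R (p + q)" if pq: "?R p" "?R q" for p q :: "'k mpoly"
  proof -
    obtain r r' where r: "r \<in> polys (skew_vars n)" "\<forall>m\<in>keys r. nest_free t m" "p - r \<in> gen.span ?PF"
      and r': "r' \<in> polys (skew_vars n)" "\<forall>m\<in>keys r'. nest_free t m" "q - r' \<in> gen.span ?PF" using pq by blast
    have "p + q - (r + r') \<in> gen.span ?PF" using gen.span_add[OF r(3) r'(3)] by (simp add: algebra_simps)
    moreover have "\<forall>m\<in>keys (r + r'). nest_free t m" using r(2) r'(2) Poly_Mapping.keys_add[of r r'] by blast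
    ultimately show ?thesis using polys_add[OF r(1) r'(1)] by blast
  qed
  have R_scale: "?R (cst c * p)" if p: "?R p" for c and p :: "'k mpoly"
  proof -
    obtain r where r: "r \<in> polys (skew_vars n)" "\<forall>m\<in>keys r. nest_free t m" "p - r \<in> gen.span ?PF" using p by blast
    have "cst c * p - cst c * r \<in> gen.span ?PF" using gen.span_scale[OF r(3), of "cst c"] by (simp add: right_diff_distrib)
    moreover have "\<forall>m\<in>keys (cst c * r). nest_free t m" using r(2) by (auto simp: in_keys_iff lookup_cst_mult)
    ultimately show ?thesis using polys_mult[OF polys_cst r(1)] by blast
  qed
  have R_sum: "?R (sum f A)" if "\<And>a. a \<in> A \<Longrightarrow> ?R (f a)" for A and f :: "(nat \<Rightarrow> nat) \<Rightarrow> 'k mpoly"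
    using that
  proof (induction A rule: infinite_finite_induct)
    case (insert x F)
    then show ?case using R_add[of "f x" "sum f F"] by simp
  qed (auto intro!: bexI[of _ 0] gen.span_zero)
  show ?case
  proof (cases "nest_free t m")
    case True
    then show ?thesis using less.prems by (intro bexI[of _ "xmon m"]) (auto simp: gen.span_zero)
  next
    case False
    then obtain c where c: "sorted_wrt nested c" "set c \<subseteq> keys m" "length c = t"
      by (auto simp: nest_free_def nest_chain_def)
    have cV: "1 \<le> fst e \<and> fst e < snd e \<and> snd e \<le> n" if "e \<in> set c" for e
      using that c(2) less.prems by (auto simp: skew_vars_def)
    have cn: "nested (c ! a) (c ! b)" if "a < b" "b < t" for a b
      using sorted_wrt_nth_less[OF c(1)] c(3) that by simp
    \<comment> \<open>Tails from the outside in, then heads from the inside out: the increasing list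
      of the endpoints of the chain.\<close>
    define l where "l = map fst c @ rev (map snd c)"
    have len: "length l = 2 * t" by (simp add: l_def c(3))
    have l1: "l ! a = fst (c ! a)" if "a < t" for a using that c(3) by (simp add: l_def nth_append)
    have l2: "l ! (2 * t - 1 - a) = snd (c ! a)" if "a < t" for a
      using that c(3) by (auto simp: l_def nth_append rev_nth)
    have l2': "l ! x = snd (c ! (2 * t - 1 - x))" if "t \<le> x" "x < 2 * t" for x
      using l2[of "2 * t - 1 - x"] that by simp
    have "l ! x < l ! y" if xy: "x < y" "y < 2 * t" for x y
    proof -
      consider "y < t" | "t \<le> x" | "x < t" "t \<le> y" by linarith
      then show ?thesis
      proof cases
        case 1
        then show ?thesis using cn[of x y] xy l1 by (simp add: nested_def)
      next
        case 2
        then show ?thesis using cn[of "2 * t - 1 - y" "2 * t - 1 - x"] xy l2' by (simp add: nested_def)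
      next
        case 3
        define b where "b = max x (2 * t - 1 - y)"
        have b: "x \<le> b" "2 * t - 1 - y \<le> b" "b < t" using 3 xy by (auto simp: b_def)
        have "fst (c ! x) \<le> fst (c ! b)" using cn[of x b] b by (cases "x = b") (auto simp: nested_def)
        also have "\<dots> < snd (c ! b)" using cV[of "c ! b"] b c(3) by simp
        also have "\<dots> \<le> snd (c ! (2 * t - 1 - y))"
          using cn[of "2 * t - 1 - y" b] b by (cases "2 * t - 1 - y = b") (auto simp: nested_def)
        finally show ?thesis using 3 xy l1 l2' by simp
      qed
    qed
    then have srt: "sorted_wrt (<) l" using len by (simp add: sorted_wrt_iff_nth_less)
    have ln: "l ! x \<in> {1..n}" if "x < 2 * t" for x
    proof -
      have "l ! x \<in> set l" using that len by simp
      then show ?thesis using cV by (force simp: l_def)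
    qed
    define pf where "pf = pfaffian t (\<lambda>a b. generic_skew_matrix (l ! a) (l ! b) :: 'k mpoly)"
    have "sorted_list_of_set (set l) = l"
      by (rule strict_sorted_equal) (use srt in \<open>simp_all\<close>)
    moreover have "set l \<subseteq> {1..n}" using ln len by (auto simp: in_set_conv_nth)
    moreover have "card (set l) = 2 * t"
      using srt len by (metis distinct_card strict_sorted_iff)
    ultimately have pf: "pf \<in> ?PF" unfolding pf_def pf_gens_def by (auto intro!: exI[of _ "set l"])
    define M where "M = match_exp l t"
    let ?p0 = "nest_perm t"
    have M0: "M ?p0 = (\<Sum>a<t. Poly_Mapping.single (c ! a) 1)"
      unfolding M_def match_exp_def using nest_perm_apply[of _ t] l1 l2 by (intro sum.cong refl) simp
    have "lookup (M ?p0) e \<le> lookup m e" for e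
    proof -
      \<comment> \<open>Nested edges differ, so the product of the chain is squarefree and divides
        the monomial.\<close>
      have "distinct c" using c(1) by (metis nested_def less_irrefl sorted_wrt_iff_nth_less distinct_conv_nth linorder_neqE_nat)
      then have "card {a \<in> {..<t}. c ! a = e} \<le> 1"
        using c(3) by (auto simp: card_le_Suc0_iff_eq distinct_conv_nth)
      moreover have "{a \<in> {..<t}. c ! a = e} = {}" if "lookup m e = 0"
      proof -
        have "e \<notin> set c" using that c(2) by (auto simp: in_keys_iff)
        then show ?thesis using c(3) by auto
      qed
      moreover have "lookup (M ?p0) e = card {a \<in> {..<t}. c ! a = e}"
        unfolding M0 lookup_sum by (simp add: lookup_single when_def sum.inter_filter[symmetric])
      ultimately show ?thesis by (cases "lookup m e = 0") auto
    qed
    then have m0: "m = (m - M ?p0) + M ?p0"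
      by (intro poly_mapping_eqI) (simp add: lookup_add lookup_minus)
    define m' where "m' = m - M ?p0"
    have mm: "m = m' + M ?p0" using m0 by (simp add: m'_def)
    have Mk: "keys (M p) \<subseteq> skew_vars n" if "p \<in> canonical t" for p
    proof
      fix e assume "e \<in> keys (M p)"
      then have "e \<in> (\<Union>a\<in>{..<t}. keys (Poly_Mapping.single (l ! p (2 * a), l ! p (2 * a + 1)) (1::nat)))"
        unfolding M_def match_exp_def by (rule subsetD[OF Poly_Mapping.keys_sum])
      then obtain a where a: "a < t" "e = (l ! p (2 * a), l ! p (2 * a + 1))" by auto
      have pp: "p permutes {..<2 * t}" "p (2 * a) < p (2 * a + 1)" using that a by (simp_all add: canonical_def)
      have "p (2 * a) < 2 * t" "p (2 * a + 1) < 2 * t" using permutes_in_image[OF pp(1)] a(1) by simp_all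
      then show "e \<in> skew_vars n"
        using a(2) ln[of "p (2 * a)"] ln[of "p (2 * a + 1)"] sorted_wrt_nth_less[OF srt pp(2)] len by (simp add: skew_vars_def)
    qed
    have step: "?R (xmon (m' + M p))" if p: "p \<in> canonical t - {?p0}" for p
    proof (rule less.hyps)
      have "keys m = keys m' \<union> keys (M ?p0)" by (subst mm) (rule keys_add_mexp)
      then show "keys (m' + M p) \<subseteq> skew_vars n"
        using less.prems Mk[of p] p unfolding keys_add_mexp by blast
      have "wt (box_wt n) (M ?p0) < wt (box_wt n) (M p)"
      proof -
        define u where "u x = n + 1 - l ! x" for x
        have "wt (box_wt n) (M q) = match_wt t u q" for q
          by (simp add: M_def wt_match_exp box_wt_def match_wt_def u_def)
        moreover have "u y < u x" if "x < y" "y < 2 * t" for x y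
          using sorted_wrt_nth_less[OF srt, of x y] ln[of y] that len by (auto simp: u_def)
        ultimately show ?thesis using match_wt_nest_perm[of p t u] p by auto
      qed
      then have "wt (box_wt n) m < wt (box_wt n) (m' + M p)" by (simp add: mm wt_add)
      moreover have "wt (\<lambda>_. 1) (m' + M p) = wt (\<lambda>_. 1) m" by (simp add: mm wt_add M_def wt_match_exp)
      moreover have "wt (box_wt n) (m' + M p) \<le> (n + 1) * (n + 1) * wt (\<lambda>_. 1) (m' + M p)"
        unfolding wt_def sum_distrib_left
      proof (rule sum_mono)
        fix v
        have "box_wt n v \<le> (n + 1) * (n + 1)" unfolding box_wt_def by (intro mult_le_mono) auto
        then show "box_wt n v * lookup (m' + M p) v \<le> (n + 1) * (n + 1) * (1 * lookup (m' + M p) v)"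
          by (simp only: mult_1_left mult_le_mono1)
      qed
      ultimately show "(n + 1) * (n + 1) * wt (\<lambda>_. 1) (m' + M p) - wt (box_wt n) (m' + M p)
          < (n + 1) * (n + 1) * wt (\<lambda>_. 1) m - wt (box_wt n) m"
        by (metis diff_less_mono2 less_le_trans)
    qed
    let ?s = "\<lambda>p. cst (of_int (sign p)) :: 'k mpoly"
    let ?rest = "\<Sum>p\<in>canonical t - {?p0}. ?s p * xmon (m' + M p)"
    \<comment> \<open>The sign of the nested term is its own inverse, so the equation is solved for
      the monomial without computing this sign.\<close>
    have ss: "?s ?p0 * ?s ?p0 = 1" by (simp add: sign_def flip: cst_mult)
    have "xmon m' * pf = (\<Sum>p\<in>canonical t. ?s p * xmon (m' + M p))"
      unfolding pf_def pfaffian_match_exp[OF srt len] sum_distrib_left M_def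
      by (intro sum.cong refl) (simp add: xmon_add)
    also have "\<dots> = ?s ?p0 * xmon m + ?rest"
      using finite_canonical nest_perm_canonical by (subst sum.remove[of _ ?p0]) (auto simp: mm)
    finally have "?s ?p0 * (xmon m' * pf) = ?s ?p0 * (?s ?p0 * xmon m + ?rest)" by simp
    also have "\<dots> = xmon m + ?s ?p0 * ?rest" by (simp only: distrib_left mult.assoc[symmetric] ss mult_1_left)
    finally have eq: "xmon m = ?s ?p0 * (xmon m' * pf) + cst (- 1) * (?s ?p0 * ?rest)"
      by (simp add: cst_uminus)
    have "?s ?p0 * (xmon m' * pf) \<in> gen.span ?PF" by (intro gen.span_scale gen.span_base pf)
    then have "?R (?s ?p0 * (xmon m' * pf))" by (intro bexI[of _ 0]) auto
    moreover have "?R (cst (- 1) * (?s ?p0 * ?rest))"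
      by (intro R_scale R_sum step)
    ultimately show ?thesis unfolding eq by (rule R_add)
  qed
qed

theorem kernel_phi:
  assumes s: "s \<in> polys (skew_vars n)" and 0: "phi d (s :: 'k::field_char_0 mpoly) = 0"
  shows "s \<in> gen.span (pf_gens n (d + 1) generic_skew_matrix)"
proof -
  let ?PF = "pf_gens n (d + 1) (generic_skew_matrix :: nat \<Rightarrow> nat \<Rightarrow> 'k mpoly)"
  have "\<exists>r\<in>polys (skew_vars n). (\<forall>m\<in>keys r. nest_free (d + 1) m) \<and> xmon m - r \<in> gen.span ?PF" if "m \<in> keys s" for m
    by (rule reduce_monomial) (rule polysD[OF s that])
  then obtain r where r: "\<And>m. m \<in> keys s \<Longrightarrow> r m \<in> polys (skew_vars n)"
    "\<And>m m'. m \<in> keys s \<Longrightarrow> m' \<in> keys (r m) \<Longrightarrow> nest_free (d + 1) m'"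
    "\<And>m. m \<in> keys s \<Longrightarrow> xmon m - r m \<in> gen.span ?PF" by metis
  define q where "q = (\<Sum>m\<in>keys s. cst (lookup s m) * r m)"
  have "s - q = (\<Sum>m\<in>keys s. cst (lookup s m) * (xmon m - r m))"
    unfolding q_def by (subst mpoly_sum_monomials[of s]) (simp only: sum_subtractf right_diff_distrib)
  also have "\<dots> \<in> gen.span ?PF" by (intro gen.span_sum gen.span_scale r)
  finally have sq: "s - q \<in> gen.span ?PF" .
  have "phi d (s - q) \<in> gen.span {0}"
    by (rule alghom_span[OF alghom_phi _ sq]) (simp add: phi_pf_gens gen.span_zero)
  then have "phi d (s - q) = 0" by (simp add: gen.span_singleton)
  then have "phi d q = 0" using 0 by (simp add: lin_diff[OF alghom_lin])
  moreover have "q \<in> polys (skew_vars n)" unfolding q_def by (intro polys_sum polys_mult r) simp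
  moreover have "nest_free (d + 1) m" if mq: "m \<in> keys q" for m
  proof -
    have "keys q \<subseteq> (\<Union>m\<in>keys s. keys (cst (lookup s m) * r m))" unfolding q_def by (rule Poly_Mapping.keys_sum)
    then obtain m1 where "m1 \<in> keys s" "m \<in> keys (cst (lookup s m1) * r m1)" using mq by blast
    then show ?thesis using r(2)[of m1 m] by (auto simp: in_keys_iff lookup_cst_mult)
  qed
  ultimately have "q = 0" using phi_nest_free_independent[of q n d] by blast
  then show ?thesis using sq by simp
qed


section \<open>A substitute for the Reynolds operator of the symplectic group\<close>

section \<open>The apolar form\<close>

lemma bilin_eqI:
  assumes "\<And>q. lin (\<lambda>p. f p q)" "\<And>p. lin (\<lambda>q. f p q)" "\<And>q. lin (\<lambda>p. g p q)" "\<And>p. lin (\<lambda>q. g p q)"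
    and "\<And>m n. f (xmon m) (xmon n) = g (xmon m) (xmon n)"
  shows "f p q = g p q"
proof (rule lin_eqI[of "\<lambda>p. f p q" "\<lambda>p. g p q", OF assms(1,3)])
  fix m
  show "f (xmon m) q = g (xmon m) q"
    by (rule lin_eqI[of "\<lambda>q. f (xmon m) q" "\<lambda>q. g (xmon m) q", OF assms(2,4)]) (rule assms(5))
qed

text \<open>The formal partial derivative. Where \<open>v\<close> does not occur the truncated
  subtraction leaves the monomial unchanged, but the coefficient is 0.\<close>

definition pd :: "nat \<times> nat \<Rightarrow> 'k::field mpoly \<Rightarrow> 'k mpoly" where
  "pd v = linext (\<lambda>m. cst (of_nat (lookup m v)) * xmon (m - Poly_Mapping.single v 1))"

lemma lin_pd [simp]: "lin (pd v)" by (simp add: pd_def)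
lemma pd_xmon: "pd v (xmon m) = cst (of_nat (lookup m v)) * xmon (m - Poly_Mapping.single v 1)"
  by (simp add: pd_def)
lemmas pd_add = lin_add[OF lin_pd] and pd_diff = lin_diff[OF lin_pd] and pd_sum = lin_sum[OF lin_pd]
  and pd_scale = lin_scale[OF lin_pd] and pd_0 [simp] = lin_0[OF lin_pd]

lemma single_minus_add:
  "lookup m v \<noteq> 0 \<Longrightarrow> (m - Poly_Mapping.single v 1) + (n :: mexp) = (m + n) - Poly_Mapping.single v 1"
  by (rule poly_mapping_eqI) (auto simp: lookup_add lookup_minus lookup_single when_def)

lemma pd_mult: "pd v (p * q) = pd v p * q + p * pd v q"
proof (rule bilin_eqI[of "\<lambda>p q. pd v (p * q)" "\<lambda>p q. pd v p * q + p * pd v q"])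
  fix m n :: mexp
  have "cst (of_nat (lookup m v)) * xmon (m - Poly_Mapping.single v 1) * (xmon n :: 'a mpoly)
      = cst (of_nat (lookup m v)) * xmon ((m + n) - Poly_Mapping.single v 1)"
    by (cases "lookup m v = 0") (simp_all add: single_minus_add[unfolded One_nat_def] mult.assoc flip: xmon_add)
  moreover have "xmon m * (cst (of_nat (lookup n v)) * xmon (n - Poly_Mapping.single v 1) :: 'a mpoly)
      = cst (of_nat (lookup n v)) * xmon ((m + n) - Poly_Mapping.single v 1)"
    using single_minus_add[of n v m, unfolded One_nat_def]
    by (cases "lookup n v = 0") (simp_all add: add.commute mult.left_commute[of "xmon m"] flip: xmon_add)
  ultimately show "pd v (xmon m * xmon n) = pd v (xmon m) * xmon n + xmon m * (pd v (xmon n) :: 'a mpoly)"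
    by (simp only: pd_xmon) (simp only: xmon_add[symmetric] pd_xmon lookup_add of_nat_add cst_add distrib_right)
qed (simp_all only: lin_def pd_add pd_scale distrib_left distrib_right mult.assoc mult.left_commute[of _ "cst _"],
     simp_all)

lemma pd_cst [simp]: "pd v (cst c) = 0"
proof -
  have "pd v (cst c * xmon 0) = 0" by (simp only: pd_scale pd_xmon) simp
  then show ?thesis by simp
qed

lemma pd_mvar: "pd v (mvar w) = (if v = w then 1 else 0)"
  by (auto simp: mvar_xmon pd_xmon lookup_single)

definition mfact :: "mexp \<Rightarrow> 'k::field_char_0" where
  "mfact m = (\<Prod>v\<in>keys m. fact (lookup m v))"

lemma mfact_superset: "finite A \<Longrightarrow> keys m \<subseteq> A \<Longrightarrow> mfact m = (\<Prod>v\<in>A. fact (lookup m v))"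
  unfolding mfact_def by (rule prod.mono_neutral_left) (auto simp: in_keys_iff)

lemma mfact_add_single: "mfact (Poly_Mapping.single v 1 + m) = of_nat (lookup m v + 1) * mfact m"
proof -
  let ?A = "insert v (keys m)"
  have "mfact (Poly_Mapping.single v 1 + m) = (\<Prod>w\<in>?A. fact (lookup (Poly_Mapping.single v 1 + m) w) :: 'a)"
    by (rule mfact_superset) (auto simp: keys_add_mexp)
  also have "\<dots> = fact (lookup (Poly_Mapping.single v 1 + m) v) * (\<Prod>w\<in>?A - {v}. fact (lookup (Poly_Mapping.single v 1 + m) w))"
    by (rule prod.remove) auto
  also have "(\<Prod>w\<in>?A - {v}. fact (lookup (Poly_Mapping.single v 1 + m) w) :: 'a) = (\<Prod>w\<in>?A - {v}. fact (lookup m w))"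
    by (rule prod.cong[OF refl]) (auto simp: lookup_add lookup_single when_def)
  also have "fact (lookup (Poly_Mapping.single v 1 + m) v) = (of_nat (lookup m v + 1) * fact (lookup m v) :: 'a)"
    by (simp add: lookup_add)
  also have "of_nat (lookup m v + 1) * fact (lookup m v) * (\<Prod>w\<in>?A - {v}. fact (lookup m w))
      = of_nat (lookup m v + 1) * (fact (lookup m v) * (\<Prod>w\<in>?A - {v}. fact (lookup m w)) :: 'a)"
    by (rule mult.assoc)
  also have "fact (lookup m v) * (\<Prod>w\<in>?A - {v}. fact (lookup m w)) = (\<Prod>w\<in>?A. fact (lookup m w) :: 'a)"
    by (rule prod.remove[symmetric]) auto
  also have "\<dots> = mfact m"
    by (rule mfact_superset[symmetric]) auto
  finally show ?thesis .
qed

text \<open>The apolar (Fischer) form: monomials are orthogonal and a monomial with exponent m has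
  norm m!. The value is a constant polynomial, so that the tools for linear maps apply; the scalar
  is its coefficient at 0.\<close>

definition apolar :: "'k::field_char_0 mpoly \<Rightarrow> 'k mpoly \<Rightarrow> 'k mpoly" where
  "apolar p q = linext (\<lambda>m. cst (mfact m * lookup q m)) p"

lemma lin_apolar1: "lin (\<lambda>p. apolar p q)" by (simp add: apolar_def)
lemma lin_apolar2: "lin (\<lambda>q. apolar p q)"
  unfolding lin_def apolar_def linext_def
proof (intro conjI allI)
  fix c and q :: "'a mpoly"
  show "(\<Sum>m\<in>keys p. cst (lookup p m) * cst (mfact m * lookup (cst c * q) m))
    = cst c * (\<Sum>m\<in>keys p. cst (lookup p m) * cst (mfact m * lookup q m))"
    unfolding sum_distrib_left lookup_cst_mult cst_mult by (intro sum.cong refl) (simp only: mult_ac)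
qed (simp add: lookup_add cst_add distrib_left sum.distrib)
lemma apolar_xmon: "apolar (xmon m) (xmon n) = (if m = n then cst (mfact m) else 0)"
  by (auto simp: apolar_def lookup_xmon)

lemma apolar_sym: "apolar p q = apolar q p"
  by (rule bilin_eqI[of apolar "\<lambda>p q. apolar q p"]) (auto simp: apolar_xmon intro: lin_apolar1 lin_apolar2)

text \<open>Multiplication by a variable is adjoint to its derivative because raising an exponent by
  one multiplies the factorial by the new exponent. This is what dictates the factor
  \<open>mfact\<close>.\<close>

lemma apolar_mvar_mult: "apolar (mvar v * p) q = apolar p (pd v q)"
proof (rule bilin_eqI[of "\<lambda>p q. apolar (mvar v * p) q" "\<lambda>p q. apolar p (pd v q)"])
  fix m n :: mexp
  let ?e = "Poly_Mapping.single v 1 :: mexp"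
  have "apolar (mvar v * xmon m) (xmon n) = (if ?e + m = n then cst (mfact (?e + m)) else 0 :: 'a mpoly)"
    unfolding mvar_xmon xmon_add[symmetric] apolar_xmon ..
  also have "\<dots> = apolar (xmon m) (pd v (xmon n))"
  proof (cases "lookup n v = 0")
    case True
    then have "?e + m \<noteq> n" by (auto simp: lookup_add)
    then show ?thesis using True by (simp add: pd_xmon lin_0[OF lin_apolar2])
  next
    case False
    have "?e + m = n \<longleftrightarrow> m = n - ?e"
    proof
      assume "m = n - ?e"
      then show "?e + m = n" using False
        by (intro poly_mapping_eqI) (auto simp: lookup_add lookup_minus lookup_single when_def)
    qed auto
    moreover have "lookup (?e + m) v = lookup m v + 1" by (simp add: lookup_add)
    ultimately show ?thesis
      unfolding pd_xmon lin_scale[OF lin_apolar2] apolar_xmon mfact_add_single cst_mult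
      by (cases "?e + m = n") auto
  qed
  finally show "apolar (mvar v * xmon m) (xmon n) = apolar (xmon m) (pd v (xmon n) :: 'a mpoly)" .
qed (rule lin_mult_arg'[OF lin_apolar1] lin_apolar2 lin_apolar1 lin_comp[OF lin_apolar2 lin_pd])+

lemma apolar_cst: "apolar p q = cst (lookup (apolar p q) 0)"
proof -
  have "apolar p q \<in> polys {}" unfolding apolar_def by (rule polys_linext) simp
  then show ?thesis by (rule polys_empty)
qed

lemma apolar_disjoint: "keys p \<inter> keys q = {} \<Longrightarrow> apolar p q = 0"
  unfolding apolar_def linext_def by (intro sum.neutral) (auto simp: in_keys_iff)

text \<open>Coefficients in the prime field. There a sum of squares vanishes only trivially, unlike
  in a general field of characteristic 0.\<close>

definition rational :: "'k::field_char_0 mpoly \<Rightarrow> bool" where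
  "rational p \<longleftrightarrow> (\<forall>m. lookup p m \<in> \<rat>)"

lemma rational_add: "rational p \<Longrightarrow> rational q \<Longrightarrow> rational (p + q)" by (simp add: rational_def lookup_add)
lemma rational_diff: "rational p \<Longrightarrow> rational q \<Longrightarrow> rational (p - q)" by (simp add: rational_def lookup_minus)
lemma rational_scale: "c \<in> \<rat> \<Longrightarrow> rational p \<Longrightarrow> rational (cst c * p)" by (simp add: rational_def lookup_cst_mult)
lemma rational_sum: "(\<And>a. a \<in> A \<Longrightarrow> rational (f a)) \<Longrightarrow> rational (sum f A)"
  by (induction A rule: infinite_finite_induct) (auto intro: rational_add, auto simp: rational_def)
lemma rational_mvar: "rational (mvar v)" by (simp add: rational_def mvar_xmon lookup_xmon)
lemma rational_1: "rational 1" by (simp add: rational_def lookup_one when_def)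
lemma rational_mult: "rational p \<Longrightarrow> rational q \<Longrightarrow> rational (p * q)"
proof -
  assume p: "rational p" and q: "rational q"
  have x: "rational (xmon m)" for m :: mexp by (simp add: rational_def lookup_xmon)
  have "p * q = (\<Sum>m\<in>keys p. cst (lookup p m) * xmon m) * (\<Sum>m\<in>keys q. cst (lookup q m) * xmon m)"
    by (rule arg_cong2[where f = "(*)", OF mpoly_sum_monomials mpoly_sum_monomials])
  also have "\<dots> = (\<Sum>m\<in>keys p. \<Sum>n\<in>keys q. cst (lookup p m * lookup q n) * xmon (m + n))"
    unfolding sum_product cst_mult xmon_add by (intro sum.cong refl) (simp only: mult_ac)
  finally show ?thesis
    using p q x by (simp only:) (intro rational_sum rational_scale, auto simp: rational_def)
qed
lemma rational_prod: "(\<And>a. a \<in> A \<Longrightarrow> rational (f a)) \<Longrightarrow> rational (prod f A)"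
  by (induction A rule: infinite_finite_induct) (auto intro: rational_mult rational_1)
lemma rational_power: "rational p \<Longrightarrow> rational (p ^ n)"
  by (induction n) (auto intro: rational_mult rational_1)

lemma lookup_apolar: "lookup (apolar p q) 0 = (\<Sum>m\<in>keys p. lookup p m * (mfact m * lookup q m))"
  by (simp add: apolar_def linext_def lookup_sum lookup_cst_mult lookup_cst)

lemma rational_apolar: "rational p \<Longrightarrow> rational q \<Longrightarrow> lookup (apolar p q) 0 \<in> \<rat>"
proof -
  assume "rational p" "rational q"
  moreover have "(fact n :: 'a) \<in> \<rat>" for n by (metis of_nat_fact Rats_of_nat)
  ultimately show ?thesis
    unfolding lookup_apolar mfact_def rational_def by (intro Rats_sum Rats_mult Rats_prod) blast+
qed

text \<open>The norm is the image of a sum of rational squares with positive integer factors, hence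
  of a positive rational number.\<close>

lemma apolar_anisotropic:
  assumes "rational p" "p \<noteq> 0"
  shows "lookup (apolar p p) 0 \<noteq> 0"
proof -
  have "\<forall>m. \<exists>q. lookup p m = of_rat q" using assms(1) by (auto simp: rational_def elim: Rats_cases)
  then obtain q where q: "\<And>m. lookup p m = of_rat (q m)" by metis
  define N where "N m = (\<Prod>v\<in>keys m. fact (lookup m v) :: nat)" for m :: mexp
  have N: "mfact m = (of_nat (N m) :: 'a)" "N m > 0" for m by (auto simp: mfact_def N_def prod_pos)
  have "lookup (apolar p p) 0 = of_rat (\<Sum>m\<in>keys p. q m * (of_nat (N m) * q m))"
    unfolding lookup_apolar by (simp add: q N(1) of_rat_sum of_rat_mult)
  moreover have "(\<Sum>m\<in>keys p. q m * (of_nat (N m) * q m)) > 0"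
  proof (rule sum_pos)
    fix m assume "m \<in> keys p"
    then have "q m \<noteq> 0" using q[of m] by (auto simp: in_keys_iff)
    then have "q m * q m > 0" by (metis not_real_square_gt_zero linorder_neqE_linordered_idom mult_neg_neg mult_pos_pos)
    moreover have "(0 :: rat) < of_nat (N m)" using N(2)[of m] by simp
    ultimately have "of_nat (N m) * (q m * q m) > 0" by (rule mult_pos_pos[rotated])
    then show "q m * (of_nat (N m) * q m) > 0" by (subst mult.left_commute)
  qed (use assms(2) in auto)
  ultimately show ?thesis by (simp del: of_rat_sum)
qed

text \<open>Gram-Schmidt: the norms divided by are nonzero by anisotropy, and rational inner
  products keep the new vectors rational. The spans are over the whole field.\<close>

lemma orthogonal_basis:
  assumes "finite B" "\<And>b. b \<in> B \<Longrightarrow> rational b"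
  shows "\<exists>U. finite U \<and> (\<forall>u\<in>U. rational u) \<and> 0 \<notin> U \<and> (\<forall>u\<in>U. \<forall>v\<in>U. u \<noteq> v \<longrightarrow> apolar u v = 0) \<and>
    kv.span U = kv.span B"
  using assms
proof (induction B rule: finite_induct)
  case empty
  then show ?case by blast
next
  case (insert b B)
  have "\<exists>U. finite U \<and> (\<forall>u\<in>U. rational u) \<and> 0 \<notin> U \<and> (\<forall>u\<in>U. \<forall>v\<in>U. u \<noteq> v \<longrightarrow> apolar u v = 0) \<and>
    kv.span U = kv.span B" using insert.prems by (intro insert.IH) blast
  then obtain U where "finite U \<and> (\<forall>u\<in>U. rational u) \<and> 0 \<notin> U \<and>
    (\<forall>u\<in>U. \<forall>v\<in>U. u \<noteq> v \<longrightarrow> apolar u v = 0) \<and> kv.span U = kv.span B" ..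
  then have U: "finite U" "\<And>u. u \<in> U \<Longrightarrow> rational u" "0 \<notin> U"
    "\<And>u v. u \<in> U \<Longrightarrow> v \<in> U \<Longrightarrow> u \<noteq> v \<Longrightarrow> apolar u v = 0" "kv.span U = kv.span B" by blast+
  define c where "c u = lookup (apolar b u) 0 / lookup (apolar u u) 0" for u
  define r where "r = (\<Sum>u\<in>U. cst (c u) * u)"
  have rU: "r \<in> kv.span U" unfolding r_def by (intro kv.span_sum kv.span_scale kv.span_base)
  have rr: "rational r" unfolding r_def c_def
    by (intro rational_sum rational_scale Rats_divide rational_apolar U(2) insert.prems) auto
  have orth: "apolar (b - r) v = 0" if v: "v \<in> U" for v
  proof -
    have "apolar r v = (\<Sum>u\<in>U. cst (c u) * apolar u v)"
      unfolding r_def lin_sum[OF lin_apolar1] by (intro sum.cong refl lin_scale[OF lin_apolar1])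
    also have "\<dots> = (\<Sum>u\<in>U. if u = v then cst (c v) * apolar v v else 0)"
      using U(4) v by (intro sum.cong refl) auto
    also have "\<dots> = cst (c v) * apolar v v" using v U(1) by simp
    also have "\<dots> = cst (c v * lookup (apolar v v) 0)" by (subst apolar_cst) (simp add: cst_mult)
    also have "c v * lookup (apolar v v) 0 = lookup (apolar b v) 0"
      using apolar_anisotropic[OF U(2)[OF v]] U(3) v by (auto simp: c_def)
    finally show ?thesis using apolar_cst[of b v] by (simp add: lin_diff[OF lin_apolar1])
  qed
  have span: "kv.span (insert b B) = kv.span (insert (b - r) U)"
  proof -
    have "kv.span (insert b B) = kv.span (insert b U)"
      using kv.span_insert[of b B] kv.span_insert[of b U] U(5) by simp
    also have "\<dots> = kv.span (insert (b - r) U)"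
      by (rule kv.eq_span_insert_eq) (simp only: diff_diff_eq2 add_diff_cancel_left' rU)
    finally show ?thesis .
  qed
  show ?case
  proof (cases "b - r = 0")
    case True
    have "kv.span (insert b B) = kv.span U" unfolding span True by (rule kv.span_redundant[OF kv.span_zero])
    then show ?thesis using U by (intro exI[of _ U]) blast
  next
    case False
    have "\<forall>u\<in>insert (b - r) U. \<forall>v\<in>insert (b - r) U. u \<noteq> v \<longrightarrow> apolar u v = 0"
    proof (intro ballI impI)
      fix u v assume "u \<in> insert (b - r) U" "v \<in> insert (b - r) U" "u \<noteq> v"
      then show "apolar u v = 0"
        using U(4)[of u v] orth[of u] orth[of v] apolar_sym[of u "b - r"] by (elim insertE) simp_all
    qed
    moreover have "rational (b - r)" using insert.prems rr by (simp add: rational_diff)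
    moreover have "finite (insert (b - r) U)" using U(1) by simp
    ultimately show ?thesis using U(2,3) False[symmetric] span
      by (intro exI[of _ "insert (b - r) U"]) (blast intro: sym)
  qed
qed

lemma orthogonal_basisE:
  assumes "finite B" "\<And>b. b \<in> B \<Longrightarrow> rational b"
  obtains U where "finite U" "\<And>u. u \<in> U \<Longrightarrow> rational u" "0 \<notin> U"
    "\<And>u v. u \<in> U \<Longrightarrow> v \<in> U \<Longrightarrow> u \<noteq> v \<Longrightarrow> apolar u v = 0" "kv.span U = kv.span B"
proof -
  obtain U where U: "finite U \<and> (\<forall>u\<in>U. rational u) \<and> 0 \<notin> U \<and>
    (\<forall>u\<in>U. \<forall>v\<in>U. u \<noteq> v \<longrightarrow> apolar u v = 0) \<and> kv.span U = kv.span B"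
    using orthogonal_basis[OF assms] ..
  show thesis by (rule that[of U]) (use U in blast)+
qed

text \<open>\<open>h\<close> has arbitrary coefficients: the Fourier coefficients with respect to a
  rational orthogonal basis only divide by norms of basis vectors.\<close>

lemma rational_projection:
  assumes "finite B" "\<And>b. b \<in> B \<Longrightarrow> rational b"
  obtains r where "r \<in> kv.span B" "\<And>b. b \<in> kv.span B \<Longrightarrow> apolar (h - r) b = 0"
proof -
  obtain U where U: "finite U" "\<And>u. u \<in> U \<Longrightarrow> rational u" "0 \<notin> U"
    "\<And>u v. u \<in> U \<Longrightarrow> v \<in> U \<Longrightarrow> u \<noteq> v \<Longrightarrow> apolar u v = 0" "kv.span U = kv.span B"
    using orthogonal_basisE[OF assms(1,2)] by blast
  define c where "c u = lookup (apolar h u) 0 / lookup (apolar u u) 0" for u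
  define r where "r = (\<Sum>u\<in>U. cst (c u) * u)"
  have rU: "r \<in> kv.span U" unfolding r_def by (intro kv.span_sum kv.span_scale kv.span_base)
  have orth: "apolar (h - r) v = 0" if v: "v \<in> U" for v
  proof -
    have "apolar r v = (\<Sum>u\<in>U. cst (c u) * apolar u v)"
      unfolding r_def lin_sum[OF lin_apolar1] by (intro sum.cong refl lin_scale[OF lin_apolar1])
    also have "\<dots> = (\<Sum>u\<in>U. if u = v then cst (c v) * apolar v v else 0)"
      using U(4) v by (intro sum.cong refl) auto
    also have "\<dots> = cst (c v) * apolar v v" using v U(1) by simp
    also have "\<dots> = cst (c v * lookup (apolar v v) 0)" by (subst apolar_cst) (simp add: cst_mult)
    also have "c v * lookup (apolar v v) 0 = lookup (apolar h v) 0"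
      using apolar_anisotropic[OF U(2)[OF v]] U(3) v by (auto simp: c_def)
    finally show ?thesis using apolar_cst[of h v] by (simp add: lin_diff[OF lin_apolar1])
  qed
  have "apolar (h - r) b = 0" if "b \<in> kv.span U" for b
    using that
  proof (induction rule: kv.span_induct_alt)
    case (step c x y)
    then show ?case by (simp add: lin_add[OF lin_apolar2] lin_scale[OF lin_apolar2] orth)
  qed (simp add: lin_0[OF lin_apolar2])
  then show thesis using that[of r] rU U(5) by simp
qed

lemma rational_nondegenerate:
  assumes "finite B" "\<And>b. b \<in> B \<Longrightarrow> rational b" "a \<in> kv.span B" "\<And>b. b \<in> kv.span B \<Longrightarrow> apolar a b = 0"
  shows "a = 0"
proof -
  obtain U where U: "finite U" "\<And>u. u \<in> U \<Longrightarrow> rational u" "0 \<notin> U"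
    "\<And>u v. u \<in> U \<Longrightarrow> v \<in> U \<Longrightarrow> u \<noteq> v \<Longrightarrow> apolar u v = 0" "kv.span U = kv.span B"
    using orthogonal_basisE[OF assms(1,2)] by blast
  have "a \<in> range (\<lambda>c. \<Sum>u\<in>U. cst (c u) * u)" using assms(3) U(5) kv.span_finite[OF U(1)] by simp
  then obtain c where c: "a = (\<Sum>u\<in>U. cst (c u) * u)" by blast
  have "c v = 0" if v: "v \<in> U" for v
  proof -
    have "v \<in> kv.span B" using v kv.span_base[of v U] unfolding U(5) by simp
    then have "0 = apolar a v" using assms(4) by simp
    also have "\<dots> = (\<Sum>u\<in>U. cst (c u) * apolar u v)"
      unfolding c lin_sum[OF lin_apolar1] by (intro sum.cong refl lin_scale[OF lin_apolar1])
    also have "\<dots> = (\<Sum>u\<in>U. if u = v then cst (c v) * apolar v v else 0)"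
      using U(4) v by (intro sum.cong refl) auto
    also have "\<dots> = cst (c v) * apolar v v" using v U(1) by simp
    finally have "cst (c v) * apolar v v = 0" by simp
    moreover have "apolar v v \<noteq> 0" using apolar_anisotropic[OF U(2)[OF v]] U(3) v by (metis lookup_zero)
    ultimately show ?thesis by simp
  qed
  then show ?thesis unfolding c by (intro sum.neutral) simp
qed

section \<open>The image of the skew ring is stable under contraction\<close>

text \<open>The differential operator obtained from f_ij by replacing each variable with its
  derivative.\<close>

definition Del :: "nat \<Rightarrow> nat \<Rightarrow> nat \<Rightarrow> 'k::field mpoly \<Rightarrow> 'k mpoly" where
  "Del d i j q = (\<Sum>k=1..d. pd (i, 2 * k - 1) (pd (j, 2 * k) q) - pd (i, 2 * k) (pd (j, 2 * k - 1) q))"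

text \<open>The cross terms in the Leibniz rule for the second-order operator \<open>Del\<close>. It
  is symmetric and a derivation in either argument, so it is determined by its values on
  generators.\<close>

definition Gam :: "nat \<Rightarrow> nat \<Rightarrow> nat \<Rightarrow> 'k::field mpoly \<Rightarrow> 'k mpoly \<Rightarrow> 'k mpoly" where
  "Gam d i j p q = (\<Sum>k=1..d. pd (i, 2 * k - 1) p * pd (j, 2 * k) q - pd (i, 2 * k) p * pd (j, 2 * k - 1) q
     + (pd (j, 2 * k) p * pd (i, 2 * k - 1) q - pd (j, 2 * k - 1) p * pd (i, 2 * k) q))"

lemma lin_Del: "lin (Del d i j)"
  unfolding Del_def by (intro lin_setsum lin_minus lin_comp[OF lin_pd lin_pd])

lemma Del_mult: "Del d i j (p * q) = Del d i j p * q + p * Del d i j q + Gam d i j p q"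
proof -
  have id: "(u1 * q + p1 * q1 + (p2 * q2 + p * u2)) - (w1 * q + r1 * s1 + (r2 * s2 + p * w2))
     = (u1 - w1) * q + p * (u2 - w2) + ((p2 * q2 - r2 * s2) + (p1 * q1 - r1 * s1))"
    for u1 q p1 q1 p2 q2 p u2 w1 r1 s1 r2 s2 w2 :: "'a mpoly" by (simp add: algebra_simps)
  have "pd (i, 2 * k - 1) (pd (j, 2 * k) (p * q)) - pd (i, 2 * k) (pd (j, 2 * k - 1) (p * q))
    = (pd (i, 2 * k - 1) (pd (j, 2 * k) p) - pd (i, 2 * k) (pd (j, 2 * k - 1) p)) * q
      + p * (pd (i, 2 * k - 1) (pd (j, 2 * k) q) - pd (i, 2 * k) (pd (j, 2 * k - 1) q))
      + ((pd (i, 2 * k - 1) p * pd (j, 2 * k) q - pd (i, 2 * k) p * pd (j, 2 * k - 1) q)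
      + (pd (j, 2 * k) p * pd (i, 2 * k - 1) q - pd (j, 2 * k - 1) p * pd (i, 2 * k) q))" for k
    unfolding pd_mult pd_add id ..
  then show ?thesis unfolding Del_def Gam_def by (simp only: sum.distrib sum_distrib_left sum_distrib_right)
qed

lemma Gam_mult_rearrange:
  "(p * a1 + q * a2) - (p * b1 + q * b2) + ((p * c1 + q * c2) - (p * e1 + q * e2))
    = p * (a1 - b1 + (c1 - e1)) + q * (a2 - b2 + (c2 - e2))" for p :: "'b::comm_ring_1"
  by (simp add: algebra_simps)

lemma Gam_mult1: "Gam d i j (p * p') q = p * Gam d i j p' q + p' * Gam d i j p q"
proof -
  have "pd u (p * p') * pd v q = p * (pd u p' * pd v q) + p' * (pd u p * pd v q)" for u v
    unfolding pd_mult by (simp only: distrib_right) (simp only: mult_ac add.commute)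
  then show ?thesis unfolding Gam_def by (simp only: Gam_mult_rearrange sum.distrib[of "\<lambda>k. p * _ k" "\<lambda>k. p' * _ k"] sum_distrib_left)
qed

lemma Gam_sym: "Gam d i j p q = Gam d i j q p"
  unfolding Gam_def by (intro sum.cong refl) (simp add: algebra_simps)

lemma Gam_mult2: "Gam d i j p (q * q') = q * Gam d i j p q' + q' * Gam d i j p q"
  by (simp only: Gam_sym[of d i j p] Gam_mult1)

lemma pd_twisted:
  assumes "1 \<le> k" "k \<le> d"
  shows "pd (i, 2 * k - 1) (twisted_lss_poly d p q) = (if i = p then mvar (q, 2 * k) else 0) - (if i = q then mvar (p, 2 * k) else 0)"
    and "pd (i, 2 * k) (twisted_lss_poly d p q) = (if i = q then mvar (p, 2 * k - 1) else 0) - (if i = p then mvar (q, 2 * k - 1) else 0)"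
proof -
  have o: "2 * k - 1 = 2 * l - 1 \<longleftrightarrow> k = l" "2 * k - 1 \<noteq> 2 * l" "2 * k \<noteq> 2 * l - 1" if "l \<in> {1..d}" for l
    using that assms by auto presburger+
  have "pd (i, 2 * k - 1) (twisted_lss_poly d p q)
      = (\<Sum>l=1..d. if l = k then (if i = p then mvar (q, 2 * k) else 0) - (if i = q then mvar (p, 2 * k) else 0) else 0)"
    unfolding twisted_lss_poly_def pd_sum
    by (intro sum.cong refl) (use o in \<open>auto simp: pd_diff pd_mult pd_mvar\<close>)
  then show "pd (i, 2 * k - 1) (twisted_lss_poly d p q) = (if i = p then mvar (q, 2 * k) else 0) - (if i = q then mvar (p, 2 * k) else 0)"
    using assms by simp
  have "pd (i, 2 * k) (twisted_lss_poly d p q)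
      = (\<Sum>l=1..d. if l = k then (if i = q then mvar (p, 2 * k - 1) else 0) - (if i = p then mvar (q, 2 * k - 1) else 0) else 0)"
    unfolding twisted_lss_poly_def pd_sum
    by (intro sum.cong refl) (use o in \<open>auto simp: pd_diff pd_mult pd_mvar\<close>)
  then show "pd (i, 2 * k) (twisted_lss_poly d p q) = (if i = q then mvar (p, 2 * k - 1) else 0) - (if i = p then mvar (q, 2 * k - 1) else 0)"
    using assms by simp
qed

text \<open>The symplectic pairing of the gradients of two generators joins their remaining ends and
  is again a signed generator. In the first four terms \<open>i\<close> meets an end of the first
  factor and \<open>j\<close> an end of the second; the last four exchange \<open>i\<close> and
  \<open>j\<close>.\<close>

lemma Gam_twisted:
  "(Gam d i j (twisted_lss_poly d p q) (twisted_lss_poly d r s) :: 'k::field mpoly)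
    = (if i = p \<and> j = r then twisted_lss_poly d q s else 0) - (if i = p \<and> j = s then twisted_lss_poly d q r else 0)
    - (if i = q \<and> j = r then twisted_lss_poly d p s else 0) + (if i = q \<and> j = s then twisted_lss_poly d p r else 0)
    - ((if j = p \<and> i = r then twisted_lss_poly d q s else 0) - (if j = p \<and> i = s then twisted_lss_poly d q r else 0)
    - (if j = q \<and> i = r then twisted_lss_poly d p s else 0) + (if j = q \<and> i = s then twisted_lss_poly d p r else 0))"
proof -
  let ?t = "\<lambda>b x y k. (if b then mvar (x, 2 * k - 1) * mvar (y, 2 * k) - mvar (x, 2 * k) * mvar (y, 2 * k - 1) else 0) :: 'k mpoly"
  have f: "(if b then twisted_lss_poly d x y else 0) = (\<Sum>k=1..d. ?t b x y k)" for b x y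
    by (simp add: twisted_lss_poly_def)
  \<comment> \<open>The contribution of a single pair of columns: \<open>a\<close> stands for
    entries of the odd column and \<open>b\<close> for entries of the even one.\<close>
  have one: "((if i = p then bq else 0) - (if i = q then bp else 0)) * ((if j = s then ar else 0) - (if j = r then as else 0))
    - ((if i = q then ap else 0) - (if i = p then aq else 0)) * ((if j = r then bs else 0) - (if j = s then br else 0))
    = (if i = p \<and> j = r then aq * bs - bq * as else 0) - (if i = p \<and> j = s then aq * br - bq * ar else 0)
    - (if i = q \<and> j = r then ap * bs - bp * as else 0) + (if i = q \<and> j = s then ap * br - bp * ar else 0)"
    for i j and ap bp aq bq ar br as bs :: "'k mpoly"
    by (cases "i = p"; cases "i = q"; cases "j = r"; cases "j = s") (simp_all add: algebra_simps)
  have "Gam d i j (twisted_lss_poly d p q) (twisted_lss_poly d r s)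
    = (\<Sum>k=1..d. (?t (i = p \<and> j = r) q s k - ?t (i = p \<and> j = s) q r k - ?t (i = q \<and> j = r) p s k + ?t (i = q \<and> j = s) p r k)
     - (?t (j = p \<and> i = r) q s k - ?t (j = p \<and> i = s) q r k - ?t (j = q \<and> i = r) p s k + ?t (j = q \<and> i = s) p r k))"
    unfolding Gam_def
  proof (intro sum.cong refl, goal_cases)
    case (1 k)
    then have k: "1 \<le> k" "k \<le> d" by auto
    have neg: "x + (y - z) = x - (z - y)" for x y z :: "'k mpoly" by simp
    show ?case unfolding pd_twisted[OF k] neg 
      by (simp only: one)
  qed
  then show ?thesis unfolding f by (simp only: sum.distrib sum_subtractf)
qed


text \<open>The algebra generated by the f_ij, classically the ring of invariants of the symplectic
  group of 2d x 2d matrices.\<close>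

definition skew_image :: "nat \<Rightarrow> nat \<Rightarrow> 'k::field mpoly set" where
  "skew_image n d = phi d ` polys (skew_vars n)"

lemmas phi_lin = alghom_lin[OF alghom_phi]

lemma skew_image_cst [simp]: "cst c \<in> skew_image n d"
  unfolding skew_image_def by (rule image_eqI[of _ _ "cst c"]) (simp_all add: alghom_cst[OF alghom_phi])
lemma skew_image_0 [simp]: "0 \<in> skew_image n d" using skew_image_cst[of 0] by simp
lemma skew_image_1 [simp]: "1 \<in> skew_image n d" using skew_image_cst[of 1] by simp
lemma skew_image_add: "p \<in> skew_image n d \<Longrightarrow> q \<in> skew_image n d \<Longrightarrow> p + q \<in> skew_image n d"
  unfolding skew_image_def by (auto simp flip: lin_add[OF phi_lin] intro!: imageI polys_add)
lemma skew_image_mult: "p \<in> skew_image n d \<Longrightarrow> q \<in> skew_image n d \<Longrightarrow> p * q \<in> skew_image n d"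
  unfolding skew_image_def by (auto simp flip: alghom_mult[OF alghom_phi] intro!: imageI polys_mult)
lemma skew_image_uminus: "p \<in> skew_image n d \<Longrightarrow> - p \<in> skew_image n d"
  unfolding skew_image_def by (auto simp flip: lin_uminus[OF phi_lin] intro!: imageI polys_uminus)
lemma skew_image_diff: "p \<in> skew_image n d \<Longrightarrow> q \<in> skew_image n d \<Longrightarrow> p - q \<in> skew_image n d"
  unfolding skew_image_def by (auto simp flip: lin_diff[OF phi_lin] intro!: imageI polys_diff)
lemma skew_image_sum: "(\<And>a. a \<in> A \<Longrightarrow> f a \<in> skew_image n d) \<Longrightarrow> sum f A \<in> skew_image n d"
  by (induction A rule: infinite_finite_induct) (auto intro: skew_image_add)

lemma twisted_lss_poly_swap: "twisted_lss_poly d j i = - twisted_lss_poly d i j"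
  unfolding twisted_lss_poly_def sum_negf[symmetric] by (intro sum.cong refl) (simp add: mult.commute)

lemma twisted_lss_poly_self: "twisted_lss_poly d i i = 0"
  unfolding twisted_lss_poly_def by (intro sum.neutral) (simp add: mult.commute)

lemma twisted_in_skew_image:
  assumes "i \<in> {1..n}" "j \<in> {1..n}"
  shows "twisted_lss_poly d i j \<in> skew_image n d"
proof -
  have *: "twisted_lss_poly d i j \<in> skew_image n d" if "i < j" "i \<in> {1..n}" "j \<in> {1..n}" for i j
    unfolding skew_image_def
    by (rule image_eqI[of _ _ "mvar (i, j)"]) (use that in \<open>simp_all add: skew_vars_def\<close>)
  consider "i < j" | "j < i" | "i = j" by linarith
  then show ?thesis
  proof cases
    case 2
    then show ?thesis using skew_image_uminus[OF *[OF 2 assms(2,1)]] by (simp add: twisted_lss_poly_swap[of d i j])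
  qed (use * assms in \<open>simp_all add: twisted_lss_poly_self\<close>)
qed

text \<open>The image is exhausted by constants, sums, and products with one generator at a time,
  which is the form in which Leibniz rules are applied. The pair \<open>i\<close>, \<open>j\<close>
  may come in any order.\<close>

lemma skew_image_induct [consumes 1, case_names cst add mult]:
  fixes p :: "'k::field mpoly"
  assumes "p \<in> skew_image n d" "\<And>c. P (cst c)"
    "\<And>p q. p \<in> skew_image n d \<Longrightarrow> q \<in> skew_image n d \<Longrightarrow> P p \<Longrightarrow> P q \<Longrightarrow> P (p + q)"
    "\<And>i j p. i \<in> {1..n} \<Longrightarrow> j \<in> {1..n} \<Longrightarrow> p \<in> skew_image n d \<Longrightarrow> P p \<Longrightarrow> P (twisted_lss_poly d i j * p)"
  shows "P p"
proof -
  have mon: "P (cst c * phi d (xmon m)) \<and> cst c * phi d (xmon m) \<in> skew_image n d" if "keys m \<subseteq> skew_vars n" for c m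
  proof -
    obtain N es where es: "m = (\<Sum>s<N. Poly_Mapping.single (es s) 1)" "\<And>s. s < N \<Longrightarrow> es s \<in> keys m"
      "\<And>e. lookup m e = card {s \<in> {..<N::nat}. es s = e}" by (rule mexp_edges[of m]) (rule that)
    have e: "fst (es s) \<in> {1..n} \<and> snd (es s) \<in> {1..n}" if "s < N" for s
      using es(2)[OF that] \<open>keys m \<subseteq> _\<close> by (auto simp: skew_vars_def)
    have "P (cst c * (\<Prod>s<M. twisted_lss_poly d (fst (es s)) (snd (es s))))
      \<and> cst c * (\<Prod>s<M. twisted_lss_poly d (fst (es s)) (snd (es s))) \<in> skew_image n d" if "M \<le> N" for M
      using that
    proof (induction M)
      case 0
      then show ?case using assms(2) by simp
    next
      case (Suc M)
      let ?q = "cst c * (\<Prod>s<M. twisted_lss_poly d (fst (es s)) (snd (es s)))"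
      have q: "P ?q" "?q \<in> skew_image n d" using Suc by auto
      have e': "fst (es M) \<in> {1..n}" "snd (es M) \<in> {1..n}" using e[of M] Suc.prems by auto
      have "cst c * (\<Prod>s<Suc M. twisted_lss_poly d (fst (es s)) (snd (es s))) = twisted_lss_poly d (fst (es M)) (snd (es M)) * ?q"
        by (simp add: mult.commute mult.left_commute)
      then show ?case
        using assms(4)[OF e' q(2,1)] skew_image_mult[OF twisted_in_skew_image[OF e'] q(2)] by (simp only:)
    qed
    from this[OF order_refl] have "P (cst c * (\<Prod>s<N. twisted_lss_poly d (fst (es s)) (snd (es s))))
      \<and> cst c * (\<Prod>s<N. twisted_lss_poly d (fst (es s)) (snd (es s))) \<in> skew_image n d" .
    moreover have "(phi d (xmon m) :: 'k mpoly) = (\<Prod>s<N. twisted_lss_poly d (fst (es s)) (snd (es s)))"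
      unfolding es(1) xmon_sum[OF finite_lessThan] alghom_prod[OF alghom_phi] mvar_xmon[symmetric] phi_mvar ..
    ultimately show ?thesis by (simp only:)
  qed
  obtain s where s: "p = phi d s" "s \<in> polys (skew_vars n)" using assms(1) by (auto simp: skew_image_def)
  have "P (\<Sum>m\<in>A. cst (lookup s m) * phi d (xmon m)) \<and> (\<Sum>m\<in>A. cst (lookup s m) * phi d (xmon m)) \<in> skew_image n d"
    if "finite A" "A \<subseteq> keys s" for A
    using that
  proof (induction A rule: finite_induct)
    case empty
    then show ?case using assms(2)[of 0] by simp
  next
    case (insert m A)
    then show ?case using mon[OF polysD[OF s(2)], of m "lookup s m"] assms(3) by (simp add: skew_image_add)
  qed
  from this[of "keys s"] have "P (\<Sum>m\<in>keys s. cst (lookup s m) * phi d (xmon m))" by simp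
  moreover have "(\<Sum>m\<in>keys s. cst (lookup s m) * phi d (xmon m)) = phi d (\<Sum>m\<in>keys s. cst (lookup s m) * xmon m)"
    by (simp add: lin_sum[OF phi_lin] lin_scale[OF phi_lin])
  ultimately show ?thesis using s(1) mpoly_sum_monomials[of s] by simp
qed

lemma Gam_add1: "Gam d i j (p + p') q = Gam d i j p q + Gam d i j p' q"
proof -
  have "lin (\<lambda>p. Gam d i j p q)"
    unfolding Gam_def mult.commute[of _ "pd _ q"]
    by (intro lin_setsum lin_plus lin_minus lin_mult_left lin_pd)
  then show ?thesis by (rule lin_add)
qed

lemma Gam_add2: "Gam d i j p (q + q') = Gam d i j p q + Gam d i j p q'"
  by (simp only: Gam_sym[of d i j p] Gam_add1)

lemma Gam_cst: "Gam d i j (cst c) q = 0" "Gam d i j p (cst c) = 0"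
  by (simp_all add: Gam_def)

text \<open>The derivation rule in each argument reduces the claim to two generators, for which
  \<open>Gam_twisted\<close> gives a combination of generators.\<close>

lemma Gam_in_skew_image:
  fixes p q :: "'k::field mpoly"
  assumes p: "p \<in> skew_image n d" and q: "q \<in> skew_image n d"
  shows "Gam d i j p q \<in> skew_image n d"
  using p
proof (induction p rule: skew_image_induct)
  case (cst c)
  then show ?case by (simp add: Gam_cst)
next
  case (add p p')
  then show ?case by (simp add: Gam_add1 skew_image_add)
next
  case (mult a b p)
  have "Gam d i j (twisted_lss_poly d a b) q \<in> skew_image n d"
    using q
  proof (induction q rule: skew_image_induct)
    case (mult r s q)
    have f: "(if x then twisted_lss_poly d y z else (0 :: 'k mpoly)) \<in> skew_image n d" if "y \<in> {1..n}" "z \<in> {1..n}" for x y z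
      by (cases x) (simp_all add: twisted_in_skew_image[OF that])
    have "(Gam d i j (twisted_lss_poly d a b) (twisted_lss_poly d r s) :: 'k mpoly) \<in> skew_image n d"
      unfolding Gam_twisted using \<open>a \<in> _\<close> \<open>b \<in> _\<close> mult(1,2) by (intro skew_image_diff skew_image_add f)
    then show ?case unfolding Gam_mult2 using mult twisted_in_skew_image[OF mult(1,2)]
      by (intro skew_image_add skew_image_mult)
  qed (simp_all add: Gam_cst Gam_add2 skew_image_add)
  then show ?case unfolding Gam_mult1 using mult twisted_in_skew_image[OF mult(1,2)]
    by (intro skew_image_add skew_image_mult)
qed

text \<open>Second derivatives of a quadric are constants.\<close>

lemma Del_twisted_in_skew_image: "Del d i j (twisted_lss_poly d p q) \<in> skew_image n d"
proof -
  have *: "pd u ((if b then mvar v else 0) - (if c then mvar w else 0)) \<in> skew_image n d" for u v w b c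
    by (auto simp: pd_diff pd_mvar intro: skew_image_diff skew_image_uminus)
  show ?thesis unfolding Del_def
  proof (rule skew_image_sum)
    fix k assume "k \<in> {1..d}"
    then have k: "1 \<le> k" "k \<le> d" by auto
    show "pd (i, 2 * k - 1) (pd (j, 2 * k) (twisted_lss_poly d p q))
      - pd (i, 2 * k) (pd (j, 2 * k - 1) (twisted_lss_poly d p q)) \<in> skew_image n d"
      unfolding pd_twisted[OF k] by (intro skew_image_diff *)
  qed
qed

lemma Del_in_skew_image:
  assumes "p \<in> skew_image n d"
  shows "Del d i j p \<in> skew_image n d"
  using assms
proof (induction p rule: skew_image_induct)
  case (cst c)
  then show ?case by (simp add: Del_def)
next
  case (add p q)
  then show ?case by (simp add: lin_add[OF lin_Del] skew_image_add)
next
  case (mult a b p)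
  then show ?case
    unfolding Del_mult using twisted_in_skew_image[OF mult(1,2)]
    by (intro skew_image_add skew_image_mult Del_twisted_in_skew_image Gam_in_skew_image)
qed

lemma apolar_twisted_mult: "apolar (twisted_lss_poly d i j * p) q = apolar p (Del d i j q)"
proof -
  have "apolar (twisted_lss_poly d i j * p) q
     = (\<Sum>k=1..d. apolar (mvar (j, 2 * k) * (mvar (i, 2 * k - 1) * p)) q - apolar (mvar (j, 2 * k - 1) * (mvar (i, 2 * k) * p)) q)"
    unfolding twisted_lss_poly_def sum_distrib_right lin_sum[OF lin_apolar1] left_diff_distrib lin_diff[OF lin_apolar1]
    by (intro sum.cong refl) (simp only: mult.assoc mult.left_commute)
  also have "\<dots> = apolar p (Del d i j q)"
    unfolding apolar_mvar_mult Del_def lin_sum[OF lin_apolar2] lin_diff[OF lin_apolar2] ..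
  finally show ?thesis .
qed

section \<open>Contracting the Lovasz-Saks-Schrijver ideal\<close>

lemma finite_mexp_bounded:
  assumes "finite V"
  shows "finite {m. keys m \<subseteq> V \<and> (\<forall>v\<in>V. lookup m v \<le> (D :: nat))}"
    and "card {m. keys m \<subseteq> V \<and> (\<forall>v\<in>V. lookup m v \<le> D)} = (D + 1) ^ card V"
proof -
  let ?M = "{m. keys m \<subseteq> V \<and> (\<forall>v\<in>V. lookup m v \<le> D)}" and ?P = "PiE V (\<lambda>_. {..D})"
  have fin: "finite ?P" using assms by (intro finite_PiE) auto
  have "bij_betw (\<lambda>m. restrict (lookup m) V) ?M ?P"
    unfolding bij_betw_def
  proof
    show "inj_on (\<lambda>m. restrict (lookup m) V) ?M"
    proof (rule inj_onI, rule poly_mapping_eqI)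
      fix m m' v assume mm: "m \<in> ?M" "m' \<in> ?M" "restrict (lookup m) V = restrict (lookup m') V"
      show "lookup m v = lookup m' v"
      proof (cases "v \<in> V")
        case True
        then show ?thesis using fun_cong[OF mm(3), of v] by simp
      next
        case False
        then have "v \<notin> keys m" "v \<notin> keys m'" using mm by auto
        then show ?thesis by (simp add: in_keys_iff)
      qed
    qed
    show "(\<lambda>m. restrict (lookup m) V) ` ?M = ?P"
    proof (intro subset_antisym subsetI)
      fix f assume f: "f \<in> ?P"
      define m where "m = (\<Sum>v\<in>V. Poly_Mapping.single v (f v))"
      have l: "lookup m v = (if v \<in> V then f v else 0)" for v
        using assms by (simp add: m_def lookup_sum lookup_single when_def)
      have "restrict (lookup m) V = f"
        using PiE_arb[OF f] by (auto simp: l restrict_def)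
      moreover have "m \<in> ?M" using f by (auto simp: l in_keys_iff split: if_splits)
      ultimately show "f \<in> (\<lambda>m. restrict (lookup m) V) ` ?M" by blast
    qed auto
  qed
  then show "finite ?M" "card ?M = (D + 1) ^ card V"
    using fin assms bij_betw_finite[of _ ?M ?P] bij_betw_same_card[of _ ?M ?P] by (auto simp: card_PiE)
qed

lemma lookup_le_wt: "lookup m v \<le> wt (\<lambda>_. 1) m"
proof (cases "v \<in> keys m")
  case True
  then show ?thesis unfolding wt_def by (simp add: member_le_sum)
qed (simp add: in_keys_iff)

lemma finite_mexp_degree: "finite V \<Longrightarrow> finite {m. keys m \<subseteq> V \<and> wt (\<lambda>_. 1) m \<le> D}"
  by (rule finite_subset[OF _ finite_mexp_bounded(1)[of V D]]) (auto intro: le_trans[OF lookup_le_wt])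

lemma finite_skew_vars: "finite (skew_vars n)"
  by (rule finite_subset[of _ "{1..n} \<times> {1..n}"]) (auto simp: skew_vars_def)

lemma homog_twisted: "homog (\<lambda>_. 1) 2 (twisted_lss_poly d i j)"
proof -
  have "homog (\<lambda>_. 1) (1 + 1) (mvar u * mvar v)" for u v
    using homog_mult[OF homog_mvar homog_mvar, of "\<lambda>_. 1"] by simp
  then show ?thesis unfolding twisted_lss_poly_def by (intro homog_sum homog_diff) (simp_all add: numeral_2_eq_2)
qed

lemma homog_prod_power:
  assumes "\<And>v. v \<in> A \<Longrightarrow> homog w r (f v)"
  shows "homog w (r * (\<Sum>v\<in>A. e v)) (\<Prod>v\<in>A. f v ^ e v)"
  using assms
proof (induction A rule: infinite_finite_induct)
  case (insert v A)
  have "homog w (r * e v) (f v ^ e v)"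
  proof (induction "e v" arbitrary: e)
    case (Suc k)
    have "homog w (r * k) (f v ^ k)" using Suc(1)[of "\<lambda>_. k"] by simp
    then show ?case using homog_mult[OF insert.prems[of v]] Suc(2) by (metis insertI1 mult_Suc_right power_Suc)
  qed simp
  then show ?case using insert homog_mult by (simp add: distrib_left)
qed simp_all

lemma homog_phi_xmon: "homog (\<lambda>_. 1) (2 * wt (\<lambda>_. 1) m) (phi d (xmon m) :: 'k::field mpoly)"
proof -
  have "(phi d (xmon m) :: 'k mpoly) = (\<Prod>v\<in>keys m. twisted_lss_poly d (fst v) (snd v) ^ lookup m v)"
    by (simp add: phi_def subst_xmon mprod_def)
  moreover have "homog (\<lambda>_. 1) (2 * (\<Sum>v\<in>keys m. lookup m v))
      (\<Prod>v\<in>keys m. (twisted_lss_poly d (fst v) (snd v) :: 'k mpoly) ^ lookup m v)"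
    by (rule homog_prod_power) (rule homog_twisted)
  ultimately show ?thesis by (simp add: wt_def)
qed

lemma rational_phi_xmon: "rational (phi d (xmon m) :: 'k::field_char_0 mpoly)"
proof -
  have "rational (twisted_lss_poly d i j :: 'k mpoly)" for i j
    unfolding twisted_lss_poly_def by (intro rational_sum rational_diff rational_mult rational_mvar)
  then show ?thesis by (simp add: phi_def subst_xmon mprod_def rational_prod rational_power)
qed

lemma phi_in_span: "s \<in> polys V \<Longrightarrow> phi d s \<in> kv.span ((\<lambda>m. phi d (xmon m)) ` {m. keys m \<subseteq> V})"
proof -
  assume s: "s \<in> polys V"
  have "phi d (\<Sum>m\<in>keys s. cst (lookup s m) * xmon m) = (\<Sum>m\<in>keys s. cst (lookup s m) * phi d (xmon m))"
    by (simp add: lin_sum[OF phi_lin] lin_scale[OF phi_lin])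
  then have "phi d s = (\<Sum>m\<in>keys s. cst (lookup s m) * phi d (xmon m))" using mpoly_sum_monomials[of s] by simp
  also have "\<dots> \<in> kv.span ((\<lambda>m. phi d (xmon m)) ` {m. keys m \<subseteq> V})"
    using polysD[OF s] by (intro kv.span_sum kv.span_scale kv.span_base) auto
  finally show ?thesis .
qed

text \<open>\<open>phi\<close> doubles degrees. For \<open>h\<close> of degree at most
  \<open>D\<close> it suffices to project onto the finite-dimensional span of images of monomials of
  degree at most \<open>D\<close>: all further images have degree above \<open>2 * D\<close> and
  share no monomial with \<open>h - r\<close>.\<close>

lemma skew_image_projection:
  fixes h :: "'a::field_char_0 mpoly"
  obtains r where "r \<in> skew_image n d" "\<And>b. b \<in> skew_image n d \<Longrightarrow> apolar (h - r) b = 0"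
proof -
  obtain D where D: "\<And>m. m \<in> keys h \<Longrightarrow> wt (\<lambda>_. 1) m \<le> D" using sum_hcomp_obtain[of h "\<lambda>_. 1"] by blast
  define B :: "'a mpoly set" where "B = (\<lambda>m. phi d (xmon m)) ` {m. keys m \<subseteq> skew_vars n \<and> wt (\<lambda>_. 1) m \<le> D}"
  have "finite B" unfolding B_def by (intro finite_imageI finite_mexp_degree finite_skew_vars)
  moreover have "\<And>b. b \<in> B \<Longrightarrow> rational b" by (auto simp: B_def rational_phi_xmon)
  ultimately obtain r where r: "r \<in> kv.span B" "\<And>b. b \<in> kv.span B \<Longrightarrow> apolar (h - r) b = 0"
    using rational_projection[of B h] by blast
  have rD: "r \<in> skew_image n d \<and> (\<forall>m\<in>keys r. wt (\<lambda>_. 1) m \<le> 2 * D)"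
    using r(1)
  proof (induction rule: kv.span_induct_alt)
    case (step c x y)
    then obtain m where m: "x = phi d (xmon m)" "keys m \<subseteq> skew_vars n" "wt (\<lambda>_. 1) m \<le> D" by (auto simp: B_def)
    have "x \<in> skew_image n d" using m by (auto simp: skew_image_def)
    moreover have "wt (\<lambda>_. 1) k \<le> 2 * D" if "k \<in> keys (cst c * x)" for k
    proof -
      have "k \<in> keys (phi d (xmon m) :: 'a mpoly)" using that m(1) by (auto simp: in_keys_iff lookup_cst_mult)
      then show ?thesis using homog_phi_xmon[of m d] m(3) unfolding homog_def by fastforce
    qed
    moreover have "cst c * x + y \<in> skew_image n d"
      using step \<open>x \<in> skew_image n d\<close> by (intro skew_image_add skew_image_mult skew_image_cst) auto
    ultimately show ?case using step Poly_Mapping.keys_add[of "cst c * x" y] by blast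
  qed auto
  have "apolar (h - r) b = 0" if b: "b \<in> skew_image n d" for b
  proof -
    have "b \<in> kv.span ((\<lambda>m. phi d (xmon m)) ` {m. keys m \<subseteq> skew_vars n})"
      using b phi_in_span by (auto simp: skew_image_def)
    then show ?thesis
    proof (induction rule: kv.span_induct_alt)
      case base
      then show ?case by (simp add: lin_0[OF lin_apolar2])
    next
      case (step c x y)
      then obtain m where m: "x = phi d (xmon m)" "keys m \<subseteq> skew_vars n" by auto
      have "apolar (h - r) x = 0"
      proof (cases "wt (\<lambda>_. 1) m \<le> D")
        case True
        then show ?thesis using r(2)[OF kv.span_base] m by (auto simp: B_def)
      next
        case False
        have "wt (\<lambda>_. 1) k \<le> 2 * D" if "k \<in> keys (h - r)" for k
        proof -
          have "k \<in> keys h \<union> keys r" using that by (auto simp: in_keys_iff lookup_minus)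
          then show ?thesis using D rD by fastforce
        qed
        moreover have "wt (\<lambda>_. 1) k > 2 * D" if "k \<in> keys x" for k
          using homog_phi_xmon[of m d] m False that by (auto simp: homog_def)
        ultimately have "keys (h - r) \<inter> keys x = {}" by fastforce
        then show ?thesis by (rule apolar_disjoint)
      qed
      then show ?case using step by (simp add: lin_add[OF lin_apolar2] lin_scale[OF lin_apolar2])
    qed
  qed
  then show thesis using that rD by blast
qed

text \<open>\<open>a\<close> lies in the span of finitely many images of monomials, which are
  rational; on such a span the form is nondegenerate even over the larger field.\<close>

lemma skew_image_nondegenerate:
  fixes a :: "'a::field_char_0 mpoly"
  assumes "a \<in> skew_image n d" "\<And>b. b \<in> skew_image n d \<Longrightarrow> apolar a b = 0"
  shows "a = 0"
proof -
  obtain s where s: "a = phi d s" "s \<in> polys (skew_vars n)" using assms(1) by (auto simp: skew_image_def)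
  define B where "B = (\<lambda>m. phi d (xmon m) :: 'a mpoly) ` keys s"
  have BA: "B \<subseteq> skew_image n d" using polysD[OF s(2)] by (auto simp: B_def skew_image_def)
  have "b \<in> skew_image n d" if "b \<in> kv.span B" for b
    using that
  proof (induction rule: kv.span_induct_alt)
    case (step c x y)
    then show ?case using BA by (intro skew_image_add skew_image_mult skew_image_cst) auto
  qed simp
  moreover have "a \<in> kv.span B"
  proof -
    have "phi d (\<Sum>m\<in>keys s. cst (lookup s m) * xmon m) = (\<Sum>m\<in>keys s. cst (lookup s m) * phi d (xmon m))"
      by (simp add: lin_sum[OF phi_lin] lin_scale[OF phi_lin])
    then have "a = (\<Sum>m\<in>keys s. cst (lookup s m) * phi d (xmon m))" using s(1) mpoly_sum_monomials[of s] by simp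
    then show ?thesis by (simp only:) (intro kv.span_sum kv.span_scale kv.span_base, simp add: B_def)
  qed
  ultimately show ?thesis
  proof (intro rational_nondegenerate[of B a])
    show "finite B" unfolding B_def by simp
    show "rational b" if "b \<in> B" for b using that rational_phi_xmon by (auto simp: B_def)
  qed (use assms(2) in auto)
qed

text \<open>The orthogonal projection onto the image of \<open>phi\<close> is linear over that image, because
  multiplication by a generator is adjoint to a contraction that preserves the image. It plays the
  part of the Reynolds operator.\<close>

theorem phi_contract:
  assumes E: "finite Es" "Es \<subseteq> skew_vars n" and s: "s \<in> polys (skew_vars n)"
    and L: "phi d (s :: 'k::field_char_0 mpoly) \<in> gen.span ((\<lambda>e. twisted_lss_poly d (fst e) (snd e)) ` Es)"
  shows "s \<in> gen.span (pf_gens n (d + 1) generic_skew_matrix \<union> mvar ` Es)"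
proof -
  let ?f = "\<lambda>e. twisted_lss_poly d (fst e) (snd e) :: 'k mpoly"
  obtain h where h: "phi d s = (\<Sum>e\<in>Es. h e * ?f e)" using span_image_finite[OF E(1) L] by blast
  have "\<exists>r. r \<in> skew_image n d \<and> (\<forall>b\<in>skew_image n d. apolar (h e - r) b = 0)" for e
    by (rule skew_image_projection[of n d "h e"]) blast
  then obtain r where r: "\<And>e. r e \<in> skew_image n d" "\<And>e b. b \<in> skew_image n d \<Longrightarrow> apolar (h e - r e) b = 0" by metis
  \<comment> \<open>The error made by replacing every cofactor with its projection. It lies in the
    image and is orthogonal to it, hence vanishes.\<close>
  define a where "a = phi d s - (\<Sum>e\<in>Es. r e * ?f e)"
  have fA: "?f e \<in> skew_image n d" if "e \<in> Es" for e
    using that E(2) by (intro twisted_in_skew_image) (auto simp: skew_vars_def)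
  have "a \<in> skew_image n d" unfolding a_def
    using s by (intro skew_image_diff skew_image_sum skew_image_mult r fA) (auto simp: skew_image_def)
  moreover have "apolar a b = 0" if b: "b \<in> skew_image n d" for b
  proof -
    have "a = (\<Sum>e\<in>Es. ?f e * (h e - r e))"
      unfolding a_def h sum_subtractf[symmetric] by (intro sum.cong refl) (simp only: right_diff_distrib mult.commute[of "?f _"])
    then have "apolar a b = (\<Sum>e\<in>Es. apolar (?f e * (h e - r e)) b)" by (simp add: lin_sum[OF lin_apolar1])
    also have "\<dots> = 0"
      unfolding apolar_twisted_mult by (intro sum.neutral ballI r Del_in_skew_image b)
    finally show ?thesis .
  qed
  ultimately have a0: "a = 0" by (rule skew_image_nondegenerate)
  have "\<exists>t. t \<in> polys (skew_vars n) \<and> r e = phi d t" for e using r(1)[of e] by (auto simp: skew_image_def)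
  then obtain t where t: "\<And>e. t e \<in> polys (skew_vars n)" "\<And>e. r e = phi d (t e)" by metis
  \<comment> \<open>The projected cofactors lift to the skew ring, so \<open>u\<close> is a
    combination of edge variables with the same image as \<open>s\<close>; the difference is in the
    kernel.\<close>
  define u where "u = (\<Sum>e\<in>Es. t e * mvar e)"
  have "phi d (s - u) = 0"
    using a0 unfolding a_def u_def t(2)
    by (simp add: lin_diff[OF phi_lin] lin_sum[OF phi_lin] alghom_mult[OF alghom_phi])
  moreover have "s - u \<in> polys (skew_vars n)" unfolding u_def
    using E(2) by (intro polys_diff s polys_sum polys_mult t) auto
  ultimately have "s - u \<in> gen.span (pf_gens n (d + 1) generic_skew_matrix)" by (intro kernel_phi)
  then have "s - u \<in> gen.span (pf_gens n (d + 1) generic_skew_matrix \<union> mvar ` Es)"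
    by (rule subsetD[OF gen.span_mono[OF Un_upper1]])
  moreover have "u \<in> gen.span (pf_gens n (d + 1) generic_skew_matrix \<union> mvar ` Es)"
    unfolding u_def by (intro gen.span_sum gen.span_scale gen.span_base) simp
  ultimately have "(s - u) + u \<in> gen.span (pf_gens n (d + 1) generic_skew_matrix \<union> mvar ` Es)"
    by (rule gen.span_add)
  then show ?thesis by simp
qed


section \<open>Dimension and height through growth of standard monomials\<close>

section \<open>Independent sets of variables and growth\<close>

definition indep :: "'k::field mpoly set \<Rightarrow> (nat \<times> nat) set \<Rightarrow> bool" where
  "indep I V \<longleftrightarrow> (\<forall>p\<in>I. p \<in> polys V \<longrightarrow> p = 0)"

text \<open>For a proper ideal this is the Krull dimension of the quotient, in a form that needs
  only elimination. Properness makes the empty set independent, so the maximum is over a nonempty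
  set.\<close>

definition vdim :: "(nat \<times> nat) set \<Rightarrow> 'k::field mpoly set \<Rightarrow> nat" where
  "vdim X I = Max (card ` {V. V \<subseteq> X \<and> indep I V})"

abbreviation deg :: "mexp \<Rightarrow> nat" where "deg \<equiv> wt (\<lambda>_. 1)"

lemma indep_empty: "idealin X I \<Longrightarrow> 1 \<notin> I \<Longrightarrow> indep I {}"
  unfolding indep_def
proof (intro ballI impI)
  fix p assume I: "idealin X I" "1 \<notin> I" and p: "p \<in> I" "p \<in> polys {}"
  have c: "p = cst (lookup p 0)" by (rule polys_empty[OF p(2)])
  show "p = 0"
  proof (rule ccontr)
    assume "p \<noteq> 0"
    then have "lookup p 0 \<noteq> 0" using c by auto
    then have "cst (inverse (lookup p 0)) * p = 1" by (subst c) (simp flip: cst_mult)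
    moreover have "cst (inverse (lookup p 0)) * p \<in> I" using I(1) p(1) by (simp add: idealin_def)
    ultimately show False using I(2) by simp
  qed
qed

lemma vdim:
  assumes "finite X" "idealin X I" "1 \<notin> I"
  shows "\<exists>V. V \<subseteq> X \<and> indep I V \<and> card V = vdim X I"
    and "V \<subseteq> X \<Longrightarrow> indep I V \<Longrightarrow> card V \<le> vdim X I"
    and "vdim X I \<le> card X"
proof -
  let ?S = "card ` {V. V \<subseteq> X \<and> indep I V}"
  have fin: "finite ?S" using assms(1) by simp
  have "?S \<noteq> {}" using indep_empty[OF assms(2,3)] by blast
  then have "vdim X I \<in> ?S" unfolding vdim_def by (rule Max_in[OF fin])
  then show 1: "\<exists>V. V \<subseteq> X \<and> indep I V \<and> card V = vdim X I" by auto
  then show "vdim X I \<le> card X" using assms(1) card_mono by metis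
  show "V \<subseteq> X \<Longrightarrow> indep I V \<Longrightarrow> card V \<le> vdim X I"
    unfolding vdim_def by (rule Max_ge[OF fin]) blast
qed

text \<open>Compares exponents by degree, with ties broken by the order on exponents, so that
  reduction never raises the degree.\<close>

definition mkey :: "mexp \<Rightarrow> nat \<times> mexp" where "mkey m = (deg m, m)"

lemma mkey_inj: "mkey m = mkey n \<longleftrightarrow> m = n" by (auto simp: mkey_def)
lemma mkey_add: "mkey m < mkey n \<Longrightarrow> mkey (k + m) < mkey (k + n)"
  by (auto simp: mkey_def wt_add less_prod_def intro: add_strict_left_mono)

definition lead_mons :: "'k::field mpoly set \<Rightarrow> mexp set" where
  "lead_mons I = {m. \<exists>p\<in>I. m \<in> keys p \<and> (\<forall>n\<in>keys p. n \<noteq> m \<longrightarrow> mkey n < mkey m)}"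

lemma lead_mons_exists:
  assumes "p \<in> I" "p \<noteq> 0"
  shows "\<exists>m\<in>keys p. m \<in> lead_mons I"
proof -
  have "Max (mkey ` keys p) \<in> mkey ` keys p" using assms(2) by (intro Max_in) auto
  then obtain m where m: "m \<in> keys p" "mkey m = Max (mkey ` keys p)" by auto
  have "mkey n < mkey m" if "n \<in> keys p" "n \<noteq> m" for n
  proof -
    have "mkey n \<le> mkey m" unfolding m(2) using that(1) by (intro Max_ge) auto
    moreover have "mkey n \<noteq> mkey m" using that(2) by (simp add: mkey_inj)
    ultimately show ?thesis by (rule le_neq_trans)
  qed
  then show ?thesis using m(1) assms(1) by (auto simp: lead_mons_def)
qed

lemma keys_xmon_mult: "keys (xmon n * p) = (+) n ` keys p"
proof -
  have "lookup (xmon n * p) (n + m) = lookup p m" for m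
  proof (induction p rule: mpoly_induct)
    case (monomial k c)
    have "xmon n * (cst c * xmon k) = cst c * xmon (n + k)" by (simp add: xmon_add mult.left_commute)
    then show ?case by (simp only: lookup_cst_mult lookup_xmon add_left_cancel)
  qed (simp add: distrib_left lookup_add)
  moreover have "keys (xmon n * p) \<subseteq> (+) n ` keys p" using keys_mult[of "xmon n" p] by auto
  ultimately show ?thesis by (auto simp: in_keys_iff)
qed

lemma lead_mons_add:
  assumes "idealin X I" "m \<in> lead_mons I" "keys n \<subseteq> X"
  shows "n + m \<in> lead_mons I"
proof -
  obtain p where p: "p \<in> I" "m \<in> keys p" "\<And>k. k \<in> keys p \<Longrightarrow> k \<noteq> m \<Longrightarrow> mkey k < mkey m"
    using assms(2) by (auto simp: lead_mons_def)
  have "xmon n * p \<in> I" using assms(1,3) p(1) by (simp add: idealin_def)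
  moreover have "n + m \<in> keys (xmon n * p)" unfolding keys_xmon_mult using p(2) by blast
  moreover have "mkey k < mkey (n + m)" if "k \<in> keys (xmon n * p)" "k \<noteq> n + m" for k
    using that p(3) unfolding keys_xmon_mult by (auto intro: mkey_add)
  ultimately show ?thesis by (auto simp: lead_mons_def)
qed

text \<open>Division by the ideal: the largest leading exponent that still occurs is cancelled
  against an element of the ideal with that leading exponent, whose other terms are smaller.\<close>

lemma normal_form:
  fixes p :: "'k::field mpoly"
  assumes X: "finite X" and I: "idealin X I" and p: "p \<in> polys X" "\<And>m. m \<in> keys p \<Longrightarrow> deg m \<le> D"
  shows "\<exists>r\<in>polys X. p - r \<in> I \<and> (\<forall>m\<in>keys r. deg m \<le> D \<and> m \<notin> lead_mons I)"
proof -
  define M where "M = {m. keys m \<subseteq> X \<and> deg m \<le> D}"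
  have finM: "finite M" unfolding M_def by (rule finite_mexp_degree[OF X])
  \<comment> \<open>All exponents of degree at most \<open>D\<close> that lie at or below some
    reducible exponent of \<open>p\<close>. This finite set shrinks whenever the largest reducible
    exponent is cancelled.\<close>
  define bad where "bad p = {m\<in>M. \<exists>n\<in>keys p \<inter> lead_mons I. mkey m \<le> mkey n}" for p :: "'k mpoly"
  show ?thesis
    using p
  proof (induction "card (bad p)" arbitrary: p rule: less_induct)
    case less
    have pM: "m \<in> M" if "m \<in> keys p" for m
      using less.prems(2)[OF that] polysD[OF less.prems(1) that] by (simp add: M_def)
    show ?case
    proof (cases "keys p \<inter> lead_mons I = {}")
      case True
      then show ?thesis using less.prems I by (intro bexI[of _ p]) (auto simp: idealin_def)
    next
      case False
      then have "Max (mkey ` (keys p \<inter> lead_mons I)) \<in> mkey ` (keys p \<inter> lead_mons I)" by (intro Max_in) auto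
      then obtain m where m: "m \<in> keys p" "m \<in> lead_mons I" "mkey m = Max (mkey ` (keys p \<inter> lead_mons I))" by auto
      have mmax: "mkey n \<le> mkey m" if "n \<in> keys p \<inter> lead_mons I" for n
        unfolding m(3) using that by (intro Max_ge) auto
      obtain g where g: "g \<in> I" "m \<in> keys g" "\<And>k. k \<in> keys g \<Longrightarrow> k \<noteq> m \<Longrightarrow> mkey k < mkey m"
        using m(2) by (auto simp: lead_mons_def)
      have gX: "g \<in> polys X" using g(1) I by (auto simp: idealin_def)
      have gD: "deg k \<le> D" if "k \<in> keys g" for k
        using g(3)[OF that] less.prems(2)[OF m(1)] by (cases "k = m") (auto simp: mkey_def less_prod_def)
      define c where "c = lookup p m / lookup g m"
      define q where "q = p - cst c * g"
      have lq: "lookup q k = lookup p k - c * lookup g k" for k by (simp add: q_def lookup_minus lookup_cst_mult)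
      have qm: "m \<notin> keys q" using g(2) by (simp add: in_keys_iff lq c_def)
      have qk: "k \<in> keys p \<or> k \<in> keys g" if "k \<in> keys q" for k using that by (auto simp: in_keys_iff lq)
      have "mkey n < mkey m" if "n \<in> keys q \<inter> lead_mons I" for n
      proof -
        have "n \<noteq> m" using that qm by auto
        then show ?thesis using qk[of n] that g(3) mmax[of n] by (auto simp: order.order_iff_strict mkey_inj)
      qed
      note lt = this
      have "bad q \<subseteq> bad p - {m}"
      proof
        fix k assume "k \<in> bad q"
        then obtain n where n: "k \<in> M" "n \<in> keys q \<inter> lead_mons I" "mkey k \<le> mkey n" by (auto simp: bad_def)
        then have "mkey k < mkey m" using lt[OF n(2)] by (rule_tac le_less_trans)
        then show "k \<in> bad p - {m}" using n(1) m(1,2) by (auto simp: bad_def intro!: bexI[of _ m])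
      qed
      moreover have "m \<in> bad p" using pM[OF m(1)] m(1,2) by (auto simp: bad_def intro!: bexI[of _ m])
      moreover have "finite (bad p)" using finM by (simp add: bad_def)
      ultimately have "card (bad q) < card (bad p)" by (metis card_Diff1_less card_mono finite_Diff le_less_trans)
      moreover have "q \<in> polys X" unfolding q_def using less.prems(1) gX by (intro polys_diff polys_mult) auto
      moreover have "\<And>k. k \<in> keys q \<Longrightarrow> deg k \<le> D" using qk gD less.prems(2) by blast
      ultimately obtain r where r: "r \<in> polys X" "q - r \<in> I" "\<forall>m\<in>keys r. deg m \<le> D \<and> m \<notin> lead_mons I"
        using less.hyps by blast
      have "cst c * g \<in> I" using I g(1) by (simp add: idealin_def)
      then have "(q - r) + cst c * g \<in> I" using I r(2) by (simp add: idealin_def)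
      then have "p - r \<in> I" by (simp add: q_def)
      then show ?thesis using r by blast
    qed
  qed
qed

lemma card_mixed_bound:
  fixes X :: "(nat \<times> nat) set"
  assumes X: "finite X" and V: "V \<subseteq> X"
  shows "finite {m. keys m \<subseteq> X \<and> (\<forall>v\<in>V. lookup m v \<le> D) \<and> (\<forall>v\<in>X - V. lookup m v \<le> B)}"
    and "card {m. keys m \<subseteq> X \<and> (\<forall>v\<in>V. lookup m v \<le> D) \<and> (\<forall>v\<in>X - V. lookup m v \<le> B)}
      \<le> (D + 1) ^ card V * (B + 1) ^ card X"
proof -
  let ?T = "{m. keys m \<subseteq> X \<and> (\<forall>v\<in>V. lookup m v \<le> D) \<and> (\<forall>v\<in>X - V. lookup m v \<le> B)}"
  let ?P = "{m. keys m \<subseteq> V \<and> (\<forall>v\<in>V. lookup m v \<le> D)}"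
  let ?Q = "{m. keys m \<subseteq> X - V \<and> (\<forall>v\<in>X - V. lookup m v \<le> B)}"
  have finV: "finite V" "finite (X - V)" using X V by (auto intro: finite_subset)
  have fin: "finite (?P \<times> ?Q)" using finite_mexp_bounded(1)[OF finV(1)] finite_mexp_bounded(1)[OF finV(2)] by simp
  have inj: "inj_on (\<lambda>m. (restr V m, restr (- V) m)) ?T"
    by (rule inj_onI) (metis (no_types, lifting) prod.inject restr_split)
  have im: "(\<lambda>m. (restr V m, restr (- V) m)) ` ?T \<subseteq> ?P \<times> ?Q" by (auto simp: lookup_restr)
  show "finite ?T" using inj_on_finite[OF inj im fin] .
  have "card ?T \<le> card (?P \<times> ?Q)" by (rule card_inj_on_le[OF inj im fin])
  also have "\<dots> = (D + 1) ^ card V * (B + 1) ^ card (X - V)"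
    by (simp only: card_cartesian_product finite_mexp_bounded(2)[OF finV(1)] finite_mexp_bounded(2)[OF finV(2)])
  also have "\<dots> \<le> (D + 1) ^ card V * (B + 1) ^ card X"
    using X by (intro mult_left_mono power_increasing card_mono) auto
  finally show "card ?T \<le> (D + 1) ^ card V * (B + 1) ^ card X" .
qed

text \<open>In a standard monomial the variables with exponent above a fixed bound \<open>B\<close>
  form an independent set, for otherwise a leading monomial in these variables would divide it. So
  the large exponents involve at most \<open>vdim X I\<close> variables, and the others are
  bounded.\<close>

lemma standard_growth:
  assumes X: "finite X" and I: "idealin X I" "1 \<notin> I"
  shows "\<exists>C. \<forall>D. card {m. keys m \<subseteq> X \<and> m \<notin> lead_mons I \<and> deg m \<le> D} \<le> C * (D + 1) ^ vdim X I"
proof -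
  \<comment> \<open>A leading exponent in the variables \<open>V\<close> if there is one, and an
    arbitrary exponent otherwise. Its degree is a number in either case, so \<open>B\<close> can
    bound all of them at once.\<close>
  define w where "w V = (SOME m. m \<in> lead_mons I \<and> keys m \<subseteq> V)" for V
  have w: "w V \<in> lead_mons I \<and> keys (w V) \<subseteq> V" if "m \<in> lead_mons I" "keys m \<subseteq> V" for V m
    unfolding w_def by (rule someI[of _ m]) (use that in simp)
  define B where "B = (\<Sum>V\<in>Pow X. deg (w V))"
  have B: "lookup (w V) v \<le> B" if "V \<subseteq> X" for V v
    using lookup_le_wt[of "w V" v] member_le_sum[of V "Pow X" "\<lambda>V. deg (w V)"] X that unfolding B_def by fastforce
  define \<V> where "\<V> = {V. V \<subseteq> X \<and> indep I V}"
  define T where "T V D = {m. keys m \<subseteq> X \<and> (\<forall>v\<in>V. lookup m v \<le> D) \<and> (\<forall>v\<in>X - V. lookup m v \<le> B)}" for V D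
  have sub: "{m. keys m \<subseteq> X \<and> m \<notin> lead_mons I \<and> deg m \<le> D} \<subseteq> (\<Union>V\<in>\<V>. T V D)" for D
  proof
    fix m assume "m \<in> {m. keys m \<subseteq> X \<and> m \<notin> lead_mons I \<and> deg m \<le> D}"
    then have m: "keys m \<subseteq> X" "m \<notin> lead_mons I" "deg m \<le> D" by auto
    define V where "V = {v\<in>X. lookup m v > B}"
    have V: "V \<subseteq> X" by (auto simp: V_def)
    have "k \<notin> lead_mons I" if "keys k \<subseteq> V" for k
    proof
      assume "k \<in> lead_mons I"
      then have wV: "w V \<in> lead_mons I" "keys (w V) \<subseteq> V" using w that by blast+
      have "lookup (w V) v \<le> lookup m v" for v
      proof (cases "v \<in> V")
        case True
        then show ?thesis using B[OF V, of v] by (simp add: V_def)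
      next
        case False
        then have "v \<notin> keys (w V)" using wV(2) by blast
        then show ?thesis by (simp add: in_keys_iff)
      qed
      then have eq: "m = (m - w V) + w V" by (intro poly_mapping_eqI) (simp add: lookup_add lookup_minus)
      have "keys (m - w V) \<subseteq> X" using m(1) by (auto simp: in_keys_iff lookup_minus)
      then have "(m - w V) + w V \<in> lead_mons I" by (rule lead_mons_add[OF I(1) wV(1)])
      then show False using eq m(2) by simp
    qed
    then have "indep I V" unfolding indep_def using lead_mons_exists[of _ I] polysD by metis
    then have "V \<in> \<V>" using V by (simp add: \<V>_def)
    moreover have "m \<in> T V D"
      using m lookup_le_wt[of m] by (auto simp: T_def V_def intro: le_trans)
    ultimately show "m \<in> (\<Union>V\<in>\<V>. T V D)" by blast
  qed
  have fin\<V>: "finite \<V>" using X by (simp add: \<V>_def)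
  have "card {m. keys m \<subseteq> X \<and> m \<notin> lead_mons I \<and> deg m \<le> D} \<le> (card \<V> * (B + 1) ^ card X) * (D + 1) ^ vdim X I" for D
  proof -
    have "card {m. keys m \<subseteq> X \<and> m \<notin> lead_mons I \<and> deg m \<le> D} \<le> card (\<Union>V\<in>\<V>. T V D)"
      using sub fin\<V> card_mixed_bound(1)[OF X] by (intro card_mono finite_UN_I) (auto simp: T_def \<V>_def)
    also have "\<dots> \<le> (\<Sum>V\<in>\<V>. card (T V D))" by (rule card_UN_le[OF fin\<V>])
    also have "\<dots> \<le> (\<Sum>V\<in>\<V>. (D + 1) ^ vdim X I * (B + 1) ^ card X)"
    proof (rule sum_mono)
      fix V assume "V \<in> \<V>"
      then have V: "V \<subseteq> X" "card V \<le> vdim X I" using vdim(2)[OF X I] by (auto simp: \<V>_def)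
      have "card (T V D) \<le> (D + 1) ^ card V * (B + 1) ^ card X" unfolding T_def by (rule card_mixed_bound(2)[OF X V(1)])
      also have "\<dots> \<le> (D + 1) ^ vdim X I * (B + 1) ^ card X" using V(2) by (intro mult_right_mono power_increasing) auto
      finally show "card (T V D) \<le> (D + 1) ^ vdim X I * (B + 1) ^ card X" .
    qed
    also have "\<dots> = (card \<V> * (B + 1) ^ card X) * (D + 1) ^ vdim X I" by simp
    finally show ?thesis .
  qed
  then show ?thesis by blast
qed

text \<open>Representatives in the span of \<open>T\<close> inherit linear independence from
  independence modulo \<open>I\<close>.\<close>

lemma card_independent_mod:
  fixes g :: "'a \<Rightarrow> 'k::field mpoly"
  assumes I: "idealin X I" and A: "finite A" and T: "finite T"
    and span: "\<And>a. a \<in> A \<Longrightarrow> \<exists>r\<in>kv.span T. g a - r \<in> I"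
    and ind: "\<And>c. (\<Sum>a\<in>A. cst (c a) * g a) \<in> I \<Longrightarrow> \<forall>a\<in>A. c a = 0"
  shows "card A \<le> card T"
proof -
  obtain r where r: "\<And>a. a \<in> A \<Longrightarrow> r a \<in> kv.span T" "\<And>a. a \<in> A \<Longrightarrow> g a - r a \<in> I" using span by metis
  have ind': "\<forall>a\<in>A. c a = 0" if "(\<Sum>a\<in>A. cst (c a) * r a) = 0" for c
  proof (rule ind)
    have "(\<Sum>a\<in>A. cst (c a) * g a) = (\<Sum>a\<in>A. cst (c a) * (g a - r a)) + (\<Sum>a\<in>A. cst (c a) * r a)"
      unfolding sum.distrib[symmetric] by (intro sum.cong refl) (simp add: right_diff_distrib)
    also have "\<dots> = (\<Sum>a\<in>A. cst (c a) * (g a - r a))" using that by simp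
    also have "\<dots> \<in> I" using r(2) I by (intro idealin_sum[OF I]) (simp add: idealin_def)
    finally show "(\<Sum>a\<in>A. cst (c a) * g a) \<in> I" .
  qed
  have inj: "inj_on r A"
  proof (rule inj_onI, rule ccontr)
    fix a b assume ab: "a \<in> A" "b \<in> A" "r a = r b" "a \<noteq> b"
    define c where "c x = (if x = a then 1 else if x = b then - 1 else 0 :: 'k)" for x
    have "(\<Sum>x\<in>A. cst (c x) * r x) = (\<Sum>x\<in>{a, b}. cst (c x) * r x)"
      using ab A by (intro sum.mono_neutral_right) (auto simp: c_def)
    also have "\<dots> = 0" using ab by (simp add: c_def cst_uminus)
    finally have "c a = 0" using ind' ab(1) by blast
    then show False by (simp add: c_def)
  qed
  have "\<not> kv.dependent (r ` A)"
  proof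
    assume "kv.dependent (r ` A)"
    then obtain u where u: "\<exists>v\<in>r ` A. u v \<noteq> 0" "(\<Sum>v\<in>r ` A. cst (u v) * v) = 0"
      using kv.dependent_finite[of "r ` A"] A by auto
    have "(\<Sum>a\<in>A. cst (u (r a)) * r a) = 0" using u(2) inj by (simp add: sum.reindex)
    then show False using ind'[of "\<lambda>a. u (r a)"] u(1) by auto
  qed
  then have "card (r ` A) \<le> card T"
    using kv.independent_span_bound[OF T, of "r ` A"] r(1) by auto
  then show ?thesis using card_image[OF inj] by simp
qed

lemma poly_in_span_xmon: "finite M \<Longrightarrow> keys r \<subseteq> M \<Longrightarrow> r \<in> kv.span (xmon ` M)"
proof -
  assume "keys r \<subseteq> M"
  then have "(\<Sum>m\<in>keys r. cst (lookup r m) * xmon m) \<in> kv.span (xmon ` M)"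
    by (intro kv.span_sum kv.span_scale kv.span_base) auto
  then show ?thesis using mpoly_sum_monomials[of r] by simp
qed

text \<open>The order of quantifiers matters: one constant serves all degree bounds and all
  families, so families of growing degree can be compared.\<close>

lemma growth_bound:
  assumes X: "finite X" and I: "idealin X (I :: 'k::field mpoly set)" "1 \<notin> I"
  shows "\<exists>C. \<forall>D (A :: 'a set) g. finite A \<longrightarrow> (\<forall>a\<in>A. g a \<in> polys X \<and> (\<forall>m\<in>keys (g a). deg m \<le> D)) \<longrightarrow>
    (\<forall>c. (\<Sum>a\<in>A. cst (c a) * g a) \<in> I \<longrightarrow> (\<forall>a\<in>A. c a = 0)) \<longrightarrow> card A \<le> C * (D + 1) ^ vdim X I"
proof -
  obtain C where C: "\<And>D. card {m. keys m \<subseteq> X \<and> m \<notin> lead_mons I \<and> deg m \<le> D} \<le> C * (D + 1) ^ vdim X I"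
    using standard_growth[OF X I] by blast
  show ?thesis
  proof (intro exI[of _ C] allI impI)
    fix D and A :: "'a set" and g
    assume A: "finite A" "\<forall>a\<in>A. g a \<in> polys X \<and> (\<forall>m\<in>keys (g a). deg m \<le> D)"
      and ind: "\<forall>c. (\<Sum>a\<in>A. cst (c a) * g a) \<in> I \<longrightarrow> (\<forall>a\<in>A. c a = 0)"
    define M where "M = {m. keys m \<subseteq> X \<and> m \<notin> lead_mons I \<and> deg m \<le> D}"
    have finM: "finite M" unfolding M_def by (rule finite_subset[OF _ finite_mexp_degree[OF X, of D]]) auto
    have "\<exists>r\<in>kv.span (xmon ` M). g a - r \<in> I" if "a \<in> A" for a
    proof -
      have g: "g a \<in> polys X" "\<And>m. m \<in> keys (g a) \<Longrightarrow> deg m \<le> D" using A(2) that by auto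
      obtain r where r: "r \<in> polys X" "g a - r \<in> I" "\<forall>m\<in>keys r. deg m \<le> D \<and> m \<notin> lead_mons I"
        using normal_form[OF X I(1) g] by blast
      have "keys r \<subseteq> M" using r(3) polysD[OF r(1)] by (simp add: M_def subset_iff)
      then show ?thesis using poly_in_span_xmon[OF finM] r(2) by blast
    qed
    then have "card A \<le> card (xmon ` M :: 'k mpoly set)"
      by (intro card_independent_mod[OF I(1) A(1)]) (use finM ind in auto)
    also have "\<dots> \<le> card M" by (rule card_image_le[OF finM])
    finally show "card A \<le> C * (D + 1) ^ vdim X I" using C[of D] unfolding M_def by linarith
  qed
qed

lemma power_growth:
  fixes a b C c :: nat
  assumes "\<And>t. (t + 1) ^ a \<le> C * (t * c + 1) ^ b"
  shows "a \<le> b"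
proof (rule ccontr)
  assume "\<not> a \<le> b"
  then have ab: "Suc b \<le> a" by simp
  \<comment> \<open>The value of \<open>t\<close> at which the two growth rates contradict each
    other: \<open>t * c + 1\<close> is at most \<open>(c + 1) * (t + 1)\<close>, so all constants
    collect into \<open>K\<close>.\<close>
  define K where "K = C * (c + 1) ^ b"
  have "(K + 1) ^ Suc b \<le> (K + 1) ^ a" by (rule power_increasing[OF ab]) simp
  also have "\<dots> \<le> C * (K * c + 1) ^ b" by (rule assms)
  also have "\<dots> \<le> C * ((c + 1) * (K + 1)) ^ b" by (intro mult_left_mono power_mono) auto
  also have "\<dots> = K * (K + 1) ^ b" by (simp only: power_mult_distrib K_def mult.assoc)
  finally have "(K + 1) * (K + 1) ^ b \<le> K * (K + 1) ^ b" by simp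
  then show False by simp
qed

section \<open>The height of an ideal\<close>

lemma degree_bound:
  fixes p :: "'k::field mpoly"
  obtains e where "\<And>m. m \<in> keys p \<Longrightarrow> deg m \<le> e"
  using sum_hcomp_obtain[of p "\<lambda>_. 1"] by blast

lemma degree_mult_bound:
  fixes p :: "'k::field mpoly"
  assumes "\<And>m. m \<in> keys p \<Longrightarrow> deg m \<le> a" "\<And>m. m \<in> keys q \<Longrightarrow> deg m \<le> b" "m \<in> keys (p * q)"
  shows "deg m \<le> a + b"
proof -
  obtain k l where "m = k + l" "k \<in> keys p" "l \<in> keys q" using keys_mult[of p q] assms(3) by blast
  then show ?thesis using assms(1)[of k] assms(2)[of l] by (simp add: wt_add)
qed

lemma degree_power_bound:
  fixes p :: "'k::field mpoly"
  assumes "\<And>m. m \<in> keys p \<Longrightarrow> deg m \<le> e"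
  shows "m \<in> keys (p ^ j) \<Longrightarrow> deg m \<le> e * j"
proof (induction j arbitrary: m)
  case 0
  then show ?case by (auto simp: wt_def)
next
  case (Suc j)
  then show ?case using degree_mult_bound[of p e "p ^ j" "e * j" m] assms by simp
qed

lemma deg_bounded:
  assumes "finite V" "keys m \<subseteq> V" "\<And>v. v \<in> V \<Longrightarrow> lookup m v \<le> t"
  shows "deg m \<le> t * card V"
proof -
  have "deg m = (\<Sum>v\<in>V. lookup m v)" using wt_superset[OF assms(1,2), of "\<lambda>_. 1"] by simp
  also have "\<dots> \<le> (\<Sum>v\<in>V. t)" by (intro sum_mono assms(3))
  finally show ?thesis by (simp add: mult.commute)
qed

lemma sum_cst_xmon_eq_0:
  assumes "finite M" "(\<Sum>m\<in>M. cst (c m) * xmon m) = 0" "m \<in> M"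
  shows "c m = 0"
proof -
  have "lookup (\<Sum>m\<in>M. cst (c m) * xmon m) m = (\<Sum>k\<in>M. if k = m then c k else 0)"
    unfolding lookup_sum by (intro sum.cong refl) (simp add: lookup_cst_mult lookup_xmon)
  then show ?thesis using assms by simp
qed

text \<open>An element \<open>f\<close> of the larger prime outside the smaller one is independent of the variables that
  are independent modulo the larger prime; comparing growth rates, the dimension drops.\<close>

lemma vdim_prime_less:
  assumes X: "finite X" and Q: "prime_in X Q" and Q': "prime_in X Q'" and sub: "Q \<subset> Q'"
  shows "vdim X Q' < vdim X (Q :: 'k::field mpoly set)"
proof -
  have IQ: "idealin X Q" "1 \<notin> Q" and IQ': "idealin X Q'" "1 \<notin> Q'" using Q Q' by (auto simp: prime_in_def)
  obtain V where V: "V \<subseteq> X" "indep Q' V" "card V = vdim X Q'" using vdim(1)[OF X IQ'] by blast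
  have finV: "finite V" using V(1) X by (rule finite_subset)
  obtain f where f: "f \<in> Q'" "f \<notin> Q" using sub by blast
  have fX: "f \<in> polys X" using f(1) IQ' by (auto simp: idealin_def)
  obtain e where e: "\<And>m. m \<in> keys f \<Longrightarrow> deg m \<le> e" using degree_bound[of f] by blast
  obtain C where C0: "\<forall>D (A :: (nat \<times> mexp) set) g. finite A \<longrightarrow> (\<forall>a\<in>A. g a \<in> polys X \<and> (\<forall>m\<in>keys (g a). deg m \<le> D)) \<longrightarrow>
    (\<forall>c. (\<Sum>a\<in>A. cst (c a) * g a) \<in> Q \<longrightarrow> (\<forall>a\<in>A. c a = 0)) \<longrightarrow> card A \<le> C * (D + 1) ^ vdim X Q"
    using growth_bound[OF X IQ, where 'a = "nat \<times> mexp"] ..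
  note C = C0[THEN spec, THEN spec, THEN spec, THEN mp, THEN mp, THEN mp]
  \<comment> \<open>Modulo the larger prime only \<open>p 0\<close> remains, so it vanishes by
    independence; then \<open>f\<close> cancels modulo the smaller prime and the argument
    repeats.\<close>
  have vanish: "\<forall>j\<le>t. p j = 0" if "\<And>j. j \<le> t \<Longrightarrow> p j \<in> polys V" "(\<Sum>j\<le>t. f ^ j * p j) \<in> Q" for t and p :: "nat \<Rightarrow> 'k mpoly"
    using that
  proof (induction t arbitrary: p)
    case 0
    have "p 0 \<in> Q" using "0.prems"(2) by simp
    then have "p 0 \<in> Q'" using sub by blast
    then have "p 0 = 0" using V(2) 0(1)[of 0] unfolding indep_def by blast
    then show ?case by simp
  next
    case (Suc t)
    have "(\<Sum>j\<le>Suc t. f ^ j * p j) = p 0 + f * (\<Sum>j\<le>t. f ^ j * p (Suc j))"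
      unfolding sum.atMost_Suc_shift sum_distrib_left by (simp only: power_0 mult_1_left power_Suc mult.assoc)
    note eq = this
    have sX: "(\<Sum>j\<le>t. f ^ j * p (Suc j)) \<in> polys X"
    proof (intro polys_sum polys_mult polys_power fX)
      fix j assume "j \<in> {..t}"
      then show "p (Suc j) \<in> polys X"
        using Suc.prems(1)[of "Suc j"] subsetD[OF polys_mono[OF V(1)]] by simp
    qed
    have "f * (\<Sum>j\<le>t. f ^ j * p (Suc j)) \<in> Q'"
      using f(1) IQ'(1) sX by (simp add: idealin_def mult.commute[of f])
    moreover have "(\<Sum>j\<le>Suc t. f ^ j * p j) \<in> Q'" using Suc.prems(2) sub by blast
    ultimately have "(\<Sum>j\<le>Suc t. f ^ j * p j) - f * (\<Sum>j\<le>t. f ^ j * p (Suc j)) \<in> Q'"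
      using idealin_diff[OF IQ'(1)] by blast
    then have "p 0 \<in> Q'" unfolding eq by simp
    then have p0: "p 0 = 0" using V(2) Suc.prems(1)[of 0] by (auto simp: indep_def)
    then have "f * (\<Sum>j\<le>t. f ^ j * p (Suc j)) \<in> Q" using Suc.prems(2) eq by simp
    then have "(\<Sum>j\<le>t. f ^ j * p (Suc j)) \<in> Q" using Q f(2) fX sX by (auto simp: prime_in_def)
    then have "\<forall>j\<le>t. p (Suc j) = 0" using Suc.prems(1) by (intro Suc.IH) auto
    then show ?case using p0 by (metis Suc_le_mono not0_implies_Suc)
  qed
  define M where "M t = {m. keys m \<subseteq> V \<and> (\<forall>v\<in>V. lookup m v \<le> t)}" for t :: nat
  have M: "finite (M t)" "card (M t) = (t + 1) ^ card V" for t
    unfolding M_def using finite_mexp_bounded[OF finV] by auto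
  \<comment> \<open>The products of powers of \<open>f\<close> with monomials in \<open>V\<close>,
    all exponents at most \<open>t\<close>, are independent modulo \<open>Q\<close>: one more free
    exponent than \<open>V\<close> has, with degrees only linear in \<open>t\<close>.\<close>
  have "(t + 1) ^ (card V + 1) \<le> C * (t * (e + card V) + 1) ^ vdim X Q" for t
  proof -
    let ?A = "{..t} \<times> M t" and ?g = "\<lambda>a. f ^ fst a * xmon (snd a) :: 'k mpoly"
    have "card ?A \<le> C * (t * (e + card V) + 1) ^ vdim X Q"
    proof (rule C)
      show "finite ?A" using M(1) by simp
      show "\<forall>a\<in>?A. ?g a \<in> polys X \<and> (\<forall>m\<in>keys (?g a). deg m \<le> t * (e + card V))"
      proof
        fix a assume "a \<in> ?A"
        then have a: "fst a \<le> t" "keys (snd a) \<subseteq> V" "\<And>v. v \<in> V \<Longrightarrow> lookup (snd a) v \<le> t" by (auto simp: M_def)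
        have "deg m \<le> t * (e + card V)" if "m \<in> keys (?g a)" for m
        proof -
          have "deg m \<le> e * fst a + t * card V"
            by (rule degree_mult_bound[of "f ^ fst a" _ "xmon (snd a) :: 'k mpoly", OF _ _ that])
              (use degree_power_bound[of f e] e deg_bounded[OF finV a(2,3)] in auto)
          also have "\<dots> \<le> e * t + t * card V" using a(1) by simp
          finally show ?thesis by (simp add: algebra_simps)
        qed
        moreover have "?g a \<in> polys X" using a(2) V(1) fX by (intro polys_mult polys_power) auto
        ultimately show "?g a \<in> polys X \<and> (\<forall>m\<in>keys (?g a). deg m \<le> t * (e + card V))" by blast
      qed
      show "\<forall>c. (\<Sum>a\<in>?A. cst (c a) * ?g a) \<in> Q \<longrightarrow> (\<forall>a\<in>?A. c a = 0)"
      proof (intro allI impI)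
        fix c assume c: "(\<Sum>a\<in>?A. cst (c a) * ?g a) \<in> Q"
        define p where "p j = (\<Sum>m\<in>M t. cst (c (j, m)) * xmon m :: 'k mpoly)" for j
        have "(\<Sum>a\<in>?A. cst (c a) * ?g a) = (\<Sum>j\<le>t. \<Sum>m\<in>M t. cst (c (j, m)) * (f ^ j * xmon m))"
          by (simp add: sum.cartesian_product split_def)
        also have "\<dots> = (\<Sum>j\<le>t. f ^ j * p j)"
          unfolding p_def sum_distrib_left by (intro sum.cong refl) (rule mult.left_commute)
        finally have "(\<Sum>j\<le>t. f ^ j * p j) \<in> Q" using c by simp
        moreover have "p j \<in> polys V" for j unfolding p_def by (intro polys_sum polys_mult) (auto simp: M_def)
        ultimately have p0: "\<forall>j\<le>t. p j = 0" using vanish by blast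
        show "\<forall>a\<in>?A. c a = 0"
        proof
          fix a assume a: "a \<in> ?A"
          then have "(\<Sum>m\<in>M t. cst (c (fst a, m)) * xmon m :: 'k mpoly) = 0" using p0 by (auto simp: p_def)
          then show "c a = 0" using sum_cst_xmon_eq_0[OF M(1), of "\<lambda>m. c (fst a, m)" t "snd a"] a by auto
        qed
      qed
    qed
    then show ?thesis using M(2)[of t] by (simp add: card_cartesian_product)
  qed
  then have "card V + 1 \<le> vdim X Q" by (rule power_growth)
  then show ?thesis using V(3) by simp
qed

lemma prime_chain_vdim:
  assumes X: "finite X" and C: "\<And>i. i \<le> m \<Longrightarrow> prime_in X (C i)" "\<And>i. i < m \<Longrightarrow> C i \<subset> C (Suc i)"
  shows "m + vdim X (C m) \<le> card X"
proof -
  have "j \<le> m \<Longrightarrow> j + vdim X (C j) \<le> vdim X (C 0)" for j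
  proof (induction j)
    case (Suc j)
    then show ?case using vdim_prime_less[OF X C(1)[of j] C(1)[of "Suc j"] C(2)[of j]] by simp
  qed simp
  from this[of m] have "m + vdim X (C m) \<le> vdim X (C 0)" by simp
  also have "\<dots> \<le> card X" using vdim(3)[OF X] C(1)[of 0] by (auto simp: prime_in_def)
  finally show ?thesis .
qed

lemma prime_in_restrict:
  assumes "prime_in X Q" "V \<subseteq> X"
  shows "prime_in V (Q \<inter> polys V)"
proof -
  have sub: "p \<in> polys X" if "p \<in> polys V" for p :: "'a mpoly" using polys_mono[OF assms(2)] that by blast
  have Q: "idealin X Q" "1 \<notin> Q" "\<And>p q. p \<in> polys X \<Longrightarrow> q \<in> polys X \<Longrightarrow> p * q \<in> Q \<Longrightarrow> p \<in> Q \<or> q \<in> Q"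
    using assms(1) unfolding prime_in_def by blast+
  have "idealin V (Q \<inter> polys V)"
    using Q(1) sub unfolding idealin_def by (simp add: polys_add polys_mult)
  moreover have "p \<in> Q \<inter> polys V \<or> q \<in> Q \<inter> polys V" if "p \<in> polys V" "q \<in> polys V" "p * q \<in> Q \<inter> polys V" for p q
    using Q(3)[OF sub[OF that(1)] sub[OF that(2)]] that by simp
  ultimately show ?thesis using Q(2) unfolding prime_in_def by simp
qed

text \<open>Starting from a largest independent \<open>V\<close>, the other variables are adjoined
  one at a time and \<open>Q\<close> is contracted to the larger variable set and extended back.
  Each step is strict: the new variable is algebraic over \<open>V\<close> modulo \<open>Q\<close>,
  and if the relation came from the previous stage, its coefficients would be relations among
  \<open>V\<close>.\<close>

lemma prime_chain_exists:
  assumes X: "finite X" and Q: "prime_in X (Q :: 'k::field mpoly set)"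
  shows "\<exists>C. (\<forall>i\<le>card X - vdim X Q. prime_in X (C i)) \<and> (\<forall>i<card X - vdim X Q. C i \<subset> C (Suc i)) \<and> C (card X - vdim X Q) = Q"
proof -
  have IQ: "idealin X Q" "1 \<notin> Q" using Q by (auto simp: prime_in_def)
  obtain V where V: "V \<subseteq> X" "indep Q V" "card V = vdim X Q" using vdim(1)[OF X IQ] by blast
  let ?m = "card X - vdim X Q"
  have finV: "finite V" using V(1) X by (rule finite_subset)
  have "card (X - V) = ?m" using card_Diff_subset[OF finV V(1)] V(3) by simp
  then obtain vs where vs: "set vs = X - V" "distinct vs" "length vs = ?m"
    using finite_distinct_list[of "X - V"] X by (metis distinct_card finite_Diff)
  define W where "W i = V \<union> set (take i vs)" for i
  have WX: "W i \<subseteq> X" for i using V(1) vs(1) set_take_subset[of i vs] by (auto simp: W_def)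
  define C where "C i = gen.span (Q \<inter> polys (W i)) \<inter> polys X" for i
  have prW: "prime_in (W i) (Q \<inter> polys (W i))" for i by (rule prime_in_restrict[OF Q WX])
  have prC: "prime_in X (C i)" for i
  proof -
    have "gen.span (Q \<inter> polys (W i)) \<inter> polys (W i) = Q \<inter> polys (W i)"
      using span_idealin[of "W i" "Q \<inter> polys (W i)"] prW[of i] gen.span_superset[of "Q \<inter> polys (W i)"]
      unfolding prime_in_def by blast
    then have "prime_in (W i) (gen.span (Q \<inter> polys (W i)) \<inter> polys (W i))" using prW[of i] by simp
    then show ?thesis unfolding C_def by (rule prime_in_extend[rotated]) (use WX in auto)
  qed
  have mono: "C i \<subseteq> C (Suc i)" for i
    unfolding C_def W_def by (intro Int_mono gen.span_mono polys_mono order_refl Un_mono set_take_subset_set_take) simp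
  have strict: "C i \<noteq> C (Suc i)" if i: "i < ?m" for i
  proof
    assume eq: "C i = C (Suc i)"
    let ?v = "vs ! i"
    have v: "?v \<in> X - V" using vs i by (metis nth_mem)
    have vW: "?v \<in> W (Suc i)" using i vs(3) by (auto simp: W_def take_Suc_conv_app_nth)
    have vn: "?v \<notin> W i"
      using v vs(2) i vs(3) by (auto simp: W_def in_set_conv_nth nth_eq_iff_index_eq)
    have "\<not> indep Q (insert ?v V)"
    proof
      assume "indep Q (insert ?v V)"
      then have "card (insert ?v V) \<le> vdim X Q" using v V(1) by (intro vdim(2)[OF X IQ]) auto
      then show False using v finV V(3) by simp
    qed
    then obtain p where p: "p \<in> Q" "p \<in> polys (insert ?v V)" "p \<noteq> 0" by (auto simp: indep_def)
    have "insert ?v V \<subseteq> W (Suc i)" using vW by (auto simp: W_def)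
    then have "p \<in> polys (W (Suc i))" using p(2) polys_mono by blast
    then have "p \<in> C (Suc i)" unfolding C_def using p(1) IQ(1) by (auto simp: idealin_def intro: gen.span_base)
    then have "p \<in> gen.span (Q \<inter> polys (W i))" using eq by (auto simp: C_def)
    then have "cf (- W i) \<mu> p \<in> gen.span (Q \<inter> polys (W i))" for \<mu> by (intro span_cf) auto
    moreover have "cf (- W i) \<mu> p \<in> polys V" for \<mu>
    proof -
      have "insert ?v V - (- W i) \<subseteq> V" using vn by auto
      then show ?thesis using polys_cf[OF p(2), of "- W i" \<mu>] polys_mono by blast
    qed
    moreover have "V \<subseteq> W i" by (auto simp: W_def)
    ultimately have "cf (- W i) \<mu> p \<in> Q" "cf (- W i) \<mu> p \<in> polys V" for \<mu>
      using span_idealin[of "W i" "Q \<inter> polys (W i)"] prW[of i] polys_mono[of V "W i"] unfolding prime_in_def by blast+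
    then have "cf (- W i) \<mu> p = 0" for \<mu> using V(2) by (simp add: indep_def)
    then have "p = 0" using cf_sum[of "restr (- W i) ` keys p" "- W i" p] by simp
    then show False using p(3) by simp
  qed
  have "W ?m = X" using vs V(1) by (auto simp: W_def)
  then have "C ?m = Q"
    using span_idealin[OF IQ(1)] IQ(1) gen.span_superset[of Q] unfolding C_def idealin_def by (auto simp: Int_absorb2)
  then show ?thesis using prC mono strict by (intro exI[of _ C]) blast
qed

lemma prime_height_vdim:
  assumes X: "finite X" and Q: "prime_in X (Q :: 'k::field mpoly set)"
  shows "prime_height (mpoly_ring TYPE('k) X) Q = enat (card X - vdim X Q)"
  unfolding prime_height_def prime_mpoly_ring
proof (rule antisym)
  show "Sup {enat m |m. \<exists>C. (\<forall>i\<le>m. prime_in X (C i)) \<and> (\<forall>i<m. C i \<subset> C (Suc i)) \<and> C m = Q} \<le> enat (card X - vdim X Q)"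
  proof (rule Sup_least)
    fix x assume "x \<in> {enat m |m. \<exists>C. (\<forall>i\<le>m. prime_in X (C i)) \<and> (\<forall>i<m. C i \<subset> C (Suc i)) \<and> C m = Q}"
    then obtain m C where x: "x = enat m" and C: "\<forall>i\<le>m. prime_in X (C i)" "\<forall>i<m. C i \<subset> C (Suc i)" "C m = Q" by blast
    show "x \<le> enat (card X - vdim X Q)" using prime_chain_vdim[OF X, of m C] C x by simp
  qed
  show "enat (card X - vdim X Q) \<le> Sup {enat m |m. \<exists>C. (\<forall>i\<le>m. prime_in X (C i)) \<and> (\<forall>i<m. C i \<subset> C (Suc i)) \<and> C m = Q}"
    using prime_chain_exists[OF X Q] by (intro Sup_upper) blast
qed

text \<open>Zorn: an ideal that is maximal among those meeting \<open>polys V\<close> only in 0 is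
  prime, because the nonzero polynomials in \<open>V\<close> form a multiplicative set.\<close>

lemma prime_avoiding:
  assumes I: "idealin X (I :: 'k::field mpoly set)" and V: "V \<subseteq> X" "indep I V"
  shows "\<exists>Q. prime_in X Q \<and> I \<subseteq> Q \<and> indep Q V"
proof -
  define \<A> where "\<A> = {J. idealin X J \<and> I \<subseteq> J \<and> indep J V}"
  have "\<exists>M\<in>\<A>. \<forall>J\<in>\<A>. M \<subseteq> J \<longrightarrow> J = M"
  proof (rule subset_Zorn_nonempty)
    show "\<A> \<noteq> {}" using I V(2) by (auto simp: \<A>_def)
    fix \<C> assume C: "\<C> \<noteq> {}" "subset.chain \<A> \<C>"
    then have CA: "\<And>J. J \<in> \<C> \<Longrightarrow> J \<in> \<A>" and tot: "\<And>J K. J \<in> \<C> \<Longrightarrow> K \<in> \<C> \<Longrightarrow> J \<subseteq> K \<or> K \<subseteq> J"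
      by (auto simp: subset.chain_def)
    have "idealin X (\<Union>\<C>)"
      unfolding idealin_def
    proof (intro conjI ballI)
      show "\<Union>\<C> \<subseteq> polys X" using CA unfolding \<A>_def idealin_def by blast
      show "0 \<in> \<Union>\<C>" using C(1) CA by (force simp: \<A>_def idealin_def)
      fix p assume "p \<in> \<Union>\<C>"
      then obtain J where J: "J \<in> \<C>" "p \<in> J" by blast
      show "q * p \<in> \<Union>\<C>" if "q \<in> polys X" for q
      proof -
        have "q * p \<in> J" using CA[OF J(1)] J(2) that unfolding \<A>_def idealin_def by blast
        then show ?thesis using J(1) by (rule UnionI[rotated])
      qed
      fix q assume "q \<in> \<Union>\<C>"
      then obtain K where K: "K \<in> \<C>" "q \<in> K" by blast
      have add: "p + q \<in> L" if "L \<in> \<C>" "p \<in> L" "q \<in> L" for L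
        using CA[OF that(1)] that(2,3) unfolding \<A>_def idealin_def by blast
      show "p + q \<in> \<Union>\<C>"
        using tot[OF J(1) K(1)]
      proof
        assume "J \<subseteq> K"
        then show ?thesis using add[OF K(1)] J(2) K by (intro UnionI[OF K(1)]) blast
      next
        assume "K \<subseteq> J"
        then show ?thesis using add[OF J(1)] J K(2) by (intro UnionI[OF J(1)]) blast
      qed
    qed
    then show "\<Union>\<C> \<in> \<A>" using C(1) CA unfolding \<A>_def indep_def by blast
  qed
  then obtain M where M: "M \<in> \<A>" "\<And>J. J \<in> \<A> \<Longrightarrow> M \<subseteq> J \<Longrightarrow> J = M" by blast
  have IM: "idealin X M" "I \<subseteq> M" "indep M V" using M(1) by (auto simp: \<A>_def)
  \<comment> \<open>By maximality the ideal generated by \<open>M\<close> and \<open>a\<close>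
    contains a nonzero polynomial in \<open>V\<close>.\<close>
  have ex: "\<exists>r\<in>polys X. \<exists>j\<in>M. j + r * a \<noteq> 0 \<and> j + r * a \<in> polys V" if a: "a \<in> polys X" "a \<notin> M" for a
  proof (rule ccontr)
    assume no: "\<not> ?thesis"
    define J where "J = {j + r * a | j r. j \<in> M \<and> r \<in> polys X}"
    have MJ: "M \<subseteq> J" unfolding J_def by (force intro: exI[of _ 0])
    have "idealin X J"
      unfolding idealin_def
    proof (intro conjI ballI)
      show "J \<subseteq> polys X" using IM(1) a(1) by (auto simp: J_def idealin_def intro!: polys_add polys_mult)
      show "0 \<in> J" using MJ IM(1) by (auto simp: idealin_def)
      fix p assume "p \<in> J"
      then obtain j r where p: "p = j + r * a" "j \<in> M" "r \<in> polys X" by (auto simp: J_def)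
      show "q * p \<in> J" if q: "q \<in> polys X" for q
      proof -
        have "q * p = q * j + (q * r) * a" unfolding p(1) by (simp only: distrib_left mult.assoc)
        moreover have "q * j \<in> M" "q * r \<in> polys X" using p q IM(1) by (auto simp: idealin_def intro: polys_mult)
        ultimately show ?thesis unfolding J_def by blast
      qed
      fix q assume "q \<in> J"
      then obtain j' r' where q: "q = j' + r' * a" "j' \<in> M" "r' \<in> polys X" by (auto simp: J_def)
      have "p + q = (j + j') + (r + r') * a" unfolding p(1) q(1) by (simp add: distrib_right)
      moreover have "j + j' \<in> M" "r + r' \<in> polys X" using p q IM(1) by (auto simp: idealin_def intro: polys_add)
      ultimately show "p + q \<in> J" unfolding J_def by blast
    qed
    moreover have "indep J V" using no unfolding indep_def J_def by blast
    ultimately have "J = M" using M(2)[of J] MJ IM(2) by (auto simp: \<A>_def)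
    moreover have "0 + 1 * a \<in> J" unfolding J_def using IM(1) polys_1 unfolding idealin_def by blast
    then have "a \<in> J" by simp
    ultimately show False using a(2) by simp
  qed
  have "prime_in X M"
    unfolding prime_in_def
  proof (intro conjI ballI impI)
    show "idealin X M" by (rule IM(1))
    show "1 \<notin> M" using IM(3) by (auto simp: indep_def)
    fix p q assume pq: "p \<in> polys X" "q \<in> polys X" "p * q \<in> M"
    show "p \<in> M \<or> q \<in> M"
    proof (rule ccontr)
      assume "\<not> ?thesis"
      then obtain r j s i where r: "r \<in> polys X" "j \<in> M" "j + r * p \<noteq> 0" "j + r * p \<in> polys V"
        and s: "s \<in> polys X" "i \<in> M" "i + s * q \<noteq> 0" "i + s * q \<in> polys V" using ex pq(1,2) by metis
      have eq: "(j + r * p) * (i + s * q) = (i + s * q) * j + (r * p) * i + (r * s) * (p * q)"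
        by (simp only: distrib_left distrib_right) (simp only: ac_simps)
      have jX: "i + s * q \<in> polys X" using s(4) polys_mono[OF V(1)] by blast
      have scale: "x * y \<in> M" if "y \<in> M" "x \<in> polys X" for x y using IM(1) that unfolding idealin_def by blast
      have add: "x + y \<in> M" if "x \<in> M" "y \<in> M" for x y using IM(1) that unfolding idealin_def by blast
      have "(j + r * p) * (i + s * q) \<in> M"
        unfolding eq by (intro add scale r s pq jX polys_mult)
      moreover have "(j + r * p) * (i + s * q) \<in> polys V" by (rule polys_mult[OF r(4) s(4)])
      ultimately have "(j + r * p) * (i + s * q) = 0" using IM(3) by (auto simp: indep_def)
      then show False using r(3) s(3) by simp
    qed
  qed
  then show ?thesis using IM by blast
qed

text \<open>A prime from \<open>prime_avoiding\<close> keeps a largest independent set independent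
  and so attains the bound; conversely a set independent modulo a prime above \<open>I\<close> is
  independent modulo \<open>I\<close>.\<close>

theorem ideal_height_vdim:
  assumes X: "finite X" and I: "idealin X (I :: 'k::field mpoly set)" "1 \<notin> I"
  shows "ideal_height (mpoly_ring TYPE('k) X) I = enat (card X - vdim X I)"
  unfolding ideal_height_def prime_mpoly_ring
proof (rule antisym)
  obtain V where V: "V \<subseteq> X" "indep I V" "card V = vdim X I" using vdim(1)[OF X I] by blast
  obtain Q where Q: "prime_in X Q" "I \<subseteq> Q" "indep Q V" using prime_avoiding[OF I(1) V(1,2)] by blast
  have "card V \<le> vdim X Q" using vdim(2)[OF X _ _ V(1) Q(3)] Q(1) by (auto simp: prime_in_def)
  then have "prime_height (mpoly_ring TYPE('k) X) Q \<le> enat (card X - vdim X I)"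
    unfolding prime_height_vdim[OF X Q(1)] using V(3) by simp
  then show "Inf {prime_height (mpoly_ring TYPE('k) X) P |P. prime_in X P \<and> I \<subseteq> P} \<le> enat (card X - vdim X I)"
    using Q(1,2) by (intro Inf_lower2[of "prime_height (mpoly_ring TYPE('k) X) Q"]) blast
  show "enat (card X - vdim X I) \<le> Inf {prime_height (mpoly_ring TYPE('k) X) P |P. prime_in X P \<and> I \<subseteq> P}"
  proof (rule Inf_greatest)
    fix x assume "x \<in> {prime_height (mpoly_ring TYPE('k) X) P |P. prime_in X P \<and> I \<subseteq> P}"
    then obtain P where P: "x = prime_height (mpoly_ring TYPE('k) X) P" "prime_in X P" "I \<subseteq> P" by blast
    have IP: "idealin X P" "1 \<notin> P" using P(2) by (auto simp: prime_in_def)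
    obtain U where U: "U \<subseteq> X" "indep P U" "card U = vdim X P" using vdim(1)[OF X IP] by blast
    have "indep I U" using U(2) P(3) by (auto simp: indep_def)
    then have "vdim X P \<le> vdim X I" using vdim(2)[OF X I U(1)] U(3) by simp
    then show "enat (card X - vdim X I) \<le> x" unfolding P(1) prime_height_vdim[OF X P(2)] by simp
  qed
qed


section \<open>Quasi-regularity and its transport between generating sets\<close>

section \<open>Regular sequences are quasi-regular\<close>

text \<open>Auxiliary variables have first index \<open>0\<close>: \<open>uvar j\<close> stands for the \<open>j\<close>-th member of a regular
  sequence, \<open>tvar e\<close> for the generator attached to the edge \<open>e\<close>.\<close>

definition uvar :: "nat \<Rightarrow> nat \<times> nat" where "uvar j = (0, 2 * j + 1)"
definition tvar :: "nat \<times> nat \<Rightarrow> nat \<times> nat" where "tvar e = (0, 2 * prod_encode e)"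

text \<open>Two complementary gradings: degree in the auxiliary variables and degree in the main
  ones. The matrix variables have first index at least 1 and so never collide with auxiliary
  ones.\<close>

definition aux_wt :: "nat \<times> nat \<Rightarrow> nat" where "aux_wt v = (if fst v = 0 then 1 else 0)"
definition main_wt :: "nat \<times> nat \<Rightarrow> nat" where "main_wt v = (if fst v = 0 then 0 else 1)"

definition at_u :: "(nat \<Rightarrow> 'k::field mpoly) \<Rightarrow> 'k mpoly \<Rightarrow> 'k mpoly" where
  "at_u f = subst (\<lambda>v. if fst v = 0 \<and> odd (snd v) then f (snd v div 2) else mvar v)"
definition at_t :: "(nat \<times> nat \<Rightarrow> 'k::field mpoly) \<Rightarrow> 'k mpoly \<Rightarrow> 'k mpoly" where
  "at_t g = subst (\<lambda>v. if fst v = 0 \<and> even (snd v) then g (prod_decode (snd v div 2)) else mvar v)"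

lemma at_u_simps [simp]: "alghom (at_u f)" "at_u f (mvar (uvar j)) = f j" "fst v \<noteq> 0 \<Longrightarrow> at_u f (mvar v) = mvar v"
  "at_u f (mvar (tvar e)) = mvar (tvar e)"
  by (simp_all add: at_u_def uvar_def tvar_def)
lemma at_t_simps [simp]: "alghom (at_t g)" "at_t g (mvar (tvar e)) = g e" "fst v \<noteq> 0 \<Longrightarrow> at_t g (mvar v) = mvar v"
  "at_t g (mvar (uvar j)) = mvar (uvar j)"
  by (simp_all add: at_t_def uvar_def tvar_def)

abbreviation main_vars :: "(nat \<times> nat) set" where "main_vars \<equiv> {v. fst v \<noteq> 0}"

lemma at_u_id: "p \<in> polys main_vars \<Longrightarrow> at_u f p = p"
  by (rule alghom_eqI[of "at_u f" "\<lambda>p. p" p main_vars]) (simp_all add: alghom_id)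
lemma at_t_id: "p \<in> polys main_vars \<Longrightarrow> at_t f p = p"
  by (rule alghom_eqI[of "at_t f" "\<lambda>p. p" p main_vars]) (simp_all add: alghom_id)

lemma homog_aux_0: "p \<in> polys main_vars \<Longrightarrow> homog aux_wt 0 p"
  by (rule homog_polys_0[of p main_vars]) (simp_all add: aux_wt_def)

lemma span_image_finite_polys:
  fixes f :: "'a \<Rightarrow> 'k::field mpoly"
  assumes E: "finite Es" and p: "p \<in> gen.span (f ` Es)" "p \<in> polys V" "f ` Es \<subseteq> polys V"
  shows "\<exists>h. (\<forall>e. h e \<in> polys V) \<and> p = (\<Sum>e\<in>Es. h e * f e)"
proof -
  obtain h where h: "p = (\<Sum>e\<in>Es. h e * f e)" using span_image_finite[OF E p(1)] by blast
  have "p = kill V p" using kill_id[OF p(2)] by simp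
  also have "\<dots> = (\<Sum>e\<in>Es. kill V (h e) * f e)"
    unfolding h lin_sum[OF alghom_lin[OF alghom_kill]] alghom_mult[OF alghom_kill]
    using p(3) by (intro sum.cong refl) (simp add: kill_id image_subset_iff)
  finally show ?thesis by (intro exI[of _ "\<lambda>e. kill V (h e)"]) (simp add: kill_polys')
qed

text \<open>Division with remainder by a single variable: \<open>part0\<close> is the remainder and
  \<open>part1\<close> the quotient.\<close>

definition part0 :: "nat \<times> nat \<Rightarrow> 'k::field mpoly \<Rightarrow> 'k mpoly" where
  "part0 u = linext (\<lambda>m. if lookup m u = 0 then xmon m else 0)"
definition part1 :: "nat \<times> nat \<Rightarrow> 'k::field mpoly \<Rightarrow> 'k mpoly" where
  "part1 u = linext (\<lambda>m. if lookup m u = 0 then 0 else xmon (m - Poly_Mapping.single u 1))"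

lemma single_plus_minus: "lookup m u \<noteq> 0 \<Longrightarrow> Poly_Mapping.single u 1 + (m - Poly_Mapping.single u 1) = (m :: mexp)"
  by (rule poly_mapping_eqI) (auto simp: lookup_add lookup_minus lookup_single when_def)

lemma part_split: "p = part0 u p + mvar u * part1 u p"
proof (rule lin_eqI[of "\<lambda>p. p" "\<lambda>p. part0 u p + mvar u * part1 u p"])
  show "lin (\<lambda>p. part0 u p + mvar u * part1 u p)"
    unfolding part0_def part1_def by (intro lin_plus lin_mult_left lin_linext)
  fix m
  show "xmon m = part0 u (xmon m) + mvar u * part1 u (xmon m :: 'a mpoly)"
    unfolding part0_def part1_def linext_xmon
    by (cases "lookup m u = 0") (simp_all add: mvar_xmon single_plus_minus[unfolded One_nat_def] flip: xmon_add)
qed (rule lin_id)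

lemma keys_minus_single: "keys ((m::mexp) - n) \<subseteq> keys m"
  by (auto simp: in_keys_iff lookup_minus)

lemma polys_part: "p \<in> polys V \<Longrightarrow> part0 u p \<in> polys (V - {u})" "p \<in> polys V \<Longrightarrow> part1 u p \<in> polys V"
  unfolding part0_def part1_def
  by (auto intro!: polys_linext dest!: polysD) (auto simp: in_keys_iff subset_iff lookup_minus)

lemma homog_linext: "(\<And>m. m \<in> keys p \<Longrightarrow> homog w s (F m)) \<Longrightarrow> homog w s (linext F p)"
  unfolding linext_def by (intro homog_sum homog_cst_mult)

lemma homog_part:
  assumes "homog w (Suc t) p" "w u = 1"
  shows "homog w (Suc t) (part0 u p)" "homog w t (part1 u p)"
proof -
  show "homog w (Suc t) (part0 u p)"
    unfolding part0_def using assms(1) by (intro homog_linext) (auto simp: homog_def)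
  have "wt w (m - Poly_Mapping.single u 1) = t" if "m \<in> keys p" "lookup m u \<noteq> 0" for m
    using assms that wt_add[of w "Poly_Mapping.single u 1" "m - Poly_Mapping.single u 1"]
    unfolding single_plus_minus[OF that(2)] by (simp add: homog_def)
  then show "homog w t (part1 u p)"
    unfolding part1_def by (intro homog_linext) (auto simp: homog_def)
qed

lemma polys_pd: "p \<in> polys V \<Longrightarrow> pd u p \<in> polys V"
  unfolding pd_def using keys_minus_single polysD[of p V] by (intro polys_linext polys_mult) (auto, blast)

lemma homog_pd:
  assumes "homog w (Suc t) p" "w u = 1"
  shows "homog w t (pd u p)"
  unfolding pd_def
proof (rule homog_linext)
  fix m assume m: "m \<in> keys p"
  show "homog w t (cst (of_nat (lookup m u)) * xmon (m - Poly_Mapping.single u 1) :: 'a mpoly)"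
  proof (cases "lookup m u = 0")
    case False
    then have "wt w (m - Poly_Mapping.single u 1) = t"
      using assms m wt_add[of w "Poly_Mapping.single u 1" "m - Poly_Mapping.single u 1"]
      unfolding single_plus_minus[OF False] by (simp add: homog_def)
    then show ?thesis by (intro homog_cst_mult) (simp add: homog_def)
  qed simp
qed

text \<open>The main variables count as constants: only the auxiliary ones carry weight and only
  they are differentiated.\<close>

lemma euler_identity:
  assumes p: "p \<in> polys (main_vars \<union> uvar ` {i..<h})" "homog aux_wt t p"
  shows "(\<Sum>j=i..<h. mvar (uvar j) * pd (uvar j) p) = cst (of_nat t) * p"
proof (rule lin_eqI[of "\<lambda>p. \<Sum>j=i..<h. mvar (uvar j) * pd (uvar j) p" "\<lambda>p. cst (of_nat t) * p"])
  show "lin (\<lambda>p. \<Sum>j=i..<h. mvar (uvar j) * pd (uvar j) p)" by (intro lin_setsum lin_mult_left lin_pd)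
  show "lin (\<lambda>p. cst (of_nat t) * p)" by (intro lin_mult_left lin_id)
  fix m assume m: "m \<in> keys p"
  have one: "mvar u * pd u (xmon m) = cst (of_nat (lookup m u)) * (xmon m :: 'a mpoly)" for u
    by (cases "lookup m u = 0")
      (simp_all add: pd_xmon mvar_xmon mult.left_commute[of _ "cst _"] single_plus_minus[unfolded One_nat_def] flip: xmon_add)
  have inj: "inj_on uvar {i..<h}" by (auto simp: inj_on_def uvar_def)
  have km: "keys m \<subseteq> main_vars \<union> uvar ` {i..<h}" using polysD[OF p(1) m] .
  have "t = wt aux_wt m" using p(2) m by (simp add: homog_def)
  also have "\<dots> = (\<Sum>v\<in>keys m \<union> uvar ` {i..<h}. aux_wt v * lookup m v)" by (rule wt_superset) auto
  also have "\<dots> = (\<Sum>v\<in>uvar ` {i..<h}. aux_wt v * lookup m v)"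
  proof (intro sum.mono_neutral_right ballI)
    fix v assume "v \<in> (keys m \<union> uvar ` {i..<h}) - uvar ` {i..<h}"
    then have "v \<in> main_vars" using km by blast
    then show "aux_wt v * lookup m v = 0" by (simp add: aux_wt_def)
  qed auto
  also have "\<dots> = (\<Sum>j=i..<h. lookup m (uvar j))" unfolding sum.reindex[OF inj] by (simp add: aux_wt_def uvar_def)
  finally have t: "t = (\<Sum>j=i..<h. lookup m (uvar j))" .
  show "(\<Sum>j=i..<h. mvar (uvar j) * pd (uvar j) (xmon m)) = cst (of_nat t) * (xmon m :: 'a mpoly)"
    unfolding one t of_nat_sum cst_sum sum_distrib_right ..
qed

definition koszul :: "(nat \<Rightarrow> 'k::field mpoly) \<Rightarrow> nat \<Rightarrow> nat \<Rightarrow> 'k mpoly set" where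
  "koszul f i h = {f a * mvar (uvar b) - f b * mvar (uvar a) | a b. a \<in> {i..<h} \<and> b \<in> {i..<h}}"

lemma at_u_koszul: "(\<And>j. f j \<in> polys main_vars) \<Longrightarrow> q \<in> koszul f i h \<Longrightarrow> at_u f q = 0"
  by (auto simp: koszul_def lin_diff[OF alghom_lin] alghom_mult at_u_id mult.commute)

lemma koszul_rearrange: "a * (x * p) - y * (b * p) = p * (a * x - b * y)" for p :: "'b::comm_ring_1"
  by (simp only: right_diff_distrib mult.assoc mult.commute mult.left_commute)

text \<open>The kernel of evaluation at a regular sequence is generated by the Koszul relations. The
  homogeneous form \<open>F\<close> is reduced modulo these relations to a multiple of the first variable, which
  is then cancelled.\<close>

lemma koszul_generates:
  fixes f :: "nat \<Rightarrow> 'k::field_char_0 mpoly"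
  assumes f: "\<And>j. f j \<in> polys main_vars"
    and reg: "\<And>i a. i < h \<Longrightarrow> f i * a \<in> gen.span (f ` {..<i}) \<Longrightarrow> a \<in> gen.span (f ` {..<i})"
    and "i \<le> h" "F \<in> polys (main_vars \<union> uvar ` {i..<h})" "homog aux_wt t F" "at_u f F \<in> gen.span (f ` {..<i})"
  shows "F \<in> gen.span (f ` {..<i} \<union> koszul f i h)"
  using assms(3-)
proof (induction "h - i" arbitrary: i F t)
  case 0
  then have "{i..<h} = {}" by simp
  then have "F \<in> polys main_vars" using 0(3) by (simp only: image_empty Un_empty_right)
  then have "F \<in> gen.span (f ` {..<i})" using at_u_id[of F f] 0(5) by (simp only:)
  then show ?case by (rule subsetD[OF gen.span_mono[OF Un_upper1]])
next
  case (Suc k)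
  then have i: "i < h" "k = h - Suc i" by auto
  let ?Z = "main_vars \<union> uvar ` {i..<h}" and ?u = "uvar i"
  let ?S = "f ` {..<i} \<union> koszul f i h"
  have sub: "gen.span (f ` {..<i}) \<subseteq> gen.span ?S" by (rule gen.span_mono) simp
  have uw: "aux_wt (uvar j) = 1" for j by (simp add: aux_wt_def uvar_def)
  have at_S: "at_u f q \<in> gen.span (f ` {..<i})" if "q \<in> gen.span ?S" for q
    by (rule alghom_span[OF at_u_simps(1) _ that])
      (use f at_u_koszul[of f] in \<open>auto simp: at_u_id intro: gen.span_base gen.span_zero\<close>)
  have fZ: "f j \<in> polys ?Z" for j using f[of j] polys_mono[of main_vars ?Z] by blast
  show ?case
    using Suc.prems(2-)
  proof (induction t arbitrary: F)
    case 0
    have "F \<in> polys main_vars"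
      unfolding polys_def
    proof (intro CollectI ballI)
      fix m assume "m \<in> keys F"
      then have "wt aux_wt m = 0" using 0(2) by (simp add: homog_def)
      then show "keys m \<subseteq> main_vars" by (auto simp: wt_eq_0_iff aux_wt_def split: if_splits)
    qed
    then have "F \<in> gen.span (f ` {..<i})" using at_u_id[of F f] 0(3) by (simp only:)
    then show ?case using sub by blast
  next
    case (Suc t)
    note inner = Suc
    let ?F0 = "part0 ?u F" and ?F1 = "part1 ?u F"
    have F: "F = ?F0 + mvar ?u * ?F1" by (rule part_split)
    have "{i..<h} = insert i {Suc i..<h}" using i(1) by auto
    then have "uvar ` {i..<h} = insert ?u (uvar ` {Suc i..<h})" by (simp only: image_insert)
    then have "?Z - {?u} \<subseteq> main_vars \<union> uvar ` {Suc i..<h}" by blast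
    then have F0: "?F0 \<in> polys (main_vars \<union> uvar ` {Suc i..<h})" "homog aux_wt (Suc t) ?F0"
      using polys_part(1)[OF inner(2), of ?u] polys_mono homog_part(1)[OF inner(3) uw] by blast+
    have F1: "?F1 \<in> polys ?Z" "homog aux_wt t ?F1"
      using polys_part(2)[OF inner(2)] homog_part(2)[OF inner(3) uw] by blast+
    have F0Z: "?F0 \<in> polys ?Z" using F0(1) polys_mono[of "main_vars \<union> uvar ` {Suc i..<h}" ?Z] by fastforce
    have img: "f ` {..<Suc i} = insert (f i) (f ` {..<i})" by (simp add: lessThan_Suc)
    \<comment> \<open>Without the variable \<open>uvar i\<close>, the remainder evaluates into the
      ideal enlarged by \<open>f i\<close>, so the claim for one more generator applies to
      it.\<close>
    have "at_u f ?F0 = at_u f F - at_u f ?F1 * f i"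
      by (subst (2) F) (simp add: alghom_add alghom_mult mult.commute)
    also have "\<dots> \<in> gen.span (f ` {..<Suc i})"
      unfolding img using inner(4) by (intro gen.span_diff gen.span_scale)
        (auto intro: gen.span_base subsetD[OF gen.span_mono[of "f ` {..<i}"]])
    finally have "?F0 \<in> gen.span (f ` {..<Suc i} \<union> koszul f (Suc i) h)"
      using Suc.hyps(1)[OF i(2) _ F0] i(1) by simp
    moreover have "f ` {..<Suc i} \<union> koszul f (Suc i) h \<subseteq> insert (f i) ?S"
      unfolding img by (fastforce simp: koszul_def)
    ultimately have "?F0 \<in> gen.span (insert (f i) ?S)" using gen.span_mono by blast
    then obtain G0 where G0: "?F0 - G0 * f i \<in> gen.span ?S" unfolding gen.span_insert by blast
    \<comment> \<open>The generators of \<open>?S\<close> are homogeneous and involve only the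
      variables \<open>?Z\<close>, so the cofactor of \<open>f i\<close> may be replaced by its
      component of the degree of \<open>?F0\<close> in these variables.\<close>
    define G where "G = hcomp aux_wt (Suc t) (kill ?Z G0)"
    have kS: "kill ?Z q \<in> gen.span ?S" if "q \<in> gen.span ?S" for q
    proof (rule alghom_span[OF alghom_kill _ that])
      fix b assume b: "b \<in> ?S"
      have "b \<in> polys ?Z"
        using b fZ by (auto simp: koszul_def intro!: polys_diff polys_mult)
      then show "kill ?Z b \<in> gen.span ?S" using b by (simp add: kill_id gen.span_base)
    qed
    have hS: "hcomp aux_wt s q \<in> gen.span ?S" if "q \<in> gen.span ?S" for s q
    proof (rule span_homog_hcomp[OF _ that])
      fix b assume "b \<in> ?S"
      then consider j where "b = f j" | a c where "b = f a * mvar (uvar c) - f c * mvar (uvar a)"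
        by (auto simp: koszul_def)
      then show "\<exists>r. homog aux_wt r b"
      proof cases
        case 1
        then show ?thesis using homog_aux_0[OF f] by blast
      next
        case 2
        have "homog aux_wt (0 + aux_wt (uvar c)) (f a * mvar (uvar c))" for a c
          by (intro homog_mult homog_aux_0 f homog_mvar)
        then have "homog aux_wt 1 b" unfolding 2 by (intro homog_diff) (simp_all add: uw)
        then show ?thesis by blast
      qed
    qed
    have "hcomp aux_wt (Suc t) (kill ?Z (?F0 - G0 * f i)) = ?F0 - G * f i"
      using kill_id[OF F0Z] kill_id[OF fZ] hcomp_homog[OF F0(2)]
        hcomp_mult_homog[OF homog_aux_0[OF f], of "Suc t" i "kill ?Z G0"]
      by (simp add: lin_diff[OF alghom_lin] lin_diff[OF lin_hcomp] alghom_mult G_def mult.commute)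
    then have FG: "?F0 - G * f i \<in> gen.span ?S" using hS[OF kS[OF G0]] by metis
    have GZ: "G \<in> polys ?Z" unfolding G_def by (intro polys_hcomp kill_polys')
    have Gh: "homog aux_wt (Suc t) G" unfolding G_def by simp
    \<comment> \<open>Euler's identity writes \<open>G\<close> as a combination of its derivatives
      times the variables; modulo the Koszul relations \<open>f i * uvar j\<close> may be traded for
      \<open>f j * uvar i\<close>, which makes \<open>f i * G\<close> a multiple of
      \<open>uvar i\<close>.\<close>
    define c where "c = inverse (of_nat (Suc t) :: 'k)"
    define G' where "G' = cst c * (\<Sum>j=i..<h. f j * pd (uvar j) G)"
    have c1: "cst c * cst (of_nat (Suc t)) = (1 :: 'k mpoly)" unfolding cst_mult[symmetric] c_def by (simp del: of_nat_Suc)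
    have "f i * G - mvar ?u * G' = cst c * (f i * (cst (of_nat (Suc t)) * G) - mvar ?u * (\<Sum>j=i..<h. f j * pd (uvar j) G))"
    proof -
      have "cst c * (f i * (cst (of_nat (Suc t)) * G)) = (cst c * cst (of_nat (Suc t))) * (f i * G)"
        by (simp only: mult_ac)
      then show ?thesis
        unfolding G'_def right_diff_distrib c1 mult_1_left mult.left_commute[of "mvar ?u" "cst c"] by simp
    qed
    also have "\<dots> = cst c * (\<Sum>j=i..<h. pd (uvar j) G * (f i * mvar (uvar j) - f j * mvar ?u))"
      unfolding euler_identity[OF GZ Gh, symmetric] sum_distrib_left[of "f i"] sum_distrib_left[of "mvar ?u"]
        sum_subtractf[symmetric] koszul_rearrange ..
    also have "\<dots> \<in> gen.span ?S"
    proof (intro gen.span_scale gen.span_sum gen.span_base UnI2)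
      fix j assume "j \<in> {i..<h}"
      then show "f i * mvar (uvar j) - f j * mvar ?u \<in> koszul f i h"
        unfolding koszul_def using i(1) by (intro CollectI exI[of _ i] exI[of _ j]) auto
    qed
    finally have GG: "f i * G - mvar ?u * G' \<in> gen.span ?S" .
    define F2 where "F2 = ?F1 + G'"
    have "F - mvar ?u * F2 = (?F0 - G * f i) + (f i * G - mvar ?u * G')"
      unfolding F2_def by (subst F) (simp add: distrib_left mult.commute)
    then have FF: "F - mvar ?u * F2 \<in> gen.span ?S" using gen.span_add[OF FG GG] by simp
    have F2Z: "F2 \<in> polys ?Z"
      unfolding F2_def G'_def by (intro polys_add F1 polys_mult polys_cst polys_sum fZ polys_pd GZ)
    have F2h: "homog aux_wt t F2"
    proof -
      have "homog aux_wt (0 + t) (f j * pd (uvar j) G)" for j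
        by (intro homog_mult homog_aux_0 f homog_pd Gh uw)
      then show ?thesis unfolding F2_def G'_def by (intro homog_add F1 homog_cst_mult homog_sum) simp
    qed
    \<comment> \<open>Regularity of \<open>f i\<close> modulo its predecessors cancels it;
      \<open>F2\<close> has degree one less, and the inner induction finishes.\<close>
    have "f i * at_u f F2 = at_u f F - at_u f (F - mvar ?u * F2)"
      by (simp add: lin_diff[OF alghom_lin] alghom_mult)
    also have "\<dots> \<in> gen.span (f ` {..<i})" by (intro gen.span_diff inner(4) at_S FF)
    finally have "at_u f F2 \<in> gen.span (f ` {..<i})" by (rule reg[OF i(1)])
    then have "F2 \<in> gen.span ?S" by (rule inner(1)[OF F2Z F2h])
    then have "(F - mvar ?u * F2) + mvar ?u * F2 \<in> gen.span ?S" by (intro gen.span_add FF gen.span_scale)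
    then show ?case by simp
  qed
qed

text \<open>Euler's identity with one variable \<open>uvar j\<close> replaced by its value
  \<open>f j\<close> lowers the degree by one and preserves the value; after at least one such step
  the coefficients lie in the ideal.\<close>

lemma lower_degree:
  fixes f :: "nat \<Rightarrow> 'k::field_char_0 mpoly"
  assumes f: "\<And>j. f j \<in> polys main_vars"
    and F: "F \<in> polys (main_vars \<union> uvar ` {0..<h})" "homog aux_wt (t + k) F"
  shows "\<exists>G. G \<in> polys (main_vars \<union> uvar ` {0..<h}) \<and> homog aux_wt t G \<and> at_u f G = at_u f F \<and>
    (k > 0 \<longrightarrow> G \<in> gen.span (f ` {..<h}))"
  using F
proof (induction k arbitrary: F)
  case 0
  then show ?case by auto
next
  case (Suc k)
  let ?Z = "main_vars \<union> uvar ` {0..<h}"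
  define c where "c = inverse (of_nat (Suc (t + k)) :: 'k)"
  define F' where "F' = cst c * (\<Sum>j=0..<h. pd (uvar j) F * f j)"
  have uw: "aux_wt (uvar j) = 1" for j by (simp add: aux_wt_def uvar_def)
  have fZ: "f j \<in> polys ?Z" for j using f[of j] polys_mono[of main_vars ?Z] by blast
  have h: "homog aux_wt (Suc (t + k)) F" using Suc.prems(2) by simp
  have F'Z: "F' \<in> polys ?Z" unfolding F'_def by (intro polys_mult polys_cst polys_sum fZ polys_pd Suc.prems)
  have "homog aux_wt (t + k + 0) (pd (uvar j) F * f j)" for j
    by (intro homog_mult homog_aux_0 f homog_pd h uw)
  then have F'h: "homog aux_wt (t + k) F'" unfolding F'_def by (intro homog_cst_mult homog_sum) simp
  have "at_u f F' = cst c * at_u f (\<Sum>j=0..<h. mvar (uvar j) * pd (uvar j) F)"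
    unfolding F'_def by (simp add: alghom_mult alghom_cst lin_sum[OF alghom_lin] at_u_id[OF f] mult.commute)
  also have "\<dots> = cst (c * of_nat (Suc (t + k))) * at_u f F"
    unfolding euler_identity[OF Suc.prems(1) h] by (simp only: alghom_mult[OF at_u_simps(1)] alghom_cst[OF at_u_simps(1)] cst_mult mult.assoc)
  also have "c * of_nat (Suc (t + k)) = 1" unfolding c_def by (simp del: of_nat_Suc)
  finally have ev: "at_u f F' = at_u f F" by simp
  have sp: "F' \<in> gen.span (f ` {..<h})"
    unfolding F'_def by (intro gen.span_scale gen.span_sum gen.span_base) auto
  obtain G where G: "G \<in> polys ?Z" "homog aux_wt t G" "at_u f G = at_u f F'" "k > 0 \<longrightarrow> G \<in> gen.span (f ` {..<h})"
    using Suc.IH[OF F'Z F'h] by blast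
  show ?case
  proof (cases "k = 0")
    case True
    then show ?thesis using F'Z F'h ev sp by auto
  next
    case False
    then show ?thesis using G ev by auto
  qed
qed

text \<open>All higher components are lowered to degree \<open>t\<close>, where they acquire
  coefficients in the ideal. The resulting form evaluates to zero, hence is a combination of Koszul
  relations, whose coefficients also lie in the ideal.\<close>

lemma quasi_regular:
  fixes f :: "nat \<Rightarrow> 'k::field_char_0 mpoly"
  assumes f: "\<And>j. f j \<in> polys main_vars"
    and reg: "\<And>i a. i < h \<Longrightarrow> f i * a \<in> gen.span (f ` {..<i}) \<Longrightarrow> a \<in> gen.span (f ` {..<i})"
    and F: "F \<in> polys (main_vars \<union> uvar ` {0..<h})" "\<And>m. m \<in> keys F \<Longrightarrow> t \<le> wt aux_wt m" "at_u f F = 0"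
  shows "hcomp aux_wt t F \<in> gen.span (f ` {..<h})"
proof -
  let ?Z = "main_vars \<union> uvar ` {0..<h}" and ?S = "gen.span (f ` {..<h})"
  obtain N where N: "F = (\<Sum>s\<le>N. hcomp aux_wt s F)" using sum_hcomp_obtain[of F aux_wt] by blast
  have 0: "hcomp aux_wt s F = 0" if "s < t" for s using F(2) that by (intro hcomp_eq_0I) fastforce
  have "\<exists>G. G \<in> polys ?Z \<and> homog aux_wt t G \<and> at_u f G = at_u f (hcomp aux_wt s F) \<and> (s \<noteq> t \<longrightarrow> G \<in> ?S) \<and> (s = t \<longrightarrow> G = hcomp aux_wt t F)" for s
  proof -
    consider "s < t" | "s = t" | "t < s" by linarith
    then show ?thesis
    proof cases
      case 1
      then show ?thesis using 0[OF 1] by (intro exI[of _ 0]) (simp add: gen.span_zero)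
    next
      case 2
      then show ?thesis using polys_hcomp[OF F(1), of aux_wt t] by (intro exI[of _ "hcomp aux_wt t F"]) simp
    next
      case 3
      then show ?thesis
        using lower_degree[OF f polys_hcomp[OF F(1), of aux_wt s], of t "s - t"] by auto
    qed
  qed
  then obtain G where G: "\<And>s. G s \<in> polys ?Z" "\<And>s. homog aux_wt t (G s)" "\<And>s. at_u f (G s) = at_u f (hcomp aux_wt s F)"
    "\<And>s. s \<noteq> t \<Longrightarrow> G s \<in> ?S" "G t = hcomp aux_wt t F" by metis
  have "at_u f (\<Sum>s\<le>N. G s) = at_u f (\<Sum>s\<le>N. hcomp aux_wt s F)" by (simp add: lin_sum[OF alghom_lin] G(3))
  also have "\<dots> = 0" using N F(3) by simp
  finally have "(\<Sum>s\<le>N. G s) \<in> gen.span (f ` {..<0} \<union> koszul f 0 h)"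
    by (intro koszul_generates[OF f reg, where t = t] polys_sum G(1) G(2) homog_sum) (auto simp: gen.span_zero)
  moreover have "koszul f 0 h \<subseteq> ?S"
  proof
    fix q assume "q \<in> koszul f 0 h"
    then obtain a b where q: "q = mvar (uvar b) * f a - mvar (uvar a) * f b" "a < h" "b < h" by (auto simp: koszul_def mult.commute)
    show "q \<in> ?S" unfolding q(1) using q(2,3) by (intro gen.span_diff gen.span_scale gen.span_base) auto
  qed
  ultimately have sum: "(\<Sum>s\<le>N. G s) \<in> ?S"
    using gen.span_mono[of "koszul f 0 h" ?S] by (auto simp: gen.span_span)
  show ?thesis
  proof (cases "t \<le> N")
    case True
    then have "(\<Sum>s\<le>N. G s) = G t + (\<Sum>s\<in>{..N} - {t}. G s)" by (intro sum.remove) auto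
    then have "G t = (\<Sum>s\<le>N. G s) - (\<Sum>s\<in>{..N} - {t}. G s)" by simp
    also have "\<dots> \<in> ?S" by (intro gen.span_diff sum gen.span_sum G(4)) auto
    finally show ?thesis using G(5) by simp
  next
    case False
    have "hcomp aux_wt t F = (\<Sum>s\<le>N. hcomp aux_wt t (hcomp aux_wt s F))" by (subst N) (simp add: lin_sum)
    also have "\<dots> = 0" using False by (intro sum.neutral) (auto simp: hcomp_hcomp)
    finally show ?thesis by (simp add: gen.span_zero)
  qed
qed


section \<open>Minimal generators of complete intersections\<close>

text \<open>Order of vanishing in the main variables; the zero polynomial has every order.\<close>

definition ordge :: "nat \<Rightarrow> 'k::field mpoly \<Rightarrow> bool" where
  "ordge s p \<longleftrightarrow> (\<forall>m\<in>keys p. s \<le> wt main_wt m)"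

lemma ordge_0 [simp]: "ordge s 0" by (simp add: ordge_def)
lemma ordge_zero: "ordge 0 p" by (simp add: ordge_def)
lemma ordge_mono: "ordge s p \<Longrightarrow> r \<le> s \<Longrightarrow> ordge r p" by (fastforce simp: ordge_def)
lemma ordge_add: "ordge s p \<Longrightarrow> ordge s q \<Longrightarrow> ordge s (p + q)"
  using Poly_Mapping.keys_add[of p q] by (auto simp: ordge_def)
lemma ordge_mult: "ordge r p \<Longrightarrow> ordge s q \<Longrightarrow> ordge (r + s) (p * q)"
  using keys_mult[of p q] by (fastforce simp: ordge_def wt_add)
lemma ordge_sum: "(\<And>a. a \<in> A \<Longrightarrow> ordge s (f a)) \<Longrightarrow> ordge s (sum f A)"
  by (induction A rule: infinite_finite_induct) (auto intro: ordge_add)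
lemma ordge_cst_mult: "ordge s p \<Longrightarrow> ordge s (cst c * p)"
  using ordge_mult[OF ordge_zero[of "cst c"], of s p] by simp
lemma ordge_xmon: "ordge (wt main_wt m) (xmon m)" by (simp add: ordge_def)

lemma ring_expand_error: "(x + (q::'b::comm_ring_1)) * (y + r) = x * y + (x * r + q * y + q * r)"
  by (simp add: algebra_simps)

text \<open>Multiplicativity of small errors: in a product of two perturbed factors each of the
  three error terms gains at least one order.\<close>

lemma alghom_order:
  fixes \<tau> :: "'k::field mpoly \<Rightarrow> 'k mpoly"
  assumes \<tau>: "alghom \<tau>" and v: "\<And>v. v \<in> V \<Longrightarrow> ordge (main_wt v + 1) (\<tau> (mvar v) - mvar v)"
    and p: "p \<in> polys V" "ordge s p"
  shows "ordge (s + 1) (\<tau> p - p)"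
proof -
  have xm: "ordge (wt main_wt m + 1) (\<tau> (xmon m) - xmon m)" if m: "keys m \<subseteq> V" for m
  proof -
    obtain N :: nat and es where es: "m = (\<Sum>s<N. Poly_Mapping.single (es s) 1)" "\<And>s. s < N \<Longrightarrow> es s \<in> keys m"
      by (rule mexp_edges[of m]) (rule that)
    have "k \<le> N \<Longrightarrow> ordge (wt main_wt (\<Sum>s<k. Poly_Mapping.single (es s) 1) + 1)
        (\<tau> (xmon (\<Sum>s<k. Poly_Mapping.single (es s) 1)) - xmon (\<Sum>s<k. Poly_Mapping.single (es s) 1))" for k
    proof (induction k)
      case 0
      then show ?case by (simp add: alghom_1[OF \<tau>])
    next
      case (Suc k)
      define a where "a = (\<Sum>s<k. Poly_Mapping.single (es s) (1::nat))"
      define q where "q = \<tau> (xmon a) - xmon a"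
      define r where "r = \<tau> (mvar (es k)) - mvar (es k)"
      have q: "ordge (wt main_wt a + 1) q" using Suc by (simp add: a_def q_def)
      have r: "ordge (main_wt (es k) + 1) r" unfolding r_def using es(2)[of k] Suc.prems m by (intro v) auto
      have mv: "ordge (main_wt (es k)) (mvar (es k))" using ordge_xmon[of "Poly_Mapping.single (es k) 1"] by (simp add: mvar_xmon)
      have s: "(\<Sum>s<Suc k. Poly_Mapping.single (es s) (1::nat)) = a + Poly_Mapping.single (es k) 1" by (simp add: a_def)
      have x: "xmon (a + Poly_Mapping.single (es k) 1) = xmon a * (mvar (es k) :: 'k mpoly)" by (simp only: xmon_add mvar_xmon)
      have "\<tau> (xmon a * mvar (es k)) = (xmon a + q) * (mvar (es k) + r)"
        by (simp add: alghom_mult[OF \<tau>] q_def r_def)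
      then have e: "\<tau> (xmon a * mvar (es k)) - xmon a * mvar (es k) = xmon a * r + q * mvar (es k) + q * r"
        unfolding ring_expand_error by simp
      have "ordge (wt main_wt a + main_wt (es k) + 1) (xmon a * r + q * mvar (es k) + q * r)"
        using ordge_mult[OF ordge_xmon r, of a] ordge_mult[OF q mv] ordge_mult[OF q r]
        by (intro ordge_add) (auto elim: ordge_mono simp: add.assoc)
      then show ?case unfolding s x e by (simp add: wt_add add.assoc)
    qed
    from this[OF order_refl] show ?thesis unfolding es(1)[symmetric] .
  qed
  have "\<tau> p - p = (\<Sum>m\<in>keys p. cst (lookup p m) * (\<tau> (xmon m) - xmon m))"
    by (subst (1 2) mpoly_sum_monomials[of p])
      (simp add: lin_sum[OF alghom_lin[OF \<tau>]] lin_scale[OF alghom_lin[OF \<tau>]] right_diff_distrib sum_subtractf)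
  moreover have "ordge (s + 1) \<dots>"
  proof (intro ordge_sum ordge_cst_mult)
    fix m assume m: "m \<in> keys p"
    then have "s + 1 \<le> wt main_wt m + 1" using p(2) by (simp add: ordge_def)
    then show "ordge (s + 1) (\<tau> (xmon m) - xmon m)" using ordge_mono[OF xm[OF polysD[OF p(1) m]]] by blast
  qed
  ultimately show ?thesis by simp
qed

lemma hcomp_ordge: "ordge (s + 1) p \<Longrightarrow> hcomp main_wt s p = 0"
  by (rule hcomp_eq_0I) (fastforce simp: ordge_def)

text \<open>Successive approximation. Once the components of \<open>P\<close> below \<open>s\<close>
  are in the graded ideal, subtracting them makes \<open>\<tau>\<close> agree with the identity in
  order \<open>s\<close>, so the component of order \<open>s\<close> is one of an element of the
  ideal.\<close>

lemma hcomp_in_span_of_alghom: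
  fixes g :: "nat \<times> nat \<Rightarrow> 'k::field mpoly"
  assumes \<tau>: "alghom \<tau>" and v: "\<And>v. v \<in> V \<Longrightarrow> ordge (main_wt v + 1) (\<tau> (mvar v) - mvar v)"
    and g: "\<And>e. e \<in> Es \<Longrightarrow> homog main_wt 2 (g e)" "\<And>e. e \<in> Es \<Longrightarrow> \<tau> (g e) = g e"
    and P: "P \<in> polys V" "\<tau> P \<in> gen.span (g ` Es)"
  shows "P \<in> gen.span (g ` Es)"
proof -
  have S: "hcomp main_wt s p \<in> gen.span (g ` Es)" if "p \<in> gen.span (g ` Es)" for s p
    using that g(1) by (intro span_homog_hcomp) auto
  have \<tau>S: "\<tau> p \<in> gen.span (g ` Es)" if "p \<in> gen.span (g ` Es)" for p
    using that by (rule alghom_span[OF \<tau>, rotated]) (auto simp: g(2) gen.span_base)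
  have comp: "hcomp main_wt s P \<in> gen.span (g ` Es)" for s
  proof (induction s rule: less_induct)
    case (less s)
    define Q where "Q = (\<Sum>r<s. hcomp main_wt r P)"
    have Q: "Q \<in> gen.span (g ` Es)" unfolding Q_def using less by (intro gen.span_sum) auto
    have QV: "P - Q \<in> polys V" unfolding Q_def by (intro polys_diff polys_sum polys_hcomp P(1))
    have lk: "lookup (P - Q) m = (if wt main_wt m < s then 0 else lookup P m)" for m
      by (simp add: Q_def lookup_minus lookup_sum lookup_hcomp sum.delta')
    have "ordge s (P - Q)" unfolding ordge_def by (metis in_keys_iff lk not_le_imp_less)
    from alghom_order[OF \<tau> v QV this] have o: "ordge (s + 1) (\<tau> (P - Q) - (P - Q))" by simp
    have "\<tau> (P - Q) \<in> gen.span (g ` Es)"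
      unfolding lin_diff[OF alghom_lin[OF \<tau>]] by (intro gen.span_diff P(2) \<tau>S Q)
    from S[OF this, of s] have "hcomp main_wt s (P - Q) \<in> gen.span (g ` Es)"
      using hcomp_ordge[OF o] unfolding lin_diff[OF lin_hcomp] by simp
    moreover have "hcomp main_wt s (P - Q) = hcomp main_wt s P"
      by (rule poly_mapping_eqI) (simp add: lookup_hcomp lk)
    ultimately show ?case by simp
  qed
  obtain N where "P = (\<Sum>s\<le>N. hcomp main_wt s P)" using sum_hcomp_obtain[of P main_wt] by blast
  then show ?thesis using gen.span_sum[of "{..N}" "\<lambda>s. hcomp main_wt s P" "g ` Es"] comp by simp
qed

lemma main_wt_eq_0:
  assumes "keys m \<subseteq> main_vars"
  shows "wt main_wt m = 0 \<longleftrightarrow> m = 0"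
proof
  assume "wt main_wt m = 0"
  then have "main_wt v = 0" if "v \<in> keys m" for v using that wt_eq_0_iff by blast
  moreover have "main_wt v = 1" if "v \<in> keys m" for v using that assms by (auto simp: main_wt_def)
  ultimately have "keys m = {}" by fastforce
  then show "m = 0" by simp
qed simp

text \<open>Lets the lowest form be taken before or after a graded change of variables.\<close>

lemma hcomp_alghom:
  fixes \<tau> :: "'k::field mpoly \<Rightarrow> 'k mpoly"
  assumes \<tau>: "alghom \<tau>" and v: "\<And>v. v \<in> V \<Longrightarrow> homog w' (w v) (\<tau> (mvar v))" and p: "p \<in> polys V"
  shows "hcomp w' s (\<tau> p) = \<tau> (hcomp w s p)"
proof (rule lin_eqI[of "\<lambda>p. hcomp w' s (\<tau> p)" "\<lambda>p. \<tau> (hcomp w s p)"])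
  show "lin (\<lambda>p. hcomp w' s (\<tau> p))" by (rule lin_comp[OF lin_hcomp alghom_lin[OF \<tau>]])
  show "lin (\<lambda>p. \<tau> (hcomp w s p))" by (rule lin_comp[OF alghom_lin[OF \<tau>] lin_hcomp])
  fix m assume "m \<in> keys p"
  then have m: "keys m \<subseteq> V" using p by (rule polysD[rotated])
  obtain N :: nat and es where es: "m = (\<Sum>s<N. Poly_Mapping.single (es s) 1)" "\<And>s. s < N \<Longrightarrow> es s \<in> keys m"
    by (rule mexp_edges[of m]) (rule that)
  have "k \<le> N \<Longrightarrow> homog w' (\<Sum>s<k. w (es s)) (\<tau> (xmon (\<Sum>s<k. Poly_Mapping.single (es s) 1)))" for k
  proof (induction k)
    case 0
    then show ?case by (simp add: alghom_1[OF \<tau>])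
  next
    case (Suc k)
    have "homog w' (w (es k)) (\<tau> (mvar (es k)))" using es(2)[of k] Suc.prems m by (intro v) auto
    then show ?case using Suc homog_mult[of w' "\<Sum>s<k. w (es s)" _ "w (es k)" "\<tau> (mvar (es k))"]
      by (simp add: xmon_add alghom_mult[OF \<tau>] mvar_xmon)
  qed
  from this[OF order_refl] have "homog w' (wt w m) (\<tau> (xmon m))"
    unfolding es(1)[symmetric] using wt_edges[of w es N] es(1) by simp
  then show "hcomp w' s (\<tau> (xmon m)) = \<tau> (hcomp w s (xmon m))"
    by (simp add: hcomp_homog hcomp_xmon lin_0[OF alghom_lin[OF \<tau>]])
qed

lemma alghom_wt_ge:
  fixes \<tau> :: "'k::field mpoly \<Rightarrow> 'k mpoly"
  assumes \<tau>: "alghom \<tau>" and v: "\<And>v. v \<in> V \<Longrightarrow> homog w' (w v) (\<tau> (mvar v))" and p: "p \<in> polys V"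
    and t: "\<And>m. m \<in> keys p \<Longrightarrow> t \<le> wt w m" and m: "m \<in> keys (\<tau> p)"
  shows "t \<le> wt w' m"
proof (rule ccontr)
  assume *: "\<not> t \<le> wt w' m"
  have "hcomp w (wt w' m) p = 0" using * t by (intro hcomp_eq_0I) metis
  moreover have "hcomp w' (wt w' m) (\<tau> p) = \<tau> (hcomp w (wt w' m) p)" by (rule hcomp_alghom[OF \<tau> v p])
  ultimately have "hcomp w' (wt w' m) (\<tau> p) = 0" by (simp add: lin_0[OF alghom_lin[OF \<tau>]])
  then have "lookup (hcomp w' (wt w' m) (\<tau> p)) m = 0" by simp
  then show False using m by (simp add: lookup_hcomp in_keys_iff)
qed

text \<open>Quasi-regularity does not depend on the choice of minimal generators: the composite of the two
  base changes is the identity up to terms of higher degree.\<close>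

lemma quasi_regular_generators:
  fixes f :: "nat \<Rightarrow> 'k::field_char_0 mpoly" and g :: "nat \<times> nat \<Rightarrow> 'k mpoly"
  assumes f: "\<And>j. f j \<in> polys main_vars"
    and reg: "\<And>i a. i < h \<Longrightarrow> f i * a \<in> gen.span (f ` {..<i}) \<Longrightarrow> a \<in> gen.span (f ` {..<i})"
    and Es: "finite Es" and g: "\<And>e. e \<in> Es \<Longrightarrow> g e \<in> polys main_vars" "\<And>e. e \<in> Es \<Longrightarrow> homog main_wt 2 (g e)"
    and ind: "\<And>c. (\<Sum>e\<in>Es. cst (c e) * g e) = 0 \<Longrightarrow> \<forall>e\<in>Es. c e = 0"
    and fg: "gen.span (f ` {..<h}) = gen.span (g ` Es)"
    and H: "H \<in> polys (main_vars \<union> tvar ` Es)" "\<And>m. m \<in> keys H \<Longrightarrow> t \<le> wt aux_wt m" "at_t g H = 0"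
  shows "hcomp aux_wt t H \<in> gen.span (g ` Es)"
proof -
  have "\<exists>a. (\<forall>j. a j \<in> polys main_vars) \<and> g e = (\<Sum>j<h. a j * f j)" if "e \<in> Es" for e
  proof (rule span_image_finite_polys)
    show "g e \<in> gen.span (f ` {..<h})" unfolding fg by (rule gen.span_base) (rule imageI[OF that])
    show "f ` {..<h} \<subseteq> polys main_vars" using f by blast
  qed (simp, rule g(1)[OF that])
  then have "\<forall>e\<in>Es. \<exists>a. (\<forall>j. a j \<in> polys main_vars) \<and> g e = (\<Sum>j<h. a j * f j)" by blast
  from bchoice[OF this] obtain M where M: "\<And>e j. e \<in> Es \<Longrightarrow> M e j \<in> polys main_vars" "\<And>e. e \<in> Es \<Longrightarrow> g e = (\<Sum>j<h. M e j * f j)"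
    by blast
  have "\<exists>a. (\<forall>e. a e \<in> polys main_vars) \<and> f j = (\<Sum>e\<in>Es. a e * g e)" if "j < h" for j
  proof (rule span_image_finite_polys)
    show "f j \<in> gen.span (g ` Es)" unfolding fg[symmetric] using that by (intro gen.span_base imageI) simp
    show "g ` Es \<subseteq> polys main_vars" using g(1) by blast
  qed (rule Es, rule f)
  then have "\<forall>j\<in>{..<h}. \<exists>a. (\<forall>e. a e \<in> polys main_vars) \<and> f j = (\<Sum>e\<in>Es. a e * g e)" by blast
  from bchoice[OF this] obtain N where N: "\<And>e j. j < h \<Longrightarrow> N j e \<in> polys main_vars" "\<And>j. j < h \<Longrightarrow> f j = (\<Sum>e\<in>Es. N j e * g e)"
    by blast
  \<comment> \<open>The matrix that expresses the \<open>g e\<close> through themselves by way of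
    the \<open>f j\<close>.\<close>
  define K where "K e e' = (\<Sum>j<h. M e j * N j e')" for e e'
  have K: "K e e' \<in> polys main_vars" if "e \<in> Es" for e e'
    unfolding K_def using that by (intro polys_sum polys_mult M N) auto
  have KG: "g e = (\<Sum>e'\<in>Es. K e e' * g e')" if e: "e \<in> Es" for e
  proof -
    have "g e = (\<Sum>j<h. \<Sum>e'\<in>Es. M e j * (N j e' * g e'))"
      unfolding M(2)[OF e] by (intro sum.cong refl) (simp add: N(2) sum_distrib_left)
    also have "\<dots> = (\<Sum>e'\<in>Es. K e e' * g e')"
      unfolding K_def sum_distrib_right mult.assoc by (rule sum.swap)
    finally show ?thesis .
  qed
  \<comment> \<open>Comparing components of degree 2 leaves only the constant terms of
    \<open>K\<close> as coefficients of the quadrics \<open>g e\<close>; their linear independence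
    forces the identity matrix.\<close>
  have K0: "lookup (K e e') 0 = (if e = e' then 1 else 0)" if e: "e \<in> Es" "e' \<in> Es" for e e'
  proof -
    have h0: "hcomp main_wt 0 (K e e') = cst (lookup (K e e') 0)" if "e' \<in> Es" for e'
    proof (rule poly_mapping_eqI)
      fix m
      show "lookup (hcomp main_wt 0 (K e e')) m = lookup (cst (lookup (K e e') 0)) m"
      proof (cases "m \<in> keys (K e e')")
        case True
        from polysD[OF K[OF e(1)] this] have "wt main_wt m = 0 \<longleftrightarrow> m = 0" by (rule main_wt_eq_0)
        then show ?thesis by (simp add: lookup_hcomp lookup_cst)
      qed (auto simp: lookup_hcomp lookup_cst in_keys_iff)
    qed
    have "hcomp main_wt 2 (K e e' * g e') = cst (lookup (K e e') 0) * g e'" if "e' \<in> Es" for e'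
      using hcomp_mult_homog[OF g(2)[OF that], of 2 "K e e'"] h0[OF that] by (simp add: mult.commute)
    then have "hcomp main_wt 2 (\<Sum>e'\<in>Es. K e e' * g e') = (\<Sum>e'\<in>Es. cst (lookup (K e e') 0) * g e')"
      unfolding lin_sum[OF lin_hcomp] by (intro sum.cong refl)
    then have 1: "g e = (\<Sum>e'\<in>Es. cst (lookup (K e e') 0) * g e')"
      using hcomp_homog[OF g(2)[OF e(1)], of 2] KG[OF e(1)] by simp
    have "(\<Sum>e'\<in>Es. cst (lookup (K e e') 0 - (if e = e' then 1 else 0)) * g e') = (\<Sum>e'\<in>Es. cst (lookup (K e e') 0) * g e' - (if e = e' then g e else 0))"
      by (intro sum.cong refl) (auto simp: cst_diff left_diff_distrib)
    also have "\<dots> = 0" unfolding sum_subtractf 1[symmetric] using Es e(1) by simp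
    finally show ?thesis using ind e(2) by fastforce
  qed
  \<comment> \<open>The two base changes in formal form: \<open>G\<close> rewrites
    \<open>tvar e\<close> in the variables \<open>uvar j\<close>, and \<open>F\<close> rewrites
    \<open>uvar j\<close> back in the variables \<open>tvar e\<close>.\<close>
  define G where "G e = (\<Sum>j<h. M e j * mvar (uvar j))" for e
  define F where "F j = (\<Sum>e\<in>Es. N j e * mvar (tvar e))" for j
  define \<tau> where "\<tau> p = at_u F (at_t G p)" for p
  let ?V = "main_vars \<union> tvar ` Es"
  have \<tau>: "alghom \<tau>" unfolding \<tau>_def by (rule alghom_comp[OF at_u_simps(1) at_t_simps(1)])
  have \<tau>id: "\<tau> p = p" if "p \<in> polys main_vars" for p using that by (simp add: \<tau>_def at_u_id at_t_id)
  have \<tau>t: "\<tau> (mvar (tvar e)) = (\<Sum>e'\<in>Es. K e e' * mvar (tvar e'))" if e: "e \<in> Es" for e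
  proof -
    have "\<tau> (mvar (tvar e)) = (\<Sum>j<h. \<Sum>e'\<in>Es. M e j * (N j e' * mvar (tvar e')))"
      unfolding \<tau>_def at_t_simps G_def lin_sum[OF alghom_lin[OF at_u_simps(1)]] alghom_mult[OF at_u_simps(1)] at_u_simps
    proof (intro sum.cong refl)
      fix j
      have "at_u F (M e j) = M e j" by (rule at_u_id[OF M(1)[OF e]])
      then show "at_u F (M e j) * F j = (\<Sum>e'\<in>Es. M e j * (N j e' * mvar (tvar e')))"
        by (simp only: F_def sum_distrib_left)
    qed
    also have "\<dots> = (\<Sum>e'\<in>Es. K e e' * mvar (tvar e'))"
      unfolding K_def sum_distrib_right mult.assoc by (rule sum.swap)
    finally show ?thesis .
  qed
  have ord: "ordge (main_wt v + 1) (\<tau> (mvar v) - mvar v)" if v: "v \<in> ?V" for v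
  proof (cases "v \<in> main_vars")
    case True
    then show ?thesis by (simp add: \<tau>id)
  next
    case False
    then obtain e where e: "e \<in> Es" "v = tvar e" using v by blast
    have "\<tau> (mvar v) - mvar v = (\<Sum>e'\<in>Es. K e e' * mvar (tvar e') - (if e = e' then mvar (tvar e) else 0))"
      unfolding e(2) \<tau>t[OF e(1)] sum_subtractf using Es e(1) by simp
    also have "\<dots> = (\<Sum>e'\<in>Es. (K e e' - cst (if e = e' then 1 else 0)) * mvar (tvar e'))"
      by (intro sum.cong refl) (auto simp: left_diff_distrib)
    also have "ordge (1 + 0) \<dots>"
    proof (intro ordge_sum ordge_mult ordge_zero)
      fix e' assume e': "e' \<in> Es"
      show "ordge 1 (K e e' - cst (if e = e' then 1 else 0))"
        unfolding ordge_def
      proof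
        fix m assume m: "m \<in> keys (K e e' - cst (if e = e' then 1 else 0))"
        have "m \<noteq> 0" using m K0[OF e(1) e'] by (auto simp: in_keys_iff lookup_minus lookup_cst)
        moreover have "keys m \<subseteq> main_vars"
          by (rule polysD[OF _ m]) (intro polys_diff K e(1) polys_cst)
        ultimately have "wt main_wt m \<noteq> 0" using main_wt_eq_0 by blast
        then show "1 \<le> wt main_wt m" by simp
      qed
    qed
    finally show ?thesis unfolding e(2) by (simp add: main_wt_def tvar_def)
  qed
  have homG: "homog aux_wt (aux_wt v) (at_t G (mvar v))" if vV: "v \<in> ?V" for v
  proof (cases "v \<in> main_vars")
    case True
    then show ?thesis by (simp add: homog_mvar)
  next
    case False
    then obtain e where e: "e \<in> Es" "v = tvar e" using vV by blast
    have "homog aux_wt (0 + aux_wt (uvar j)) (M e j * mvar (uvar j))" for j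
      by (intro homog_mult homog_mvar homog_aux_0 M(1) e(1))
    then show ?thesis unfolding e(2) at_t_simps G_def by (intro homog_sum) (simp add: aux_wt_def uvar_def tvar_def)
  qed
  have hc: "hcomp aux_wt s (at_t G H) = at_t G (hcomp aux_wt s H)" for s
    by (rule hcomp_alghom[OF at_t_simps(1) homG H(1)])
  have "at_t G H \<in> polys (main_vars \<union> uvar ` {0..<h})"
    unfolding at_t_def
  proof (rule polys_subst[OF H(1)])
    fix v assume v: "v \<in> ?V"
    have "G e \<in> polys (main_vars \<union> uvar ` {0..<h})" if "e \<in> Es" for e
      unfolding G_def using M(1)[OF that] polys_mono[of main_vars "main_vars \<union> uvar ` {0..<h}"]
      by (intro polys_sum polys_mult) auto
    then show "(if fst v = 0 \<and> even (snd v) then G (prod_decode (snd v div 2)) else mvar v) \<in> polys (main_vars \<union> uvar ` {0..<h})"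
      using v by (auto simp: tvar_def)
  qed
  moreover have "t \<le> wt aux_wt m" if "m \<in> keys (at_t G H)" for m
    by (rule alghom_wt_ge[OF at_t_simps(1) homG H(1,2) that])
  moreover have "at_u f (at_t G H) = at_t g H"
  proof (rule alghom_eqI[of "\<lambda>p. at_u f (at_t G p)" "at_t g" H ?V])
    fix v assume v: "v \<in> ?V"
    show "at_u f (at_t G (mvar v)) = at_t g (mvar v)"
    proof (cases "v \<in> main_vars")
      case False
      then obtain e where e: "e \<in> Es" "v = tvar e" using v by blast
      show ?thesis unfolding e(2) at_t_simps G_def lin_sum[OF alghom_lin[OF at_u_simps(1)]] alghom_mult[OF at_u_simps(1)] at_u_simps M(2)[OF e(1)]
        by (intro sum.cong refl) (simp add: at_u_id[OF M(1)[OF e(1)]])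
    qed simp
  qed (rule alghom_comp[OF at_u_simps(1) at_t_simps(1)], rule at_t_simps(1), rule H(1))
  \<comment> \<open>Quasi-regularity is available for the regular sequence only, so it is applied to
    the relation rewritten in the variables \<open>uvar j\<close>.\<close>
  ultimately have "hcomp aux_wt t (at_t G H) \<in> gen.span (f ` {..<h})"
    using H(3) by (intro quasi_regular[OF f reg]) auto
  then have "at_t G (hcomp aux_wt t H) \<in> gen.span (f ` {..<h})" unfolding hc .
  then have "\<tau> (hcomp aux_wt t H) \<in> gen.span (f ` {..<h})"
    unfolding \<tau>_def by (rule alghom_span[OF at_u_simps(1), rotated]) (auto simp: at_u_id[OF f] gen.span_base)
  then have S: "\<tau> (hcomp aux_wt t H) \<in> gen.span (g ` Es)" unfolding fg .
  show ?thesis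
    by (rule hcomp_in_span_of_alghom[where V = ?V, OF \<tau> ord g(2) \<tau>id[OF g(1)] polys_hcomp[OF H(1)] S])
qed


section \<open>Descent of primality and radicality along \<open>phi\<close>\<close>

section \<open>Setting the variables of the edges to zero\<close>

lemma kill_congruent: "p - kill (- W) p \<in> gen.span (mvar ` W)"
proof (induction p rule: mpoly_induct)
  case (monomial m c)
  have "xmon m - kill (- W) (xmon m) \<in> gen.span (mvar ` W :: 'a mpoly set)"
  proof (cases "keys m \<inter> W = {}")
    case True
    then have "kill (- W) (xmon m) = (xmon m :: 'a mpoly)" by (intro kill_id) auto
    then show ?thesis by (simp add: gen.span_zero)
  next
    case False
    then obtain v where v: "v \<in> keys m" "v \<in> W" by auto
    have x: "xmon m = (mvar v * xmon (m - Poly_Mapping.single v 1) :: 'a mpoly)"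
      using v(1) unfolding mvar_xmon xmon_add[symmetric] by (subst single_plus_minus) (auto simp: in_keys_iff)
    have "kill (- W) (mvar v) = (0 :: 'a mpoly)" using v(2) by (simp add: kill_def)
    then have "kill (- W) (xmon m) = (0 :: 'a mpoly)" unfolding x alghom_mult[OF alghom_kill] by simp
    moreover have "xmon m \<in> gen.span (mvar ` W :: 'a mpoly set)"
      unfolding x mult.commute[of "mvar v"] using v(2) by (intro gen.span_scale gen.span_base imageI)
    ultimately show ?thesis by simp
  qed
  then show ?case
    unfolding lin_scale[OF alghom_lin[OF alghom_kill]] right_diff_distrib[symmetric] by (rule gen.span_scale)
next
  case (add p q)
  have "p + q - kill (- W) (p + q) = (p - kill (- W) p) + (q - kill (- W) q)"
    unfolding alghom_add[OF alghom_kill] by simp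
  then show ?case by (simp only: gen.span_add[OF add])
qed

lemma polys_phi: "p \<in> polys (skew_vars n) \<Longrightarrow> phi d p \<in> polys (lss_vars n d)"
  unfolding phi_def
  by (rule polys_subst) (auto simp: twisted_lss_poly_def skew_vars_def lss_vars_def intro!: polys_sum polys_diff polys_mult)

lemma pf_gens_polys: "pf_gens n t generic_skew_matrix \<subseteq> polys (skew_vars n)"
proof
  fix g :: "'a mpoly" assume "g \<in> pf_gens n t generic_skew_matrix"
  then obtain I where I: "I \<subseteq> {1..n}" "card I = 2 * t"
    "g = pfaffian t (\<lambda>a b. generic_skew_matrix (sorted_list_of_set I ! a) (sorted_list_of_set I ! b))"
    by (auto simp: pf_gens_def)
  have fin: "finite I" using I(1) finite_subset by blast
  have *: "sorted_list_of_set I ! a \<in> {1..n}" if "a < 2 * t" for a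
    using that I(1,2) fin nth_mem[of a "sorted_list_of_set I"] by auto
  have gm: "generic_skew_matrix i j \<in> polys (skew_vars n)" if "i \<in> {1..n}" "j \<in> {1..n}" for i j
    using that by (auto simp: generic_skew_matrix_def skew_vars_def intro!: polys_uminus)
  show "g \<in> polys (skew_vars n)"
    unfolding I(3) pfaffian_def cst_of_int[symmetric]
  proof (intro polys_sum polys_mult polys_cst polys_prod gm *)
    fix p a assume p: "p \<in> {p. p permutes {..<2 * t} \<and> (\<forall>a<t. p (2 * a) < p (2 * a + 1)) \<and>
      (\<forall>a b. a < b \<and> b < t \<longrightarrow> p (2 * a) < p (2 * b))}" and a: "a \<in> {..<t}"
    have "x < 2 * t \<Longrightarrow> p x < 2 * t" for x using p permutes_in_image[of p "{..<2 * t}" x] by auto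
    then show "p (2 * a) < 2 * t" "p (2 * a + 1) < 2 * t" using a by auto
  qed
qed

definition edges :: "nat set set \<Rightarrow> (nat \<times> nat) set" where
  "edges E = {(i, j). i < j \<and> {i, j} \<in> E}"

abbreviation edge_poly :: "nat \<Rightarrow> nat \<times> nat \<Rightarrow> 'k::field mpoly" where
  "edge_poly d e \<equiv> twisted_lss_poly d (fst e) (snd e)"

lemma kill_generic_skew_matrix:
  "kill (- edges E) (generic_skew_matrix i j) = (graph_skew_matrix E i j :: 'k::field mpoly)"
proof -
  have "kill (- edges E) (mvar (a, b)) = (if {a, b} \<in> E then 0 else mvar (a, b) :: 'k mpoly)" if "a < b" for a b
    using that by (simp add: kill_def edges_def)
  moreover have "{i, j} = {j, i}" by auto
  ultimately show ?thesis
    by (simp add: generic_skew_matrix_def graph_skew_matrix_def lin_0[OF alghom_lin] lin_uminus[OF alghom_lin])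
qed

text \<open>A Pfaffian is an integer polynomial in the matrix entries, so it commutes with setting
  variables to zero.\<close>

lemma pf_gens_graph: "pf_gens n t (graph_skew_matrix E) = kill (- edges E) ` pf_gens n t generic_skew_matrix"
proof -
  have k: "pfaffian t (\<lambda>a b. graph_skew_matrix E (l ! a) (l ! b)) = kill (- edges E) (pfaffian t (\<lambda>a b. generic_skew_matrix (l ! a) (l ! b)))" for l
    unfolding alghom_pfaffian[OF alghom_kill] kill_generic_skew_matrix ..
  show ?thesis unfolding pf_gens_def k by blast
qed

lemma pf_gens_graph_polys: "pf_gens n t (graph_skew_matrix E) \<subseteq> polys (skew_vars n - edges E)"
  unfolding pf_gens_graph using pf_gens_polys[of n t] kill_polys[of _ "skew_vars n" "- edges E"] by (auto simp: Diff_eq Int_commute)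

locale graph =
  fixes n d :: nat and E :: "nat set set"
  assumes E: "E \<subseteq> {e. e \<subseteq> {1..n} \<and> card e = 2}"
begin

lemma edges_skew_vars: "edges E \<subseteq> skew_vars n"
  using E by (auto simp: edges_def skew_vars_def)

lemma finite_edges: "finite (edges E)"
  using edges_skew_vars finite_skew_vars finite_subset by blast

lemma edge_poly_polys: "edge_poly d ` edges E \<subseteq> polys (lss_vars n d)"
proof -
  have "phi d (mvar e) \<in> polys (lss_vars n d)" if "e \<in> edges E" for e
    using that edges_skew_vars by (intro polys_phi) auto
  then show ?thesis by auto
qed

lemma twisted_lss_ideal_span:
  "twisted_lss_ideal TYPE('k::field) n d E = gen.span (edge_poly d ` edges E) \<inter> polys (lss_vars n d)"
proof -
  have "{twisted_lss_poly d i j | i j. i < j \<and> {i, j} \<in> E} = (edge_poly d ` edges E :: 'k mpoly set)"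
    by (force simp: edges_def image_iff)
  then show ?thesis
    using Idl_mpoly_ring[OF edge_poly_polys] by (simp add: twisted_lss_ideal_def lss_ring_def lss_vars_def)
qed

lemma phi_kill: "phi d (p - kill (- edges E) p) \<in> gen.span (edge_poly d ` edges E)"
proof (rule alghom_span[OF alghom_phi _ kill_congruent])
  fix b :: "'a mpoly" assume "b \<in> mvar ` edges E"
  then have "phi d b \<in> edge_poly d ` edges E" by (auto intro: rev_image_eqI)
  then show "phi d b \<in> gen.span (edge_poly d ` edges E)" by (rule gen.span_base)
qed

text \<open>Setting edge variables to zero alters the image under \<open>phi\<close> only by
  elements of the ideal of the f_e, so Pfaffians of the graph matrix land there. Conversely
  \<open>phi_contract\<close> puts \<open>s\<close> into the generic Pfaffians plus edge variables,
  and setting the latter to zero fixes \<open>s\<close>.\<close>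

lemma in_graph_pfaffian_iff:
  fixes s :: "'k::field_char_0 mpoly"
  assumes s: "s \<in> polys (skew_vars n - edges E)"
  shows "s \<in> gen.span (pf_gens n (d + 1) (graph_skew_matrix E)) \<longleftrightarrow> phi d s \<in> gen.span (edge_poly d ` edges E)"
proof
  assume "s \<in> gen.span (pf_gens n (d + 1) (graph_skew_matrix E))"
  then show "phi d s \<in> gen.span (edge_poly d ` edges E)"
  proof (rule alghom_span[OF alghom_phi, rotated])
    fix b :: "'k mpoly" assume "b \<in> pf_gens n (d + 1) (graph_skew_matrix E)"
    then obtain g where g: "g \<in> pf_gens n (d + 1) (generic_skew_matrix :: nat \<Rightarrow> nat \<Rightarrow> 'k mpoly)" "b = kill (- edges E) g"
      unfolding pf_gens_graph by blast
    have "- phi d b \<in> gen.span (edge_poly d ` edges E)"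
      using phi_kill[of g] phi_pf_gens[OF g(1)] by (simp add: g(2) lin_diff[OF alghom_lin])
    from gen.span_neg[OF this] show "phi d b \<in> gen.span (edge_poly d ` edges E)" by simp
  qed
next
  assume "phi d s \<in> gen.span (edge_poly d ` edges E)"
  then have "s \<in> gen.span (pf_gens n (d + 1) generic_skew_matrix \<union> mvar ` edges E)"
    using s polys_mono[of "skew_vars n - edges E" "skew_vars n"]
    by (intro phi_contract finite_edges edges_skew_vars) auto
  then have "kill (- edges E) s \<in> gen.span (pf_gens n (d + 1) (graph_skew_matrix E))"
  proof (rule alghom_span[OF alghom_kill, rotated])
    fix b :: "'k mpoly" assume "b \<in> pf_gens n (d + 1) generic_skew_matrix \<union> mvar ` edges E"
    then show "kill (- edges E) b \<in> gen.span (pf_gens n (d + 1) (graph_skew_matrix E))"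
    proof
      assume "b \<in> mvar ` edges E"
      then have "kill (- edges E) b = 0" by (auto simp: kill_def)
      then show ?thesis by (simp add: gen.span_zero)
    qed (auto simp: pf_gens_graph intro: gen.span_base)
  qed
  moreover have "kill (- edges E) s = s"
    using s polys_mono[of "skew_vars n - edges E" "- edges E"] by (intro kill_id) auto
  ultimately show "s \<in> gen.span (pf_gens n (d + 1) (graph_skew_matrix E))" by simp
qed

lemma pfaffian_ideal_graph:
  "pfaffian_ideal TYPE('k::field) n t (graph_skew_matrix E)
    = gen.span (pf_gens n t (graph_skew_matrix E)) \<inter> polys (skew_vars n)"
proof -
  have "pf_gens n t (graph_skew_matrix E) \<subseteq> (polys (skew_vars n) :: 'k mpoly set)"
    using pf_gens_graph_polys[of n t E] polys_mono[of "skew_vars n - edges E" "skew_vars n"] by blast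
  from Idl_mpoly_ring[OF this] show ?thesis
    by (simp add: pfaffian_ideal_def skew_ring_def skew_vars_def pf_gens_def)
qed

lemma pfaffian_ideal_generic:
  "pfaffian_ideal TYPE('k::field) n t generic_skew_matrix
    = gen.span (pf_gens n t generic_skew_matrix) \<inter> polys (skew_vars n)"
  using Idl_mpoly_ring[OF pf_gens_polys, of n t] by (simp add: pfaffian_ideal_def skew_ring_def skew_vars_def pf_gens_def)

lemma phi_skew_vars:
  "p \<in> polys (skew_vars n - edges E) \<Longrightarrow> phi d p \<in> polys (lss_vars n d)"
  using polys_mono[of "skew_vars n - edges E" "skew_vars n"] by (intro polys_phi) auto

text \<open>In the variables outside the edges the ideal is a preimage of a prime under a ring
  homomorphism; the edge variables, which do not occur in the generators, are adjoined
  afterwards.\<close>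

lemma prime_transfer:
  assumes "prime_in (lss_vars n d) (gen.span (edge_poly d ` edges E :: 'k::field_char_0 mpoly set) \<inter> polys (lss_vars n d))"
  shows "prime_in (skew_vars n) (gen.span (pf_gens n (d + 1) (graph_skew_matrix E) :: 'k mpoly set) \<inter> polys (skew_vars n))"
proof (rule prime_in_extend[OF pf_gens_graph_polys])
  let ?X = "skew_vars n - edges E" and ?P = "gen.span (pf_gens n (d + 1) (graph_skew_matrix E) :: 'k mpoly set)"
    and ?L = "gen.span (edge_poly d ` edges E :: 'k mpoly set)"
  have L1: "1 \<notin> ?L" and L2: "\<And>p q. p \<in> polys (lss_vars n d) \<Longrightarrow> q \<in> polys (lss_vars n d) \<Longrightarrow> p * q \<in> ?L \<Longrightarrow> p \<in> ?L \<or> q \<in> ?L"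
    using assms by (auto simp: prime_in_def polys_mult)
  show "prime_in ?X (?P \<inter> polys ?X)"
    unfolding prime_in_def
  proof (intro conjI ballI impI)
    show "idealin ?X (?P \<inter> polys ?X)" by (rule idealin_span[OF pf_gens_graph_polys])
    show "1 \<notin> ?P \<inter> polys ?X" using in_graph_pfaffian_iff[of "1 :: 'k mpoly"] L1 by (simp add: alghom_1)
    fix p q assume pq: "p \<in> polys ?X" "q \<in> polys ?X" "p * q \<in> ?P \<inter> polys ?X"
    then have "phi d p * phi d q \<in> ?L" using in_graph_pfaffian_iff[of "p * q"] by (simp add: alghom_mult)
    from L2[OF phi_skew_vars[OF pq(1)] phi_skew_vars[OF pq(2)] this]
    show "p \<in> ?P \<inter> polys ?X \<or> q \<in> ?P \<inter> polys ?X" using in_graph_pfaffian_iff pq(1,2) by auto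
  qed
qed blast

lemma radical_transfer:
  assumes "radical_in (lss_vars n d) (gen.span (edge_poly d ` edges E :: 'k::field_char_0 mpoly set) \<inter> polys (lss_vars n d))"
  shows "radical_in (skew_vars n) (gen.span (pf_gens n (d + 1) (graph_skew_matrix E) :: 'k mpoly set) \<inter> polys (skew_vars n))"
proof (rule radical_in_extend[OF pf_gens_graph_polys])
  let ?X = "skew_vars n - edges E" and ?P = "gen.span (pf_gens n (d + 1) (graph_skew_matrix E) :: 'k mpoly set)"
    and ?L = "gen.span (edge_poly d ` edges E :: 'k mpoly set)"
  have L: "\<And>p m. p \<in> polys (lss_vars n d) \<Longrightarrow> p ^ m \<in> ?L \<Longrightarrow> p \<in> ?L"
    using assms by (auto simp: radical_in_def polys_power)
  show "radical_in ?X (?P \<inter> polys ?X)"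
    unfolding radical_in_def
  proof (intro conjI ballI allI impI)
    show "idealin ?X (?P \<inter> polys ?X)" by (rule idealin_span[OF pf_gens_graph_polys])
    fix p m assume p: "p \<in> polys ?X" "p ^ m \<in> ?P \<inter> polys ?X"
    then have "phi d p ^ m \<in> ?L" using in_graph_pfaffian_iff[of "p ^ m"] by (simp add: alghom_power)
    from L[OF phi_skew_vars[OF p(1)] this]
    show "p \<in> ?P \<inter> polys ?X" using in_graph_pfaffian_iff p(1) by auto
  qed
qed blast

end


section \<open>Equality of the heights\<close>

section \<open>Comparison of heights\<close>

lemma one_notin_span_homog:
  assumes "\<And>b. b \<in> B \<Longrightarrow> \<exists>r. homog w (Suc r) b"
  shows "(1 :: 'k::field mpoly) \<notin> gen.span B"
proof
  have *: "hcomp w 0 p = 0" if "p \<in> gen.span B" for p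
    using that
  proof (induction rule: gen.span_induct_alt)
    case base
    then show ?case by (simp add: lin_0)
  next
    case (step c b y)
    obtain r where "homog w (Suc r) b" using assms[OF step(1)] by blast
    from hcomp_mult_homog[OF this, of 0 c] step(2) show ?case by (simp add: lin_add mult.commute)
  qed
  assume "(1 :: 'k mpoly) \<in> gen.span B"
  from *[OF this] have "hcomp w 0 (1 :: 'k mpoly) = 0" .
  moreover have "hcomp w 0 (1 :: 'k mpoly) = 1" by (simp add: hcomp_homog[OF homog_1])
  ultimately show False by simp
qed

lemma homog_Un_mvar:
  assumes "\<And>g. g \<in> G \<Longrightarrow> \<exists>r. homog (\<lambda>_. 1) (Suc r) g" and "b \<in> G \<union> mvar ` Es"
  shows "\<exists>r. homog (\<lambda>_. 1) (Suc r) b"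
  using assms(2)
proof
  assume "b \<in> mvar ` Es"
  then have "homog (\<lambda>_. 1) (Suc 0) b" using homog_mvar[of "\<lambda>_. 1"] by auto
  then show ?thesis by blast
qed (rule assms(1))

lemma homog_pf_gens:
  assumes "g \<in> pf_gens n t generic_skew_matrix"
  shows "homog (\<lambda>_. 1) t g"
proof -
  have m: "homog (\<lambda>_. 1) 1 (generic_skew_matrix i j :: 'a mpoly)" for i j
  proof -
    have v: "homog (\<lambda>_. 1) 1 (mvar v :: 'a mpoly)" for v using homog_mvar[of "\<lambda>_. 1" v] by simp
    then have "homog (\<lambda>_. 1) 1 (- mvar v :: 'a mpoly)" for v using homog_diff[OF homog_0 v] by simp
    then show ?thesis using v by (simp add: generic_skew_matrix_def)
  qed
  have "homog (\<lambda>_. 1) t (pfaffian t (\<lambda>a b. generic_skew_matrix (l ! a) (l ! b)) :: 'a mpoly)" for l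
    unfolding pfaffian_def cst_of_int[symmetric]
    using homog_prod_power[where A = "{..<t}" and r = 1 and e = "\<lambda>_. 1", OF m]
    by (intro homog_sum homog_cst_mult) simp
  then show ?thesis using assms by (auto simp: pf_gens_def)
qed

text \<open>All generators are homogeneous, so components above degree \<open>D\<close> can be
  discarded on both sides; a cofactor of a variable then has degree below \<open>D\<close>.\<close>

lemma span_image_truncate:
  fixes G :: "'k::field mpoly set"
  assumes X: "Es \<subseteq> X" "finite Es" "G \<subseteq> polys X" and G: "\<And>g. g \<in> G \<Longrightarrow> \<exists>r. homog (\<lambda>_. 1) r g"
    and p: "p \<in> gen.span (G \<union> mvar ` Es)" "p \<in> polys X" "\<And>m. m \<in> keys p \<Longrightarrow> deg m \<le> D"
  shows "\<exists>a. (\<forall>e\<in>Es. a e \<in> polys X \<and> (\<forall>m\<in>keys (a e). deg m < D)) \<and> p - (\<Sum>e\<in>Es. mvar e * a e) \<in> gen.span G \<inter> polys X"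
proof -
  obtain x y where xy: "p = x + y" "x \<in> gen.span G" "y \<in> gen.span (mvar ` Es)"
    using p(1) unfolding gen.span_Un by blast
  obtain b where b: "y = (\<Sum>e\<in>Es. b e * mvar e)" using span_image_finite[OF X(2) xy(3)] by blast
  define a where "a e = kill X (\<Sum>s<D. hcomp (\<lambda>_. 1) s (b e))" for e
  have hc: "(\<Sum>s\<le>D. hcomp (\<lambda>_. 1) s (b e * mvar e)) = (\<Sum>s<D. hcomp (\<lambda>_. 1) s (b e)) * mvar e" for e
  proof -
    have "hcomp (\<lambda>_. 1) s (b e * mvar e) = (if s = 0 then 0 else mvar e * hcomp (\<lambda>_. 1) (s - 1) (b e))" for s
      using hcomp_mult_homog[OF homog_mvar, of "\<lambda>_. 1" s e "b e"] by (auto simp: mult.commute)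
    then have "(\<Sum>s\<le>D. hcomp (\<lambda>_. 1) s (b e * mvar e)) = (\<Sum>s\<le>D. if s = 0 then 0 else mvar e * hcomp (\<lambda>_. 1) (s - 1) (b e))"
      by simp
    also have "\<dots> = (\<Sum>s<D. mvar e * hcomp (\<lambda>_. 1) s (b e))" by (simp add: sum.atMost_shift)
    finally show ?thesis by (simp add: sum_distrib_left mult.commute)
  qed
  have "p = (\<Sum>s\<le>D. hcomp (\<lambda>_. 1) s p)" using p(3) by (rule sum_hcomp)
  also have "\<dots> = (\<Sum>s\<le>D. hcomp (\<lambda>_. 1) s x) + (\<Sum>e\<in>Es. \<Sum>s\<le>D. hcomp (\<lambda>_. 1) s (b e * mvar e))"
    unfolding xy(1) b lin_add[OF lin_hcomp] lin_sum[OF lin_hcomp] sum.distrib by (subst (2) sum.swap) (rule refl)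
  finally have eq: "p = (\<Sum>s\<le>D. hcomp (\<lambda>_. 1) s x) + (\<Sum>e\<in>Es. (\<Sum>s<D. hcomp (\<lambda>_. 1) s (b e)) * mvar e)"
    unfolding hc .
  have kl: "lin (kill X :: 'k mpoly \<Rightarrow> _)" by (rule alghom_lin[OF alghom_kill])
  have km: "kill X (q * mvar e) = mvar e * kill X q" if "e \<in> Es" for e and q :: "'k mpoly"
  proof -
    have "kill X (mvar e) = (mvar e :: 'k mpoly)" using that X(1) by (intro kill_id) auto
    then show ?thesis by (simp add: alghom_mult[OF alghom_kill] mult.commute)
  qed
  have "p = kill X ((\<Sum>s\<le>D. hcomp (\<lambda>_. 1) s x) + (\<Sum>e\<in>Es. (\<Sum>s<D. hcomp (\<lambda>_. 1) s (b e)) * mvar e))"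
    using kill_id[OF p(2)] eq by simp
  also have "\<dots> = kill X (\<Sum>s\<le>D. hcomp (\<lambda>_. 1) s x) + (\<Sum>e\<in>Es. mvar e * a e)"
    unfolding lin_add[OF kl] lin_sum[OF kl, of _ Es] a_def by (simp add: km cong: sum.cong)
  finally have "p - (\<Sum>e\<in>Es. mvar e * a e) = kill X (\<Sum>s\<le>D. hcomp (\<lambda>_. 1) s x)" by simp
  moreover have "(\<Sum>s\<le>D. hcomp (\<lambda>_. 1) s x) \<in> gen.span G"
    by (intro gen.span_sum span_homog_hcomp[OF G xy(2)])
  then have "kill X (\<Sum>s\<le>D. hcomp (\<lambda>_. 1) s x) \<in> gen.span G"
  proof (rule alghom_span[OF alghom_kill, rotated])
    fix g assume g: "g \<in> G"
    then have "kill X g = g" using X(3) by (intro kill_id) auto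
    then show "kill X g \<in> gen.span G" using g by (simp add: gen.span_base)
  qed
  moreover have "deg m < D" if m: "m \<in> keys (a e)" for e m
  proof -
    have kd: "homog (\<lambda>_. 1) s (kill X (hcomp (\<lambda>_. 1) s (b e)))" for s
    proof -
      have "homog (\<lambda>_. 1) 1 (kill X (mvar v) :: 'k mpoly)" for v
        by (simp add: kill_def homog_mvar[of "\<lambda>_. 1", unfolded One_nat_def])
      then have "hcomp (\<lambda>_. 1) s (kill X (hcomp (\<lambda>_. 1) s (b e))) = kill X (hcomp (\<lambda>_. 1) s (hcomp (\<lambda>_. 1) s (b e)))"
        by (intro hcomp_alghom[where V = UNIV]) auto
      then show ?thesis unfolding homog_iff_hcomp hcomp_hcomp by simp
    qed
    have "m \<in> keys (\<Sum>s<D. kill X (hcomp (\<lambda>_. 1) s (b e)))" using m unfolding a_def lin_sum[OF kl] .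
    then have "(\<Sum>s<D. lookup (kill X (hcomp (\<lambda>_. 1) s (b e))) m) \<noteq> 0" by (simp add: in_keys_iff lookup_sum)
    then obtain s where "s < D" "lookup (kill X (hcomp (\<lambda>_. 1) s (b e))) m \<noteq> 0" by (meson lessThan_iff sum.neutral)
    then show ?thesis using kd[of s] by (simp add: homog_def in_keys_iff)
  qed
  moreover have "a e \<in> polys X" for e unfolding a_def by (rule kill_polys')
  ultimately show ?thesis by (intro exI[of _ a]) (auto simp: kill_polys')
qed

lemma idealin_add: "idealin X I \<Longrightarrow> p \<in> I \<Longrightarrow> q \<in> I \<Longrightarrow> p + q \<in> I"
  by (simp add: idealin_def)

text \<open>After reduction modulo the larger ideal the remainder is, modulo \<open>G\<close>, a
  combination of the variables \<open>Es\<close> with cofactors of smaller degree, to which the same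
  reduction applies. Each round contributes one variable to \<open>\<alpha>\<close>.\<close>

lemma span_variables_growth:
  fixes G :: "'k::field mpoly set"
  assumes X: "Es \<subseteq> X" "finite X" "G \<subseteq> polys X" and G: "\<And>g. g \<in> G \<Longrightarrow> \<exists>r. homog (\<lambda>_. 1) r g"
    and p: "p \<in> polys X" "\<And>m. m \<in> keys p \<Longrightarrow> deg m \<le> D"
  shows "\<exists>r\<in>kv.span ((\<lambda>(\<alpha>, m). xmon (\<alpha> + m)) ` ({\<alpha>. keys \<alpha> \<subseteq> Es \<and> (\<forall>v\<in>Es. lookup \<alpha> v \<le> D)} \<times>
      {m. keys m \<subseteq> X \<and> m \<notin> lead_mons (gen.span (G \<union> mvar ` Es) \<inter> polys X) \<and> deg m \<le> D})).
    p - r \<in> gen.span G \<inter> polys X"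
  using p
proof (induction D arbitrary: p rule: less_induct)
  case (less D)
  let ?J = "gen.span (G \<union> mvar ` Es) \<inter> polys X" and ?P = "gen.span G \<inter> polys X"
  let ?T = "\<lambda>D. (\<lambda>(\<alpha>, m). xmon (\<alpha> + m) :: 'k mpoly) ` ({\<alpha>. keys \<alpha> \<subseteq> Es \<and> (\<forall>v\<in>Es. lookup \<alpha> v \<le> D)} \<times>
      {m. keys m \<subseteq> X \<and> m \<notin> lead_mons ?J \<and> deg m \<le> D})"
  have fin: "finite Es" using X(1,2) finite_subset by blast
  have IJ: "idealin X ?J" using X(1,3) by (intro idealin_span) auto
  have IP: "idealin X ?P" by (rule idealin_span[OF X(3)])
  obtain r where r: "r \<in> polys X" "p - r \<in> ?J" "\<forall>m\<in>keys r. deg m \<le> D \<and> m \<notin> lead_mons ?J"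
    using normal_form[OF X(2) IJ less(2,3)] by blast
  have dg: "deg m \<le> D" if "m \<in> keys (p - r)" for m
  proof -
    have "m \<in> keys p \<union> keys r" using that by (auto simp: in_keys_iff lookup_minus)
    then show ?thesis using less(3) r(3) by blast
  qed
  from r(2) have "p - r \<in> gen.span (G \<union> mvar ` Es)" by simp
  from span_image_truncate[OF X(1) fin X(3) G this polys_diff[OF less(2) r(1)] dg]
  obtain a where a: "\<And>e. e \<in> Es \<Longrightarrow> a e \<in> polys X" "\<And>e m. e \<in> Es \<Longrightarrow> m \<in> keys (a e) \<Longrightarrow> deg m < D"
    "p - r - (\<Sum>e\<in>Es. mvar e * a e) \<in> ?P" by auto
  have "\<exists>b. b \<in> kv.span (?T D) \<and> mvar e * a e - b \<in> ?P" if e: "e \<in> Es" for e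
  proof (cases "a e = 0")
    case True
    then show ?thesis using IP kv.span_zero by (intro exI[of _ 0]) (simp add: idealin_def)
  next
    case False
    then obtain m where "m \<in> keys (a e)" by (metis all_not_in_conv keys_eq_empty)
    then have D: "D - 1 < D" "\<And>m. m \<in> keys (a e) \<Longrightarrow> deg m \<le> D - 1" using a(2)[OF e] by fastforce+
    obtain q where q: "q \<in> kv.span (?T (D - 1))" "a e - q \<in> ?P" using less(1)[OF D(1) a(1)[OF e] D(2)] by blast
    have "mvar e * q \<in> kv.span (?T D)"
      using q(1)
    proof (induction rule: kv.span_induct_alt)
      case base
      then show ?case by (simp add: kv.span_zero)
    next
      case (step c b y)
      then obtain \<alpha> m where am: "b = xmon (\<alpha> + m)" "keys \<alpha> \<subseteq> Es" "\<forall>v\<in>Es. lookup \<alpha> v \<le> D - 1"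
        "keys m \<subseteq> X" "m \<notin> lead_mons ?J" "deg m \<le> D - 1" by auto
      have "mvar e * b = xmon ((Poly_Mapping.single e 1 + \<alpha>) + m)" unfolding am(1) mvar_xmon xmon_add by (simp only: mult.assoc)
      also have "\<dots> \<in> ?T D"
        using am e D(1) by (intro image_eqI[of _ _ "(Poly_Mapping.single e 1 + \<alpha>, m)"])
          (auto simp: keys_add_mexp lookup_add lookup_single when_def)
      finally have "cst c * (mvar e * b) + mvar e * y \<in> kv.span (?T D)"
        by (rule kv.span_add[OF kv.span_scale[OF kv.span_base] step(2)])
      then show ?case by (simp only: distrib_left mult.left_commute)
    qed
    moreover have "mvar e * (a e - q) \<in> ?P" using IP q(2) e X(1) by (auto simp: idealin_def)
    ultimately show ?thesis by (intro exI[of _ "mvar e * q"]) (simp only: right_diff_distrib)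
  qed
  then have "\<forall>e\<in>Es. \<exists>b. b \<in> kv.span (?T D) \<and> mvar e * a e - b \<in> ?P" by blast
  from bchoice[OF this] obtain b where b: "\<And>e. e \<in> Es \<Longrightarrow> b e \<in> kv.span (?T D)" "\<And>e. e \<in> Es \<Longrightarrow> mvar e * a e - b e \<in> ?P"
    by blast
  have "(\<Sum>m\<in>keys r. cst (lookup r m) * xmon m) \<in> kv.span (?T D)"
  proof (intro kv.span_sum kv.span_scale kv.span_base)
    fix m assume m: "m \<in> keys r"
    then show "xmon m \<in> ?T D" using r(3) polysD[OF r(1)] by (intro image_eqI[of _ _ "(0, m)"]) auto
  qed
  then have rT: "r + (\<Sum>e\<in>Es. b e) \<in> kv.span (?T D)"
    using b(1) mpoly_sum_monomials[of r] by (intro kv.span_add kv.span_sum) auto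
  have "(p - r - (\<Sum>e\<in>Es. mvar e * a e)) + (\<Sum>e\<in>Es. mvar e * a e - b e) \<in> ?P"
    by (rule idealin_add[OF IP a(3) idealin_sum[OF IP b(2)]])
  moreover have "(p - r - (\<Sum>e\<in>Es. mvar e * a e)) + (\<Sum>e\<in>Es. mvar e * a e - b e) = p - (r + (\<Sum>e\<in>Es. b e))"
    by (simp add: sum_subtractf)
  ultimately have "p - (r + (\<Sum>e\<in>Es. b e)) \<in> ?P" by (simp only:)
  with rT show ?case by (rule bexI[rotated])
qed

text \<open>Modulo the ideal spanned by \<open>G\<close>, a polynomial of degree at most \<open>D\<close> is a combination of monomials in
  the variables \<open>Es\<close> times monomials that are standard modulo the larger ideal; compare growth rates.\<close>

lemma vdim_add_variables:
  fixes G :: "'k::field mpoly set"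
  assumes X: "Es \<subseteq> X" "finite X" "G \<subseteq> polys X" and G: "\<And>g. g \<in> G \<Longrightarrow> \<exists>r. homog (\<lambda>_. 1) (Suc r) g"
  shows "vdim X (gen.span G \<inter> polys X) \<le> card Es + vdim X (gen.span (G \<union> mvar ` Es) \<inter> polys X)"
proof -
  let ?J = "gen.span (G \<union> mvar ` Es) \<inter> polys X" and ?P = "gen.span G \<inter> polys X"
  have fin: "finite Es" using X(1,2) finite_subset by blast
  have IJ: "idealin X ?J" using X(1,3) by (intro idealin_span) auto
  have IP: "idealin X ?P" by (rule idealin_span[OF X(3)])
  have 1: "1 \<notin> gen.span (G \<union> mvar ` Es)" using homog_Un_mvar[OF G] by (rule one_notin_span_homog)
  have 1: "1 \<notin> ?J" "1 \<notin> ?P" using 1 gen.span_mono[of G "G \<union> mvar ` Es"] by auto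
  have G': "\<exists>r. homog (\<lambda>_. 1) r g" if "g \<in> G" for g using G[OF that] by blast
  obtain C where C: "\<And>D. card {m. keys m \<subseteq> X \<and> m \<notin> lead_mons ?J \<and> deg m \<le> D} \<le> C * (D + 1) ^ vdim X ?J"
    using standard_growth[OF X(2) IJ 1(1)] by blast
  obtain V where V: "V \<subseteq> X" "indep ?P V" "card V = vdim X ?P" using vdim(1)[OF X(2) IP 1(2)] by blast
  have finV: "finite V" using V(1) X(2) finite_subset by blast
  \<comment> \<open>Monomials in an independent set \<open>V\<close> on the left; on the right the
    spanning set, in which the variables \<open>Es\<close> contribute the exponent
    \<open>card Es\<close> and the standard monomials contribute \<open>vdim X ?J\<close>.\<close>
  have "(t + 1) ^ card V \<le> C * (t * card V + 1) ^ (card Es + vdim X ?J)" for t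
  proof -
    let ?D = "t * card V"
    let ?A = "{m. keys m \<subseteq> V \<and> (\<forall>v\<in>V. lookup m v \<le> t)}"
    let ?B = "{\<alpha>. keys \<alpha> \<subseteq> Es \<and> (\<forall>v\<in>Es. lookup \<alpha> v \<le> ?D)}" and ?S = "{m. keys m \<subseteq> X \<and> m \<notin> lead_mons ?J \<and> deg m \<le> ?D}"
    let ?T = "(\<lambda>(\<alpha>, m). xmon (\<alpha> + m) :: 'k mpoly) ` (?B \<times> ?S)"
    have finS: "finite ?S" by (rule finite_subset[OF _ finite_mexp_degree[OF X(2), of ?D]]) auto
    have finBS: "finite (?B \<times> ?S)" using finS finite_mexp_bounded(1)[OF fin] by (rule finite_cartesian_product[rotated])
    have "card ?A \<le> card ?T"
    proof (rule card_independent_mod[OF IP, of _ _ xmon])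
      show "finite ?A" by (rule finite_mexp_bounded(1)[OF finV])
      show "finite ?T" using finBS by (rule finite_imageI)
      fix m assume m: "m \<in> ?A"
      show "\<exists>r\<in>kv.span ?T. xmon m - r \<in> ?P"
        by (rule span_variables_growth[OF X G']) (use m V(1) deg_bounded[OF finV, of m t] in auto)
    next
      fix c assume "(\<Sum>a\<in>?A. cst (c a) * xmon a) \<in> ?P"
      moreover have "(\<Sum>a\<in>?A. cst (c a) * xmon a) \<in> polys V" by (intro polys_sum polys_mult) auto
      ultimately have "(\<Sum>a\<in>?A. cst (c a) * xmon a) = 0" using V(2) by (simp add: indep_def)
      then show "\<forall>a\<in>?A. c a = 0" using sum_cst_xmon_eq_0[OF finite_mexp_bounded(1)[OF finV]] by blast
    qed
    also have "\<dots> \<le> card (?B \<times> ?S)" by (rule card_image_le[OF finBS])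
    also have "\<dots> = (?D + 1) ^ card Es * card ?S" unfolding card_cartesian_product finite_mexp_bounded(2)[OF fin] ..
    also have "\<dots> \<le> (?D + 1) ^ card Es * (C * (?D + 1) ^ vdim X ?J)" by (rule mult_left_mono[OF C]) simp
    also have "\<dots> = C * (?D + 1) ^ (card Es + vdim X ?J)" unfolding power_add by (simp only: mult.left_commute)
    finally show ?thesis unfolding finite_mexp_bounded(2)[OF finV] .
  qed
  then have "card V \<le> card Es + vdim X ?J" by (rule power_growth)
  then show ?thesis unfolding V(3) .
qed


text \<open>Moves an exponent in edge variables to the corresponding auxiliary variables.\<close>

definition tshift :: "mexp \<Rightarrow> mexp" where
  "tshift \<alpha> = (\<Sum>v\<in>keys \<alpha>. Poly_Mapping.single (tvar v) (lookup \<alpha> v))"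

lemma inj_tvar: "inj tvar" by (auto simp: inj_def tvar_def)

lemma lookup_tshift: "lookup (tshift \<alpha>) (tvar v) = lookup \<alpha> v"
proof -
  have "lookup (tshift \<alpha>) (tvar v) = (\<Sum>u\<in>keys \<alpha>. if u = v then lookup \<alpha> u else 0)"
    unfolding tshift_def lookup_sum
    by (intro sum.cong refl) (auto simp: lookup_single when_def inj_eq[OF inj_tvar])
  then show ?thesis by (simp add: in_keys_iff)
qed

lemma tshift_inj: "tshift \<alpha> = tshift \<beta> \<longleftrightarrow> \<alpha> = \<beta>"
  by (metis lookup_tshift poly_mapping_eqI)

lemma keys_tshift: "keys (tshift \<alpha>) \<subseteq> tvar ` keys \<alpha>"
  unfolding tshift_def using keys_sum[of "\<lambda>v. Poly_Mapping.single (tvar v) (lookup \<alpha> v)" "keys \<alpha>"]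
  by (fastforce split: if_splits)

lemma xmon_tshift: "xmon (tshift \<alpha>) = mprod (\<lambda>v. mvar (tvar v)) \<alpha>"
proof -
  have "xmon (Poly_Mapping.single v k) = (mvar v ^ k :: 'a mpoly)" for v k
    using xmon_mprod[of "Poly_Mapping.single v k"] by simp
  then show ?thesis unfolding tshift_def mprod_def by (simp add: xmon_sum)
qed

text \<open>\<open>phi_edges\<close> is \<open>phi\<close> with an independent copy of the variables of the edges.\<close>

definition phi_edges :: "(nat \<times> nat) set \<Rightarrow> nat \<Rightarrow> 'k::field mpoly \<Rightarrow> 'k mpoly" where
  "phi_edges W d = subst (\<lambda>v. if v \<in> W then mvar (tvar v) else edge_poly d v)"

lemma alghom_phi_edges [simp]: "alghom (phi_edges W d)" by (simp add: phi_edges_def)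

lemma lss_vars_main: "lss_vars n d \<subseteq> main_vars" by (auto simp: lss_vars_def)

text \<open>Because the copied variables are disjoint from the variables of the f_ij, extracting a
  coefficient before the map or after it gives the same result.\<close>

lemma cf_phi_edges:
  assumes p: "p \<in> polys (skew_vars n)"
  shows "cf (tvar ` W) (tshift \<alpha>) (phi_edges W d p) = phi d (cf W \<alpha> p)"
proof (rule lin_eqI[of "\<lambda>p. cf (tvar ` W) (tshift \<alpha>) (phi_edges W d p)" "\<lambda>p. phi d (cf W \<alpha> p)"])
  show "lin (\<lambda>p. cf (tvar ` W) (tshift \<alpha>) (phi_edges W d p))" by (rule lin_comp[OF lin_cf alghom_lin[OF alghom_phi_edges]])
  show "lin (\<lambda>p. phi d (cf W \<alpha> p))" by (rule lin_comp[OF alghom_lin[OF alghom_phi] lin_cf])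
  fix m assume m: "m \<in> keys p"
  let ?a = "restr W m" and ?b = "restr (- W) m"
  have "phi_edges W d (xmon ?b) = phi d (xmon ?b :: 'a mpoly)"
    by (rule alghom_eqI[of _ _ _ "- W"]) (auto simp: phi_edges_def)
  moreover have "phi_edges W d (xmon ?a) = (xmon (tshift ?a) :: 'a mpoly)"
    unfolding xmon_tshift alghom_xmon[OF alghom_phi_edges]
    by (simp add: mprod_def phi_edges_def)
  moreover have "xmon m = xmon ?a * (xmon ?b :: 'a mpoly)" unfolding xmon_add[symmetric] restr_split[symmetric] ..
  ultimately have x: "phi_edges W d (xmon m) = xmon (tshift ?a) * phi d (xmon ?b :: 'a mpoly)"
    by (simp add: alghom_mult)
  have b: "phi d (xmon ?b) \<in> polys (- tvar ` W)"
  proof -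
    have "phi d (xmon ?b) \<in> polys (lss_vars n d)" using polysD[OF p m] by (intro polys_phi) auto
    moreover have "lss_vars n d \<subseteq> - tvar ` W" by (auto simp: lss_vars_def tvar_def)
    ultimately show ?thesis using polys_mono by blast
  qed
  have k: "keys (tshift ?a) \<subseteq> tvar ` W" using keys_tshift[of ?a] by auto
  show "cf (tvar ` W) (tshift \<alpha>) (phi_edges W d (xmon m)) = phi d (cf W \<alpha> (xmon m :: 'a mpoly))"
    unfolding x cf_xmon_mult[OF b k] cf_xmon by (simp add: tshift_inj lin_0[OF alghom_lin] eq_commute)
qed

text \<open>A single edge cannot be nested in itself, so for \<open>d\<close> at least 1 single
  variables are nest-free and independence of their images is a special case of
  \<open>phi_nest_free_independent\<close>.\<close>

lemma edge_poly_independent: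
  assumes d: "d \<ge> 1" and Es: "finite Es" "Es \<subseteq> skew_vars n"
    and 0: "(\<Sum>e\<in>Es. cst (c e) * edge_poly d e) = (0 :: 'k::field_char_0 mpoly)" and e: "e \<in> Es"
  shows "c e = 0"
proof -
  define s where "s = (\<Sum>e\<in>Es. cst (c e) * mvar e)"
  have lk: "lookup s m = (\<Sum>e\<in>Es. if Poly_Mapping.single e 1 = m then c e else 0)" for m
    unfolding s_def lookup_sum mvar_xmon by (intro sum.cong refl) (simp add: lookup_cst_mult lookup_xmon)
  have "s = 0"
  proof (rule phi_nest_free_independent)
    show "s \<in> polys (skew_vars n)" unfolding s_def using Es(2) by (intro polys_sum polys_mult) auto
    show "phi d s = 0"
      unfolding s_def lin_sum[OF alghom_lin[OF alghom_phi]] lin_scale[OF alghom_lin[OF alghom_phi]] phi_mvar by (rule 0)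
    fix m assume "m \<in> keys s"
    then have "(\<Sum>e\<in>Es. if Poly_Mapping.single e 1 = m then c e else 0) \<noteq> 0" by (simp add: in_keys_iff lk)
    then obtain v where "(if Poly_Mapping.single v 1 = m then c v else 0) \<noteq> 0"
      by (rule sum.not_neutral_contains_not_neutral)
    then have v: "Poly_Mapping.single v 1 = m" by (simp split: if_splits)
    show "nest_free (d + 1) m"
      unfolding nest_free_def
    proof (intro allI impI notI)
      fix l assume l: "nest_chain (keys m) l" "length l = d + 1"
      have "set l \<subseteq> {v}" using l(1) unfolding v[symmetric] by (simp add: nest_chain_def)
      moreover have "l ! 0 \<in> set l" "l ! 1 \<in> set l" using l(2) d by (intro nth_mem; simp)+
      moreover have "nested (l ! 0) (l ! 1)"
        using l d by (auto simp: nest_chain_def sorted_wrt_iff_nth_less)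
      ultimately have "nested v v" by (metis singletonD subsetD)
      then show False by (simp add: nested_def)
    qed
  qed
  then have "0 = lookup s (Poly_Mapping.single e 1)" by simp
  also have "\<dots> = (\<Sum>e'\<in>Es. if e' = e then c e' else 0)"
  proof -
    have "Poly_Mapping.single e' (1::nat) = Poly_Mapping.single e 1 \<longleftrightarrow> e' = e" for e' :: "nat \<times> nat"
      by (metis lookup_single_eq lookup_single_not_eq zero_neq_one)
    then show ?thesis unfolding lk by simp
  qed
  also have "\<dots> = c e" using Es(1) e by simp
  finally show ?thesis by simp
qed

text \<open>Regularity in the carrier passes to the ambient ring by comparing coefficients at the
  monomials in the remaining variables. The sequence is padded with zeros so that it is indexed by
  all naturals.\<close>

lemma regular_sequence_span:
  fixes fs :: "'k::field mpoly list"
  assumes "regular_sequence (mpoly_ring TYPE('k) Y) fs"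
    and f_def: "\<And>j. f j = (if j < length fs then fs ! j else 0)"
  shows "f j \<in> polys Y" and "f ` {..<length fs} = set fs"
    and "i < length fs \<Longrightarrow> f i * a \<in> gen.span (f ` {..<i}) \<Longrightarrow> a \<in> gen.span (f ` {..<i})"
proof -
  have fs: "set fs \<subseteq> polys Y" using assms(1) by (simp add: regular_sequence_def)
  then show fY: "f j \<in> polys Y" for j by (auto simp: f_def)
  show "f ` {..<length fs} = set fs" by (force simp: f_def set_conv_nth)
  assume i: "i < length fs" and a: "f i * a \<in> gen.span (f ` {..<i})"
  have im: "f ` {..<i} = set (take i fs)"
    using i by (auto simp: f_def set_conv_nth image_iff) (metis lessThan_iff nth_take order_less_trans)
  have sub: "set (take i fs) \<subseteq> polys Y" using fs set_take_subset[of i fs] by blast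
  have reg: "b \<in> gen.span (f ` {..<i})" if "b \<in> polys Y" "f i * b \<in> gen.span (f ` {..<i})" for b
  proof -
    have "f i * b \<in> Idl\<^bsub>mpoly_ring TYPE('k) Y\<^esub> (set (take i fs))"
      unfolding Idl_mpoly_ring[OF sub] using that fY[of i] by (simp add: im polys_mult)
    then have "b \<in> Idl\<^bsub>mpoly_ring TYPE('k) Y\<^esub> (set (take i fs))"
      using assms(1) that(1) i by (simp add: regular_sequence_def f_def mpoly_ring_def polys_iff_mvars)
    then show ?thesis unfolding Idl_mpoly_ring[OF sub] by (simp add: im)
  qed
  have B: "f ` {..<i} \<subseteq> polys (- (- Y))" using sub im by simp
  show "a \<in> gen.span (f ` {..<i})"
    unfolding span_cf_iff[OF B, of a]
  proof
    fix \<mu>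
    have "f i * cf (- Y) \<mu> a \<in> gen.span (f ` {..<i})"
      using span_cf[OF B a, of \<mu>] cf_mult_const[of "f i" "- Y" \<mu> a] fY[of i] by simp
    moreover have "cf (- Y) \<mu> a \<in> polys Y" using polys_cf'[of "- Y" \<mu> a] by simp
    ultimately show "cf (- Y) \<mu> a \<in> gen.span (f ` {..<i})" by (rule reg[rotated])
  qed
qed

context graph
begin

lemma pf_gens_homog:
  "g \<in> pf_gens n (d + 1) (generic_skew_matrix :: nat \<Rightarrow> nat \<Rightarrow> 'k::field mpoly) \<Longrightarrow> \<exists>r. homog (\<lambda>_. 1) (Suc r) g"
  using homog_pf_gens[of g n "d + 1"] by auto

text \<open>All generators are homogeneous of positive degree, so the ideals are proper, as
  \<open>vdim\<close> requires.\<close>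

lemma one_notin:
  shows "(1 :: 'k::field mpoly) \<notin> gen.span (pf_gens n (d + 1) generic_skew_matrix \<union> mvar ` edges E)" (is ?A)
    and "(1 :: 'k mpoly) \<notin> gen.span (pf_gens n (d + 1) generic_skew_matrix)"
    and "(1 :: 'k mpoly) \<notin> gen.span (pf_gens n (d + 1) (graph_skew_matrix E))"
    and "gen.span (pf_gens n (d + 1) (graph_skew_matrix E)) \<subseteq>
      gen.span (pf_gens n (d + 1) generic_skew_matrix \<union> (mvar ` edges E :: 'k mpoly set))" (is ?B)
proof -
  show A: ?A using homog_Un_mvar[OF pf_gens_homog] by (rule one_notin_span_homog)
  then show "(1 :: 'k mpoly) \<notin> gen.span (pf_gens n (d + 1) generic_skew_matrix)"
    using gen.span_mono[OF Un_upper1] by blast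
  have "b \<in> gen.span (pf_gens n (d + 1) generic_skew_matrix \<union> (mvar ` edges E :: 'k mpoly set))"
    if b: "b \<in> pf_gens n (d + 1) (graph_skew_matrix E)" for b
  proof -
    obtain g where g: "g \<in> pf_gens n (d + 1) (generic_skew_matrix :: nat \<Rightarrow> nat \<Rightarrow> 'k mpoly)" "b = kill (- edges E) g"
      using b unfolding pf_gens_graph by blast
    have "g - b \<in> gen.span (pf_gens n (d + 1) generic_skew_matrix \<union> mvar ` edges E)"
      unfolding g(2) by (rule subsetD[OF gen.span_mono[OF Un_upper2] kill_congruent])
    moreover have "g \<in> gen.span (pf_gens n (d + 1) generic_skew_matrix \<union> mvar ` edges E)"
      using g(1) by (intro gen.span_base UnI1)
    ultimately have "g - (g - b) \<in> gen.span (pf_gens n (d + 1) generic_skew_matrix \<union> mvar ` edges E)"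
      by (rule gen.span_diff[rotated])
    then show ?thesis by simp
  qed
  then show ?B by (intro gen.span_minimal gen.subspace_span) auto
  then show "(1 :: 'k mpoly) \<notin> gen.span (pf_gens n (d + 1) (graph_skew_matrix E))" using A by blast
qed

abbreviation (input) Pfaffians :: "'k::field itself \<Rightarrow> 'k mpoly set" where
  "Pfaffians _ \<equiv> gen.span (pf_gens n (d + 1) generic_skew_matrix) \<inter> polys (skew_vars n)"
abbreviation (input) graph_Pfaffians :: "'k::field itself \<Rightarrow> 'k mpoly set" where
  "graph_Pfaffians _ \<equiv> gen.span (pf_gens n (d + 1) (graph_skew_matrix E)) \<inter> polys (skew_vars n)"

lemma graph_polys: "pf_gens n t (graph_skew_matrix E) \<subseteq> (polys (skew_vars n) :: 'k::field mpoly set)"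
  using pf_gens_graph_polys[of n t E] polys_mono[of "skew_vars n - edges E" "skew_vars n"] by blast

text \<open>Let \<open>?J\<close> be the generic Pfaffians plus the edge variables. A set
  independent modulo \<open>?J\<close> avoids the edges, and joined with them it is independent
  modulo the Pfaffians of the graph, in which no edge variable occurs; by
  \<open>vdim_add_variables\<close> it is then large enough.\<close>

lemma vdim_le: "vdim (skew_vars n) (Pfaffians TYPE('k::field)) \<le> vdim (skew_vars n) (graph_Pfaffians TYPE('k))"
proof -
  let ?X = "skew_vars n"
  let ?J = "gen.span (pf_gens n (d + 1) generic_skew_matrix \<union> (mvar ` edges E :: 'k mpoly set)) \<inter> polys ?X"
  have "pf_gens n (d + 1) generic_skew_matrix \<union> mvar ` edges E \<subseteq> (polys ?X :: 'k mpoly set)"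
    using pf_gens_polys edges_skew_vars by auto
  then have IJ: "idealin ?X ?J" by (rule idealin_span)
  have J1: "1 \<notin> ?J" using one_notin(1) by blast
  obtain V where V: "V \<subseteq> ?X" "indep ?J V" "card V = vdim ?X ?J" using vdim(1)[OF finite_skew_vars IJ J1] by blast
  have disj: "V \<inter> edges E = {}"
  proof (rule ccontr)
    assume "V \<inter> edges E \<noteq> {}"
    then obtain e where e: "e \<in> V" "e \<in> edges E" by blast
    have "mvar e \<in> ?J" using e edges_skew_vars by (auto intro: gen.span_base)
    then have "mvar e = (0 :: 'k mpoly)" using V(2) e(1) unfolding indep_def by simp
    then show False by (simp add: mvar_xmon)
  qed
  have "indep (graph_Pfaffians TYPE('k)) (V \<union> edges E)"
    unfolding indep_def
  proof (intro ballI impI)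
    fix p :: "'k mpoly" assume p: "p \<in> graph_Pfaffians TYPE('k)" "p \<in> polys (V \<union> edges E)"
    have "cf (edges E) \<mu> p = 0" for \<mu>
    proof -
      have "cf (edges E) \<mu> p \<in> gen.span (pf_gens n (d + 1) (graph_skew_matrix E))"
      proof (rule span_cf)
        show "pf_gens n (d + 1) (graph_skew_matrix E) \<subseteq> polys (- edges E)"
          using pf_gens_graph_polys polys_mono[of "skew_vars n - edges E" "- edges E"] by blast
      qed (use p in simp)
      then have "cf (edges E) \<mu> p \<in> gen.span (pf_gens n (d + 1) generic_skew_matrix \<union> mvar ` edges E)"
        using one_notin(4) by blast
      moreover have cV: "cf (edges E) \<mu> p \<in> polys V"
        using polys_cf[OF p(2), of "edges E"] polys_mono[of "V \<union> edges E - edges E" V] by blast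
      moreover have "cf (edges E) \<mu> p \<in> polys ?X" using cV polys_mono[OF V(1)] by blast
      ultimately show ?thesis using V(2) unfolding indep_def by blast
    qed
    then show "p = 0" using cf_sum[of "restr (edges E) ` keys p" "edges E" p] by simp
  qed
  then have "card (V \<union> edges E) \<le> vdim ?X (graph_Pfaffians TYPE('k))"
    using V(1) edges_skew_vars one_notin(3)
    by (intro vdim(2)[OF finite_skew_vars idealin_span[OF graph_polys]]) auto
  moreover have "card (V \<union> edges E) = card V + card (edges E)"
    using finite_subset[OF V(1) finite_skew_vars] finite_edges disj by (rule card_Un_disjoint)
  moreover have "vdim ?X (Pfaffians TYPE('k)) \<le> card (edges E) + vdim ?X ?J"
    by (rule vdim_add_variables[OF edges_skew_vars finite_skew_vars pf_gens_polys pf_gens_homog])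
  ultimately show ?thesis using V(3) by simp
qed

lemma indep_edges:
  assumes d: "d \<ge> 1" and CI: "complete_intersection (gen.span (edge_poly d ` edges E) \<inter> polys (lss_vars n d)) (mpoly_ring TYPE('k::field_char_0) (lss_vars n d))"
    and V: "V \<subseteq> skew_vars n - edges E" "indep (graph_Pfaffians TYPE('k)) V"
  shows "indep (Pfaffians TYPE('k)) (V \<union> edges E)"
  unfolding indep_def
proof (intro ballI impI)
  let ?Y = "lss_vars n d" and ?Es = "edges E" and ?S = "gen.span (edge_poly d ` edges E :: 'k mpoly set)"
  fix F :: "'k mpoly" assume F: "F \<in> Pfaffians TYPE('k)" "F \<in> polys (V \<union> ?Es)"
  obtain fs :: "'k mpoly list" where fs: "regular_sequence (mpoly_ring TYPE('k) ?Y) fs"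
    "?S \<inter> polys ?Y = Idl\<^bsub>mpoly_ring TYPE('k) ?Y\<^esub> (set fs)"
    using CI unfolding complete_intersection_def by blast
  define f where "f j = (if j < length fs then fs ! j else 0)" for j
  note f = regular_sequence_span[OF fs(1) f_def]
  have fsY: "set fs \<subseteq> polys ?Y" using fs(1) by (simp add: regular_sequence_def)
  have "gen.span (gen.span (set fs) \<inter> polys ?Y) = gen.span (?S \<inter> polys ?Y)"
    unfolding fs(2) Idl_mpoly_ring[OF fsY] ..
  then have fg: "gen.span (f ` {..<length fs}) = ?S"
    unfolding f(2) span_Int_mono[OF fsY] span_Int_mono[OF edge_poly_polys] .
  have fm: "f j \<in> polys main_vars" for j using f(1)[of j] polys_mono[OF lss_vars_main] by blast
  have gm: "edge_poly d e \<in> (polys main_vars :: 'k mpoly set)" if "e \<in> ?Es" for e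
    using that edge_poly_polys polys_mono[OF lss_vars_main] by blast
  have gh: "homog main_wt 2 (edge_poly d e :: 'k mpoly)" if "e \<in> ?Es" for e
  proof -
    have "main_wt (fst e, a) = 1" "main_wt (snd e, a) = 1" for a
      using that edges_skew_vars by (auto simp: main_wt_def skew_vars_def)
    then have "homog main_wt (1 + 1) (mvar (fst e, a) * mvar (snd e, b) :: 'k mpoly)" for a b
      using homog_mult[OF homog_mvar homog_mvar, of main_wt "(fst e, a)" "(snd e, b)"] by simp
    then show ?thesis unfolding twisted_lss_poly_def one_add_one by (intro homog_sum homog_diff)
  qed
  have ind: "\<forall>e\<in>?Es. c e = 0" if "(\<Sum>e\<in>?Es. cst (c e) * edge_poly d e) = (0 :: 'k mpoly)" for c
    using edge_poly_independent[OF d finite_edges edges_skew_vars that] by blast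
  \<comment> \<open>The degree in the edge variables, which \<open>phi_edges\<close> carries to
    \<open>aux_wt\<close>.\<close>
  define ew where "ew v = (if v \<in> ?Es then 1 else 0 :: nat)" for v
  let ?\<psi> = "phi_edges ?Es d :: 'k mpoly \<Rightarrow> 'k mpoly"
  have FX: "F \<in> polys (skew_vars n)" using F(1) by simp
  have \<psi>h: "homog aux_wt (ew v) (?\<psi> (mvar v))" if v: "v \<in> skew_vars n" for v
  proof (cases "v \<in> ?Es")
    case True
    then show ?thesis using homog_mvar[of aux_wt "tvar v"] by (simp add: phi_edges_def ew_def aux_wt_def tvar_def)
  next
    case False
    have "phi d (mvar v) \<in> (polys (lss_vars n d) :: 'k mpoly set)" using v by (intro polys_phi) simp
    then have "edge_poly d v \<in> (polys main_vars :: 'k mpoly set)" using polys_mono[OF lss_vars_main] by auto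
    then show ?thesis using False homog_aux_0 by (simp add: phi_edges_def ew_def)
  qed
  have \<psi>p: "?\<psi> F \<in> polys (main_vars \<union> tvar ` ?Es)"
    unfolding phi_edges_def
  proof (rule polys_subst[OF FX])
    fix v assume v: "v \<in> skew_vars n"
    have "phi d (mvar v) \<in> (polys (lss_vars n d) :: 'k mpoly set)" using v by (intro polys_phi) simp
    then have "edge_poly d v \<in> (polys (main_vars \<union> tvar ` ?Es) :: 'k mpoly set)"
      using polys_mono[of "lss_vars n d" "main_vars \<union> tvar ` ?Es"] lss_vars_main[of n d] by auto
    then show "(if v \<in> ?Es then mvar (tvar v) else edge_poly d v) \<in> (polys (main_vars \<union> tvar ` ?Es) :: 'k mpoly set)" by simp
  qed
  \<comment> \<open>Evaluating the copied variables at the f_e undoes the separation, so a Pfaffian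
    relation becomes a relation among the f_e.\<close>
  have "at_t (edge_poly d) (?\<psi> F) = phi d F"
  proof (rule alghom_eqI[of "\<lambda>p. at_t (edge_poly d) (?\<psi> p)", OF alghom_comp[OF at_t_simps(1) alghom_phi_edges] alghom_phi FX])
    fix v assume v: "v \<in> skew_vars n"
    have "phi d (mvar v) \<in> (polys (lss_vars n d) :: 'k mpoly set)" using v by (intro polys_phi) simp
    then have "edge_poly d v \<in> (polys main_vars :: 'k mpoly set)" using polys_mono[OF lss_vars_main] by auto
    then show "at_t (edge_poly d) (?\<psi> (mvar v)) = phi d (mvar v)" by (simp add: phi_edges_def at_t_id)
  qed
  also have "phi d F \<in> gen.span {}"
  proof (rule alghom_span[OF alghom_phi])
    show "F \<in> gen.span (pf_gens n (d + 1) generic_skew_matrix)" using F(1) by simp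
  qed (simp only: phi_pf_gens gen.span_zero)
  then have "phi d F = 0" by simp
  finally have at0: "at_t (edge_poly d) (?\<psi> F) = 0" .
  show "F = 0"
  proof (rule ccontr)
    assume "F \<noteq> 0"
    then obtain m0 where m0: "m0 \<in> keys F" by (metis all_not_in_conv keys_eq_empty)
    obtain m where m: "m \<in> keys F" "\<And>m'. m' \<in> keys F \<Longrightarrow> wt ew m \<le> wt ew m'"
      using ex_has_least_nat[of "\<lambda>m. m \<in> keys F" m0 "wt ew"] m0 by blast
    let ?t = "wt ew m"
    define F' where "F' = hcomp ew ?t F"
    have F'p: "F' \<in> polys (V \<union> ?Es)" "F' \<in> polys (skew_vars n)" unfolding F'_def by (intro polys_hcomp F(2) FX)+
    have "hcomp aux_wt ?t (?\<psi> F) \<in> ?S"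
      by (rule quasi_regular_generators[OF fm f(3) finite_edges gm gh ind fg \<psi>p
            alghom_wt_ge[OF alghom_phi_edges \<psi>h FX m(2)] at0])
    moreover have "hcomp aux_wt ?t (?\<psi> F) = ?\<psi> F'"
      unfolding F'_def by (rule hcomp_alghom[OF alghom_phi_edges \<psi>h FX])
    ultimately have S: "?\<psi> F' \<in> ?S" by simp
    \<comment> \<open>A coefficient of the lowest form maps into L, so it is a Pfaffian relation of
      the graph in the variables \<open>V\<close> alone.\<close>
    have "cf ?Es \<alpha> F' = 0" for \<alpha>
    proof -
      have "cf (tvar ` ?Es) (tshift \<alpha>) (?\<psi> F') \<in> ?S"
      proof (rule span_cf[OF _ S])
        have "lss_vars n d \<subseteq> - tvar ` ?Es" by (auto simp: lss_vars_def tvar_def)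
        then show "edge_poly d ` ?Es \<subseteq> polys (- tvar ` ?Es)" using edge_poly_polys polys_mono by blast
      qed
      then have p: "phi d (cf ?Es \<alpha> F') \<in> ?S" unfolding cf_phi_edges[OF F'p(2)] .
      have cV: "cf ?Es \<alpha> F' \<in> polys V"
        using polys_cf[OF F'p(1), of ?Es] polys_mono[of "V \<union> ?Es - ?Es" V] by blast
      then have cX: "cf ?Es \<alpha> F' \<in> polys (skew_vars n - ?Es)" using polys_mono[OF V(1)] by blast
      have "cf ?Es \<alpha> F' \<in> graph_Pfaffians TYPE('k)"
        using p in_graph_pfaffian_iff[OF cX] cX polys_mono[of "skew_vars n - ?Es" "skew_vars n"] by blast
      then show ?thesis using V(2) cV unfolding indep_def by blast
    qed
    then have "F' = 0" using cf_sum[of "restr ?Es ` keys F'" ?Es F'] by simp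
    then have "lookup (hcomp ew ?t F) m = 0" unfolding F'_def by simp
    then show False using m(1) by (simp add: lookup_hcomp in_keys_iff)
  qed
qed

text \<open>A largest independent set may contain some edges but need not contain all; these are
  removed and the full set of edges is adjoined, which does not lower the cardinality.\<close>

lemma vdim_ge:
  assumes d: "d \<ge> 1" and CI: "complete_intersection (gen.span (edge_poly d ` edges E) \<inter> polys (lss_vars n d)) (mpoly_ring TYPE('k::field_char_0) (lss_vars n d))"
  shows "vdim (skew_vars n) (graph_Pfaffians TYPE('k)) \<le> vdim (skew_vars n) (Pfaffians TYPE('k))"
proof -
  let ?X = "skew_vars n"
  obtain V where V: "V \<subseteq> ?X" "indep (graph_Pfaffians TYPE('k)) V" "card V = vdim ?X (graph_Pfaffians TYPE('k))"
    using vdim(1)[OF finite_skew_vars idealin_span[OF graph_polys]] one_notin(3) by blast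
  have "indep (graph_Pfaffians TYPE('k)) (V - edges E)"
    using V(2) polys_mono[of "V - edges E" V] unfolding indep_def by blast
  then have "indep (Pfaffians TYPE('k)) (V - edges E \<union> edges E)"
    using V(1) by (intro indep_edges[OF d CI]) auto
  then have "card (V \<union> edges E) \<le> vdim ?X (Pfaffians TYPE('k))"
    using V(1) edges_skew_vars one_notin(2)
    by (intro vdim(2)[OF finite_skew_vars idealin_span[OF pf_gens_polys]]) auto
  moreover have "card V \<le> card (V \<union> edges E)"
    using finite_subset[OF V(1) finite_skew_vars] finite_edges by (intro card_mono) auto
  ultimately show ?thesis using V(3) by simp
qed

lemma height_transfer:
  assumes d: "d \<ge> 1" and CI: "complete_intersection (gen.span (edge_poly d ` edges E) \<inter> polys (lss_vars n d)) (mpoly_ring TYPE('k::field_char_0) (lss_vars n d))"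
  shows "ideal_height (mpoly_ring TYPE('k) (skew_vars n)) (graph_Pfaffians TYPE('k))
    = ideal_height (mpoly_ring TYPE('k) (skew_vars n)) (Pfaffians TYPE('k))"
proof -
  have "vdim (skew_vars n) (graph_Pfaffians TYPE('k)) = vdim (skew_vars n) (Pfaffians TYPE('k))"
    using vdim_ge[OF d CI] vdim_le by (rule antisym)
  moreover have "1 \<notin> graph_Pfaffians TYPE('k)" "1 \<notin> Pfaffians TYPE('k)" using one_notin(2,3) by blast+
  ultimately show ?thesis
    using ideal_height_vdim[OF finite_skew_vars idealin_span[OF graph_polys], where ?'k = 'k]
      ideal_height_vdim[OF finite_skew_vars idealin_span[OF pf_gens_polys], where ?'k = 'k] by simp
qed

end

theorem proposition7p7:
  fixes n d :: nat and E :: "nat set set"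
  assumes "d \<ge> 1"
    and "E \<subseteq> {e. e \<subseteq> {1..n} \<and> card e = 2}"
  defines "L \<equiv> twisted_lss_ideal TYPE('k::field_char_0) n d E"
    and "P \<equiv> pfaffian_ideal TYPE('k) n (d + 1) (graph_skew_matrix E)"
  shows "(radical_ideal L (lss_ring TYPE('k) n d) \<longrightarrow>
            radical_ideal P (skew_ring TYPE('k) n)) \<and>
         (complete_intersection L (lss_ring TYPE('k) n d) \<longrightarrow>
            ideal_height (skew_ring TYPE('k) n) P =
            ideal_height (skew_ring TYPE('k) n)
              (pfaffian_ideal TYPE('k) n (d + 1) generic_skew_matrix)) \<and>
         (primeideal L (lss_ring TYPE('k) n d) \<longrightarrow>
            primeideal P (skew_ring TYPE('k) n))"
proof -
  interpret graph n d E by unfold_locales (rule assms(2))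
  have lss: "lss_ring TYPE('k) n d = mpoly_ring TYPE('k) (lss_vars n d)" by (simp add: lss_ring_def lss_vars_def)
  have skew: "skew_ring TYPE('k) n = mpoly_ring TYPE('k) (skew_vars n)" by (simp add: skew_ring_def skew_vars_def)
  show ?thesis
    unfolding L_def P_def lss skew twisted_lss_ideal_span pfaffian_ideal_graph pfaffian_ideal_generic
      radical_mpoly_ring prime_mpoly_ring
    using radical_transfer prime_transfer height_transfer[OF assms(1)] by blast
qed


end
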